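(* Let $\Phi$ be an indecomposable root system of rank $>1$ and $G_\pi(\Phi,\mathbb R^c)$ the Chevalley group over the field $\mathbb R^c$ of computable real numbers. Then: 1) The Diophantine problem in the group $G_\pi(\Phi,\mathbb R^c)$ (the group of computable elements of $G_\pi(\Phi,\mathbb R)$) is undecidable. 2) For any finitely generated subgroup $C$ of $G_\pi(\Phi,\mathbb R^c)$, the Diophantine problem in $G_\pi(\Phi,\mathbb R^c)$ with coefficients in $C$ is decidable.
   Context: A real number $a$ is computable if its standard decimal expansion $a=a_0.a_1a_2\ldots$ is computable, i.e. the function $n\mapsto a_n$ is computable; equivalently, $a$ can be effectively approximated by rationals with any precision. $\mathbb R^c$ denotes the (countable, real closed) field of all computable reals. A matrix over $\mathbb R$ is computable if all its entries are computable reals. Root systems are reduced. Let $\pi$ be a faithful finite-dimensional representation of the complex semisimple Lie algebra with root system $\Phi$, with weight lattice $\Lambda_\pi$. $G_\pi(\Phi,K)$ denotes the Chevalley group of type $(\Phi,\Lambda_\pi)$ over a commutative ring $K$ with $1$, i.e. the group of $K$-points of the Chevalley--Demazure group scheme, realized as the subgroup of $\mathrm{SL}_n(K)$, $n=\dim\pi$, given by polynomial equations with integer coefficients in the matrix entries. The Diophantine problem in a group $G$ with coefficients in a countable subset $C$, given with an enumeration (surjective map) $\nu:\mathbb N\to C$, asks for an algorithm which, given a finite system of group equations with coefficients in $C$ (presented through $\nu$), decides whether the system has a solution in $G$. It is called decidable if such an algorithm exists (for some enumeration) and undecidable otherwise. For countable $G$, "the Diophantine problem in $G$" means $C=G$.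 For a finitely generated subgroup $C$, elements are presented as words in a finite generating set. *)

theory Defs
  imports
    "HOL-Analysis.Analysis"
    "HOL-Library.Poly_Mapping"
    "HOL-Library.Nat_Bijection"
    "HOL-Algebra.Generated_Groups"
begin

section \<open>Computability\<close>

text \<open>
  General recursive functions: \<^term>\<open>f\<close> is used only on argument lists of length \<^term>\<open>k\<close>.
  Minimization is restricted to the regular case, so all functions are total; by Kleene's normal
  form theorem these are exactly the total computable functions.
\<close>

inductive general_recursive :: "nat \<Rightarrow> (nat list \<Rightarrow> nat) \<Rightarrow> bool" where
  zero: "general_recursive k (\<lambda>_. 0)"
| succ: "general_recursive 1 (\<lambda>xs. Suc (hd xs))"
| proj: "i < k \<Longrightarrow> general_recursive k (\<lambda>xs. xs ! i)"
| comp: "\<lbrakk>general_recursive (length hs) g; \<forall>h\<in>set hs. general_recursive k h\<rbrakk>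
    \<Longrightarrow> general_recursive k (\<lambda>xs. g (map (\<lambda>h. h xs) hs))"
| prim_rec: "\<lbrakk>general_recursive k f; general_recursive (k + 2) g\<rbrakk>
    \<Longrightarrow> general_recursive (k + 1)
          (\<lambda>xs. rec_nat (f (tl xs)) (\<lambda>n r. g (n # r # tl xs)) (hd xs))"
| minimize: "\<lbrakk>general_recursive (k + 1) f; \<forall>xs. length xs = k \<longrightarrow> (\<exists>n. f (n # xs) = 0)\<rbrakk>
    \<Longrightarrow> general_recursive k (\<lambda>xs. LEAST n. f (n # xs) = 0)"

definition computable :: "(nat \<Rightarrow> nat) \<Rightarrow> bool" where
  "computable f \<longleftrightarrow> (\<exists>F. general_recursive 1 F \<and> (\<forall>n. F [n] = f n))"

text \<open>
  The standard decimal expansion of a negative real is that of its absolute value preceded by a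
  sign, and the sign is irrelevant for computability. The integral part is the entry at 0.
\<close>

definition decimal_expansion :: "real \<Rightarrow> nat \<Rightarrow> nat" where
  "decimal_expansion a n =
     (if n = 0 then nat \<lfloor>\<bar>a\<bar>\<rfloor> else nat (\<lfloor>10 ^ n * \<bar>a\<bar>\<rfloor> mod 10))"

definition computable_reals :: "real set" where
  "computable_reals = {a. computable (decimal_expansion a)}"

section \<open>Diophantine problems in groups\<close>

text \<open>
  An equation is a group word, to be set equal to 1, in variables and coefficients; coefficients
  are referred to by their index in an enumeration.
\<close>

datatype letter = Var nat | Var_Inv nat | Coef nat | Coef_Inv nat

type_synonym group_equation = "letter list"

fun letter_code :: "letter \<Rightarrow> nat" where
  "letter_code (Var i) = 4 * i"
| "letter_code (Var_Inv i) = 4 * i + 1"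
| "letter_code (Coef i) = 4 * i + 2"
| "letter_code (Coef_Inv i) = 4 * i + 3"

definition system_code :: "group_equation list \<Rightarrow> nat" where
  "system_code S = list_encode (map (\<lambda>w. list_encode (map letter_code w)) S)"

definition group_prod :: "('a, 'b) monoid_scheme \<Rightarrow> 'a list \<Rightarrow> 'a" where
  "group_prod G xs = foldr (\<lambda>x y. x \<otimes>\<^bsub>G\<^esub> y) xs \<one>\<^bsub>G\<^esub>"

fun letter_value ::
  "('a, 'b) monoid_scheme \<Rightarrow> (nat \<Rightarrow> 'a) \<Rightarrow> (nat \<Rightarrow> 'a) \<Rightarrow> letter \<Rightarrow> 'a" where
  "letter_value G \<nu> \<sigma> (Var i) = \<sigma> i"
| "letter_value G \<nu> \<sigma> (Var_Inv i) = inv\<^bsub>G\<^esub> (\<sigma> i)"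
| "letter_value G \<nu> \<sigma> (Coef i) = \<nu> i"
| "letter_value G \<nu> \<sigma> (Coef_Inv i) = inv\<^bsub>G\<^esub> (\<nu> i)"

definition solvable_system ::
  "('a, 'b) monoid_scheme \<Rightarrow> (nat \<Rightarrow> 'a) \<Rightarrow> group_equation list \<Rightarrow> bool" where
  "solvable_system G \<nu> S \<longleftrightarrow>
     (\<exists>\<sigma>. range \<sigma> \<subseteq> carrier G \<and> (\<forall>w\<in>set S. group_prod G (map (letter_value G \<nu> \<sigma>) w) = \<one>\<^bsub>G\<^esub>))"

definition diophantine_decidable_via ::
  "('a, 'b) monoid_scheme \<Rightarrow> 'a set \<Rightarrow> (nat \<Rightarrow> 'a) \<Rightarrow> bool" where
  "diophantine_decidable_via G C \<nu> \<longleftrightarrow>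
     range \<nu> = C \<and>
     (\<exists>f. computable f \<and> (\<forall>S. f (system_code S) = (if solvable_system G \<nu> S then 1 else 0)))"

definition diophantine_decidable :: "('a, 'b) monoid_scheme \<Rightarrow> 'a set \<Rightarrow> bool" where
  "diophantine_decidable G C \<longleftrightarrow> (\<exists>\<nu>. diophantine_decidable_via G C \<nu>)"

text \<open>
  Enumeration of the subgroup generated by a finite list by the codes of words in its members
  and their inverses; letters beyond the end of the list stand for 1.
\<close>

definition word_enum :: "('a, 'b) monoid_scheme \<Rightarrow> 'a list \<Rightarrow> nat \<Rightarrow> 'a" where
  "word_enum G gs n = group_prod G
     (map (\<lambda>k. if k div 2 < length gs
                then (if even k then gs ! (k div 2) else inv\<^bsub>G\<^esub> (gs ! (k div 2)))
                else \<one>\<^bsub>G\<^esub>)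
       (list_decode n))"

section \<open>Root systems\<close>

definition cartan_number :: "'e::euclidean_space \<Rightarrow> 'e \<Rightarrow> real" where
  "cartan_number \<beta> \<alpha> = 2 * inner \<beta> \<alpha> / inner \<alpha> \<alpha>"

definition root_system :: "'e::euclidean_space set \<Rightarrow> bool" where
  "root_system \<Phi> \<longleftrightarrow>
     finite \<Phi> \<and> 0 \<notin> \<Phi> \<and> span \<Phi> = UNIV \<and>
     (\<forall>\<alpha>\<in>\<Phi>. \<forall>\<beta>\<in>\<Phi>. \<beta> - cartan_number \<beta> \<alpha> *\<^sub>R \<alpha> \<in> \<Phi> \<and> cartan_number \<beta> \<alpha> \<in> \<int>) \<and>
     (\<forall>\<alpha>\<in>\<Phi>. \<forall>c. c *\<^sub>R \<alpha> \<in> \<Phi> \<longrightarrow> c = 1 \<or> c = -1)"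

definition indecomposable :: "'e::euclidean_space set \<Rightarrow> bool" where
  "indecomposable \<Phi> \<longleftrightarrow>
     \<Phi> \<noteq> {} \<and>
     \<not> (\<exists>A B. A \<noteq> {} \<and> B \<noteq> {} \<and> A \<inter> B = {} \<and> A \<union> B = \<Phi> \<and> (\<forall>\<alpha>\<in>A. \<forall>\<beta>\<in>B. inner \<alpha> \<beta> = 0))"

definition root_rank :: "'e::euclidean_space set \<Rightarrow> nat" where
  "root_rank \<Phi> = dim \<Phi>"

section \<open>Complex semisimple Lie algebras and Chevalley bases\<close>

locale complex_lie_algebra = vector_space scale
  for scale :: "complex \<Rightarrow> 'g::ab_group_add \<Rightarrow> 'g" +
  fixes bracket :: "'g \<Rightarrow> 'g \<Rightarrow> 'g"
  assumes finite_dimensional: "\<exists>B. finite B \<and> span B = UNIV"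
    and bracket_add_left: "bracket (x + y) z = bracket x z + bracket y z"
    and bracket_add_right: "bracket x (y + z) = bracket x y + bracket x z"
    and bracket_scale_left: "bracket (scale c x) y = scale c (bracket x y)"
    and bracket_scale_right: "bracket x (scale c y) = scale c (bracket x y)"
    and bracket_self: "bracket x x = 0"
    and jacobi: "bracket x (bracket y z) + bracket y (bracket z x) + bracket z (bracket x y) = 0"
begin

definition bracket_span :: "'g set \<Rightarrow> 'g set \<Rightarrow> 'g set" where
  "bracket_span A B = span {bracket x y |x y. x \<in> A \<and> y \<in> B}"

definition lie_ideal :: "'g set \<Rightarrow> bool" where
  "lie_ideal I \<longleftrightarrow> subspace I \<and> (\<forall>x. \<forall>y\<in>I. bracket x y \<in> I)"

definition lie_solvable :: "'g set \<Rightarrow> bool" where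
  "lie_solvable I \<longleftrightarrow> (\<exists>k. ((\<lambda>J. bracket_span J J) ^^ k) I = {0})"

definition lie_nilpotent :: "'g set \<Rightarrow> bool" where
  "lie_nilpotent I \<longleftrightarrow> (\<exists>k. ((\<lambda>J. bracket_span I J) ^^ k) I = {0})"

definition semisimple :: bool where
  "semisimple \<longleftrightarrow> (\<forall>I. lie_ideal I \<and> lie_solvable I \<longrightarrow> I = {0})"

definition cartan_subalgebra :: "'g set \<Rightarrow> bool" where
  "cartan_subalgebra H \<longleftrightarrow>
     subspace H \<and> (\<forall>x\<in>H. \<forall>y\<in>H. bracket x y \<in> H) \<and> lie_nilpotent H \<and>
     {x. \<forall>h\<in>H. bracket x h \<in> H} = H"

definition root_space :: "'g set \<Rightarrow> ('g \<Rightarrow> complex) \<Rightarrow> 'g set" where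
  "root_space H a = {x. \<forall>h\<in>H. bracket h x = scale (a h) x}"

text \<open>
  Functionals on \<^term>\<open>H\<close> are extensional functions, so that distinct members of
  \<^term>\<open>roots H\<close> are distinct on \<^term>\<open>H\<close>. Linearity is implied by the existence of a
  nonzero simultaneous eigenvector.
\<close>

definition roots :: "'g set \<Rightarrow> ('g \<Rightarrow> complex) set" where
  "roots H = {a \<in> extensional H. (\<exists>h\<in>H. a h \<noteq> 0) \<and> root_space H a \<noteq> {0}}"

text \<open>
  \<^term>\<open>r\<close> identifies \<^term>\<open>\<Phi>\<close> with the roots relative to \<^term>\<open>H\<close>. Cartan numbers on the Lie
  algebra side are the values of roots at coroots; the coroot of \<^term>\<open>r \<alpha>\<close> is the element
  of the line \<open>[L\<^sub>\<alpha>, L\<^sub>-\<^sub>\<alpha>]\<close> at which \<^term>\<open>r \<alpha>\<close> takes the value 2.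
\<close>

definition root_identification ::
  "'e::euclidean_space set \<Rightarrow> 'g set \<Rightarrow> ('e \<Rightarrow> 'g \<Rightarrow> complex) \<Rightarrow> bool" where
  "root_identification \<Phi> H r \<longleftrightarrow>
     bij_betw r \<Phi> (roots H) \<and>
     (\<forall>\<alpha>\<in>\<Phi>. \<exists>t \<in> H \<inter> bracket_span (root_space H (r \<alpha>)) (root_space H (r (- \<alpha>))).
        \<forall>\<beta>\<in>\<Phi>. r \<beta> t = of_real (cartan_number \<beta> \<alpha>))"

text \<open>
  The root vectors of a Chevalley basis; its remaining members are the coroots
  \<open>[e\<^sub>\<alpha>, e\<^sub>-\<^sub>\<alpha>]\<close> of the simple roots, so they need not be given separately.
\<close>

definition chevalley_root_vectors ::
  "'e::euclidean_space set \<Rightarrow> 'g set \<Rightarrow> ('e \<Rightarrow> 'g \<Rightarrow> complex) \<Rightarrow> ('e \<Rightarrow> 'g) \<Rightarrow> bool" where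
  "chevalley_root_vectors \<Phi> H r e \<longleftrightarrow>
     (\<forall>\<alpha>\<in>\<Phi>. e \<alpha> \<in> root_space H (r \<alpha>)) \<and>
     (\<forall>\<alpha>\<in>\<Phi>. bracket (e \<alpha>) (e (- \<alpha>)) \<in> H \<and>
        (\<forall>\<beta>\<in>\<Phi>. r \<beta> (bracket (e \<alpha>) (e (- \<alpha>))) = of_real (cartan_number \<beta> \<alpha>))) \<and>
     (\<forall>\<alpha>\<in>\<Phi>. \<forall>\<beta>\<in>\<Phi>. \<alpha> + \<beta> \<in> \<Phi> \<longrightarrow>
        (let p = Max {p::nat. \<beta> - of_nat p *\<^sub>R \<alpha> \<in> \<Phi>}
         in bracket (e \<alpha>) (e \<beta>) = scale (of_nat (p + 1)) (e (\<alpha> + \<beta>)) \<or>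
            bracket (e \<alpha>) (e \<beta>) = - scale (of_nat (p + 1)) (e (\<alpha> + \<beta>))))"

definition faithful_representation :: "('g \<Rightarrow> complex^'n^'n) \<Rightarrow> bool" where
  "faithful_representation \<pi> \<longleftrightarrow>
     (\<forall>x y. \<pi> (x + y) = \<pi> x + \<pi> y) \<and>
     (\<forall>c x i j. \<pi> (scale c x) $ i $ j = c * \<pi> x $ i $ j) \<and>
     (\<forall>x y. \<pi> (bracket x y) = \<pi> x ** \<pi> y - \<pi> y ** \<pi> x) \<and>
     inj \<pi>"

end

section \<open>Chevalley groups\<close>

definition matrix_power :: "'k::comm_ring_1^'n^'n \<Rightarrow> nat \<Rightarrow> 'k^'n^'n" where
  "matrix_power A k = (((**) A) ^^ k) (mat 1)"

definition matrix_exp :: "complex^'n^'n \<Rightarrow> complex^'n^'n" where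
  "matrix_exp A = (\<chi> i j. suminf (\<lambda>k. matrix_power A k $ i $ j / fact k))"

text \<open>
  The standard basis of \<open>\<complex>\<^sup>n\<close> spans a lattice that is stable under the divided powers
  \<open>\<pi>(e\<^sub>\<alpha>)\<^sup>k / k!\<close>.
\<close>

definition admissible_basis ::
  "'e set \<Rightarrow> ('e \<Rightarrow> 'g) \<Rightarrow> ('g \<Rightarrow> complex^'n^'n) \<Rightarrow> bool" where
  "admissible_basis \<Phi> e \<pi> \<longleftrightarrow>
     (\<forall>\<alpha>\<in>\<Phi>. \<forall>k i j. matrix_power (\<pi> (e \<alpha>)) k $ i $ j / fact k \<in> \<int>)"

definition SL :: "'k::comm_ring_1 set \<Rightarrow> ('k^'n^'n) monoid" where
  "SL K = \<lparr>carrier = {A. (\<forall>i j. A $ i $ j \<in> K) \<and> det A = 1}, mult = (**), one = mat 1\<rparr>"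

definition root_element ::
  "('e \<Rightarrow> 'g) \<Rightarrow> ('g \<Rightarrow> complex^'n^'n) \<Rightarrow> 'e \<Rightarrow> complex \<Rightarrow> complex^'n^'n" where
  "root_element e \<pi> \<alpha> t = matrix_exp (\<chi> i j. t * \<pi> (e \<alpha>) $ i $ j)"

definition complex_chevalley_group ::
  "'e set \<Rightarrow> ('e \<Rightarrow> 'g) \<Rightarrow> ('g \<Rightarrow> complex^'n^'n) \<Rightarrow> (complex^'n^'n) set" where
  "complex_chevalley_group \<Phi> e \<pi> =
     generate (SL UNIV) {root_element e \<pi> \<alpha> t |\<alpha> t. \<alpha> \<in> \<Phi>}"

text \<open>Polynomials with integer coefficients in the matrix entries, and their evaluation.\<close>

type_synonym 'n entry_poly = "(('n \<times> 'n) \<Rightarrow>\<^sub>0 nat) \<Rightarrow>\<^sub>0 int"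

definition eval_entry_poly :: "'n::finite entry_poly \<Rightarrow> 'k::comm_ring_1^'n^'n \<Rightarrow> 'k" where
  "eval_entry_poly p A =
     (\<Sum>m\<in>Poly_Mapping.keys p. of_int (Poly_Mapping.lookup p m) *
        (\<Prod>ij\<in>Poly_Mapping.keys m. (A $ fst ij $ snd ij) ^ Poly_Mapping.lookup m ij))"

text \<open>
  The coordinate ring of the Chevalley--Demazure scheme is the ring of polynomials over
  \<open>\<int>\<close> in the matrix entries modulo those vanishing on the complex group, so its points over a
  subring \<^term>\<open>K\<close> of \<^typ>\<open>'k\<close> are the matrices over \<^term>\<open>K\<close> on which these vanish.
\<close>

definition chevalley_group ::
  "'e set \<Rightarrow> ('e \<Rightarrow> 'g) \<Rightarrow> ('g \<Rightarrow> complex^'n^'n) \<Rightarrow> 'k::comm_ring_1 set \<Rightarrow> ('k^'n^'n) monoid" where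
  "chevalley_group \<Phi> e \<pi> K =
     (SL K)\<lparr>carrier := {A \<in> carrier (SL K). \<forall>p :: 'n entry_poly.
        (\<forall>B\<in>complex_chevalley_group \<Phi> e \<pi>. eval_entry_poly p B = 0) \<longrightarrow> eval_entry_poly p A = 0}\<rparr>"

end

theory Submission
  imports Defs "HOL-Library.Function_Algebras"
begin

text \<open>
  Undecidability: let \<open>\<alpha>\<close> be a longest root and \<open>u = x\<^sub>\<alpha>(1)\<close>. An element that commutes with \<open>h\<^sub>\<alpha>(2)\<close> maps the
  root vector of \<open>\<alpha>\<close> to a multiple of itself, since this spans the eigenspace of \<open>h\<^sub>\<alpha>(2)\<close> for the eigenvalue 4. Hence
  \<open>a > 0\<close> iff \<open>z\<^sup>2 u z\<^sup>-\<^sup>2 = x\<^sub>\<alpha>(a)\<close> for some \<open>z\<close> that commutes with \<open>h\<^sub>\<alpha>(2)\<close>, because \<open>\<real>\<^sup>c\<close> contains the square roots of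
  its positive elements. With \<open>x\<^sub>\<alpha>(n a - m) = x\<^sub>\<alpha>(a)\<^sup>n u\<^sup>-\<^sup>m\<close> a decision procedure would compare \<open>a\<close> with \<open>m / n\<close> uniformly in
  the index of \<open>x\<^sub>\<alpha>(a)\<close>, so that the digits of all computable reals could be listed, contrary to diagonalization.

  Decidability: solvability over \<open>\<real>\<^sup>c\<close> of a system with fixed parameters is a sentence on the real closed field \<open>\<real>\<^sup>c\<close> with
  finitely many computable parameters. Quantifier elimination reduces it to the signs of integral polynomials at
  these parameters. The sign at a fixed tuple is recursive: by Hilbert's basis theorem its vanishing is implied by
  finitely many equations, and otherwise approximation finds the sign.
\<close>

section \<open>Recursive functions on the natural numbers\<close>

text \<open>The two halves differ in uniformity. At a fixed tuple of parameters the sign of an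
  integral polynomial is recursive, but the algorithm contains finite data that depend on the tuple
  and are only shown to exist; from an index of an arbitrary group element no such data can be
  found. The structure theory of Chevalley groups is avoided: the points of the scheme are
  identified with the Zariski closure of the group generated by the integral matrices
  \<open>X \<beta> t\<close> for integers \<open>t\<close>, because a polynomial in \<open>t\<close>
  that vanishes at all integers is 0. Relations such as the action of \<open>h \<alpha> t\<close> on
  root vectors are proved over the reals by differentiation in \<open>t\<close>, so that only
  commutators of the matrices \<open>N \<beta>\<close> enter. A longest root is taken because then
  \<open>cartan_number \<beta> \<alpha> = 2\<close> forces \<open>\<beta> = \<alpha>\<close>; for a
  short root, longer roots can share the eigenvalue. Closure of the computable reals under sums,
  products and square roots is not proved by estimates: each result is a root of a polynomial over
  computable parameters, and its comparisons with fractions are decided by the sign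
  procedure.\<close>

definition recursive_on :: "nat \<Rightarrow> (nat list \<Rightarrow> nat) \<Rightarrow> bool" where
  "recursive_on k F \<longleftrightarrow> (\<exists>F'. general_recursive k F' \<and> (\<forall>xs. length xs = k \<longrightarrow> F' xs = F xs))"

text \<open>\<open>general_recursive\<close> yields particular functions on all lists, whose values
  on lists of the wrong length are accidental; agreement on lists of length \<open>k\<close> removes
  this dependence.\<close>

lemma recursive_on_cong:
  assumes "recursive_on k F" "\<And>xs. length xs = k \<Longrightarrow> F xs = F' xs"
  shows "recursive_on k F'"
  using assms unfolding recursive_on_def by metis

lemma general_recursive_imp_recursive_on: "general_recursive k F \<Longrightarrow> recursive_on k F"
  unfolding recursive_on_def by blast

lemma recursive_on_proj: "i < k \<Longrightarrow> recursive_on k (\<lambda>xs. xs ! i)"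
  by (intro general_recursive_imp_recursive_on general_recursive.proj)

text \<open>\<open>general_recursive.comp\<close> needs genuine members of the inductive class, so
  each \<open>h\<close> in \<open>hs\<close> is replaced by a chosen function that agrees with it on
  lists of length \<open>k\<close>.\<close>

lemma recursive_on_comp:
  assumes g: "recursive_on (length hs) g" and hs: "\<And>h. h \<in> set hs \<Longrightarrow> recursive_on k h"
  shows "recursive_on k (\<lambda>xs. g (map (\<lambda>h. h xs) hs))"
proof -
  obtain g' where g': "general_recursive (length hs) g'" "\<And>xs. length xs = length hs \<Longrightarrow> g' xs = g xs"
    using g unfolding recursive_on_def by blast
  define rep where "rep h = (SOME h'. general_recursive k h' \<and> (\<forall>xs. length xs = k \<longrightarrow> h' xs = h xs))" for h
  have rep: "general_recursive k (rep h) \<and> (\<forall>xs. length xs = k \<longrightarrow> rep h xs = h xs)" if "h \<in> set hs" for h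
    using someI_ex[OF hs[OF that, unfolded recursive_on_def]] unfolding rep_def .
  have "general_recursive k (\<lambda>xs. g' (map (\<lambda>h. h xs) (map rep hs)))"
    by (rule general_recursive.comp) (use g'(1) rep in auto)
  moreover have "g' (map (\<lambda>h. h xs) (map rep hs)) = g (map (\<lambda>h. h xs) hs)" if "length xs = k" for xs
  proof -
    have "map (\<lambda>h. h xs) (map rep hs) = map (\<lambda>h. h xs) hs" using rep that by auto
    then show ?thesis using g'(2)[of "map (\<lambda>h. h xs) (map rep hs)"] by (simp del: map_map)
  qed
  ultimately show ?thesis unfolding recursive_on_def by blast
qed

lemma recursive_on_comp1:
  assumes "recursive_on 1 (\<lambda>xs. g (xs ! 0))" "recursive_on k a"
  shows "recursive_on k (\<lambda>xs. g (a xs))"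
  using recursive_on_comp[of "[a]" "\<lambda>xs. g (xs ! 0)" k] assms by simp

lemma recursive_on_comp2:
  assumes "recursive_on 2 (\<lambda>xs. g (xs ! 0) (xs ! 1))" "recursive_on k a" "recursive_on k b"
  shows "recursive_on k (\<lambda>xs. g (a xs) (b xs))"
  using recursive_on_comp[of "[a, b]" "\<lambda>xs. g (xs ! 0) (xs ! 1)" k] assms
  by (auto simp: numeral_2_eq_2)

lemma recursive_on_Suc:
  assumes "recursive_on k a" shows "recursive_on k (\<lambda>xs. Suc (a xs))"
proof (rule recursive_on_comp1[of Suc])
  show "recursive_on 1 (\<lambda>xs. Suc (xs ! 0))"
    by (rule recursive_on_cong[OF general_recursive_imp_recursive_on[OF general_recursive.succ]])
       (simp add: hd_conv_nth flip: length_greater_0_conv)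
qed (fact assms)

lemma recursive_on_const: "recursive_on k (\<lambda>_. c)"
  by (induction c) (auto intro: recursive_on_Suc general_recursive_imp_recursive_on general_recursive.zero)

lemma recursive_on_prim_rec:
  assumes f: "recursive_on k f" and g: "recursive_on (k + 2) g"
  shows "recursive_on (k + 1) (\<lambda>xs. rec_nat (f (tl xs)) (\<lambda>n r. g (n # r # tl xs)) (hd xs))"
proof -
  obtain f' g' where f': "general_recursive k f'" "\<And>xs. length xs = k \<Longrightarrow> f' xs = f xs"
    and g': "general_recursive (k + 2) g'" "\<And>xs. length xs = k + 2 \<Longrightarrow> g' xs = g xs"
    using f g unfolding recursive_on_def by blast
  show ?thesis
    by (rule recursive_on_cong[OF general_recursive_imp_recursive_on[OF general_recursive.prim_rec[OF f'(1) g'(1)]]])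
       (simp add: f' g')
qed

lemma recursive_on_minimize:
  assumes f: "recursive_on (k + 1) f" and ex: "\<And>xs. length xs = k \<Longrightarrow> \<exists>n. f (n # xs) = 0"
  shows "recursive_on k (\<lambda>xs. LEAST n. f (n # xs) = 0)"
proof -
  obtain f' where f': "general_recursive (k + 1) f'" "\<And>xs. length xs = k + 1 \<Longrightarrow> f' xs = f xs"
    using f unfolding recursive_on_def by blast
  have "general_recursive k (\<lambda>xs. LEAST n. f' (n # xs) = 0)"
    by (rule general_recursive.minimize[OF f'(1)]) (use ex f'(2) in auto)
  then show ?thesis
    by (rule recursive_on_cong[OF general_recursive_imp_recursive_on]) (simp add: f'(2))
qed

lemma computable_iff_recursive_on: "computable f \<longleftrightarrow> recursive_on 1 (\<lambda>xs. f (xs ! 0))"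
proof
  assume "computable f"
  then obtain F where F: "general_recursive 1 F" "\<And>n. F [n] = f n" unfolding computable_def by blast
  show "recursive_on 1 (\<lambda>xs. f (xs ! 0))"
    by (rule recursive_on_cong[OF general_recursive_imp_recursive_on[OF F(1)]])
       (auto simp: length_Suc_conv F(2))
next
  assume "recursive_on 1 (\<lambda>xs. f (xs ! 0))"
  then obtain F where "general_recursive 1 F" "\<And>xs. length xs = 1 \<Longrightarrow> F xs = f (xs ! 0)"
    unfolding recursive_on_def by blast
  then show "computable f" unfolding computable_def by (intro exI[of _ F]) simp
qed

text \<open>\<open>prim_rec\<close> puts the counter first, the accumulator second and the parameter
  last, which explains the positions in the hypothesis on \<open>s\<close>.\<close>

lemma recursive_on_rec_nat2:
  assumes "recursive_on 1 (\<lambda>xs. b (xs ! 0))" "recursive_on 3 (\<lambda>xs. s (xs ! 2) (xs ! 0) (xs ! 1))"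
  shows "recursive_on 2 (\<lambda>xs. rec_nat (b (xs ! 1)) (s (xs ! 1)) (xs ! 0))"
proof -
  have "recursive_on (1 + 1) (\<lambda>xs. rec_nat ((\<lambda>xs. b (xs ! 0)) (tl xs))
      (\<lambda>n r. (\<lambda>xs. s (xs ! 2) (xs ! 0) (xs ! 1)) (n # r # tl xs)) (hd xs))"
    by (rule recursive_on_prim_rec) (use assms in \<open>simp_all add: numeral_3_eq_3\<close>)
  then show ?thesis
    unfolding one_add_one by (rule recursive_on_cong) (auto simp: length_Suc_conv numeral_2_eq_2)
qed

lemma recursive_on_rec_nat:
  assumes "recursive_on 1 (\<lambda>xs. b (xs ! 0))" "recursive_on 3 (\<lambda>xs. s (xs ! 2) (xs ! 0) (xs ! 1))"
    "recursive_on k x" "recursive_on k n"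
  shows "recursive_on k (\<lambda>xs. rec_nat (b (x xs)) (s (x xs)) (n xs))"
  by (rule recursive_on_comp2[of "\<lambda>n x. rec_nat (b x) (s x) n", OF recursive_on_rec_nat2]) (use assms in auto)

lemma rec_nat_add: "rec_nat x (\<lambda>_ r. Suc r) n = x + n" for x :: nat by (induction n) auto
lemma rec_nat_pred: "rec_nat 0 (\<lambda>k _. k) n = n - 1" for n :: nat by (cases n) auto
lemma rec_nat_diff: "rec_nat x (\<lambda>_ r. r - 1) n = x - n" for x :: nat by (induction n) auto
lemma rec_nat_triangle: "rec_nat 0 (\<lambda>k r. r + Suc k) n = triangle n" by (induction n) auto

lemma recursive_on_add: "recursive_on k a \<Longrightarrow> recursive_on k b \<Longrightarrow> recursive_on k (\<lambda>xs. a xs + b xs)"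
  using recursive_on_rec_nat[of "\<lambda>x. x" "\<lambda>_ _ r. Suc r" k a b]
  by (simp add: rec_nat_add recursive_on_proj recursive_on_Suc)

lemma recursive_on_diff: "recursive_on k a \<Longrightarrow> recursive_on k b \<Longrightarrow> recursive_on k (\<lambda>xs. a xs - b xs)"
proof -
  assume a: "recursive_on k a" "recursive_on k b"
  have pred: "recursive_on j (\<lambda>xs. c xs - 1)" if "recursive_on j c" for j c
    using recursive_on_rec_nat[of "\<lambda>_. 0" "\<lambda>_ n _. n" j "\<lambda>_. 0" c] that
    by (simp add: rec_nat_pred recursive_on_proj recursive_on_const)
  show ?thesis
    using recursive_on_rec_nat[of "\<lambda>x. x" "\<lambda>_ _ r. r - 1" k a b] a pred[of 3 "\<lambda>xs. xs ! 1"]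
    unfolding rec_nat_diff by (simp add: recursive_on_proj)
qed

lemma recursive_on_triangle: "recursive_on k a \<Longrightarrow> recursive_on k (\<lambda>xs. triangle (a xs))"
  using recursive_on_rec_nat[of "\<lambda>_. 0" "\<lambda>_ n r. r + Suc n" k "\<lambda>_. 0" a]
  by (simp add: rec_nat_triangle recursive_on_proj recursive_on_const recursive_on_add recursive_on_Suc
      del: add_Suc_right)

lemma recursive_on_prod_encode:
  "recursive_on k a \<Longrightarrow> recursive_on k b \<Longrightarrow> recursive_on k (\<lambda>xs. prod_encode (a xs, b xs))"
  by (simp add: prod_encode_def recursive_on_add recursive_on_triangle)

lemma triangle_mono: "m \<le> n \<Longrightarrow> triangle m \<le> triangle n"
  by (induction n) (auto simp: le_Suc_eq)

lemma le_triangle: "n \<le> triangle n"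
  by (induction n) auto

text \<open>The diagonal of the Cantor pairing on which the pair coded by \<open>n\<close> lies.\<close>

definition diagonal :: "nat \<Rightarrow> nat" where
  "diagonal n = (LEAST s. Suc n - triangle (Suc s) = 0)"

lemma recursive_on_diagonal: "recursive_on k a \<Longrightarrow> recursive_on k (\<lambda>xs. diagonal (a xs))"
proof (rule recursive_on_comp1[of diagonal])
  have "recursive_on 1 (\<lambda>xs. LEAST n. (\<lambda>xs. Suc (xs ! 1) - triangle (Suc (xs ! 0))) (n # xs) = 0)"
  proof (rule recursive_on_minimize)
    fix xs :: "nat list"
    \<comment> \<open>The number itself bounds the search, since n \<le> triangle n.\<close>
    have "Suc (xs ! 0) - triangle (Suc (xs ! 0)) = 0" using le_triangle[of "Suc (xs ! 0)"] by simp
    then show "\<exists>n. Suc ((n # xs) ! 1) - triangle (Suc ((n # xs) ! 0)) = 0"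
      by (intro exI[of _ "xs ! 0"]) simp
  qed (intro recursive_on_diff recursive_on_triangle recursive_on_Suc recursive_on_proj; simp)
  then show "recursive_on 1 (\<lambda>xs. diagonal (xs ! 0))" by (simp add: diagonal_def)
qed

lemma diagonal_prod_encode: "diagonal (prod_encode (a, b)) = a + b"
  unfolding diagonal_def prod_encode_def
proof (rule Least_equality)
  fix s assume "Suc (case (a, b) of (m, n) \<Rightarrow> triangle (m + n) + m) - triangle (Suc s) = 0"
  moreover have "triangle (Suc s) \<le> triangle (a + b)" if "s < a + b" using that by (intro triangle_mono) auto
  ultimately show "a + b \<le> s" by (cases "s < a + b") auto
qed simp

text \<open>Subtraction, \<open>triangle\<close> and \<open>diagonal\<close> are recursive, so this
  form of the decoding makes both projections recursive.\<close>

lemma prod_decode_conv_diagonal: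
  "prod_decode n = (n - triangle (diagonal n), diagonal n - (n - triangle (diagonal n)))"
proof -
  obtain a b where n: "n = prod_encode (a, b)" by (metis prod_decode_inverse surj_pair)
  show ?thesis unfolding n prod_encode_inverse diagonal_prod_encode by (simp add: prod_encode_def)
qed

section \<open>Unary functions with Cantor pairing\<close>

lemma computable_id: "computable (\<lambda>n. n)"
  by (simp add: computable_iff_recursive_on recursive_on_proj)

lemma computable_const: "computable (\<lambda>_. c)"
  by (simp add: computable_iff_recursive_on recursive_on_const)

lemma computable_comp: "computable f \<Longrightarrow> computable g \<Longrightarrow> computable (\<lambda>n. f (g n))"
  unfolding computable_iff_recursive_on by (rule recursive_on_comp1[of f])

lemma computable_prod_encode:
  "computable f \<Longrightarrow> computable g \<Longrightarrow> computable (\<lambda>n. prod_encode (f n, g n))"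
  unfolding computable_iff_recursive_on by (rule recursive_on_prod_encode)

lemma computable_fst: "computable f \<Longrightarrow> computable (\<lambda>n. fst (prod_decode (f n)))"
  unfolding computable_iff_recursive_on prod_decode_conv_diagonal fst_conv
  by (intro recursive_on_diff recursive_on_triangle recursive_on_diagonal)

lemma computable_snd: "computable f \<Longrightarrow> computable (\<lambda>n. snd (prod_decode (f n)))"
  unfolding computable_iff_recursive_on prod_decode_conv_diagonal snd_conv
  by (intro recursive_on_diff recursive_on_triangle recursive_on_diagonal)

lemma computable_Suc: "computable f \<Longrightarrow> computable (\<lambda>n. Suc (f n))"
  unfolding computable_iff_recursive_on by (rule recursive_on_Suc)

lemma computable_diff: "computable f \<Longrightarrow> computable g \<Longrightarrow> computable (\<lambda>n. f n - g n)"
  unfolding computable_iff_recursive_on by (rule recursive_on_diff)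

lemma computable_rec_nat:
  assumes "computable b" "computable s" "computable x" "computable m"
  shows "computable (\<lambda>n. rec_nat (b (x n)) (\<lambda>k r. s (prod_encode (x n, prod_encode (k, r)))) (m n))"
  unfolding computable_iff_recursive_on
proof (rule recursive_on_rec_nat[where s = "\<lambda>x k r. s (prod_encode (x, prod_encode (k, r)))"])
  show "recursive_on 3 (\<lambda>xs. s (prod_encode (xs ! 2, prod_encode (xs ! 0, xs ! 1))))"
    using assms(2) unfolding computable_iff_recursive_on
    by (rule recursive_on_comp1) (intro recursive_on_prod_encode recursive_on_proj; simp)
qed (use assms in \<open>simp_all add: computable_iff_recursive_on\<close>)

lemma computable_minimize:
  assumes "computable f" "\<And>n. \<exists>m. f (prod_encode (n, m)) = 0"
  shows "computable (\<lambda>n. LEAST m. f (prod_encode (n, m)) = 0)"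
proof -
  have "recursive_on (1 + 1) (\<lambda>xs. f (prod_encode (xs ! 1, xs ! 0)))"
    using assms(1) unfolding computable_iff_recursive_on
    by (rule recursive_on_comp1) (intro recursive_on_prod_encode recursive_on_proj; simp)
  then have "recursive_on 1 (\<lambda>xs. LEAST m. (\<lambda>xs. f (prod_encode (xs ! 1, xs ! 0))) (m # xs) = 0)"
    by (rule recursive_on_minimize) (use assms(2) in simp)
  then show ?thesis by (simp add: computable_iff_recursive_on)
qed

section \<open>Recursive functions between coded types\<close>

text \<open>A bijection, not only an injection: every number is a code, so \<open>dec\<close> is
  total, recursiveness carries no domain conditions, and a search through all numbers is a search
  through the type.\<close>

class coded =
  fixes enc :: "'a \<Rightarrow> nat"
  assumes bij_enc: "bij enc"
begin

definition dec :: "nat \<Rightarrow> 'a" where "dec = inv_into UNIV enc"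

lemma dec_enc [simp]: "dec (enc x) = x"
  unfolding dec_def using bij_enc by (simp add: bij_is_inj)

lemma enc_dec [simp]: "enc (dec n) = n"
  unfolding dec_def using bij_enc by (simp add: bij_is_surj surj_f_inv_f)

lemma enc_inject [simp]: "enc x = enc y \<longleftrightarrow> x = y"
  by (metis dec_enc)

end

instantiation nat :: coded
begin
definition enc_nat :: "nat \<Rightarrow> nat" where "enc_nat n = n"
instance by standard (auto simp: enc_nat_def bij_def inj_def surj_def)
end

instantiation int :: coded
begin
definition enc_int :: "int \<Rightarrow> nat" where "enc_int = int_encode"
instance by standard (simp add: enc_int_def bij_int_encode)
end

instantiation prod :: (coded, coded) coded
begin
definition enc_prod :: "'a \<times> 'b \<Rightarrow> nat" where "enc_prod p = prod_encode (map_prod enc enc p)"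
instance
proof
  have "bij (prod_encode \<circ> map_prod (enc :: 'a \<Rightarrow> nat) (enc :: 'b \<Rightarrow> nat))"
    using bij_comp[OF _ bij_prod_encode] bij_betw_map_prod[OF bij_enc bij_enc] by simp
  then show "bij (enc :: 'a \<times> 'b \<Rightarrow> nat)" by (simp add: enc_prod_def[abs_def] comp_def)
qed
end

instantiation list :: (coded) coded
begin
definition enc_list :: "'a list \<Rightarrow> nat" where "enc_list xs = list_encode (map enc xs)"
instance
proof
  have "map enc (map dec xs :: 'a list) = xs" for xs by (simp add: comp_def)
  then have "bij (map (enc :: 'a \<Rightarrow> nat))"
    by (intro o_bij[of "map dec"]) (auto simp: comp_def)
  then have "bij (list_encode \<circ> map (enc :: 'a \<Rightarrow> nat))" by (rule bij_comp[OF _ bij_list_encode])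
  then show "bij (enc :: 'a list \<Rightarrow> nat)" by (simp add: enc_list_def[abs_def] comp_def)
qed
end

instantiation letter :: coded
begin
definition enc_letter :: "letter \<Rightarrow> nat" where "enc_letter = letter_code"
instance
proof
  have "letter_code x = letter_code y \<Longrightarrow> x = y" for x y
    by (cases x; cases y; simp; presburger)
  moreover have "\<exists>x. n = letter_code x" for n
  proof -
    consider "n mod 4 = 0" | "n mod 4 = 1" | "n mod 4 = 2" | "n mod 4 = 3" by linarith
    then show ?thesis
    proof cases
      case 1 then show ?thesis by (intro exI[of _ "Var (n div 4)"]) (simp only: letter_code.simps, presburger)
    next
      case 2 then show ?thesis by (intro exI[of _ "Var_Inv (n div 4)"]) (simp only: letter_code.simps, presburger)
    next
      case 3 then show ?thesis by (intro exI[of _ "Coef (n div 4)"]) (simp only: letter_code.simps, presburger)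
    next
      case 4 then show ?thesis by (intro exI[of _ "Coef_Inv (n div 4)"]) (simp only: letter_code.simps, presburger)
    qed
  qed
  ultimately show "bij (enc :: letter \<Rightarrow> nat)"
    unfolding enc_letter_def by (auto simp: bij_def inj_def surj_def)
qed
end

text \<open>The coding of lists and letters by the class agrees with the one fixed in the definition
  of the decision problem.\<close>

lemma enc_system_code: "system_code S = enc S"
  by (simp add: system_code_def enc_list_def[abs_def] enc_letter_def comp_def)

definition recf :: "('a::coded \<Rightarrow> 'b::coded) \<Rightarrow> bool" where
  "recf f \<longleftrightarrow> computable (\<lambda>n. enc (f (dec n)))"

definition decp :: "('a::coded \<Rightarrow> bool) \<Rightarrow> bool" where
  "decp P \<longleftrightarrow> recf (\<lambda>x. if P x then 1 else (0::nat))"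

named_theorems rec_intros

lemma recf_comp: "recf f \<Longrightarrow> recf g \<Longrightarrow> recf (\<lambda>x. f (g x))"
  unfolding recf_def by (drule (1) computable_comp) simp

lemma recf_codeI:
  assumes "computable F" "\<And>x. F (enc x) = enc (f x)" shows "recf f"
proof -
  have "enc (f (dec n)) = F n" for n using assms(2)[of "dec n"] by simp
  then show ?thesis unfolding recf_def using assms(1) by simp
qed

lemma recf_codeD:
  assumes "recf f" obtains F where "computable F" "\<And>x. F (enc x) = enc (f x)"
  using assms unfolding recf_def by force

lemma recf_id [rec_intros]: "recf (\<lambda>x. x)"
  unfolding recf_def by (simp add: computable_id)

lemma recf_const [rec_intros]: "recf (\<lambda>_. c)"
  unfolding recf_def by (simp add: computable_const)

lemma enc_Pair: "enc (x, y) = prod_encode (enc x, enc y)"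
  by (simp add: enc_prod_def)

lemma recf_Pair [rec_intros]: "recf f \<Longrightarrow> recf g \<Longrightarrow> recf (\<lambda>x. (f x, g x))"
  unfolding recf_def enc_Pair by (rule computable_prod_encode)

lemma recf_fst [rec_intros]: "recf f \<Longrightarrow> recf (\<lambda>x. fst (f x))"
proof (rule recf_comp[of fst])
  show "recf (fst :: 'b \<times> 'c \<Rightarrow> 'b)"
    by (rule recf_codeI[OF computable_fst[OF computable_id]]) (auto simp: enc_prod_def)
qed

lemma recf_snd [rec_intros]: "recf f \<Longrightarrow> recf (\<lambda>x. snd (f x))"
proof (rule recf_comp[of snd])
  show "recf (snd :: 'b \<times> 'c \<Rightarrow> 'c)"
    by (rule recf_codeI[OF computable_snd[OF computable_id]]) (auto simp: enc_prod_def)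
qed

lemma recf_Suc [rec_intros]: "recf f \<Longrightarrow> recf (\<lambda>x. Suc (f x))"
  unfolding recf_def by (auto simp: enc_nat_def dest: computable_Suc)

lemma recf_diff [rec_intros]: "recf f \<Longrightarrow> recf g \<Longrightarrow> recf (\<lambda>x. f x - g x :: nat)"
  unfolding recf_def by (auto simp: enc_nat_def dest: computable_diff)

text \<open>The step function may depend on the parameter, the counter and the accumulator, packed
  into one argument \<open>q\<close>. This shape lets \<open>rec_intros\<close> prove recursiveness
  by following the syntax of a definition.\<close>

lemma recf_rec_nat [rec_intros]:
  assumes "recf b" "recf (\<lambda>q. s (fst q) (fst (snd q)) (snd (snd q)))" "recf n"
  shows "recf (\<lambda>x. rec_nat (b x) (s x) (n x))"
proof -
  obtain B where B: "computable B" "\<And>x. B (enc x) = enc (b x)" using recf_codeD[OF assms(1)] by blast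
  obtain S where S: "computable S" "\<And>q. S (enc q) = enc (s (fst q) (fst (snd q)) (snd (snd q)))"
    using recf_codeD[OF assms(2)] by blast
  obtain N where N: "computable N" "\<And>x. N (enc x) = n x"
    using recf_codeD[OF assms(3)] unfolding enc_nat_def by blast
  have "rec_nat (B (enc x)) (\<lambda>k r. S (prod_encode (enc x, prod_encode (k, r)))) m = enc (rec_nat (b x) (s x) m)"
    for x m
  proof (induction m)
    case (Suc m)
    then show ?case using S(2)[of "(x, m, rec_nat (b x) (s x) m)"] by (simp add: enc_Pair enc_nat_def)
  qed (simp add: B)
  then show ?thesis
    by (intro recf_codeI[OF computable_rec_nat[OF B(1) S(1) computable_id N(1)]]) (simp add: N)
qed

text \<open>A case distinction is a primitive recursion of length 0 or 1.\<close>

lemma recf_if [rec_intros]: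
  assumes "decp P" "recf f" "recf g"
  shows "recf (\<lambda>x. if P x then f x else g x)"
proof -
  have "recf (\<lambda>x. rec_nat (g x) (\<lambda>_ _. f x) (if P x then 1 else 0))"
    by (intro rec_intros recf_comp[OF assms(2)] assms(1)[unfolded decp_def] assms(3))
  moreover have "rec_nat (g x) (\<lambda>_ _. f x) (if P x then 1 else 0) = (if P x then f x else g x)" for x
    by simp
  ultimately show ?thesis by simp
qed

lemma decp_comp: "decp P \<Longrightarrow> recf f \<Longrightarrow> decp (\<lambda>x. P (f x))"
  unfolding decp_def by (rule recf_comp)

lemma decp_True [rec_intros]: "decp (\<lambda>_. c)"
  unfolding decp_def by (rule recf_const)

lemma decp_eq_0: "recf f \<Longrightarrow> decp (\<lambda>x. f x = (0::nat))"
proof -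
  assume "recf f"
  then have "recf (\<lambda>x. 1 - f x)" by (intro rec_intros)
  moreover have "1 - f x = (if f x = 0 then 1 else 0)" for x by simp
  ultimately show ?thesis unfolding decp_def by simp
qed

lemma decp_not [rec_intros]: "decp P \<Longrightarrow> decp (\<lambda>x. \<not> P x)"
proof -
  assume "decp P"
  then have "decp (\<lambda>x. (if P x then 1 else (0::nat)) = 0)" unfolding decp_def[of P] by (rule decp_eq_0)
  moreover have "((if P x then 1 else (0::nat)) = 0) = (\<not> P x)" for x by simp
  ultimately show ?thesis by simp
qed

lemma decp_if [rec_intros]: "decp P \<Longrightarrow> decp Q \<Longrightarrow> decp R \<Longrightarrow> decp (\<lambda>x. if P x then Q x else R x)"
proof -
  assume "decp P" "decp Q" "decp R"
  then have "recf (\<lambda>x. if P x then (if Q x then 1 else 0) else (if R x then 1 else (0::nat)))"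
    unfolding decp_def[of Q] decp_def[of R] by (rule recf_if)
  moreover have "(if P x then (if Q x then 1 else 0) else (if R x then 1 else (0::nat))) =
    (if (if P x then Q x else R x) then 1 else 0)" for x by simp
  ultimately show ?thesis unfolding decp_def by simp
qed
lemma decp_conj [rec_intros]: "decp P \<Longrightarrow> decp Q \<Longrightarrow> decp (\<lambda>x. P x \<and> Q x)"
proof -
  assume "decp P" "decp Q"
  then have "decp (\<lambda>x. if P x then Q x else False)" by (intro rec_intros)
  moreover have "(\<lambda>x. if P x then Q x else False) = (\<lambda>x. P x \<and> Q x)" by auto
  ultimately show ?thesis by simp
qed

lemma decp_disj [rec_intros]: "decp P \<Longrightarrow> decp Q \<Longrightarrow> decp (\<lambda>x. P x \<or> Q x)"
proof -
  assume "decp P" "decp Q"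
  then have "decp (\<lambda>x. \<not> (\<not> P x \<and> \<not> Q x))" by (intro rec_intros)
  then show ?thesis by simp
qed

lemma recf_add [rec_intros]: "recf f \<Longrightarrow> recf g \<Longrightarrow> recf (\<lambda>x. f x + g x :: nat)"
proof -
  assume a: "recf f" "recf g"
  have "recf (\<lambda>x. rec_nat (f x) (\<lambda>_ r. Suc r) (g x))" by (intro rec_intros a)
  then show ?thesis by (simp add: rec_nat_add)
qed

lemma recf_mult [rec_intros]: "recf f \<Longrightarrow> recf g \<Longrightarrow> recf (\<lambda>x. f x * g x :: nat)"
proof -
  assume a: "recf f" "recf g"
  have "recf (\<lambda>x. rec_nat 0 (\<lambda>_ r. r + f x) (g x))" by (intro rec_intros a recf_comp[OF a(1)])
  moreover have "rec_nat 0 (\<lambda>_ r. r + m) n = m * n" for m n :: nat by (induction n) auto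
  ultimately show ?thesis by simp
qed

lemma recf_power [rec_intros]: "recf f \<Longrightarrow> recf g \<Longrightarrow> recf (\<lambda>x. f x ^ g x :: nat)"
proof -
  assume a: "recf f" "recf g"
  have "recf (\<lambda>x. rec_nat 1 (\<lambda>_ r. f x * r) (g x))" by (intro rec_intros a recf_comp[OF a(1)])
  moreover have "rec_nat 1 (\<lambda>_ r. m * r) n = m ^ n" for m n :: nat by (induction n) auto
  ultimately show ?thesis by simp
qed

lemma decp_le [rec_intros]: "recf f \<Longrightarrow> recf g \<Longrightarrow> decp (\<lambda>x. f x \<le> (g x :: nat))"
  by (drule (1) recf_diff, drule decp_eq_0) simp

lemma decp_less [rec_intros]: "recf f \<Longrightarrow> recf g \<Longrightarrow> decp (\<lambda>x. f x < (g x :: nat))"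
  unfolding Suc_le_eq[symmetric] by (intro rec_intros)

lemma recf_enc [rec_intros]: "recf f \<Longrightarrow> recf (\<lambda>x. enc (f x))"
  unfolding recf_def by (simp add: enc_nat_def)

lemma recf_dec [rec_intros]: "recf f \<Longrightarrow> recf (\<lambda>x. dec (f x) :: 'b::coded)"
  unfolding recf_def by (simp add: enc_nat_def)

lemma decp_eq [rec_intros]:
  assumes "recf f" "recf g" shows "decp (\<lambda>x. f x = g x)"
proof -
  have "decp (\<lambda>x. enc (f x) \<le> enc (g x) \<and> enc (g x) \<le> enc (f x))" by (intro rec_intros assms)
  then show ?thesis by (simp flip: eq_iff)
qed

subsection \<open>Search\<close>

lemma recf_Least:
  assumes "decp (\<lambda>q. P (fst q) (snd q))" "\<And>x. \<exists>n. P x n"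
  shows "recf (\<lambda>x. LEAST n::nat. P x n)"
proof -
  have "recf (\<lambda>q. if P (fst q) (snd q) then 0 else (1::nat))" by (intro rec_intros assms(1))
  then obtain F where F: "computable F" "\<And>q. F (enc q) = (if P (fst q) (snd q) then 0 else 1)"
    using recf_codeD[of "\<lambda>q. if P (fst q) (snd q) then 0 else (1::nat)"] unfolding enc_nat_def by blast
  have F': "F (prod_encode (enc x, n)) = (if P x n then 0 else 1)" for x n
    using F(2)[of "(x, n)"] by (simp add: enc_Pair enc_nat_def)
  have "computable (\<lambda>n. LEAST m. F (prod_encode (n, m)) = 0)"
    
  proof (rule computable_minimize[OF F(1)])
    fix n show "\<exists>m. F (prod_encode (n, m)) = 0"
      using assms(2)[of "dec n"] F'[of "dec n"] by auto
  qed
  then show ?thesis by (rule recf_codeI) (simp add: F' enc_nat_def)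
qed

lemma recf_div [rec_intros]:
  assumes "recf f" "recf g" shows "recf (\<lambda>x. f x div (g x :: nat))"
proof -
  \<comment> \<open>The disjunct for a zero divisor stops the search at 0, which is the value of
    division by zero.\<close>
  have "recf (\<lambda>x. LEAST q. g x = 0 \<or> f x < Suc q * g x)"
  proof (intro recf_Least rec_intros recf_comp[OF assms(1)] recf_comp[OF assms(2)])
    fix x
    have "g x = 0 \<or> f x < Suc (f x) * g x" by (cases "g x") auto
    then show "\<exists>q. g x = 0 \<or> f x < Suc q * g x" ..
  qed
  moreover have "(LEAST q. d = 0 \<or> m < Suc q * d) = m div d" for m d :: nat
  proof (rule Least_equality)
    show "d = 0 \<or> m < Suc (m div d) * d"
      using dividend_less_times_div[of d m] by (auto simp: mult.commute)
    show "m div d \<le> q" if "d = 0 \<or> m < Suc q * d" for q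
      using that less_mult_imp_div_less[of m "Suc q" d] by auto
  qed
  ultimately show ?thesis by simp
qed

lemma recf_mod [rec_intros]:
  assumes "recf f" "recf g" shows "recf (\<lambda>x. f x mod (g x :: nat))"
proof -
  have "recf (\<lambda>x. f x - g x * (f x div g x))" by (intro rec_intros assms)
  then show ?thesis by (simp add: minus_mult_div_eq_mod)
qed

lemma decp_even [rec_intros]: "recf f \<Longrightarrow> decp (\<lambda>x. even (f x :: nat))"
  unfolding even_iff_mod_2_eq_zero by (intro rec_intros)

text \<open>Search through the codes makes a decidable relation with at least one value everywhere
  into a recursive choice function, without any bound on the search.\<close>

lemma recf_choice:
  fixes P :: "'a::coded \<Rightarrow> 'b::coded \<Rightarrow> bool"
  assumes "decp (\<lambda>q. P (fst q) (snd q))" "\<And>x. \<exists>y. P x y"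
  obtains f where "recf f" "\<And>x. P x (f x)"
proof
  have 1: "decp (\<lambda>q. P (fst q) (dec (snd q)))"
    by (rule decp_comp[OF assms(1), of "\<lambda>q. (fst q, dec (snd q))", simplified]) (intro rec_intros)
  have 2: "\<exists>n. P x (dec n)" for x using assms(2)[of x] by (metis dec_enc)
  show "recf (\<lambda>x. dec (LEAST n. P x (dec n)) :: 'b)"
    by (intro recf_dec recf_Least 1 2)
  show "P x (dec (LEAST n. P x (dec n)))" for x using 2 by (rule LeastI_ex)
qed

section \<open>Recursively enumerable predicates and Post's theorem\<close>

definition rep :: "('a::coded \<Rightarrow> bool) \<Rightarrow> bool" where
  "rep P \<longleftrightarrow> (\<exists>Q :: 'a \<times> nat \<Rightarrow> bool. decp Q \<and> (\<forall>x. P x \<longleftrightarrow> (\<exists>n. Q (x, n))))"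

lemma repE:
  assumes "rep P" obtains Q where "decp Q" "\<And>x. P x \<longleftrightarrow> (\<exists>n. Q (x, n::nat))"
  using assms unfolding rep_def by blast

lemma rep_exI:
  fixes Q :: "'a::coded \<times> 'b::coded \<Rightarrow> bool"
  assumes "decp Q" "\<And>x. P x \<longleftrightarrow> (\<exists>y. Q (x, y))" shows "rep P"
proof -
  have "decp (\<lambda>q. Q (fst q, dec (snd q)))" by (rule decp_comp[OF assms(1)]) (intro rec_intros)
  moreover have "P x \<longleftrightarrow> (\<exists>n. Q (x, dec n))" for x using assms(2)[of x] by (metis dec_enc)
  ultimately show ?thesis unfolding rep_def
    by (intro exI[of _ "\<lambda>q. Q (fst q, dec (snd q))"]) simp
qed

lemma rep_decp: "decp P \<Longrightarrow> rep P"
  by (rule rep_exI[of "\<lambda>q::'a \<times> nat. P (fst q)"]) (simp_all add: decp_comp[OF _ recf_fst[OF recf_id]])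

lemma rep_comp: "rep P \<Longrightarrow> recf f \<Longrightarrow> rep (\<lambda>x. P (f x))"
proof (erule repE)
  fix Q assume f: "recf f" and Q: "decp Q" "\<And>x. P x \<longleftrightarrow> (\<exists>n::nat. Q (x, n))"
  show ?thesis
  proof (rule rep_exI)
    show "decp (\<lambda>q. Q (f (fst q), snd q :: nat))"
      by (intro decp_comp[OF Q(1)] recf_comp[OF f] rec_intros)
  qed (simp add: Q(2))
qed

lemma rep_ex:
  fixes P :: "'a::coded \<times> 'b::coded \<Rightarrow> bool"
  assumes "rep P" shows "rep (\<lambda>x. \<exists>y. P (x, y))"
proof -
  obtain Q where Q: "decp Q" "\<And>x. P x \<longleftrightarrow> (\<exists>n::nat. Q (x, n))" using repE[OF assms] by blast
  show ?thesis
  proof (rule rep_exI)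
    show "decp (\<lambda>q. Q ((fst q, fst (snd q)), snd (snd q) :: nat))"
      by (intro decp_comp[OF Q(1)] rec_intros)
  qed (simp add: Q(2))
qed

lemma rep_conj:
  assumes "rep P" "rep P'" shows "rep (\<lambda>x. P x \<and> P' x)"
proof -
  obtain Q where Q: "decp Q" "\<And>x. P x \<longleftrightarrow> (\<exists>n::nat. Q (x, n))" using repE[OF assms(1)] by blast
  obtain Q' where Q': "decp Q'" "\<And>x. P' x \<longleftrightarrow> (\<exists>n::nat. Q' (x, n))" using repE[OF assms(2)] by blast
  show ?thesis
  proof (rule rep_exI)
    show "decp (\<lambda>q. Q (fst q, fst (snd q) :: nat) \<and> Q' (fst q, snd (snd q) :: nat))"
      by (intro decp_conj decp_comp[OF Q(1)] decp_comp[OF Q'(1)] rec_intros)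
  qed (simp add: Q(2) Q'(2))
qed

lemma rep_all_less:
  fixes m :: nat
  assumes "\<And>i. i < m \<Longrightarrow> rep (P i)" shows "rep (\<lambda>x. \<forall>i<m. P i x)"
  using assms
proof (induction m)
  case 0
  show ?case by (simp add: rep_decp decp_True)
next
  case (Suc m)
  then have "rep (\<lambda>x. (\<forall>i<m. P i x) \<and> P m x)" by (intro rep_conj) auto
  then show ?case by (simp add: less_Suc_eq all_conj_distrib conj_commute)
qed

text \<open>Post's theorem: search for a witness of either predicate, then ask whether the one found
  belongs to \<open>P\<close>.\<close>

lemma decp_post:
  assumes "rep P" "rep (\<lambda>x. \<not> P x)" shows "decp P"
proof -
  obtain Q where Q: "decp Q" "\<And>x. P x \<longleftrightarrow> (\<exists>n::nat. Q (x, n))" using repE[OF assms(1)] by blast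
  obtain Q' where Q': "decp Q'" "\<And>x. \<not> P x \<longleftrightarrow> (\<exists>n::nat. Q' (x, n))" using repE[OF assms(2)] by blast
  have "decp (\<lambda>q. Q (fst q, snd q) \<or> Q' (fst q, snd q))"
    by (intro decp_disj decp_comp[OF Q(1)] decp_comp[OF Q'(1)] rec_intros)
  then have "recf (\<lambda>x. LEAST n. Q (x, n) \<or> Q' (x, n))"
    by (intro recf_Least) (auto, metis Q(2) Q'(2))
  then have "decp (\<lambda>x. Q (x, LEAST n. Q (x, n) \<or> Q' (x, n)))"
    by (intro decp_comp[OF Q(1)] rec_intros)
  moreover have "Q (x, LEAST n. Q (x, n) \<or> Q' (x, n)) \<longleftrightarrow> P x" for x
    using LeastI_ex[of "\<lambda>n. Q (x, n) \<or> Q' (x, n)"] Q(2)[of x] Q'(2)[of x] by blast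
  ultimately show ?thesis by simp
qed

subsection \<open>Lists\<close>

lemma enc_Nil [simp]: "enc [] = 0"
  by (simp add: enc_list_def)

lemma enc_Cons: "enc (x # xs) = Suc (prod_encode (enc x, enc xs))"
  by (simp add: enc_list_def)

lemma recf_Cons [rec_intros]: "recf f \<Longrightarrow> recf g \<Longrightarrow> recf (\<lambda>x. f x # g x)"
  unfolding recf_def enc_Cons by (intro computable_Suc computable_prod_encode)

lemma computable_pred: "computable (\<lambda>n. n - 1)"
  by (intro computable_diff computable_id computable_const)

lemma recf_tl [rec_intros]: "recf f \<Longrightarrow> recf (\<lambda>x. tl (f x))"
proof (rule recf_comp[of tl])
  have "snd (prod_decode (enc xs - 1)) = enc (tl xs)" for xs :: "'b list"
  proof (cases xs)
    case Nil
    then show ?thesis using prod_encode_inverse[of "(0, 0)"] by (simp add: prod_encode_def)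
  qed (simp add: enc_Cons)
  then show "recf (tl :: 'b list \<Rightarrow> 'b list)" by (rule recf_codeI[OF computable_snd[OF computable_pred]])
qed

text \<open>Unlike \<^term>\<open>hd\<close>, this is a recursive function also on the empty list.\<close>

definition hd0 :: "'a::coded list \<Rightarrow> 'a" where
  "hd0 xs = dec (fst (prod_decode (enc xs - 1)))"

lemma hd0_Cons [simp]: "hd0 (x # xs) = x"
  by (simp add: hd0_def enc_Cons)

lemma recf_hd0 [rec_intros]: "recf f \<Longrightarrow> recf (\<lambda>x. hd0 (f x))"
  by (rule recf_comp[of hd0], rule recf_codeI[OF computable_fst[OF computable_pred]])
     (simp_all add: hd0_def)

lemma length_le_enc: "length xs \<le> enc xs"
proof (induction xs)
  case (Cons x xs)
  then show ?case using le_prod_encode_2[of "enc xs" "enc x"] by (simp add: enc_Cons)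
qed simp

lemma recf_foldl [rec_intros]:
  assumes "recf (\<lambda>q. f (fst q) (fst (snd q)) (snd (snd q)))" "recf a" "recf l"
  shows "recf (\<lambda>x. foldl (f x) (a x) (l x))"
proof -
  have iter: "rec_nat (xs, c) (\<lambda>_ st. if fst st = [] then st else (tl (fst st), g (snd st) (hd0 (fst st)))) n
      = (drop n xs, foldl g c (take n xs))" for g :: "'b \<Rightarrow> 'c \<Rightarrow> 'b" and xs c n
  proof (induction n)
    case (Suc n)
    show ?case
    proof (cases "n < length xs")
      case True
      then obtain y ys where "drop n xs = y # ys" "xs ! n = y" by (metis Cons_nth_drop_Suc)
      then show ?thesis using True Suc by (simp add: take_Suc_conv_app_nth drop_Suc tl_drop[symmetric])
    qed (use Suc in simp)
  qed simp
  \<comment> \<open>The code of a list bounds its length, so \<open>enc (l x)\<close> steps exhaust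
    it; once the list is empty, the state no longer changes.\<close>
  have "recf (\<lambda>x. snd (rec_nat (l x, a x) (\<lambda>_ st. if fst st = [] then st
      else (tl (fst st), f x (snd st) (hd0 (fst st)))) (enc (l x))))"
    by (intro rec_intros assms(2,3)
        recf_comp[OF assms(1), of "\<lambda>q. (fst q, snd (snd (snd q)), hd0 (fst (snd (snd q))))", simplified])
  then show ?thesis by (simp add: iter length_le_enc)
qed

lemma foldl_rev_Cons: "foldl (\<lambda>r y. y # r) zs xs = rev xs @ zs"
  by (induction xs arbitrary: zs) auto

lemma recf_rev [rec_intros]: "recf f \<Longrightarrow> recf (\<lambda>x. rev (f x))"
  using recf_foldl[of "\<lambda>_ r y. y # r" "\<lambda>_. []" f] by (simp add: foldl_rev_Cons rec_intros)

text \<open>Recursion from the right as a fold over the reversed list: the state carries the tail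
  read so far next to the value.\<close>

lemma foldl_rev_rec_list:
  "foldl (\<lambda>st y. (y # fst st, t y (fst st) (snd st))) ([], c) (rev xs) = (xs, rec_list c t xs)"
  by (induction xs) auto

lemma foldr_rec_list: "rec_list c (\<lambda>y _ r. g y r) xs = foldr g xs c"
  by (induction xs) auto

lemma recf_rec_list [rec_intros]:
  assumes "recf b" "recf (\<lambda>q. s (fst q) (fst (snd q)) (fst (snd (snd q))) (snd (snd (snd q))))" "recf l"
  shows "recf (\<lambda>x. rec_list (b x) (s x) (l x))"
proof -
  have "recf (\<lambda>x. snd (foldl (\<lambda>st y. (y # fst st, s x y (fst st) (snd st))) ([], b x) (rev (l x))))"
    by (intro rec_intros assms(1,3) recf_comp[OF assms(2),
        of "\<lambda>q. (fst q, snd (snd q), fst (fst (snd q)), snd (fst (snd q)))", simplified])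
  then show ?thesis by (simp add: foldl_rev_rec_list)
qed

lemma recf_foldr [rec_intros]:
  assumes "recf (\<lambda>q. f (fst q) (fst (snd q)) (snd (snd q)))" "recf l" "recf a"
  shows "recf (\<lambda>x. foldr (f x) (l x) (a x))"
proof -
  have "recf (\<lambda>x. rec_list (a x) (\<lambda>y _ r. f x y r) (l x))"
    by (intro rec_intros assms(2,3) recf_comp[OF assms(1),
        of "\<lambda>q. (fst q, fst (snd q), snd (snd (snd q)))", simplified])
  then show ?thesis by (simp add: foldr_rec_list)
qed

lemma recf_map [rec_intros]:
  assumes "recf (\<lambda>q. f (fst q) (snd q))" "recf l"
  shows "recf (\<lambda>x. map (f x) (l x))"
proof -
  have "foldr (\<lambda>y r. g y # r) xs [] = map g xs" for g :: "'b \<Rightarrow> 'c" and xs by (induction xs) auto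
  moreover have "recf (\<lambda>x. foldr (\<lambda>y r. f x y # r) (l x) [])"
    by (intro rec_intros assms(2) recf_comp[OF assms(1), of "\<lambda>q. (fst q, fst (snd q))", simplified])
  ultimately show ?thesis by simp
qed

lemma recf_append [rec_intros]: "recf f \<Longrightarrow> recf g \<Longrightarrow> recf (\<lambda>x. f x @ g x)"
proof -
  assume a: "recf f" "recf g"
  have "recf (\<lambda>x. foldr (\<lambda>y r. y # r) (f x) (g x))" by (intro rec_intros a)
  moreover have "foldr (\<lambda>y r. y # r) xs ys = xs @ ys" for xs ys :: "'b list" by (induction xs) auto
  ultimately show ?thesis by simp
qed

lemma recf_concat [rec_intros]: "recf f \<Longrightarrow> recf (\<lambda>x. concat (f x))"
  using recf_foldr[of "\<lambda>_. (@)" f "\<lambda>_. []"] by (simp add: rec_intros flip: concat_conv_foldr)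

lemma recf_filter [rec_intros]:
  assumes "decp (\<lambda>q. P (fst q) (snd q))" "recf l"
  shows "recf (\<lambda>x. filter (P x) (l x))"
proof -
  have "foldr (\<lambda>y r. if P y then y # r else r) xs [] = filter P xs" for P :: "'b \<Rightarrow> bool" and xs
    by (induction xs) auto
  moreover have "recf (\<lambda>x. foldr (\<lambda>y r. if P x y then y # r else r) (l x) [])"
    by (intro rec_intros assms(2) decp_comp[OF assms(1), of "\<lambda>q. (fst q, fst (snd q))", simplified])
  ultimately show ?thesis by simp
qed

lemma recf_length [rec_intros]: "recf f \<Longrightarrow> recf (\<lambda>x. length (f x))"
proof -
  assume "recf f"
  then have "recf (\<lambda>x. foldr (\<lambda>_ n. Suc n) (f x) 0)" by (intro rec_intros)
  moreover have "foldr (\<lambda>_ n. Suc n) xs 0 = length xs" for xs :: "'b list" by (induction xs) auto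
  ultimately show ?thesis by simp
qed

lemma decp_list_all [rec_intros]:
  assumes "decp (\<lambda>q. P (fst q) (snd q))" "recf l"
  shows "decp (\<lambda>x. \<forall>y\<in>set (l x). P x y)"
proof -
  have "decp (\<lambda>x. filter (\<lambda>y. \<not> P x y) (l x) = [])" by (intro rec_intros assms)
  then show ?thesis by (simp add: filter_empty_conv)
qed

lemma decp_list_ex [rec_intros]:
  assumes "decp (\<lambda>q. P (fst q) (snd q))" "recf l"
  shows "decp (\<lambda>x. \<exists>y\<in>set (l x). P x y)"
  using decp_not[OF decp_list_all[OF decp_not[OF assms(1)] assms(2)]] by simp

lemma decp_in_set [rec_intros]:
  assumes "recf f" "recf l" shows "decp (\<lambda>x. f x \<in> set (l x))"
proof -
  have "decp (\<lambda>x. \<exists>y\<in>set (l x). f x = y)" by (intro rec_intros assms recf_comp[OF assms(1)])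
  then show ?thesis by simp
qed

lemma recf_upt [rec_intros]: "recf f \<Longrightarrow> recf g \<Longrightarrow> recf (\<lambda>x. [f x..<g x])"
proof -
  assume a: "recf f" "recf g"
  have "recf (\<lambda>x. rec_nat [] (\<lambda>k r. if f x \<le> k then r @ [k] else r) (g x))"
    by (intro rec_intros a recf_comp[OF a(1)])
  moreover have "rec_nat [] (\<lambda>k r. if m \<le> k then r @ [k] else r) n = [m..<n]" for m n by (induction n) auto
  ultimately show ?thesis by simp
qed

text \<open>Unlike \<open>nth\<close>, this has a prescribed value outside the list and therefore is
  recursive on all arguments.\<close>

lemma recf_nth_default [rec_intros]:
  assumes "recf d" "recf l" "recf n"
  shows "recf (\<lambda>x. nth_default (d x) (l x) (n x))"
proof -
  have "rec_nat xs (\<lambda>_ r. tl r) k = drop k xs" for xs :: "'b list" and k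
    by (induction k) (auto simp: drop_Suc tl_drop)
  moreover have "recf (\<lambda>x. if n x < length (l x) then hd0 (rec_nat (l x) (\<lambda>_ r. tl r) (n x)) else d x)"
    by (intro rec_intros assms)
  moreover have "hd0 (drop k xs) = xs ! k" if "k < length xs" for xs :: "'b list" and k
    using that by (metis Cons_nth_drop_Suc hd0_Cons)
  ultimately show ?thesis by (simp add: nth_default_def cong: if_cong)
qed

lemma recf_butlast [rec_intros]: "recf f \<Longrightarrow> recf (\<lambda>x. butlast (f x))"
proof -
  assume "recf f"
  then have "recf (\<lambda>x. rev (tl (rev (f x))))" by (intro rec_intros)
  moreover have "rev (tl (rev xs)) = butlast xs" for xs :: "'b list" by (metis butlast_rev rev_rev_ident)
  ultimately show ?thesis by simp
qed

lemma recf_replicate [rec_intros]: "recf n \<Longrightarrow> recf f \<Longrightarrow> recf (\<lambda>x. replicate (n x) (f x))"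
proof -
  assume a: "recf n" "recf f"
  have "recf (\<lambda>x. map (\<lambda>_. f x) [0..<n x])" by (intro rec_intros a recf_comp[OF a(2)])
  then show ?thesis by (simp add: map_replicate_const)
qed

subsection \<open>Integers\<close>

lemma enc_int_of_nat: "enc (int n) = 2 * n"
  by (simp add: enc_int_def int_encode_def sum_encode_def)

lemma enc_int_neg: "enc (- int (Suc n)) = Suc (2 * n)"
  by (simp add: enc_int_def int_encode_def sum_encode_def)

lemma recf_int [rec_intros]: "recf f \<Longrightarrow> recf (\<lambda>x. int (f x))"
proof (rule recf_comp[of int])
  have "recf (\<lambda>n::nat. dec (2 * n) :: int)" by (intro rec_intros)
  moreover have "(dec (2 * n) :: int) = int n" for n by (metis dec_enc enc_int_of_nat)
  ultimately show "recf int" by simp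
qed

text \<open>A positive number \<open>n\<close> has code \<open>2 * n\<close> and \<open>- n\<close>
  has code \<open>2 * n - 1\<close>, so negation exchanges neighbouring codes and fixes 0.\<close>

lemma recf_uminus_int [rec_intros]: "recf f \<Longrightarrow> recf (\<lambda>x. - f x :: int)"
proof (rule recf_comp[of uminus])
  have "recf (\<lambda>k::int. dec (if enc k = 0 then 0 else if even (enc k) then enc k - 1 else Suc (enc k)) :: int)"
    by (intro rec_intros)
  moreover have "(dec (if enc k = 0 then 0 else if even (enc k) then enc k - 1 else Suc (enc k)) :: int) = - k" for k
  proof -
    have "(if enc k = 0 then 0 else if even (enc k) then enc k - 1 else Suc (enc k)) = enc (- k)"
    proof (cases k)
      case (nonneg n)
      then show ?thesis
      proof (cases n)
        case (Suc m)
        then show ?thesis using nonneg enc_int_of_nat[of n] enc_int_neg[of m] by simp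
      qed (simp add: enc_int_def int_encode_def sum_encode_def)
    next
      case (neg n)
      then show ?thesis using enc_int_of_nat[of "Suc n"] enc_int_neg[of n] by (simp add: add.commute)
    qed
    then show ?thesis by simp
  qed
  ultimately show "recf (uminus :: int \<Rightarrow> int)" by simp
qed

lemma recf_nat [rec_intros]: "recf f \<Longrightarrow> recf (\<lambda>x. nat (f x))"
proof (rule recf_comp[of nat])
  have "recf (\<lambda>k::int. if even (enc k) then enc k div 2 else 0)" by (intro rec_intros)
  moreover have "(if even (enc k) then enc k div 2 else 0) = nat k" for k :: int
  proof (cases k)
    case (nonneg n)
    then show ?thesis by (simp add: enc_int_of_nat)
  next
    case (neg n)
    then show ?thesis using enc_int_neg[of n] by simp
  qed
  ultimately show "recf nat" by simp
qed

lemma recf_int_diff: "recf f \<Longrightarrow> recf g \<Longrightarrow> recf (\<lambda>x. int (f x) - int (g x))"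
proof -
  assume a: "recf f" "recf g"
  have "recf (\<lambda>x. if g x \<le> f x then int (f x - g x) else - int (g x - f x))" by (intro rec_intros a)
  moreover have "(if n \<le> m then int (m - n) else - int (n - m)) = int m - int n" for m n by simp
  ultimately show ?thesis by simp
qed

lemma recf_add_int [rec_intros]:
  assumes "recf f" "recf g" shows "recf (\<lambda>x. f x + g x :: int)"
proof -
  \<comment> \<open>Both numbers are split into positive and negative part, which leaves sums of
    naturals and one difference.\<close>
  have "recf (\<lambda>x. int (nat (f x) + nat (g x)) - int (nat (- f x) + nat (- g x)))"
    by (intro recf_int_diff rec_intros assms)
  moreover have "int (nat k + nat l) - int (nat (- k) + nat (- l)) = k + l" for k l by simp
  ultimately show ?thesis by simp
qed

lemma recf_diff_int [rec_intros]: "recf f \<Longrightarrow> recf g \<Longrightarrow> recf (\<lambda>x. f x - g x :: int)"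
  using recf_add_int[OF _ recf_uminus_int, of f g] by simp

lemma recf_mult_int [rec_intros]:
  assumes "recf f" "recf g" shows "recf (\<lambda>x. f x * g x :: int)"
proof -
  have "recf (\<lambda>x. int (nat (f x) * nat (g x) + nat (- f x) * nat (- g x)) -
      int (nat (f x) * nat (- g x) + nat (- f x) * nat (g x)))"
    by (intro recf_int_diff rec_intros assms)
  moreover have "int (nat k * nat l + nat (- k) * nat (- l)) - int (nat k * nat (- l) + nat (- k) * nat l) = k * l"
    for k l
  proof -
    consider a b where "k = int a" "l = int b" | a b where "k = - int a" "l = int b"
      | a b where "k = int a" "l = - int b" | a b where "k = - int a" "l = - int b"
      by (metis int_cases2)
    then show ?thesis by cases (simp_all flip: of_nat_mult)
  qed
  ultimately show ?thesis by simp
qed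

lemma decp_less_int [rec_intros]: "recf f \<Longrightarrow> recf g \<Longrightarrow> decp (\<lambda>x. f x < (g x :: int))"
  using decp_less[OF recf_const recf_nat[OF recf_diff_int], of g f 0] by simp

lemma decp_le_int [rec_intros]: "recf f \<Longrightarrow> recf g \<Longrightarrow> decp (\<lambda>x. f x \<le> (g x :: int))"
  using decp_not[OF decp_less_int, of g f] by (simp add: not_less)

lemma recf_sgn_int [rec_intros]: "recf f \<Longrightarrow> recf (\<lambda>x. sgn (f x :: int))"
  unfolding sgn_if by (intro rec_intros)

section \<open>Integer polynomials in several variables\<close>

text \<open>A monomial is its coefficient with the list of its variables, with repetitions, and a polynomial the
  list of its monomials, so that addition is concatenation.\<close>

type_synonym int_mpoly = "(int \<times> nat list) list"

text \<open>Monomials are not merged, so many lists denote the same polynomial and only values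
  matter. The ring is arbitrary because one list is evaluated at integers, reals and complex
  numbers.\<close>

definition mev :: "(nat \<Rightarrow> 'a::comm_ring_1) \<Rightarrow> int_mpoly \<Rightarrow> 'a" where
  "mev e p = (\<Sum>m\<leftarrow>p. of_int (fst m) * prod_list (map e (snd m)))"

definition mconst :: "int \<Rightarrow> int_mpoly" where "mconst k = [(k, [])]"
definition mvar :: "nat \<Rightarrow> int_mpoly" where "mvar i = [(1, [i])]"
definition mneg :: "int_mpoly \<Rightarrow> int_mpoly" where "mneg p = map (\<lambda>m. (- fst m, snd m)) p"
definition mmult :: "int_mpoly \<Rightarrow> int_mpoly \<Rightarrow> int_mpoly" where
  "mmult p q = concat (map (\<lambda>m. map (\<lambda>m'. (fst m * fst m', snd m @ snd m')) q) p)"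

lemma mev_Nil [simp]: "mev e [] = 0" by (simp add: mev_def)
lemma mev_Cons: "mev e (m # p) = of_int (fst m) * prod_list (map e (snd m)) + mev e p"
  by (simp add: mev_def)
lemma mev_append [simp]: "mev e (p @ q) = mev e p + mev e q" by (simp add: mev_def)
lemma mev_mconst [simp]: "mev e (mconst k) = of_int k" by (simp add: mev_def mconst_def)
lemma mev_mvar [simp]: "mev e (mvar i) = e i" by (simp add: mev_def mvar_def)
lemma mev_mneg [simp]: "mev e (mneg p) = - mev e p"
  by (induction p) (simp_all add: mev_def mneg_def)
lemma mev_map_mmult: "mev e (map (\<lambda>m'. (k * fst m', vs @ snd m')) q) = of_int k * prod_list (map e vs) * mev e q"
  by (induction q) (simp_all add: mev_def algebra_simps)
lemma mev_mmult [simp]: "mev e (mmult p q) = mev e p * mev e q"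
proof (induction p)
  case (Cons m p)
  have "mmult (m # p) q = map (\<lambda>m'. (fst m * fst m', snd m @ snd m')) q @ mmult p q"
    by (simp add: mmult_def)
  then show ?case using Cons by (simp add: mev_map_mmult mev_Cons distrib_right)
qed (simp add: mmult_def)

lemma recf_comp2:
  assumes "recf (\<lambda>q. h (fst q) (snd q))" "recf f" "recf g" shows "recf (\<lambda>x. h (f x) (g x))"
  using recf_comp[OF assms(1) recf_Pair[OF assms(2,3)]] by simp

lemma recf_mconst [rec_intros]: "recf f \<Longrightarrow> recf (\<lambda>x. mconst (f x))"
  unfolding mconst_def by (intro rec_intros)
lemma recf_mvar [rec_intros]: "recf f \<Longrightarrow> recf (\<lambda>x. mvar (f x))"
  unfolding mvar_def by (intro rec_intros)
lemma recf_mneg [rec_intros]: "recf f \<Longrightarrow> recf (\<lambda>x. mneg (f x))"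
  unfolding mneg_def by (intro rec_intros)
lemma recf_mmult [rec_intros]: "recf f \<Longrightarrow> recf g \<Longrightarrow> recf (\<lambda>x. mmult (f x) (g x))"
  by (rule recf_comp2[of mmult]) (unfold mmult_def, intro rec_intros)

definition mcoeff :: "nat \<Rightarrow> int_mpoly \<Rightarrow> nat \<Rightarrow> int_mpoly" where
  "mcoeff v p j = map (\<lambda>m. (fst m, filter (\<lambda>i. i \<noteq> v) (snd m)))
     (filter (\<lambda>m. length (filter (\<lambda>i. i = v) (snd m)) = j) p)"

definition mcoeffs :: "nat \<Rightarrow> int_mpoly \<Rightarrow> int_mpoly list" where
  "mcoeffs v p = map (mcoeff v p) [0..<Suc (length (concat (map snd p)))]"

lemma recf_mcoeffs: "recf (\<lambda>q. mcoeffs (fst q) (snd q))"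
  unfolding mcoeffs_def mcoeff_def by (intro rec_intros)

definition upoly :: "(nat \<Rightarrow> real) \<Rightarrow> int_mpoly list \<Rightarrow> real poly" where
  "upoly e p = Poly (map (mev e) p)"

lemma poly_Poly: "poly (Poly xs) (x::'a::comm_semiring_1) = (\<Sum>i<length xs. xs ! i * x ^ i)"
proof (induction xs)
  case (Cons a xs)
  have "(\<Sum>i<length (a # xs). (a # xs) ! i * x ^ i) = a + (\<Sum>i<length xs. xs ! i * x ^ Suc i)"
    by (simp add: sum.lessThan_Suc_shift del: sum.lessThan_Suc)
  then show ?case using Cons by (simp add: sum_distrib_left mult_ac)
qed simp

lemma prod_list_fun_upd:
  "prod_list (map (e(v := x)) vs) =
     prod_list (map e (filter (\<lambda>i. i \<noteq> v) vs)) * (x::'a::comm_ring_1) ^ length (filter (\<lambda>i. i = v) vs)"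
  by (induction vs) (auto simp: mult_ac)

lemma mev_fun_upd_sum:
  assumes "\<And>m. m \<in> set p \<Longrightarrow> length (filter (\<lambda>i. i = v) (snd m)) < B"
  shows "(\<Sum>j<B. mev e (mcoeff v p j) * x ^ j) = mev (e(v := x)) p"
  using assms
proof (induction p)
  case (Cons m p)
  let ?k = "length (filter (\<lambda>i. i = v) (snd m))"
  let ?r = "of_int (fst m) * prod_list (map e (filter (\<lambda>i. i \<noteq> v) (snd m)))"
  have "(\<Sum>j<B. mev e (mcoeff v (m # p) j) * x ^ j) =
      (\<Sum>j<B. (if j = ?k then ?r * x ^ j else 0) + mev e (mcoeff v p j) * x ^ j)"
    by (intro sum.cong) (auto simp: mcoeff_def mev_Cons distrib_right)
  also have "\<dots> = ?r * x ^ ?k + (\<Sum>j<B. mev e (mcoeff v p j) * x ^ j)"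
    using Cons.prems[of m] by (simp add: sum.distrib)
  also have "(\<Sum>j<B. mev e (mcoeff v p j) * x ^ j) = mev (e(v := x)) p"
    by (rule Cons.IH) (use Cons.prems in auto)
  finally show ?case by (simp only: mev_Cons prod_list_fun_upd mult.assoc)
qed (simp add: mcoeff_def)

lemma poly_upoly_mcoeffs: "poly (upoly e (mcoeffs v p)) x = mev (e(v := x)) p"
proof -
  let ?B = "Suc (length (concat (map snd p)))"
  have "length (filter (\<lambda>i. i = v) (snd m)) < ?B" if "m \<in> set p" for m
  proof -
    have "length (snd m) \<le> length (concat (map snd p))" using that by (induction p) auto
    then show ?thesis using length_filter_le[of "\<lambda>i. i = v" "snd m"] by linarith
  qed
  from mev_fun_upd_sum[of p v ?B e x, OF this] show ?thesis
    unfolding upoly_def poly_Poly mcoeffs_def by (simp del: upt_Suc)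
qed

section \<open>Elimination of a real quantifier\<close>

subsection \<open>Univariate polynomials with polynomial coefficients\<close>

text \<open>Signs are integers, since recursive functions compare values of a coded type.\<close>

definition isgn :: "real \<Rightarrow> int" where
  "isgn x = (if x < 0 then -1 else if x = 0 then 0 else 1)"

lemma isgn_simps [simp]: "isgn x = -1 \<longleftrightarrow> x < 0" "isgn x = 0 \<longleftrightarrow> x = 0" "isgn x = 1 \<longleftrightarrow> x > 0"
  by (auto simp: isgn_def)

lemma isgn_cases: "isgn x = -1 \<or> isgn x = 0 \<or> isgn x = 1"
  by (simp only: isgn_simps) linarith

lemma isgn_minus [simp]: "isgn (- x) = - isgn x"
  by (auto simp: isgn_def)

lemma isgn_mult: "isgn (x * y) = isgn x * isgn y"
  by (auto simp: isgn_def zero_less_mult_iff mult_less_0_iff)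

definition alook :: "('a \<times> int) list \<Rightarrow> 'a \<Rightarrow> int" where
  "alook l a = foldr (\<lambda>y r. if fst y = a then snd y else r) l 0"

lemma alook_eq:
  assumes "\<And>y. y \<in> set l \<Longrightarrow> snd y = f (fst y)" "a \<in> fst ` set l" shows "alook l a = f a"
  using assms by (induction l) (auto simp: alook_def)

lemma recf_alook [rec_intros]: "recf f \<Longrightarrow> recf g \<Longrightarrow> recf (\<lambda>x. alook (f x) (g x))"
  by (rule recf_comp2[of alook]) (unfold alook_def, intro rec_intros)

text \<open>A list holds the coefficient of the \<open>i\<close>-th power at position
  \<open>i\<close>. Its last entry is only formally the leading coefficient: it can vanish at the
  given parameters, and then \<open>butlast\<close> denotes the same polynomial.\<close>

definition ulast :: "int_mpoly list \<Rightarrow> int_mpoly" where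
  "ulast p = nth_default [] p (length p - 1)"

definition uderiv :: "int_mpoly list \<Rightarrow> int_mpoly list" where
  "uderiv p = map (\<lambda>i. mmult (mconst (int (Suc i))) (nth_default [] p (Suc i))) [0..<length p - 1]"

text \<open>One step of the division of \<open>p\<close> by \<open>q\<close>, multiplied by the square of the leading
  coefficient of \<open>q\<close>, so that signs are preserved at the roots of \<open>q\<close>.\<close>

definition rstep :: "int_mpoly list \<Rightarrow> int_mpoly list \<Rightarrow> int_mpoly list" where
  "rstep p q = map (\<lambda>i. mmult (mmult (ulast q) (ulast q)) (nth_default [] p i) @
     mneg (mmult (mmult (ulast q) (ulast p))
       (if i < length p - length q then [] else nth_default [] q (i - (length p - length q)))))
     [0..<length p - 1]"

text \<open>Each step shortens the list by one, so for \<open>p\<close> at least as long as a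
  nonempty \<open>q\<close> this number of steps ends at length \<open>length q - 1\<close>.\<close>

definition prem :: "int_mpoly list \<Rightarrow> int_mpoly list \<Rightarrow> int_mpoly list" where
  "prem p q = rec_nat p (\<lambda>_ r. rstep r q) (Suc (length p) - length q)"

lemma recf_ulast [rec_intros]: "recf f \<Longrightarrow> recf (\<lambda>x. ulast (f x))"
  unfolding ulast_def by (intro rec_intros)
lemma recf_uderiv [rec_intros]: "recf f \<Longrightarrow> recf (\<lambda>x. uderiv (f x))"
  by (rule recf_comp[of uderiv]) (unfold uderiv_def, intro rec_intros)
lemma recf_rstep [rec_intros]: "recf f \<Longrightarrow> recf g \<Longrightarrow> recf (\<lambda>x. rstep (f x) (g x))"
  by (rule recf_comp2[of rstep]) (unfold rstep_def, intro rec_intros)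
lemma recf_prem [rec_intros]: "recf f \<Longrightarrow> recf g \<Longrightarrow> recf (\<lambda>x. prem (f x) (g x))"
  by (rule recf_comp2[of prem]) (unfold prem_def, intro rec_intros)

lemma coeff_upoly: "coeff (upoly e p) i = mev e (nth_default [] p i)"
  by (simp add: upoly_def nth_default_def)

lemma pderiv_upoly: "pderiv (upoly e p) = upoly e (uderiv p)"
  by (rule poly_eqI) (auto simp: coeff_pderiv coeff_upoly uderiv_def nth_default_def)

lemma ulast_eq_last: "p \<noteq> [] \<Longrightarrow> ulast p = last p"
  by (simp add: ulast_def last_conv_nth nth_default_nth)

lemma upoly_butlast: "mev e (ulast p) = 0 \<Longrightarrow> upoly e (butlast p) = upoly e p"
  by (cases p rule: rev_cases) (simp_all add: upoly_def ulast_eq_last Poly_append)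

lemma degree_upoly:
  assumes "mev e (ulast p) \<noteq> 0" "p \<noteq> []" shows "degree (upoly e p) = length p - 1"
proof (rule antisym)
  show "degree (upoly e p) \<le> length p - 1"
    by (rule degree_le) (auto simp: coeff_upoly nth_default_def)
  show "length p - 1 \<le> degree (upoly e p)"
    by (rule le_degree) (use assms in \<open>simp add: coeff_upoly ulast_def\<close>)
qed

lemma lead_coeff_upoly:
  assumes "mev e (ulast p) \<noteq> 0" "p \<noteq> []" shows "lead_coeff (upoly e p) = mev e (ulast p)"
  using degree_upoly[OF assms] by (simp add: coeff_upoly ulast_def)

lemma length_rstep [simp]: "length (rstep p q) = length p - 1"
  by (simp add: rstep_def)

lemma upoly_rstep:
  assumes "q \<noteq> []" "length q \<le> length p"
  shows "upoly e (rstep p q) = smult (mev e (ulast q) ^ 2) (upoly e p) -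
    monom (mev e (ulast q) * mev e (ulast p)) (length p - length q) * upoly e q"
proof (rule poly_eqI)
  fix i
  consider "i < length p - 1" | "i = length p - 1" | "i \<ge> length p" by linarith
  then show "coeff (upoly e (rstep p q)) i = coeff (smult (mev e (ulast q) ^ 2) (upoly e p) -
    monom (mev e (ulast q) * mev e (ulast p)) (length p - length q) * upoly e q) i"
  proof cases
    case 1
    then show ?thesis
      by (simp add: coeff_upoly rstep_def nth_default_nth coeff_monom_mult power2_eq_square)
  next
    case 2
    have "p \<noteq> []" using assms by auto
    moreover have "\<not> i < length p - length q" "i - (length p - length q) = length q - 1"
      using 2 assms \<open>p \<noteq> []\<close> by (cases q; simp; linarith)+
    ultimately show ?thesis using 2
      by (simp add: coeff_upoly nth_default_beyond coeff_monom_mult power2_eq_square ulast_def)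
  next
    case 3
    then have "i - (length p - length q) \<ge> length q" using assms by linarith
    then show ?thesis using 3
      by (simp add: coeff_upoly nth_default_beyond coeff_monom_mult)
  qed
qed

lemma length_prem: "length q \<le> length p \<Longrightarrow> q \<noteq> [] \<Longrightarrow> length (prem p q) = length q - 1"
proof -
  assume a: "length q \<le> length p" "q \<noteq> []"
  have "length (rec_nat p (\<lambda>_ r. rstep r q) n) = length p - n" for n by (induction n) auto
  then show ?thesis using a by (simp add: prem_def)
qed

text \<open>At a root of \<open>q\<close> the multiple of \<open>q\<close> subtracted in a step
  vanishes, and the factor left over is a nonzero square.\<close>

lemma isgn_prem:
  assumes "mev e (ulast q) \<noteq> 0" "q \<noteq> []" "poly (upoly e q) x = 0"
  shows "isgn (poly (upoly e (prem p q)) x) = isgn (poly (upoly e p) x)"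
proof -
  have "length (rec_nat p (\<lambda>_ r. rstep r q) n) = length p - n \<and>
    isgn (poly (upoly e (rec_nat p (\<lambda>_ r. rstep r q) n)) x) = isgn (poly (upoly e p) x)"
    if "n \<le> Suc (length p) - length q" for n
    using that
  proof (induction n)
    case (Suc n)
    let ?r = "rec_nat p (\<lambda>_ r. rstep r q) n"
    have IH: "length ?r = length p - n" "isgn (poly (upoly e ?r) x) = isgn (poly (upoly e p) x)"
      using Suc by auto
    have "length q \<le> length ?r" using IH(1) Suc.prems by auto
    from upoly_rstep[OF assms(2) this, of e]
    have "poly (upoly e (rstep ?r q)) x = mev e (ulast q) ^ 2 * poly (upoly e ?r) x"
      using assms(3) by simp
    moreover have "isgn (mev e (ulast q) ^ 2) = 1" using assms(1) by simp
    ultimately show ?case using IH by (simp add: isgn_mult)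
  qed simp
  then show ?thesis unfolding prem_def by blast
qed

subsection \<open>Sign tables\<close>

type_synonym sign_column = "(int_mpoly list \<times> int) list"

text \<open>A table lists the sign columns along the real line: that of the leftmost interval, followed
  by those of each root and of the interval to its right.\<close>

type_synonym sign_table = "sign_column \<times> (sign_column \<times> sign_column) list"

text \<open>At a root of \<open>q\<close> the sign of \<open>p\<close> is that of its remainder modulo \<open>q\<close>, which stands further down in the column.\<close>

definition root_sign :: "(int_mpoly \<times> int) list \<Rightarrow> int_mpoly list \<Rightarrow> sign_column \<Rightarrow> int" where
  "root_sign \<sigma> p c = alook c (prem p (fst (hd0
     (filter (\<lambda>y. snd y = 0 \<and> 2 \<le> length (fst y) \<and> alook \<sigma> (ulast (fst y)) \<noteq> 0) c))))"

text \<open>The derivative of \<open>p\<close> has constant sign on an interval of the table, so that \<open>p\<close> has at most one root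
  there, which its signs at the two ends reveal.\<close>

definition split_interval ::
  "int_mpoly list \<Rightarrow> int \<Rightarrow> int \<Rightarrow> sign_column \<Rightarrow> sign_table" where
  "split_interval p sl sr I = (if sl * sr = -1 then ((p, sl) # I, [((p, 0) # I, (p, sr) # I)])
     else ((p, if sl = 0 then sr else sl) # I, []))"

text \<open>Runs from right to left. The first component is the sign of \<open>p\<close> at the left
  end of the part already treated, starting with the sign near infinity; the interval to its left
  needs it as the sign at its right end.\<close>

definition add_rows ::
  "(int_mpoly \<times> int) list \<Rightarrow> int_mpoly list \<Rightarrow> (sign_column \<times> sign_column) list \<Rightarrow>
     int \<times> (sign_column \<times> sign_column) list" where
  "add_rows \<sigma> p T = foldr (\<lambda>y r.
     (root_sign \<sigma> p (fst y),
      ((p, root_sign \<sigma> p (fst y)) # fst y,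
       fst (split_interval p (root_sign \<sigma> p (fst y)) (fst r) (snd y))) #
      snd (split_interval p (root_sign \<sigma> p (fst y)) (fst r) (snd y)) @ snd r))
     T (alook \<sigma> (ulast p), [])"

text \<open>The sign near minus infinity; even length means odd degree.\<close>

definition left_sign :: "(int_mpoly \<times> int) list \<Rightarrow> int_mpoly list \<Rightarrow> int" where
  "left_sign \<sigma> p = (if even (length p) then - alook \<sigma> (ulast p) else alook \<sigma> (ulast p))"

text \<open>The zero polynomial and constants have the same sign everywhere; if the leading
  coefficient vanishes, the row of \<open>butlast p\<close> is copied; only a genuine polynomial of
  positive degree can add roots.\<close>

definition extend_table ::
  "(int_mpoly \<times> int) list \<Rightarrow> int_mpoly list \<Rightarrow> sign_table \<Rightarrow> sign_table" where
  "extend_table \<sigma> p T =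
     (if p = [] then ((p, 0) # fst T, map (\<lambda>y. ((p, 0) # fst y, (p, 0) # snd y)) (snd T))
      else if alook \<sigma> (ulast p) = 0 then
        ((p, alook (fst T) (butlast p)) # fst T,
         map (\<lambda>y. ((p, alook (fst y) (butlast p)) # fst y, (p, alook (snd y) (butlast p)) # snd y)) (snd T))
      else if length p = 1 then
        ((p, alook \<sigma> (ulast p)) # fst T,
         map (\<lambda>y. ((p, alook \<sigma> (ulast p)) # fst y, (p, alook \<sigma> (ulast p)) # snd y)) (snd T))
      else
        (fst (split_interval p (left_sign \<sigma> p) (fst (add_rows \<sigma> p (snd T))) (fst T)),
         snd (split_interval p (left_sign \<sigma> p) (fst (add_rows \<sigma> p (snd T))) (fst T)) @
           snd (add_rows \<sigma> p (snd T))))"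

text \<open>The fold starts at the end of \<open>ps\<close>, so the polynomials consulted by a row
  must stand behind it.\<close>

definition table :: "(int_mpoly \<times> int) list \<Rightarrow> int_mpoly list list \<Rightarrow> sign_table" where
  "table \<sigma> ps = foldr (extend_table \<sigma>) ps ([], [])"

definition columns :: "sign_table \<Rightarrow> sign_column list" where
  "columns T = fst T # concat (map (\<lambda>y. [fst y, snd y]) (snd T))"

lemma recf_comp3:
  assumes "recf (\<lambda>q. h (fst q) (fst (snd q)) (snd (snd q)))" "recf f" "recf g" "recf k"
  shows "recf (\<lambda>x. h (f x) (g x) (k x))"
  using recf_comp[OF assms(1) recf_Pair[OF assms(2) recf_Pair[OF assms(3,4)]]] by simp

lemma recf_comp4:
  assumes "recf (\<lambda>q. h (fst q) (fst (snd q)) (fst (snd (snd q))) (snd (snd (snd q))))"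
    "recf f" "recf g" "recf k" "recf l"
  shows "recf (\<lambda>x. h (f x) (g x) (k x) (l x))"
  using recf_comp[OF assms(1) recf_Pair[OF assms(2) recf_Pair[OF assms(3) recf_Pair[OF assms(4,5)]]]] by simp

lemma recf_root_sign [rec_intros]:
  "recf f \<Longrightarrow> recf g \<Longrightarrow> recf h \<Longrightarrow> recf (\<lambda>x. root_sign (f x) (g x) (h x))"
  by (rule recf_comp3[of root_sign]) (unfold root_sign_def, intro rec_intros)

lemma recf_split_interval [rec_intros]:
  "recf f \<Longrightarrow> recf g \<Longrightarrow> recf h \<Longrightarrow> recf k \<Longrightarrow> recf (\<lambda>x. split_interval (f x) (g x) (h x) (k x))"
  by (rule recf_comp4[of split_interval]) (unfold split_interval_def, intro rec_intros)

lemma recf_add_rows [rec_intros]: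
  "recf f \<Longrightarrow> recf g \<Longrightarrow> recf h \<Longrightarrow> recf (\<lambda>x. add_rows (f x) (g x) (h x))"
  by (rule recf_comp3[of add_rows]) (unfold add_rows_def, intro rec_intros)

lemma recf_left_sign [rec_intros]: "recf f \<Longrightarrow> recf g \<Longrightarrow> recf (\<lambda>x. left_sign (f x) (g x))"
  by (rule recf_comp2[of left_sign]) (unfold left_sign_def, intro rec_intros)

lemma recf_extend_table [rec_intros]:
  "recf f \<Longrightarrow> recf g \<Longrightarrow> recf h \<Longrightarrow> recf (\<lambda>x. extend_table (f x) (g x) (h x))"
  by (rule recf_comp3[of extend_table]) (unfold extend_table_def, intro rec_intros)

lemma recf_table [rec_intros]: "recf f \<Longrightarrow> recf g \<Longrightarrow> recf (\<lambda>x. table (f x) (g x))"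
  by (rule recf_comp2[of table]) (unfold table_def, intro rec_intros)

lemma recf_columns [rec_intros]: "recf f \<Longrightarrow> recf (\<lambda>x. columns (f x))"
  by (rule recf_comp[of columns]) (unfold columns_def, intro rec_intros)

text \<open>Endpoints are extended reals, and \<open>left\<close> and \<open>right\<close> ask for a
  point of the given sign on either side of each \<open>x\<close>. This is the endpoint itself when
  it is finite and a far point otherwise, so bounded and unbounded intervals are treated
  alike.\<close>

lemma strict_mono_interval_sign:
  fixes f :: "real poly" and lo hi :: ereal
  assumes deriv: "\<And>x. lo < ereal x \<Longrightarrow> ereal x < hi \<Longrightarrow> poly (pderiv f) x > 0"
    and left: "\<And>x. lo < ereal x \<Longrightarrow> ereal x < hi \<Longrightarrow> \<exists>y<x. lo \<le> ereal y \<and> isgn (poly f y) = sl"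
    and right: "\<And>x. lo < ereal x \<Longrightarrow> ereal x < hi \<Longrightarrow> \<exists>y>x. ereal y \<le> hi \<and> isgn (poly f y) = sr"
    and "lo < hi"
  shows "(if sl * sr = -1
     then \<exists>z. lo < ereal z \<and> ereal z < hi \<and> poly f z = 0 \<and>
       (\<forall>x. lo < ereal x \<and> x < z \<longrightarrow> isgn (poly f x) = sl) \<and> (\<forall>x. z < x \<and> ereal x < hi \<longrightarrow> isgn (poly f x) = sr)
     else \<forall>x. lo < ereal x \<and> ereal x < hi \<longrightarrow> isgn (poly f x) = (if sl = 0 then sr else sl))"
proof -
  have mono: "poly f a < poly f b" if "a < b" "lo \<le> ereal a" "ereal b \<le> hi" for a b
  proof (rule DERIV_pos_imp_increasing_open[OF that(1)])
    fix x assume "a < x" "x < b"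
    then have "lo < ereal x" "ereal x < hi" using that
      by (meson ereal_less_eq(3) less_ereal.simps(1) le_less_trans less_le_trans)+
    then show "\<exists>y. DERIV (poly f) x :> y \<and> y > 0" using deriv poly_DERIV by blast
  qed (intro continuous_intros)
  obtain x0 where x0: "lo < ereal x0" "ereal x0 < hi" using ereal_dense2[OF \<open>lo < hi\<close>] by auto
  obtain y1 where y1: "y1 < x0" "lo \<le> ereal y1" "isgn (poly f y1) = sl" using left[OF x0] by blast
  obtain y2 where y2: "x0 < y2" "ereal y2 \<le> hi" "isgn (poly f y2) = sr" using right[OF x0] by blast
  have sgns: "sl = -1 \<or> sl = 0 \<or> sl = 1" "sr = -1 \<or> sr = 0 \<or> sr = 1"
    using y1(3) y2(3) isgn_cases by blast+
  have lt: "poly f y1 < poly f y2"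
    using mono[of y1 y2] y1 y2 by auto
  have pos: "isgn (poly f x) = 1" if x: "lo < ereal x" "ereal x < hi" and sl: "sl = 0 \<or> sl = 1" for x
  proof -
    obtain y where y: "y < x" "lo \<le> ereal y" "isgn (poly f y) = sl" using left[OF x] by blast
    have "poly f y < poly f x" using y x by (intro mono) auto
    moreover have "0 \<le> poly f y" using y(3) sl by (auto simp: isgn_def split: if_splits)
    ultimately show ?thesis by simp
  qed
  have neg: "isgn (poly f x) = -1" if x: "lo < ereal x" "ereal x < hi" and sr: "sr = 0 \<or> sr = -1" for x
  proof -
    obtain y where y: "x < y" "ereal y \<le> hi" "isgn (poly f y) = sr" using right[OF x] by blast
    have "poly f x < poly f y" using y x by (intro mono) auto
    moreover have "poly f y \<le> 0" using y(3) sr by (auto simp: isgn_def split: if_splits)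
    ultimately show ?thesis by simp
  qed
  consider "sl = 0 \<or> sl = 1" | "sl = -1" "sr = 0 \<or> sr = -1" | "sl = -1" "sr = 1" using sgns by blast
  then show ?thesis
  proof cases
    case 1
    have "sr = 1" using lt y1(3) y2(3) 1 sgns by (auto simp: isgn_def split: if_splits)
    then show ?thesis using 1 pos by auto
  next
    case 2
    then show ?thesis using neg by auto
  next
    case 3
    have "poly f y1 < 0" "0 < poly f y2" using 3 y1 y2 by (auto simp flip: isgn_simps)
    then obtain z where z: "y1 < z" "z < y2" "poly f z = 0" using poly_IVT_pos[of y1 y2 f] y1 y2 by auto
    have lo: "lo < ereal z" using z(1) y1(2) by (meson ereal_less(2) le_less_trans less_ereal.simps(1))
    have hi: "ereal z < hi" using z(2) y2(2) by (meson less_le_trans less_ereal.simps(1))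
    have "isgn (poly f x) = sl" if "lo < ereal x" "x < z" for x
      using mono[of x z] that hi z(3) 3 by (auto intro: less_imp_le)
    moreover have "isgn (poly f x) = sr" if "z < x" "ereal x < hi" for x
      using mono[of z x] that lo z(3) 3 by (auto intro: less_imp_le)
    ultimately show ?thesis using lo hi z(3) 3 by auto
  qed
qed

lemma interval_sign:
  fixes f :: "real poly" and lo hi :: ereal
  assumes deriv: "\<And>x. lo < ereal x \<Longrightarrow> ereal x < hi \<Longrightarrow> isgn (poly (pderiv f) x) = d" and "d \<noteq> 0"
    and left: "\<And>x. lo < ereal x \<Longrightarrow> ereal x < hi \<Longrightarrow> \<exists>y<x. lo \<le> ereal y \<and> isgn (poly f y) = sl"
    and right: "\<And>x. lo < ereal x \<Longrightarrow> ereal x < hi \<Longrightarrow> \<exists>y>x. ereal y \<le> hi \<and> isgn (poly f y) = sr"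
    and "lo < hi"
  shows "(if sl * sr = -1
     then \<exists>z. lo < ereal z \<and> ereal z < hi \<and> poly f z = 0 \<and>
       (\<forall>x. lo < ereal x \<and> x < z \<longrightarrow> isgn (poly f x) = sl) \<and> (\<forall>x. z < x \<and> ereal x < hi \<longrightarrow> isgn (poly f x) = sr)
     else \<forall>x. lo < ereal x \<and> ereal x < hi \<longrightarrow> isgn (poly f x) = (if sl = 0 then sr else sl))"
proof -
  obtain x0 where x0: "lo < ereal x0" "ereal x0 < hi" using ereal_dense2[OF \<open>lo < hi\<close>] by auto
  have "d = -1 \<or> d = 1" using deriv[OF x0] \<open>d \<noteq> 0\<close> by (auto simp: isgn_def split: if_splits)
  then show ?thesis
  proof
    assume "d = 1"
    then show ?thesis using deriv left right \<open>lo < hi\<close> by (intro strict_mono_interval_sign) auto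
  next
    assume "d = -1"
    \<comment> \<open>A decreasing polynomial is handled through \<open>- f\<close>; both end signs
      flip and their product stays.\<close>
    have "(if (- sl) * (- sr) = -1
     then \<exists>z. lo < ereal z \<and> ereal z < hi \<and> poly (- f) z = 0 \<and>
       (\<forall>x. lo < ereal x \<and> x < z \<longrightarrow> isgn (poly (- f) x) = - sl) \<and>
       (\<forall>x. z < x \<and> ereal x < hi \<longrightarrow> isgn (poly (- f) x) = - sr)
     else \<forall>x. lo < ereal x \<and> ereal x < hi \<longrightarrow> isgn (poly (- f) x) = (if - sl = 0 then - sr else - sl))"
      using deriv \<open>d = -1\<close> left right \<open>lo < hi\<close>
      by (intro strict_mono_interval_sign) (auto simp: pderiv_minus)
    then show ?thesis by (auto split: if_splits)
  qed
qed

lemma sign_at_infinity: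
  fixes f :: "real poly"
  assumes "f \<noteq> 0"
  shows "\<exists>y0. \<forall>y\<ge>y0. isgn (poly f y) = isgn (lead_coeff f)"
proof (cases "lead_coeff f > 0")
  case True
  then obtain n where "\<And>x. x \<ge> n \<Longrightarrow> poly f x \<ge> lead_coeff f" using poly_pinfty_gt_lc by blast
  then show ?thesis using True by (intro exI[of _ n]) (auto simp: isgn_def, force+)
next
  case False
  then have neg: "lead_coeff (- f) > 0" using assms by (simp add: not_less le_less)
  then obtain n where "\<And>x. x \<ge> n \<Longrightarrow> poly (- f) x \<ge> lead_coeff (- f)" using poly_pinfty_gt_lc by blast
  then have "poly f x < 0" if "x \<ge> n" for x using neg that by fastforce
  then show ?thesis using neg by (intro exI[of _ n]) (auto simp: isgn_def)
qed

lemma sign_at_minus_infinity: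
  fixes f :: "real poly"
  assumes "f \<noteq> 0"
  shows "\<exists>y0. \<forall>y\<le>y0. isgn (poly f y) = (if even (degree f) then isgn (lead_coeff f) else - isgn (lead_coeff f))"
proof -
  let ?g = "pcompose f [:0, -1:]"
  have g: "poly ?g x = poly f (- x)" for x by (simp add: poly_pcompose)
  have lc: "lead_coeff ?g = lead_coeff f * (-1) ^ degree f" by (subst lead_coeff_comp) auto
  have "?g \<noteq> 0" using lc assms by (auto simp flip: leading_coeff_0_iff)
  from sign_at_infinity[OF this] obtain y0 where "\<And>y. y \<ge> y0 \<Longrightarrow> isgn (poly f (- y)) = isgn (lead_coeff ?g)"
    unfolding g by blast
  then have "isgn (poly f y) = isgn (lead_coeff f * (-1) ^ degree f)" if "y \<le> - y0" for y
    using that lc by (metis le_minus_iff minus_minus)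
  then show ?thesis by (intro exI[of _ "- y0"]) (auto simp: isgn_mult isgn_def)
qed

section \<open>Tables that describe the sign columns along the real line\<close>

primrec describes ::
  "(real \<Rightarrow> sign_column) \<Rightarrow> ereal \<Rightarrow> sign_column \<Rightarrow> (sign_column \<times> sign_column) list \<Rightarrow> bool" where
  "describes C lo I [] \<longleftrightarrow> (\<forall>x. lo < ereal x \<longrightarrow> C x = I)"
| "describes C lo I (y # T) \<longleftrightarrow> (\<exists>r. lo < ereal r \<and> (\<forall>x. lo < ereal x \<and> x < r \<longrightarrow> C x = I) \<and>
     C r = fst y \<and> describes C (ereal r) (snd y) T)"

definition column_at :: "(nat \<Rightarrow> real) \<Rightarrow> int_mpoly list list \<Rightarrow> real \<Rightarrow> sign_column" where
  "column_at e ps x = map (\<lambda>p. (p, isgn (poly (upoly e p) x))) ps"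

text \<open>The left end varies in the induction, so that the part of a table behind a root is again
  a table. Density makes each interval nonempty, so that its column really occurs.\<close>

lemma describes_columns:
  assumes "describes C lo I T" "lo < \<infinity>"
  shows "{C x |x. lo < ereal x} = set (columns (I, T))"
  using assms
proof (induction T arbitrary: lo I)
  case Nil
  obtain x where "lo < ereal x" using ereal_dense2[OF Nil(2)] by auto
  then show ?case using Nil by (auto simp: columns_def)
next
  case (Cons y T)
  then obtain r where r: "lo < ereal r" "\<And>x. lo < ereal x \<Longrightarrow> x < r \<Longrightarrow> C x = I" "C r = fst y"
    "describes C (ereal r) (snd y) T" by auto
  obtain x where x: "lo < ereal x" "ereal x < ereal r" using ereal_dense2[OF r(1)] by auto
  have split: "lo < ereal x \<longleftrightarrow> (lo < ereal x \<and> x < r) \<or> x = r \<or> ereal r < ereal x" for x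
    using r(1) by (auto dest: less_trans[of lo "ereal r" "ereal x"])
  have "{C x |x. lo < ereal x} = {C x |x. lo < ereal x \<and> x < r} \<union> {C r} \<union> {C x |x. ereal r < ereal x}"
    by (subst split) blast
  also have "{C x |x. lo < ereal x \<and> x < r} = {I}" using r(2) x by auto
  also have "{C x |x. ereal r < ereal x} = set (columns (snd y, T))" using Cons.IH[OF r(4)] by simp
  finally show ?case using r(3) by (auto simp: columns_def)
qed

lemma describes_add_row:
  assumes "describes (column_at e ps) lo I T"
    "\<And>x. lo < ereal x \<Longrightarrow> isgn (poly (upoly e p) x) = f (column_at e ps x)"
  shows "describes (column_at e (p # ps)) lo ((p, f I) # I) (map (\<lambda>y. ((p, f (fst y)) # fst y, (p, f (snd y)) # snd y)) T)"
  using assms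
proof (induction T arbitrary: lo I)
  case Nil
  then show ?case by (auto simp: column_at_def)
next
  case (Cons y T)
  from Cons.prems(1) obtain r where r: "lo < ereal r" "\<And>x. lo < ereal x \<Longrightarrow> x < r \<Longrightarrow> column_at e ps x = I"
    "column_at e ps r = fst y" "describes (column_at e ps) (ereal r) (snd y) T" by auto
  have "describes (column_at e (p # ps)) (ereal r) ((p, f (snd y)) # snd y)
      (map (\<lambda>y. ((p, f (fst y)) # fst y, (p, f (snd y)) # snd y)) T)"
    using r(1) by (intro Cons.IH[OF r(4)] Cons.prems(2)) (erule less_trans)
  moreover have "column_at e (p # ps) x = (p, f (column_at e ps x)) # column_at e ps x" if "lo < ereal x" for x
    using Cons.prems(2)[OF that] by (simp add: column_at_def)
  ultimately show ?case using r(1-3) by auto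
qed

lemma alook_column_at: "q \<in> set ps \<Longrightarrow> alook (column_at e ps x) q = isgn (poly (upoly e q) x)"
  unfolding column_at_def by (rule alook_eq) (auto simp: image_image)

text \<open>The hypothesis on \<open>q\<close> ensures that the filtered list is not empty. The
  entry picked may be a different one, but every entry in it has a nonzero leading coefficient and
  vanishes at \<open>r\<close>.\<close>

lemma root_sign_eq:
  assumes "(q, 0) \<in> set (column_at e ps r)" "2 \<le> length q" "alook \<sigma> (ulast q) \<noteq> 0"
    and prem: "\<And>q. q \<in> set ps \<Longrightarrow> 2 \<le> length q \<Longrightarrow> prem p q \<in> set ps"
    and \<sigma>: "\<And>q. q \<in> set ps \<Longrightarrow> q \<noteq> [] \<Longrightarrow> alook \<sigma> (ulast q) = isgn (mev e (ulast q))"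
  shows "root_sign \<sigma> p (column_at e ps r) = isgn (poly (upoly e p) r)"
proof -
  let ?l = "filter (\<lambda>y. snd y = 0 \<and> 2 \<le> length (fst y) \<and> alook \<sigma> (ulast (fst y)) \<noteq> 0) (column_at e ps r)"
  have "(q, 0) \<in> set ?l" using assms by simp
  then have "hd0 ?l \<in> set ?l" by (cases ?l) auto
  then have y: "hd0 ?l \<in> set (column_at e ps r)" "snd (hd0 ?l) = 0" "2 \<le> length (fst (hd0 ?l))"
    "alook \<sigma> (ulast (fst (hd0 ?l))) \<noteq> 0" by auto
  then have q': "fst (hd0 ?l) \<in> set ps" "poly (upoly e (fst (hd0 ?l))) r = 0"
    by (auto simp: column_at_def)
  have ne: "fst (hd0 ?l) \<noteq> []" using y(3) by auto
  have "mev e (ulast (fst (hd0 ?l))) \<noteq> 0" using \<sigma>[OF q'(1) ne] y(4) by auto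
  from isgn_prem[OF this ne q'(2)] show ?thesis
    unfolding root_sign_def using alook_column_at[OF prem[OF q'(1) y(3)]] by simp
qed

text \<open>A new root moves the left end, so the rest \<open>T'\<close> of the table is assumed
  correct for every left end below \<open>hi\<close> from which the column is constant up to
  \<open>hi\<close>.\<close>

lemma describes_split_interval:
  assumes "2 \<le> length p" "mev e (ulast p) \<noteq> 0" "uderiv p \<in> set ps" "lo < hi"
    and I: "\<And>x. lo < ereal x \<Longrightarrow> ereal x < hi \<Longrightarrow> column_at e ps x = I"
    and left: "\<And>x. lo < ereal x \<Longrightarrow> \<exists>y<x. lo \<le> ereal y \<and> isgn (poly (upoly e p) y) = sl"
    and right: "\<And>x. ereal x < hi \<Longrightarrow> \<exists>y>x. ereal y \<le> hi \<and> isgn (poly (upoly e p) y) = sr"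
    and T': "\<And>lo' J. lo' < hi \<Longrightarrow> (\<And>x. lo' < ereal x \<Longrightarrow> ereal x < hi \<Longrightarrow> column_at e (p # ps) x = J) \<Longrightarrow>
      describes (column_at e (p # ps)) lo' J T'"
  shows "describes (column_at e (p # ps)) lo (fst (split_interval p sl sr I)) (snd (split_interval p sl sr I) @ T')"
proof -
  let ?f = "upoly e p"
  have ne: "p \<noteq> []" using assms(1) by auto
  have col: "column_at e (p # ps) x = (p, isgn (poly ?f x)) # I" if "lo < ereal x" "ereal x < hi" for x
    using I[OF that] by (simp add: column_at_def)
  have d: "isgn (poly (pderiv ?f) x) = alook I (uderiv p)" if "lo < ereal x" "ereal x < hi" for x
    using alook_column_at[OF assms(3), of e x] I[OF that] by (simp add: pderiv_upoly)
  \<comment> \<open>If the derivative vanished on the interval, it would vanish identically and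
    \<open>p\<close> would be constant.\<close>
  have "alook I (uderiv p) \<noteq> 0"
  proof
    assume z: "alook I (uderiv p) = 0"
    obtain a where a: "lo < ereal a" "ereal a < hi" using ereal_dense2[OF \<open>lo < hi\<close>] by auto
    obtain b where b: "ereal a < ereal b" "ereal b < hi" using ereal_dense2[OF a(2)] by auto
    have "poly (pderiv ?f) x = 0" if "x \<in> {a..b}" for x
    proof -
      have "lo < ereal x" "ereal x < hi" using that a b
        by (auto intro: less_le_trans le_less_trans simp flip: ereal_less_eq(3))
      from d[OF this] z show ?thesis by simp
    qed
    then have "{a..b} \<subseteq> {x. poly (pderiv ?f) x = 0}" by auto
    moreover have "infinite {a..b}" using b(1) by (simp add: infinite_Icc)
    ultimately have "pderiv ?f = 0" using poly_roots_finite finite_subset by blast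
    then have "degree ?f = 0" by (simp add: pderiv_eq_0_iff)
    then show False using degree_upoly[OF assms(2) ne] assms(1) by simp
  qed
  note sgn = interval_sign[of lo hi ?f, OF d this left right \<open>lo < hi\<close>]
  show ?thesis
  proof (cases "sl * sr = -1")
    case True
    with sgn obtain z where z: "lo < ereal z" "ereal z < hi" "poly ?f z = 0"
      "\<And>x. lo < ereal x \<Longrightarrow> x < z \<Longrightarrow> isgn (poly ?f x) = sl" "\<And>x. z < x \<Longrightarrow> ereal x < hi \<Longrightarrow> isgn (poly ?f x) = sr"
      by auto
    have "describes (column_at e (p # ps)) (ereal z) ((p, sr) # I) T'"
    proof (rule T'[OF z(2)])
      fix x assume x: "ereal z < ereal x" "ereal x < hi"
      show "column_at e (p # ps) x = (p, sr) # I"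
        using z(5)[of x] col[OF less_trans[OF z(1) x(1)] x(2)] x by simp
    qed
    moreover have "column_at e (p # ps) x = (p, sl) # I" if "lo < ereal x" "x < z" for x
      using z(4)[OF that] col[OF that(1)] less_trans[of "ereal x" "ereal z", OF _ z(2)] that by simp
    ultimately show ?thesis using True z(1,3) col[OF z(1,2)]
      by (auto simp: split_interval_def)
  next
    case False
    then show ?thesis using sgn col by (auto simp: split_interval_def intro!: T' \<open>lo < hi\<close>)
  qed
qed

lemma add_rows_Nil: "add_rows \<sigma> p [] = (alook \<sigma> (ulast p), [])"
  by (simp add: add_rows_def)

lemma add_rows_Cons: "add_rows \<sigma> p (y # T) = (root_sign \<sigma> p (fst y),
    ((p, root_sign \<sigma> p (fst y)) # fst y, fst (split_interval p (root_sign \<sigma> p (fst y)) (fst (add_rows \<sigma> p T)) (snd y))) #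
    snd (split_interval p (root_sign \<sigma> p (fst y)) (fst (add_rows \<sigma> p T)) (snd y)) @ snd (add_rows \<sigma> p T))"
  by (simp add: add_rows_def)

lemma describes_add_rows:
  assumes "2 \<le> length p" "mev e (ulast p) \<noteq> 0" "alook \<sigma> (ulast p) = isgn (mev e (ulast p))" "uderiv p \<in> set ps"
    and "describes (column_at e ps) lo I T" "lo < \<infinity>"
    and roots: "\<And>y r. y \<in> set T \<Longrightarrow> column_at e ps r = fst y \<Longrightarrow> root_sign \<sigma> p (fst y) = isgn (poly (upoly e p) r)"
    and left: "\<And>x. lo < ereal x \<Longrightarrow> \<exists>y<x. lo \<le> ereal y \<and> isgn (poly (upoly e p) y) = sl"
  shows "describes (column_at e (p # ps)) lo (fst (split_interval p sl (fst (add_rows \<sigma> p T)) I))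
     (snd (split_interval p sl (fst (add_rows \<sigma> p T)) I) @ snd (add_rows \<sigma> p T))"
  using assms(5-)
proof (induction T arbitrary: lo I sl)
  case Nil
  have ne: "p \<noteq> []" using assms(1) by auto
  note lc = lead_coeff_upoly[OF assms(2) ne]
  then have "upoly e p \<noteq> 0" using assms(2) by auto
  from sign_at_infinity[OF this] obtain y0
    where y0: "\<And>y. y \<ge> y0 \<Longrightarrow> isgn (poly (upoly e p) y) = alook \<sigma> (ulast p)" unfolding lc assms(3) by blast
  show ?case unfolding add_rows_Nil fst_conv snd_conv
  proof (rule describes_split_interval[OF assms(1,2,4) Nil(2)])
    fix x show "\<exists>y>x. ereal y \<le> \<infinity> \<and> isgn (poly (upoly e p) y) = alook \<sigma> (ulast p)"
      using y0[of "max y0 (x + 1)"] by (intro exI[of _ "max y0 (x + 1)"]) auto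
  qed (use Nil in auto)
next
  case (Cons y T)
  from Cons.prems(1) obtain r where r: "lo < ereal r" "\<And>x. lo < ereal x \<Longrightarrow> x < r \<Longrightarrow> column_at e ps x = I"
    "column_at e ps r = fst y" "describes (column_at e ps) (ereal r) (snd y) T" by auto
  let ?R = "add_rows \<sigma> p T"
  let ?s = "root_sign \<sigma> p (fst y)"
  have s: "isgn (poly (upoly e p) r) = ?s" using Cons.prems(3)[OF _ r(3)] by simp
  let ?z = "split_interval p ?s (fst ?R) (snd y)"
  have IH: "describes (column_at e (p # ps)) (ereal r) (fst ?z) (snd ?z @ snd ?R)"
    by (rule Cons.IH[OF r(4)]) (use Cons.prems(3) s in auto)
  have eq: "add_rows \<sigma> p (y # T) = (?s, ((p, ?s) # fst y, fst ?z) # snd ?z @ snd ?R)"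
    by (simp add: add_rows_Cons)
  show ?case unfolding eq fst_conv snd_conv
  proof (rule describes_split_interval[OF assms(1,2,4) r(1)])
    fix x assume "ereal x < ereal r"
    then show "\<exists>y>x. ereal y \<le> ereal r \<and> isgn (poly (upoly e p) y) = ?s" using s by (intro exI[of _ r]) auto
  next
    fix lo' J assume "lo' < ereal r" "\<And>x. lo' < ereal x \<Longrightarrow> ereal x < ereal r \<Longrightarrow> column_at e (p # ps) x = J"
    then show "describes (column_at e (p # ps)) lo' J (((p, ?s) # fst y, fst ?z) # snd ?z @ snd ?R)"
      using IH s r(3) by (auto simp: column_at_def)
  qed (use r Cons.prems(4) in auto)
qed

text \<open>The closure is triangular: all that the row of \<open>p\<close> consults stands behind
  \<open>p\<close> and is in the table when \<open>p\<close> is added.\<close>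

primrec prem_closed :: "int_mpoly list list \<Rightarrow> bool" where
  "prem_closed [] \<longleftrightarrow> True"
| "prem_closed (p # ps) \<longleftrightarrow> prem_closed ps \<and> (p \<noteq> [] \<longrightarrow> butlast p \<in> set ps) \<and>
     (2 \<le> length p \<longrightarrow> uderiv p \<in> set ps \<and> (\<forall>q\<in>set ps. 2 \<le> length q \<longrightarrow> prem p q \<in> set ps))"

text \<open>Every root in the table belongs to some polynomial of positive degree whose leading
  coefficient does not vanish; \<open>root_sign\<close> divides by such a polynomial.\<close>

definition has_root_witness :: "(int_mpoly \<times> int) list \<Rightarrow> sign_column \<Rightarrow> bool" where
  "has_root_witness \<sigma> c \<longleftrightarrow> (\<exists>q. (q, 0) \<in> set c \<and> 2 \<le> length q \<and> alook \<sigma> (ulast q) \<noteq> 0)"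

lemma has_root_witness_Cons: "has_root_witness \<sigma> c \<Longrightarrow> has_root_witness \<sigma> (y # c)"
  by (auto simp: has_root_witness_def)

lemma add_rows_witness:
  assumes "\<And>y. y \<in> set T \<Longrightarrow> has_root_witness \<sigma> (fst y)" "2 \<le> length p" "alook \<sigma> (ulast p) \<noteq> 0"
    "y \<in> set (snd (add_rows \<sigma> p T))"
  shows "has_root_witness \<sigma> (fst y)"
  using assms
proof (induction T)
  case (Cons z T)
  have new: "has_root_witness \<sigma> ((p, 0) # c)" for c using Cons.prems by (auto simp: has_root_witness_def)
  have z: "has_root_witness \<sigma> (fst z)" and T: "\<And>y. y \<in> set T \<Longrightarrow> has_root_witness \<sigma> (fst y)" using Cons.prems by auto
  from Cons.prems(4) consider "fst y = (p, root_sign \<sigma> p (fst z)) # fst z"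
    | "y \<in> set (snd (split_interval p (root_sign \<sigma> p (fst z)) (fst (add_rows \<sigma> p T)) (snd z)))"
    | "y \<in> set (snd (add_rows \<sigma> p T))"
    unfolding add_rows_Cons by auto
  then show ?case
  proof cases
    case 1
    then show ?thesis using has_root_witness_Cons[OF z] by simp
  next
    case 2
    then show ?thesis using new by (auto simp: split_interval_def split: if_splits)
  next
    case 3
    then show ?thesis using Cons.IH[OF T Cons.prems(2,3)] by blast
  qed
qed (simp add: add_rows_Nil)

theorem describes_table:
  assumes "prem_closed ps" "\<And>p. p \<in> set ps \<Longrightarrow> p \<noteq> [] \<Longrightarrow> alook \<sigma> (ulast p) = isgn (mev e (ulast p))"
  shows "describes (column_at e ps) (-\<infinity>) (fst (table \<sigma> ps)) (snd (table \<sigma> ps)) \<and>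
    (\<forall>y\<in>set (snd (table \<sigma> ps)). has_root_witness \<sigma> (fst y))"
  using assms
proof (induction ps)
  case Nil
  then show ?case by (simp add: table_def column_at_def)
next
  case (Cons p ps)
  define T where "T = table \<sigma> ps"
  have T: "table \<sigma> (p # ps) = extend_table \<sigma> p T" by (simp add: table_def T_def)
  have IH: "describes (column_at e ps) (-\<infinity>) (fst T) (snd T)" "\<And>y. y \<in> set (snd T) \<Longrightarrow> has_root_witness \<sigma> (fst y)"
    using Cons unfolding T_def by auto
  consider "p = []" | "p \<noteq> []" "alook \<sigma> (ulast p) = 0" | "p \<noteq> []" "alook \<sigma> (ulast p) \<noteq> 0" "length p = 1"
    | "2 \<le> length p" "alook \<sigma> (ulast p) \<noteq> 0"
    by (cases p; cases "length p") (auto simp: Suc_le_eq)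
  then show ?case
  proof cases
    case 1
    then show ?thesis unfolding T using describes_add_row[OF IH(1), of p "\<lambda>_. 0"] IH(2)
      by (auto simp: extend_table_def upoly_def has_root_witness_Cons)
  next
    case 2
    have "upoly e (butlast p) = upoly e p" by (rule upoly_butlast) (use Cons.prems(2)[of p] 2 in auto)
    moreover have "butlast p \<in> set ps" using Cons.prems(1) 2 by auto
    ultimately have "isgn (poly (upoly e p) x) = alook (column_at e ps x) (butlast p)" for x
      by (simp add: alook_column_at)
    then show ?thesis unfolding T using 2 describes_add_row[OF IH(1), of p "\<lambda>c. alook c (butlast p)"] IH(2)
      by (auto simp: extend_table_def has_root_witness_Cons)
  next
    case 3
    then obtain a where p: "p = [a]" by (auto simp: length_Suc_conv)
    have "isgn (poly (upoly e p) x) = alook \<sigma> (ulast p)" for x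
      using Cons.prems(2)[of p] by (simp add: p upoly_def ulast_eq_last)
    then show ?thesis unfolding T using 3 describes_add_row[OF IH(1), of p "\<lambda>c. alook \<sigma> (ulast p)"] IH(2)
      by (auto simp: extend_table_def has_root_witness_Cons)
  next
    case 4
    have ne: "p \<noteq> []" using 4 by auto
    have \<sigma>: "alook \<sigma> (ulast p) = isgn (mev e (ulast p))" using Cons.prems(2)[of p] ne by simp
    then have lc: "mev e (ulast p) \<noteq> 0" using 4(2) by auto
    let ?R = "add_rows \<sigma> p (snd T)"
    let ?z = "split_interval p (left_sign \<sigma> p) (fst ?R) (fst T)"
    have eq: "extend_table \<sigma> p T = (fst ?z, snd ?z @ snd ?R)"
      using 4 by (auto simp: extend_table_def)
    have "describes (column_at e (p # ps)) (-\<infinity>) (fst ?z) (snd ?z @ snd ?R)"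
    proof (rule describes_add_rows[OF 4(1) lc \<sigma> _ IH(1)])
      show "uderiv p \<in> set ps" using Cons.prems(1) 4(1) by simp
      show "root_sign \<sigma> p (fst y) = isgn (poly (upoly e p) r)"
        if y: "y \<in> set (snd T)" "column_at e ps r = fst y" for y r
      proof -
        obtain q where "(q, 0) \<in> set (column_at e ps r)" "2 \<le> length q" "alook \<sigma> (ulast q) \<noteq> 0"
          using IH(2)[OF y(1)] y(2) by (auto simp: has_root_witness_def)
        then have "root_sign \<sigma> p (column_at e ps r) = isgn (poly (upoly e p) r)"
          by (rule root_sign_eq) (use Cons.prems 4(1) in auto)
        then show ?thesis using y(2) by simp
      qed
      fix x :: real
      have "upoly e p \<noteq> 0" using lead_coeff_upoly[OF lc ne] lc by auto
      moreover have "even (degree (upoly e p)) \<longleftrightarrow> odd (length p)" using degree_upoly[OF lc ne] ne by simp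
      ultimately obtain y0
        where y0: "\<And>y. y \<le> y0 \<Longrightarrow> isgn (poly (upoly e p) y) = left_sign \<sigma> p"
        using sign_at_minus_infinity[of "upoly e p"]
        unfolding left_sign_def \<sigma> lead_coeff_upoly[OF lc ne] by (auto split: if_splits)
      show "\<exists>y<x. -\<infinity> \<le> ereal y \<and> isgn (poly (upoly e p) y) = left_sign \<sigma> p"
        using y0[of "min y0 (x - 1)"] by (intro exI[of _ "min y0 (x - 1)"]) auto
    qed simp
    moreover have "has_root_witness \<sigma> (fst y)" if "y \<in> set (snd ?z @ snd ?R)" for y
    proof (cases "y \<in> set (snd ?R)")
      case True
      show ?thesis by (rule add_rows_witness[OF _ 4 True]) (rule IH(2))
    next
      case False
      then show ?thesis using that 4 by (auto simp: split_interval_def has_root_witness_def split: if_splits)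
    qed
    ultimately show ?thesis unfolding T eq by simp
  qed
qed

lemma table_columns:
  assumes "prem_closed ps" "\<And>p. p \<in> set ps \<Longrightarrow> p \<noteq> [] \<Longrightarrow> alook \<sigma> (ulast p) = isgn (mev e (ulast p))"
  shows "set (columns (table \<sigma> ps)) = range (column_at e ps)"
  using describes_columns[of "column_at e ps" "-\<infinity>" "fst (table \<sigma> ps)" "snd (table \<sigma> ps)"]
    describes_table[OF assms] by (simp add: full_SetCompr_eq)

subsection \<open>Closure under remainders\<close>

inductive_set prem_closure :: "int_mpoly list set \<Rightarrow> int_mpoly list set" for F where
  "p \<in> F \<Longrightarrow> p \<in> prem_closure F"
| "p \<in> prem_closure F \<Longrightarrow> p \<noteq> [] \<Longrightarrow> butlast p \<in> prem_closure F"
| "p \<in> prem_closure F \<Longrightarrow> 2 \<le> length p \<Longrightarrow> uderiv p \<in> prem_closure F"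
| "p \<in> prem_closure F \<Longrightarrow> q \<in> prem_closure F \<Longrightarrow> 2 \<le> length q \<Longrightarrow> length q \<le> length p \<Longrightarrow>
     prem p q \<in> prem_closure F"

lemma length_uderiv [simp]: "length (uderiv p) = length p - 1"
  by (simp add: uderiv_def)

lemma length_prem': "2 \<le> length q \<Longrightarrow> length q \<le> length p \<Longrightarrow> length (prem p q) = length q - 1"
  by (rule length_prem) auto

text \<open>Every operation returns a list shorter than its arguments. Hence a member of the closure
  lies in \<open>F\<close> or comes from longer members, and those longer than \<open>L - n\<close>
  are finite in number by induction on \<open>n\<close>, where \<open>L\<close> bounds the lengths
  in \<open>F\<close>.\<close>

lemma finite_prem_closure:
  assumes "finite F" shows "finite (prem_closure F)"
proof -
  obtain L where L: "\<And>p. p \<in> F \<Longrightarrow> length p \<le> L"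
    using finite_imageI[OF assms, of length] by (meson Max_ge image_eqI)
  have le: "length p \<le> L" if "p \<in> prem_closure F" for p
    using that by induction (auto simp: L length_prem')
  have "finite {p \<in> prem_closure F. L < length p + n}" for n
  proof (induction n)
    case 0
    have "{p \<in> prem_closure F. L < length p + 0} = {}" using le by (auto simp: not_less)
    then show ?case by (simp only: finite.emptyI)
  next
    case (Suc n)
    let ?S = "{p \<in> prem_closure F. L < length p + n}"
    have "p \<in> F \<union> butlast ` ?S \<union> uderiv ` ?S \<union> (\<lambda>(p, q). prem p q) ` (?S \<times> ?S)"
      if "p \<in> prem_closure F" "L < length p + Suc n" for p
      using that
    proof cases
      case (2 p')
      then have "length p = length p' - 1" "length p' \<noteq> 0" by simp_all
      then have "L < length p' + n" using that(2) by linarith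
      then have "p' \<in> ?S" using 2 by simp
      then show ?thesis using 2(1) by blast
    next
      case (3 p')
      then have "p' \<in> ?S" using that(2) by auto
      then show ?thesis using 3(1) by blast
    next
      case (4 p' q)
      have "length p = length q - 1" using 4 by (simp add: length_prem')
      then have "(p', q) \<in> ?S \<times> ?S" using that(2) 4 by auto
      then show ?thesis using 4(1) by force
    qed blast
    then have "{p \<in> prem_closure F. L < length p + Suc n} \<subseteq>
      F \<union> butlast ` ?S \<union> uderiv ` ?S \<union> (\<lambda>(p, q). prem p q) ` (?S \<times> ?S)"
      by (intro subsetI) (elim CollectE conjE, assumption | blast)
    then show ?case by (rule finite_subset) (use Suc assms in auto)
  qed
  from this[of "Suc L"] show ?thesis by simp
qed

lemma ex_prem_closed:
  assumes "finite F" shows "\<exists>ps. prem_closed ps \<and> F \<subseteq> set ps"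
proof -
  obtain xs where xs: "set xs = prem_closure F" using finite_list[OF finite_prem_closure[OF assms]] by blast
  \<comment> \<open>Order by decreasing length: each list required by \<open>prem_closed\<close> is
    strictly shorter and so stands further back.\<close>
  define ps where "ps = rev (sort_key length xs)"
  have set: "set ps = prem_closure F" by (simp add: ps_def xs)
  have sorted: "sorted_wrt (\<lambda>p q. length q \<le> length p) ps"
    using sorted_sort_key[of length xs] by (simp add: ps_def sorted_wrt_rev sorted_wrt_map sorted_map)
  have "prem_closed zs" if "ps = ys @ zs" for ys zs
    using that
  proof (induction zs arbitrary: ys)
    case (Cons p zs)
    have IH: "prem_closed zs" using Cons.IH[of "ys @ [p]"] Cons.prems by simp
    have in_zs: "r \<in> set zs" if "r \<in> prem_closure F" "length r < length p" for r
      using that sorted unfolding set[symmetric] Cons.prems by (auto simp: sorted_wrt_append)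
    have p: "p \<in> prem_closure F" using set Cons.prems by auto
    have zs: "q \<in> prem_closure F" "length q \<le> length p" if "q \<in> set zs" for q
      using that set sorted Cons.prems by (auto simp: sorted_wrt_append)
    have "prem p q \<in> set zs" if "q \<in> set zs" "2 \<le> length q" for q
    proof (rule in_zs)
      show "prem p q \<in> prem_closure F" using prem_closure.intros(4)[OF p zs(1)[OF that(1)] that(2) zs(2)[OF that(1)]] .
      have "q \<noteq> []" using that by auto
      then show "length (prem p q) < length p" using length_prem[of q p] that zs(2)[OF that(1)] by auto
    qed
    moreover have "butlast p \<in> set zs" if "p \<noteq> []"
      by (rule in_zs[OF prem_closure.intros(2)[OF p that]]) (use that in auto)
    moreover have "uderiv p \<in> set zs" if "2 \<le> length p"
      by (rule in_zs[OF prem_closure.intros(3)[OF p that]]) (use that in auto)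
    ultimately show ?case using IH by simp
  qed simp
  then have "prem_closed ps" by simp
  then show ?thesis using set prem_closure.intros(1) by blast
qed

subsection \<open>Sign conditions\<close>

definition sat :: "(nat \<Rightarrow> real) \<Rightarrow> (int_mpoly \<times> int) list \<Rightarrow> bool" where
  "sat e \<Delta> \<longleftrightarrow> (\<forall>y\<in>set \<Delta>. isgn (mev e (fst y)) = snd y)"

definition all_signs :: "int_mpoly list \<Rightarrow> (int_mpoly \<times> int) list list" where
  "all_signs F = foldr (\<lambda>f r. concat (map (\<lambda>\<sigma>. [(f, -1) # \<sigma>, (f, 0) # \<sigma>, (f, 1) # \<sigma>]) r)) F [[]]"

lemma actual_signs: "map (\<lambda>f. (f, isgn (mev e f))) F \<in> set (all_signs F)"
proof (induction F)
  case (Cons f F)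
  then show ?case using isgn_cases[of "mev e f"] by (auto simp: all_signs_def)
qed (simp add: all_signs_def)

lemma all_signs_fst: "\<sigma> \<in> set (all_signs F) \<Longrightarrow> map fst \<sigma> = F"
  by (induction F arbitrary: \<sigma>) (auto simp: all_signs_def)

lemma alook_sat:
  assumes "\<sigma> \<in> set (all_signs F)" "sat e \<sigma>" "f \<in> set F" shows "alook \<sigma> f = isgn (mev e f)"
  by (rule alook_eq) (use assms all_signs_fst[OF assms(1)] in \<open>auto simp: sat_def simp flip: set_map\<close>)

text \<open>A certificate is found by unbounded search, which makes the elimination recursive without a bound on the
  process of closing under remainders.\<close>

definition elim_certificate ::
  "nat \<times> (int_mpoly \<times> int) list \<Rightarrow> int_mpoly list list \<times> int_mpoly list \<Rightarrow> bool" where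
  "elim_certificate vD c \<longleftrightarrow> prem_closed (fst c) \<and> (\<forall>y\<in>set (snd vD). mcoeffs (fst vD) (fst y) \<in> set (fst c)) \<and>
     (\<forall>p\<in>set (fst c). p = [] \<or> ulast p \<in> set (snd c))"

lemma decp_prem_closed: "decp prem_closed"
proof -
  have "prem_closed ps \<longleftrightarrow> rec_list (1::nat) (\<lambda>p ps r. if (p = [] \<or> butlast p \<in> set ps) \<and>
     (\<not> 2 \<le> length p \<or> uderiv p \<in> set ps \<and> (\<forall>q\<in>set ps. \<not> 2 \<le> length q \<or> prem p q \<in> set ps)) then r else 0) ps = 1" for ps
    by (induction ps) auto
  moreover have "decp (\<lambda>ps. rec_list (1::nat) (\<lambda>p ps r. if (p = [] \<or> butlast p \<in> set ps) \<and>
     (\<not> 2 \<le> length p \<or> uderiv p \<in> set ps \<and> (\<forall>q\<in>set ps. \<not> 2 \<le> length q \<or> prem p q \<in> set ps)) then r else 0) ps = 1)"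
    by (intro rec_intros)
  ultimately show ?thesis by presburger
qed

lemma decp_elim_certificate: "decp (\<lambda>q. elim_certificate (fst q) (snd q))"
  unfolding elim_certificate_def
  by (intro rec_intros decp_comp[OF decp_prem_closed] recf_comp2[OF recf_mcoeffs])

lemma ex_elim_certificate: "\<exists>c. elim_certificate vD c"
proof -
  obtain ps where "prem_closed ps" "(\<lambda>y. mcoeffs (fst vD) (fst y)) ` set (snd vD) \<subseteq> set ps"
    using ex_prem_closed[of "(\<lambda>y. mcoeffs (fst vD) (fst y)) ` set (snd vD)"] by auto
  then have "elim_certificate vD (ps, map ulast ps)" by (auto simp: elim_certificate_def)
  then show ?thesis ..
qed

text \<open>A disjunction over the sign assignments whose table has a column fulfilling the
  conditions. An assignment that contradicts the parameters may give a meaningless table, but the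
  parameters do not satisfy it.\<close>

definition elim_result ::
  "nat \<times> (int_mpoly \<times> int) list \<Rightarrow> int_mpoly list list \<times> int_mpoly list \<Rightarrow> (int_mpoly \<times> int) list list" where
  "elim_result vD c = filter (\<lambda>\<sigma>. \<exists>C\<in>set (columns (table \<sigma> (fst c))).
     \<forall>y\<in>set (snd vD). alook C (mcoeffs (fst vD) (fst y)) = snd y) (all_signs (snd c))"

lemma recf_elim_result: "recf (\<lambda>q. elim_result (fst q) (snd q))"
  unfolding elim_result_def all_signs_def by (intro rec_intros recf_comp2[OF recf_mcoeffs])

lemma sat_elim_result:
  assumes "elim_certificate (v, \<Delta>) c"
  shows "(\<exists>x. sat (e(v := x)) \<Delta>) \<longleftrightarrow> (\<exists>\<sigma>\<in>set (elim_result (v, \<Delta>) c). sat e \<sigma>)"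
proof -
  obtain ps F where c: "c = (ps, F)" by force
  have cert: "prem_closed ps" "\<And>y. y \<in> set \<Delta> \<Longrightarrow> mcoeffs v (fst y) \<in> set ps" "\<And>p. p \<in> set ps \<Longrightarrow> p \<noteq> [] \<Longrightarrow> ulast p \<in> set F"
    using assms by (auto simp: elim_certificate_def c)
  have key: "(\<exists>C\<in>set (columns (table \<sigma> ps)). \<forall>y\<in>set \<Delta>. alook C (mcoeffs v (fst y)) = snd y) \<longleftrightarrow>
      (\<exists>x. sat (e(v := x)) \<Delta>)" if \<sigma>: "\<sigma> \<in> set (all_signs F)" "sat e \<sigma>" for \<sigma>
  proof -
    have "set (columns (table \<sigma> ps)) = range (column_at e ps)"
      by (rule table_columns[OF cert(1)]) (intro alook_sat[OF \<sigma>] cert(3))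
    moreover have "(\<forall>y\<in>set \<Delta>. alook (column_at e ps x) (mcoeffs v (fst y)) = snd y) \<longleftrightarrow> sat (e(v := x)) \<Delta>" for x
      by (auto simp: sat_def alook_column_at[OF cert(2)] poly_upoly_mcoeffs simp del: fun_upd_apply)
    ultimately show ?thesis by auto
  qed
  show ?thesis
  proof
    assume ex: "\<exists>x. sat (e(v := x)) \<Delta>"
    let ?\<sigma> = "map (\<lambda>f. (f, isgn (mev e f))) F"
    have "sat e ?\<sigma>" by (auto simp: sat_def)
    then show "\<exists>\<sigma>\<in>set (elim_result (v, \<Delta>) c). sat e \<sigma>"
      using key[OF actual_signs \<open>sat e ?\<sigma>\<close>] ex actual_signs[of e F]
      by (intro bexI[of _ ?\<sigma>]) (auto simp: elim_result_def c)
  next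
    assume "\<exists>\<sigma>\<in>set (elim_result (v, \<Delta>) c). sat e \<sigma>"
    then show "\<exists>x. sat (e(v := x)) \<Delta>" using key by (auto simp: elim_result_def c)
  qed
qed

lemma ex_quantifier_elimination:
  obtains qe where "recf qe" "\<And>v \<Delta> e. (\<exists>x. sat (e(v := x)) \<Delta>) \<longleftrightarrow> (\<exists>\<sigma>\<in>set (qe (v, \<Delta>)). sat e \<sigma>)"
proof -
  obtain f where f: "recf f" "\<And>vD. elim_certificate vD (f vD)"
    using recf_choice[OF decp_elim_certificate ex_elim_certificate] by blast
  show ?thesis
  proof
    show "recf (\<lambda>vD. elim_result vD (f vD))" by (intro recf_comp2[OF recf_elim_result] f(1) rec_intros)
  qed (use sat_elim_result f(2) in blast)
qed

definition exsat :: "nat list \<Rightarrow> (nat \<Rightarrow> real) \<Rightarrow> (int_mpoly \<times> int) list \<Rightarrow> bool" where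
  "exsat vs e \<Delta> \<longleftrightarrow> (\<exists>e'. (\<forall>i. i \<notin> set vs \<longrightarrow> e' i = e i) \<and> sat e' \<Delta>)"

lemma exsat_Nil: "exsat [] e \<Delta> \<longleftrightarrow> sat e \<Delta>"
proof -
  have "(\<forall>i. e' i = e i) \<longleftrightarrow> e' = e" for e' by (auto simp: fun_eq_iff)
  then show ?thesis unfolding exsat_def by auto
qed

lemma exsat_Cons: "exsat (v # vs) e \<Delta> \<longleftrightarrow> (\<exists>x. exsat vs (e(v := x)) \<Delta>)"
proof
  assume "exsat (v # vs) e \<Delta>"
  then obtain e' where e': "\<And>i. i \<notin> set (v # vs) \<Longrightarrow> e' i = e i" "sat e' \<Delta>" unfolding exsat_def by blast
  then have "exsat vs (e(v := e' v)) \<Delta>" unfolding exsat_def by (intro exI[of _ e']) auto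
  then show "\<exists>x. exsat vs (e(v := x)) \<Delta>" ..
next
  assume "\<exists>x. exsat vs (e(v := x)) \<Delta>"
  then obtain x e' where e': "\<And>i. i \<notin> set vs \<Longrightarrow> e' i = (e(v := x)) i" "sat e' \<Delta>" unfolding exsat_def by blast
  then show "exsat (v # vs) e \<Delta>" unfolding exsat_def by (intro exI[of _ e']) auto
qed

lemma exsat_elimination:
  obtains qs where "recf (\<lambda>q. qs (fst q) (snd q))"
    "\<And>vs \<Delta> e. exsat vs e \<Delta> \<longleftrightarrow> (\<exists>\<sigma>\<in>set (qs vs \<Delta>). sat e \<sigma>)"
proof -
  obtain qe where qe: "recf qe" "\<And>v \<Delta> e. (\<exists>x. sat (e(v := x)) \<Delta>) \<longleftrightarrow> (\<exists>\<sigma>\<in>set (qe (v, \<Delta>)). sat e \<sigma>)"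
    using ex_quantifier_elimination by blast
  \<comment> \<open>The last variable of \<open>vs\<close> is eliminated first. \<open>D\<close> is
    a disjunction whose members are conjunctions.\<close>
  define qs where "qs vs \<Delta> = foldr (\<lambda>v D. concat (map (\<lambda>\<Delta>. qe (v, \<Delta>)) D)) vs [\<Delta>]" for vs \<Delta>
  have "recf (\<lambda>q. qs (fst q) (snd q))"
    unfolding qs_def by (intro rec_intros recf_comp[OF qe(1)])
  moreover have "exsat vs e \<Delta> \<longleftrightarrow> (\<exists>\<sigma>\<in>set (qs vs \<Delta>). sat e \<sigma>)" for vs \<Delta> e
  proof (induction vs arbitrary: e)
    case (Cons v vs)
    have "exsat (v # vs) e \<Delta> \<longleftrightarrow> (\<exists>\<tau>\<in>set (qs vs \<Delta>). \<exists>x. sat (e(v := x)) \<tau>)"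
      unfolding exsat_Cons Cons.IH by blast
    also have "\<dots> \<longleftrightarrow> (\<exists>\<sigma>\<in>set (qs (v # vs) \<Delta>). sat e \<sigma>)"
      unfolding qe(2) by (auto simp: qs_def)
    finally show ?case .
  qed (simp add: exsat_Nil qs_def)
  ultimately show ?thesis using that by blast
qed

theorem decp_exsat:
  assumes "recf (\<lambda>p. isgn (mev e p))"
  shows "decp (\<lambda>q. exsat (fst q) e (snd q))"
proof -
  obtain qs where qs: "recf (\<lambda>q. qs (fst q) (snd q))"
    "\<And>vs \<Delta> e. exsat vs e \<Delta> \<longleftrightarrow> (\<exists>\<sigma>\<in>set (qs vs \<Delta>). sat e \<sigma>)" using exsat_elimination by blast
  show ?thesis unfolding qs(2) sat_def
    by (intro rec_intros recf_comp2[OF qs(1)] recf_comp[OF assms])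
qed

text \<open>At the origin only constant terms survive. This makes sentences without parameters
  decidable, the case from which all others are bootstrapped.\<close>

lemma recf_isgn_mev_0: "recf (\<lambda>p. isgn (mev (\<lambda>_. 0) p))"
proof -
  have prod0: "prod_list (map (\<lambda>_. 0::real) vs) = (if vs = [] then 1 else 0)" for vs :: "nat list" by (cases vs) auto
  have "mev (\<lambda>_. 0) p = real_of_int (foldr (\<lambda>m r. if snd m = [] then fst m + r else r) p 0)" for p
    by (induction p) (auto simp: mev_Cons prod0)
  moreover have "isgn (real_of_int k) = sgn k" for k by (simp add: isgn_def sgn_if)
  moreover have "recf (\<lambda>p :: int_mpoly. sgn (foldr (\<lambda>m r. if snd m = [] then fst m + r else r) p 0))"
    by (intro rec_intros)
  ultimately show ?thesis by simp
qed

lemmas decp_exsat_0 = decp_exsat[OF recf_isgn_mev_0]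

section \<open>The Hilbert basis theorem\<close>

text \<open>Subrings and ideals are subsets of one ambient ring, so that a tower of extensions stays
  within a single type.\<close>

inductive_set ideal_gen :: "'a::comm_ring_1 set \<Rightarrow> 'a set \<Rightarrow> 'a set" for R S where
  zero: "0 \<in> ideal_gen R S"
| add: "x \<in> ideal_gen R S \<Longrightarrow> s \<in> S \<Longrightarrow> r \<in> R \<Longrightarrow> r * s + x \<in> ideal_gen R S"

definition is_subring :: "'a::comm_ring_1 set \<Rightarrow> bool" where
  "is_subring R \<longleftrightarrow> 0 \<in> R \<and> 1 \<in> R \<and> (\<forall>x\<in>R. \<forall>y\<in>R. x + y \<in> R \<and> x * y \<in> R \<and> - x \<in> R)"

definition noetherian :: "'a::comm_ring_1 set \<Rightarrow> bool" where
  "noetherian R \<longleftrightarrow> (\<forall>S\<subseteq>R. \<exists>F. finite F \<and> F \<subseteq> S \<and> S \<subseteq> ideal_gen R F)"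

lemma is_subringD:
  assumes "is_subring R"
  shows "0 \<in> R" "1 \<in> R" "x \<in> R \<Longrightarrow> y \<in> R \<Longrightarrow> x + y \<in> R" "x \<in> R \<Longrightarrow> y \<in> R \<Longrightarrow> x * y \<in> R" "x \<in> R \<Longrightarrow> - x \<in> R"
  using assms by (auto simp: is_subring_def)

lemma is_subring_power: "is_subring R \<Longrightarrow> x \<in> R \<Longrightarrow> x ^ n \<in> R"
  by (induction n) (auto dest: is_subringD)

lemma ideal_gen_plus: "x \<in> ideal_gen R S \<Longrightarrow> y \<in> ideal_gen R S \<Longrightarrow> x + y \<in> ideal_gen R S"
  by (induction rule: ideal_gen.induct) (auto simp: add.assoc intro: ideal_gen.add)

lemma ideal_gen_mult:
  assumes "is_subring R" "c \<in> R" "x \<in> ideal_gen R S" shows "c * x \<in> ideal_gen R S"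
  using assms(3)
proof induction
  case (add x s r)
  have "(c * r) * s + c * x \<in> ideal_gen R S"
    using add assms by (intro ideal_gen.add) (auto dest: is_subringD)
  then show ?case by (simp add: algebra_simps)
qed (simp add: ideal_gen.zero)

lemma ideal_gen_superset: "is_subring R \<Longrightarrow> s \<in> S \<Longrightarrow> s \<in> ideal_gen R S"
  using ideal_gen.add[OF ideal_gen.zero, of s S 1 R] by (simp add: is_subring_def)

lemma ideal_gen_trans:
  assumes "is_subring R" "B \<subseteq> ideal_gen R S" shows "ideal_gen R B \<subseteq> ideal_gen R S"
proof
  fix x assume "x \<in> ideal_gen R B"
  then show "x \<in> ideal_gen R S"
    by induction (use assms in \<open>auto intro: ideal_gen.zero ideal_gen_plus ideal_gen_mult\<close>)
qed

lemma ideal_gen_mono: "S \<subseteq> S' \<Longrightarrow> ideal_gen R S \<subseteq> ideal_gen R S'"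
proof
  fix x assume S: "S \<subseteq> S'" and "x \<in> ideal_gen R S"
  from this(2) show "x \<in> ideal_gen R S'"
    by induction (use S in \<open>auto intro: ideal_gen.intros\<close>)
qed

lemma ideal_gen_finite:
  "x \<in> ideal_gen R S \<Longrightarrow> \<exists>F. finite F \<and> F \<subseteq> S \<and> x \<in> ideal_gen R F"
proof (induction rule: ideal_gen.induct)
  case (add x s r)
  then obtain F where F: "finite F" "F \<subseteq> S" "x \<in> ideal_gen R F" by blast
  have "r * s + x \<in> ideal_gen R (insert s F)"
    using add F ideal_gen_mono[of F "insert s F" R] by (intro ideal_gen.add) auto
  then show ?case using F add by (intro exI[of _ "insert s F"]) auto
qed (auto intro: ideal_gen.zero)

lemma ideal_gen_finite_subset:
  assumes "finite B" "B \<subseteq> ideal_gen R S" shows "\<exists>F. finite F \<and> F \<subseteq> S \<and> B \<subseteq> ideal_gen R F"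
  using assms
proof (induction B)
  case (insert b B)
  then obtain F where F: "finite F" "F \<subseteq> S" "B \<subseteq> ideal_gen R F" by blast
  obtain F' where F': "finite F'" "F' \<subseteq> S" "b \<in> ideal_gen R F'"
    using ideal_gen_finite[of b R S] insert.prems by auto
  have "insert b B \<subseteq> ideal_gen R (F \<union> F')"
    using F(3) F'(3) ideal_gen_mono[of F "F \<union> F'" R] ideal_gen_mono[of F' "F \<union> F'" R] by auto
  then show ?case using F F' by (intro exI[of _ "F \<union> F'"]) auto
qed (auto intro: exI[of _ "{}"])

lemma ideal_gen_subset: "is_subring R \<Longrightarrow> S \<subseteq> R \<Longrightarrow> ideal_gen R S \<subseteq> R"
proof
  fix x assume R: "is_subring R" "S \<subseteq> R" and "x \<in> ideal_gen R S"
  from this(3) show "x \<in> R"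
    by induction (use R(2) in \<open>auto intro!: is_subringD[OF R(1)]\<close>)
qed

section \<open>Adjoining an element to a Noetherian ring\<close>

definition adjoin_upto :: "'a::comm_ring_1 set \<Rightarrow> 'a \<Rightarrow> nat \<Rightarrow> 'a set" where
  "adjoin_upto R t n = {x. \<exists>a. (\<forall>i. a i \<in> R) \<and> x = (\<Sum>i<n. a i * t ^ i)}"

definition adjoin :: "'a::comm_ring_1 set \<Rightarrow> 'a \<Rightarrow> 'a set" where
  "adjoin R t = (\<Union>n. adjoin_upto R t n)"

lemma adjoin_uptoI: "(\<And>i. a i \<in> R) \<Longrightarrow> x = (\<Sum>i<n. a i * t ^ i) \<Longrightarrow> x \<in> adjoin_upto R t n"
  unfolding adjoin_upto_def by blast

lemma adjoin_uptoE:
  assumes "x \<in> adjoin_upto R t n"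
  obtains a where "\<And>i. a i \<in> R" "x = (\<Sum>i<n. a i * t ^ i)"
  using assms unfolding adjoin_upto_def by blast

lemma adjoin_upto_0: "x \<in> adjoin_upto R t 0 \<Longrightarrow> x = 0"
  by (erule adjoin_uptoE) simp

lemma adjoin_upto_SucE:
  assumes "x \<in> adjoin_upto R t (Suc n)"
  obtains a g where "a \<in> R" "g \<in> adjoin_upto R t n" "x = a * t ^ n + g"
proof -
  obtain a where a: "\<And>i. a i \<in> R" "x = (\<Sum>i<Suc n. a i * t ^ i)" using adjoin_uptoE[OF assms] by blast
  show ?thesis
  proof (rule that[of "a n" "\<Sum>i<n. a i * t ^ i"])
    show "(\<Sum>i<n. a i * t ^ i) \<in> adjoin_upto R t n" by (rule adjoin_uptoI[OF a(1) refl])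
  qed (simp_all add: a add.commute)
qed

lemma adjoin_upto_SucI:
  assumes "c \<in> R" "g \<in> adjoin_upto R t n" shows "c * t ^ n + g \<in> adjoin_upto R t (Suc n)"
proof -
  obtain a where a: "\<And>i. a i \<in> R" "g = (\<Sum>i<n. a i * t ^ i)" using adjoin_uptoE[OF assms(2)] by blast
  show ?thesis
    by (rule adjoin_uptoI[of "a(n := c)"]) (use a assms(1) in \<open>auto simp: add.commute\<close>)
qed

lemma adjoin_upto_add:
  assumes "is_subring R" "x \<in> adjoin_upto R t n" "y \<in> adjoin_upto R t n" shows "x + y \<in> adjoin_upto R t n"
proof -
  obtain a where a: "\<And>i. a i \<in> R" "x = (\<Sum>i<n. a i * t ^ i)" using adjoin_uptoE[OF assms(2)] by blast
  obtain b where b: "\<And>i. b i \<in> R" "y = (\<Sum>i<n. b i * t ^ i)" using adjoin_uptoE[OF assms(3)] by blast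
  show ?thesis
    by (rule adjoin_uptoI[of "\<lambda>i. a i + b i"])
       (simp_all add: a b is_subringD(3)[OF assms(1)] sum.distrib distrib_right)
qed

lemma adjoin_upto_scale:
  assumes "is_subring R" "x \<in> adjoin_upto R t n" "c \<in> R" shows "c * x \<in> adjoin_upto R t n"
proof -
  obtain a where a: "\<And>i. a i \<in> R" "x = (\<Sum>i<n. a i * t ^ i)" using adjoin_uptoE[OF assms(2)] by blast
  show ?thesis
    by (rule adjoin_uptoI[of "\<lambda>i. c * a i"])
       (simp_all add: a assms(3) is_subringD(4)[OF assms(1)] sum_distrib_left mult.assoc)
qed

lemma adjoin_upto_zero: "is_subring R \<Longrightarrow> 0 \<in> adjoin_upto R t n"
  by (rule adjoin_uptoI[of "\<lambda>_. 0"]) (simp_all add: is_subringD(1))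

lemma one_adjoin_upto: "is_subring R \<Longrightarrow> 1 \<in> adjoin_upto R t 1"
  by (rule adjoin_uptoI[of "\<lambda>_. 1"]) (simp_all add: is_subringD(2))

lemma adjoin_upto_mono:
  assumes "is_subring R" "n \<le> m" shows "adjoin_upto R t n \<subseteq> adjoin_upto R t m"
  using assms(2)
proof (induction m rule: dec_induct)
  case (step m)
  show ?case
  proof
    fix x assume "x \<in> adjoin_upto R t n"
    then have "0 * t ^ m + x \<in> adjoin_upto R t (Suc m)"
      using step.IH by (intro adjoin_upto_SucI is_subringD(1)[OF assms(1)]) blast
    then show "x \<in> adjoin_upto R t (Suc m)" by simp
  qed
qed simp

lemma adjoin_upto_shift:
  assumes "is_subring R" "x \<in> adjoin_upto R t n" shows "t ^ k * x \<in> adjoin_upto R t (n + k)"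
  using assms(2)
proof (induction n arbitrary: x)
  case 0
  then show ?case using adjoin_upto_zero[OF assms(1)] by (auto dest: adjoin_upto_0)
next
  case (Suc n)
  then obtain a g where a: "a \<in> R" "g \<in> adjoin_upto R t n" "x = a * t ^ n + g"
    using adjoin_upto_SucE by blast
  then have "t ^ k * x = a * t ^ (n + k) + t ^ k * g" by (simp add: algebra_simps power_add)
  then show ?case using adjoin_upto_SucI[OF a(1) Suc.IH[OF a(2)]] by simp
qed

lemma is_subring_adjoin:
  assumes "is_subring R" shows "is_subring (adjoin R t)"
proof -
  have mult: "x * y \<in> adjoin_upto R t (n + m)" if "x \<in> adjoin_upto R t n" "y \<in> adjoin_upto R t m" for x y n m
    using that(1)
  proof (induction n arbitrary: x)
    case 0
    then show ?case using adjoin_upto_zero[OF assms] by (auto dest: adjoin_upto_0)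
  next
    case (Suc n)
    then obtain a g where a: "a \<in> R" "g \<in> adjoin_upto R t n" "x = a * t ^ n + g"
      using adjoin_upto_SucE by blast
    have "t ^ n * (a * y) \<in> adjoin_upto R t (Suc n + m)"
      by (rule subsetD[OF adjoin_upto_mono[OF assms, of "m + n"]])
         (simp, rule adjoin_upto_shift[OF assms adjoin_upto_scale[OF assms that(2) a(1)]])
    moreover have "g * y \<in> adjoin_upto R t (Suc n + m)"
      by (rule subsetD[OF adjoin_upto_mono[OF assms, of "n + m"] Suc.IH[OF a(2)]]) simp
    moreover have "x * y = t ^ n * (a * y) + g * y" using a(3) by (simp add: algebra_simps)
    ultimately show ?case using adjoin_upto_add[OF assms] by metis
  qed
  have add: "x + y \<in> adjoin_upto R t (max n m)" if "x \<in> adjoin_upto R t n" "y \<in> adjoin_upto R t m" for x y n m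
    by (intro adjoin_upto_add[OF assms] subsetD[OF adjoin_upto_mono[OF assms] that(1)]
        subsetD[OF adjoin_upto_mono[OF assms] that(2)]) simp_all
  have neg: "- x \<in> adjoin_upto R t n" if "x \<in> adjoin_upto R t n" for x n
    using adjoin_upto_scale[OF assms that is_subringD(5)[OF assms is_subringD(2)[OF assms]]] by simp
  show ?thesis unfolding is_subring_def adjoin_def
  proof (intro conjI ballI)
    show "0 \<in> (\<Union>n. adjoin_upto R t n)" using adjoin_upto_zero[OF assms] by blast
    show "1 \<in> (\<Union>n. adjoin_upto R t n)" using one_adjoin_upto[OF assms] by blast
    fix x y assume "x \<in> (\<Union>n. adjoin_upto R t n)" "y \<in> (\<Union>n. adjoin_upto R t n)"
    then obtain n m where nm: "x \<in> adjoin_upto R t n" "y \<in> adjoin_upto R t m" by blast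
    show "x + y \<in> (\<Union>n. adjoin_upto R t n)" using add[OF nm] by blast
    show "x * y \<in> (\<Union>n. adjoin_upto R t n)" using mult[OF nm] by blast
    show "- x \<in> (\<Union>n. adjoin_upto R t n)" using neg[OF nm(1)] by blast
  qed
qed

lemma subset_adjoin:
  assumes "is_subring R" shows "R \<subseteq> adjoin R t" and "t \<in> adjoin R t"
proof -
  show "R \<subseteq> adjoin R t"
  proof
    fix x assume "x \<in> R"
    then have "x \<in> adjoin_upto R t 1" by (intro adjoin_uptoI[of "\<lambda>_. x"]) auto
    then show "x \<in> adjoin R t" by (auto simp: adjoin_def)
  qed
  have "t ^ 1 * 1 \<in> adjoin_upto R t (1 + 1)"
    by (intro adjoin_upto_shift[OF assms] one_adjoin_upto[OF assms])
  then show "t \<in> adjoin R t" by (auto simp: adjoin_def)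
qed

text \<open>Hilbert's proof with leading coefficients. As \<open>t\<close> may satisfy equations
  over \<open>R\<close>, an element has no degree of its own; leading coefficients belong to
  representations \<open>a * t ^ d + g\<close>.\<close>

theorem noetherian_adjoin:
  assumes R: "is_subring R" "noetherian R"
  shows "noetherian (adjoin R t)"
  unfolding noetherian_def
proof (intro allI impI)
  let ?A = "adjoin R t"
  fix S assume "S \<subseteq> ?A"
  note A = is_subring_adjoin[OF R(1), of t]
  define I where "I = ideal_gen ?A S"
  have IA: "I \<subseteq> ?A" unfolding I_def by (rule ideal_gen_subset[OF A \<open>S \<subseteq> ?A\<close>])
  define lead where "lead d = {a \<in> R. \<exists>g \<in> adjoin_upto R t d. a * t ^ d + g \<in> I}" for d
  have I_mult: "c * x \<in> I" if "c \<in> ?A" "x \<in> I" for c x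
    using ideal_gen_mult[OF A that(1)] that(2) unfolding I_def by blast
  have lead_R: "lead d \<subseteq> R" for d unfolding lead_def by blast
  have lead_Suc: "lead d \<subseteq> lead (Suc d)" for d
  proof
    fix a assume "a \<in> lead d"
    then obtain g where g: "a \<in> R" "g \<in> adjoin_upto R t d" "a * t ^ d + g \<in> I" unfolding lead_def by blast
    have "t * (a * t ^ d + g) \<in> I"
      by (rule I_mult[OF subset_adjoin(2)[OF R(1)] g(3)])
    moreover have "t ^ 1 * g \<in> adjoin_upto R t (d + 1)" by (rule adjoin_upto_shift[OF R(1) g(2)])
    ultimately show "a \<in> lead (Suc d)" using g(1)
      unfolding lead_def by (intro CollectI conjI bexI[of _ "t * g"]) (simp_all add: algebra_simps)
  qed
  then have lead_mono: "d \<le> d' \<Longrightarrow> lead d \<subseteq> lead d'" for d d' using lift_Suc_mono_le[of lead] by blast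
  obtain L where L: "finite L" "L \<subseteq> (\<Union>d. lead d)" "(\<Union>d. lead d) \<subseteq> ideal_gen R L"
    using R(2)[unfolded noetherian_def, rule_format, of "\<Union>d. lead d"] lead_R by blast
  have "\<exists>D. L \<subseteq> lead D"
    using L(1,2)
  proof (induction L)
    case (insert a L)
    then obtain D d where "L \<subseteq> lead D" "a \<in> lead d" by auto
    then have "insert a L \<subseteq> lead (max D d)"
      using lead_mono[of D "max D d"] lead_mono[of d "max D d"] by auto
    then show ?case ..
  qed auto
  then obtain D where D: "L \<subseteq> lead D" by blast
  have "\<exists>F. finite F \<and> F \<subseteq> lead d \<and> lead d \<subseteq> ideal_gen R F" for d
    using R(2)[unfolded noetherian_def, rule_format, OF lead_R[of d]] .
  then obtain Ld where Ld: "\<And>d. finite (Ld d)" "\<And>d. Ld d \<subseteq> lead d" "\<And>d. lead d \<subseteq> ideal_gen R (Ld d)" by metis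
  \<comment> \<open>Below degree \<open>D\<close> each set of leading coefficients has its own
    generators; from \<open>D\<close> on those of the union suffice, since multiplication by
    \<open>t\<close> makes these sets increase.\<close>
  define gens where "gens d = (if d < D then Ld d else L)" for d
  define lift where "lift d a = (SOME h. h \<in> I \<and> (\<exists>g \<in> adjoin_upto R t d. h = a * t ^ d + g))" for d a
  have lift: "lift d a \<in> I \<and> (\<exists>g \<in> adjoin_upto R t d. lift d a = a * t ^ d + g)" if "a \<in> lead d" for d a
    unfolding lift_def by (rule someI_ex) (use that in \<open>unfold lead_def, blast\<close>)
  define B where "B = (\<Union>d\<le>D. lift d ` gens d)"
  have gens: "gens d \<subseteq> lead (min d D)" "lead d \<subseteq> ideal_gen R (gens d)" for d
  proof -
    show "gens d \<subseteq> lead (min d D)" using Ld(2)[of d] D by (simp add: gens_def min_def)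
    have "lead d \<subseteq> ideal_gen R L" using L(3) by blast
    then show "lead d \<subseteq> ideal_gen R (gens d)" using Ld(3)[of d] by (simp add: gens_def)
  qed
  have B: "finite B" "B \<subseteq> I"
  proof -
    show "finite B" using Ld(1) L(1) by (auto simp: B_def gens_def)
    have "lift d a \<in> I" if "d \<le> D" "a \<in> gens d" for d a
      using lift[of a d] gens(1)[of d] that by (simp add: min_def subset_iff)
    then show "B \<subseteq> I" unfolding B_def by blast
  qed
  \<comment> \<open>The leading term \<open>a * t ^ d\<close> is matched by generators in
    \<open>B\<close> of degree at most \<open>D\<close>, raised to degree \<open>d\<close> by powers
    of \<open>t\<close>.\<close>
  have reduce: "\<exists>b\<in>ideal_gen ?A B. \<exists>g\<in>adjoin_upto R t d. b = a * t ^ d + g" if "a \<in> ideal_gen R (gens d)" for a d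
    using that
  proof (induction rule: ideal_gen.induct)
    case zero
    show ?case
      using adjoin_upto_zero[OF R(1)] ideal_gen.zero by (intro bexI[of _ 0]) auto
  next
    case (add x s r)
    then obtain b g where b: "b \<in> ideal_gen ?A B" "g \<in> adjoin_upto R t d" "b = x * t ^ d + g" by blast
    define m where "m = min d D"
    have gm: "gens d = gens m" by (simp add: gens_def m_def min_def)
    have "s \<in> lead m" using gens(1)[of d] add(2) unfolding m_def by blast
    from lift[OF this] obtain g' where g': "g' \<in> adjoin_upto R t m" "lift m s = s * t ^ m + g'" by blast
    have "m \<le> D" by (simp add: m_def)
    then have "lift m s \<in> B" using add(2) unfolding gm B_def by blast
    moreover have "r * t ^ (d - m) \<in> ?A"
      by (intro is_subringD(4)[OF A] is_subring_power[OF A] subset_adjoin(2)[OF R(1)]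
          subsetD[OF subset_adjoin(1)[OF R(1)] add(3)])
    ultimately have "(r * t ^ (d - m)) * lift m s + b \<in> ideal_gen ?A B" by (intro ideal_gen.add[OF b(1)])
    moreover have "(r * t ^ (d - m)) * lift m s + b = (r * s + x) * t ^ d + (t ^ (d - m) * (r * g') + g)"
    proof -
      have "t ^ d = t ^ (d - m) * t ^ m" by (simp add: m_def flip: power_add)
      then show ?thesis unfolding g'(2) b(3) by (simp add: algebra_simps)
    qed
    moreover have "t ^ (d - m) * (r * g') + g \<in> adjoin_upto R t d"
    proof (rule adjoin_upto_add[OF R(1) _ b(2)])
      have "m + (d - m) = d" by (simp add: m_def)
      then show "t ^ (d - m) * (r * g') \<in> adjoin_upto R t d"
        using adjoin_upto_shift[OF R(1) adjoin_upto_scale[OF R(1) g'(1) add(3)], of "d - m"] by metis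
    qed
    ultimately show ?case by metis
  qed
  \<comment> \<open>Subtracting such a match removes the top term, and induction on the length of
    the representation applies.\<close>
  have "f \<in> ideal_gen ?A B" if "f \<in> I" "f \<in> adjoin_upto R t n" for f n
    using that
  proof (induction n arbitrary: f)
    case 0
    then show ?case by (auto dest: adjoin_upto_0 intro: ideal_gen.zero)
  next
    case (Suc n)
    then obtain a g where a: "a \<in> R" "g \<in> adjoin_upto R t n" "f = a * t ^ n + g"
      using adjoin_upto_SucE by blast
    then have "a \<in> lead n" using Suc.prems(1) unfolding lead_def by blast
    then have "a \<in> ideal_gen R (gens n)" using gens(2) by blast
    from reduce[OF this] obtain b g' where b: "b \<in> ideal_gen ?A B" "g' \<in> adjoin_upto R t n" "b = a * t ^ n + g'" by blast
    have "b \<in> I" using b(1) ideal_gen_trans[OF A, of B S] B(2) unfolding I_def by blast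
    then have "(-1) * b \<in> I" by (intro I_mult is_subringD(5)[OF A is_subringD(2)[OF A]])
    then have "f + (-1) * b \<in> I" using Suc.prems(1) unfolding I_def by (intro ideal_gen_plus)
    moreover have "f + (-1) * b = g + (-1) * g'" by (simp add: a(3) b(3))
    moreover have "g + (-1) * g' \<in> adjoin_upto R t n"
      by (intro adjoin_upto_add[OF R(1)] adjoin_upto_scale[OF R(1)] a(2) b(2)
          is_subringD(5)[OF R(1) is_subringD(2)[OF R(1)]])
    ultimately have "f + (-1) * b \<in> ideal_gen ?A B" using Suc.IH by metis
    from ideal_gen_plus[OF this b(1)] show ?case by simp
  qed
  note I_B = this
  have "I \<subseteq> ideal_gen ?A B"
  proof
    fix f assume f: "f \<in> I"
    then obtain n where "f \<in> adjoin_upto R t n" using IA unfolding adjoin_def[of R t] by blast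
    then show "f \<in> ideal_gen ?A B" by (rule I_B[OF f])
  qed
  moreover obtain F where F: "finite F" "F \<subseteq> S" "B \<subseteq> ideal_gen ?A F"
    using ideal_gen_finite_subset[OF B(1) B(2)[unfolded I_def]] by blast
  moreover have "S \<subseteq> I" unfolding I_def by (intro subsetI ideal_gen_superset[OF A])
  ultimately have "S \<subseteq> ideal_gen ?A F" using ideal_gen_trans[OF A F(3)] by (meson order_trans)
  then show "\<exists>F. finite F \<and> F \<subseteq> S \<and> S \<subseteq> ideal_gen ?A F" using F by blast
qed

lemma is_subring_ints: "is_subring (range of_int)"
  unfolding is_subring_def by (auto simp flip: of_int_add of_int_mult of_int_minus)
     (metis of_int_0 rangeI, metis of_int_1 rangeI)

text \<open>The least positive integer mapped into the ideal generates it, by division with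
  remainder. Working with integer preimages covers rings of any characteristic.\<close>

lemma noetherian_ints: "noetherian (range (of_int :: int \<Rightarrow> 'a::comm_ring_1))"
  unfolding noetherian_def
proof (intro allI impI)
  let ?R = "range (of_int :: int \<Rightarrow> 'a)"
  fix S assume S: "S \<subseteq> ?R"
  define T where "T k \<longleftrightarrow> (of_int k :: 'a) \<in> ideal_gen ?R S" for k
  have T_mult: "T (k * l)" if "T l" for k l
    using that ideal_gen_mult[OF is_subring_ints, of "of_int k" "of_int l" S] by (simp add: T_def)
  have T_add: "T (k + l)" if "T k" "T l" for k l
    using that ideal_gen_plus by (simp add: T_def)
  show "\<exists>F. finite F \<and> F \<subseteq> S \<and> S \<subseteq> ideal_gen ?R F"
  proof (cases "\<exists>n::nat. 0 < n \<and> T (int n)")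
    case False
    have "s = 0" if s: "s \<in> S" for s
    proof -
      obtain k where k: "s = of_int k" using s S by auto
      then have "T k" using ideal_gen_superset[OF is_subring_ints s] by (simp add: T_def)
      then have "T (int (nat \<bar>k\<bar>))" using T_mult[of k "sgn k"] by (simp add: mult_sgn_abs sgn_if split: if_splits)
      then have "k = 0" using False by (metis abs_eq_0 nat_0_iff neq0_conv zero_less_abs_iff zero_less_nat_eq)
      then show ?thesis using k by simp
    qed
    then show ?thesis using ideal_gen.zero[of ?R "{}"] by (intro exI[of _ "{}"]) auto
  next
    case True
    define d where "d = (LEAST n::nat. 0 < n \<and> T (int n))"
    have d: "0 < d" "T (int d)" using LeastI_ex[OF True] unfolding d_def by blast+
    have least: "d \<le> n" if "0 < n" "T (int n)" for n
      unfolding d_def by (rule Least_le) (use that in blast)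
    have dvd: "int d dvd k" if "T k" for k
    proof -
      have "k mod int d = k + (- (k div int d)) * int d" by (simp add: minus_div_mult_eq_mod [symmetric])
      then have "T (k mod int d)" using T_add[OF that T_mult[OF d(2)]] by metis
      then have "T (int (nat (k mod int d)))" using d(1) by simp
      moreover have "nat (k mod int d) < d" using d(1) by (simp add: nat_less_iff)
      ultimately have "nat (k mod int d) = 0" using least[of "nat (k mod int d)"] by linarith
      then have "k mod int d = 0" using d(1) by (simp add: order_antisym)
      then show ?thesis by (simp add: dvd_eq_mod_eq_0)
    qed
    obtain F where F: "finite F" "F \<subseteq> S" "of_int (int d) \<in> ideal_gen ?R F"
      using ideal_gen_finite[OF d(2)[unfolded T_def]] by blast
    have "s \<in> ideal_gen ?R F" if s: "s \<in> S" for s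
    proof -
      obtain k where k: "s = of_int k" using s S by auto
      then have "T k" using ideal_gen_superset[OF is_subring_ints s] by (simp add: T_def)
      then obtain l where "k = int d * l" using dvd by (auto simp: dvd_def)
      then have "s = of_int l * of_int (int d)" using k by (simp add: mult.commute)
      then show ?thesis using ideal_gen_mult[OF is_subring_ints _ F(3), of "of_int l"] by simp
    qed
    then show ?thesis using F by blast
  qed
qed

section \<open>Rings of integral polynomial functions\<close>

primrec poly_functions :: "nat \<Rightarrow> ((nat \<Rightarrow> real) \<Rightarrow> real) set" where
  "poly_functions 0 = range of_int"
| "poly_functions (Suc m) = adjoin (poly_functions m) (\<lambda>x. x m)"

lemma is_subring_poly_functions: "is_subring (poly_functions m)"
  by (induction m) (auto intro: is_subring_ints is_subring_adjoin)

lemma noetherian_poly_functions: "noetherian (poly_functions m)"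
  by (induction m) (auto intro: noetherian_ints noetherian_adjoin is_subring_poly_functions)

lemma coordinate_poly_functions: "i < m \<Longrightarrow> (\<lambda>x. x i) \<in> poly_functions m"
proof (induction m)
  case (Suc m)
  show ?case
  proof (cases "i = m")
    case True
    then show ?thesis using subset_adjoin(2)[OF is_subring_poly_functions] by simp
  next
    case False
    then show ?thesis
      using Suc subsetD[OF subset_adjoin(1)[OF is_subring_poly_functions[of m]]] by simp
  qed
qed simp

lemma of_int_poly_functions: "(\<lambda>x. of_int k) \<in> poly_functions m"
proof (induction m)
  case 0
  have "(\<lambda>x. of_int k) = (of_int k :: (nat \<Rightarrow> real) \<Rightarrow> real)"
    by (cases k rule: int_cases2) (simp_all add: fun_eq_iff of_nat_fun)
  then show ?case by simp
qed (use subset_adjoin(1)[OF is_subring_poly_functions] in auto)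

definition truncate_env :: "nat \<Rightarrow> (nat \<Rightarrow> real) \<Rightarrow> nat \<Rightarrow> real" where
  "truncate_env m x i = (if i < m then x i else 0)"

lemma mev_poly_functions: "(\<lambda>x. mev (truncate_env m x) p) \<in> poly_functions m"
proof (induction p)
  case Nil
  show ?case using of_int_poly_functions[of 0 m] by simp
next
  case (Cons y p)
  note R = is_subringD[OF is_subring_poly_functions[of m]]
  have coord: "(\<lambda>x. truncate_env m x i) \<in> poly_functions m" for i
    using coordinate_poly_functions[of i m] of_int_poly_functions[of 0 m] by (cases "i < m") (auto simp: truncate_env_def)
  have "(\<lambda>x. prod_list (map (truncate_env m x) vs)) \<in> poly_functions m" for vs
  proof (induction vs)
    case Nil
    show ?case using of_int_poly_functions[of 1 m] by simp
  next
    case (Cons v vs)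
    then show ?case using R(4)[OF coord Cons] by (simp add: times_fun_def)
  qed
  from R(3)[OF R(4)[OF of_int_poly_functions[of "fst y"] this] Cons] show ?case
    by (simp add: mev_Cons times_fun_def plus_fun_def)
qed

text \<open>All functions given by \<open>Z\<close> lie in the ideal generated by finitely many of
  them, so they vanish wherever these do; truncation changes nothing at points supported below
  \<open>m\<close>. \<open>Fs\<close> is not computed from \<open>Z\<close> but enters the later
  algorithms as fixed data.\<close>

lemma finite_equations:
  "\<exists>Fs. set Fs \<subseteq> Z \<and> (\<forall>x. (\<forall>i\<ge>m. x i = 0) \<longrightarrow> (\<forall>f\<in>set Fs. mev x f = (0::real)) \<longrightarrow> (\<forall>p\<in>Z. mev x p = 0))"
proof -
  let ?g = "\<lambda>p x. mev (truncate_env m x) p"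
  have "?g ` Z \<subseteq> poly_functions m" by (intro image_subsetI mev_poly_functions)
  from noetherian_poly_functions[of m, unfolded noetherian_def, rule_format, OF this]
  obtain F where F: "finite F" "F \<subseteq> ?g ` Z" "?g ` Z \<subseteq> ideal_gen (poly_functions m) F"
    by (elim exE conjE) (rule that)
  from finite_subset_image[OF F(1,2)] obtain Y where Y: "finite Y" "Y \<subseteq> Z" "F = ?g ` Y"
    by (elim exE conjE) (rule that)
  obtain Fs where Fs: "set Fs = Y" using finite_list[OF Y(1)] by blast
  have "mev x p = 0" if x: "\<And>i. i \<ge> m \<Longrightarrow> x i = 0" "\<And>f. f \<in> Y \<Longrightarrow> mev x f = 0" and p: "p \<in> Z" for x :: "nat \<Rightarrow> real" and p
  proof -
    have tr: "truncate_env m x = x" using x(1) by (auto simp: truncate_env_def fun_eq_iff)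
    have F0: "s x = 0" if "s \<in> F" for s using that x(2) Y(3) tr by auto
    have "h x = 0" if "h \<in> ideal_gen (poly_functions m) F" for h
      using that by induction (simp_all add: F0)
    from this[OF subsetD[OF F(3) imageI[OF p]]] show ?thesis using tr by simp
  qed
  then show ?thesis using Y(2) Fs by (intro exI[of _ Fs]) simp
qed

section \<open>Computable reals\<close>

lemma recf_nat_iff: "recf (f :: nat \<Rightarrow> nat) \<longleftrightarrow> computable f"
proof -
  have "dec n = n" for n :: nat by (metis dec_enc enc_nat_def)
  then show ?thesis by (simp add: recf_def enc_nat_def)
qed

lemma computable_reals_uminus [simp]: "- a \<in> computable_reals \<longleftrightarrow> a \<in> computable_reals"
proof -
  have "decimal_expansion (- a) = decimal_expansion a" by (simp add: decimal_expansion_def fun_eq_iff)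
  then show ?thesis by (simp add: computable_reals_def)
qed

text \<open>Comparing \<open>\<bar>a\<bar>\<close> with fractions finds the integral part of
  \<open>10 ^ n * \<bar>a\<bar>\<close> by search.\<close>

lemma computable_realsI:
  assumes "decp (\<lambda>q :: nat \<times> nat. \<bar>a\<bar> * real (Suc (snd q)) < real (fst q))"
  shows "a \<in> computable_reals"
proof -
  define fl where "fl n = nat \<lfloor>10 ^ n * \<bar>a\<bar>\<rfloor>" for n
  \<comment> \<open>Denominators have the form \<open>Suc d\<close>, so \<open>10 ^ n\<close> is
    written as the successor of \<open>10 ^ n - 1\<close>.\<close>
  have "recf (\<lambda>n. LEAST q. \<bar>a\<bar> * real (Suc (10 ^ n - 1)) < real (Suc q))"
  proof (rule recf_Least)
    show "decp (\<lambda>q. \<bar>a\<bar> * real (Suc (10 ^ fst q - 1)) < real (Suc (snd q)))"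
      by (rule decp_comp[OF assms, of "\<lambda>q. (Suc (snd q), 10 ^ fst q - 1)", simplified fst_conv snd_conv]) (intro rec_intros)
    fix n
    show "\<exists>q. \<bar>a\<bar> * real (Suc (10 ^ n - 1)) < real (Suc q)"
      by (meson less_trans lessI of_nat_less_iff reals_Archimedean2)
  qed
  moreover have "(LEAST q. \<bar>a\<bar> * real (Suc (10 ^ n - 1)) < real (Suc q)) = fl n" for n
  proof (rule Least_equality)
    have *: "real (Suc (10 ^ n - 1)) = 10 ^ n" by simp
    show "\<bar>a\<bar> * real (Suc (10 ^ n - 1)) < real (Suc (fl n))"
      unfolding * fl_def by (simp add: mult.commute) linarith
    show "fl n \<le> q" if "\<bar>a\<bar> * real (Suc (10 ^ n - 1)) < real (Suc q)" for q
      using that unfolding * fl_def by (simp add: mult.commute nat_le_iff floor_le_iff)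
  qed
  ultimately have fl: "recf fl" by simp
  have "recf (\<lambda>n. if n = 0 then fl n else fl n mod 10)" by (intro rec_intros fl)
  moreover have "(if n = 0 then fl n else fl n mod 10) = decimal_expansion a n" for n
    by (simp add: decimal_expansion_def fl_def nat_mod_distrib)
  ultimately have "recf (decimal_expansion a)" by simp
  then show ?thesis by (simp add: recf_nat_iff computable_reals_def)
qed

lemma recf_floor_power:
  assumes "a \<in> computable_reals" shows "recf (\<lambda>n. nat \<lfloor>10 ^ n * \<bar>a\<bar>\<rfloor>)"
proof -
  have D: "recf (decimal_expansion a)" using assms by (simp add: recf_nat_iff computable_reals_def)
  have "recf (\<lambda>n. rec_nat (decimal_expansion a 0) (\<lambda>k r. 10 * r + decimal_expansion a (Suc k)) n)"
    by (intro rec_intros recf_comp[OF D])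
  moreover have "rec_nat (decimal_expansion a 0) (\<lambda>k r. 10 * r + decimal_expansion a (Suc k)) n = nat \<lfloor>10 ^ n * \<bar>a\<bar>\<rfloor>" for n
  proof (induction n)
    case (Suc n)
    let ?y = "10 ^ Suc n * \<bar>a\<bar>"
    have "\<lfloor>10 ^ n * \<bar>a\<bar>\<rfloor> = \<lfloor>?y\<rfloor> div 10"
      using floor_divide_real_eq_div[of 10 ?y] by simp
    moreover have "\<lfloor>?y\<rfloor> = 10 * (\<lfloor>?y\<rfloor> div 10) + \<lfloor>?y\<rfloor> mod 10" by simp
    moreover have "0 \<le> \<lfloor>?y\<rfloor>" by simp
    moreover have "nat m = 10 * nat (m div 10) + nat (m mod 10)" if "0 \<le> m" for m :: int
      by (subst of_nat_eq_iff[symmetric, where 'a = int]) (use that in simp)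
    ultimately have "nat \<lfloor>?y\<rfloor> = 10 * nat \<lfloor>10 ^ n * \<bar>a\<bar>\<rfloor> + nat (\<lfloor>?y\<rfloor> mod 10)" by metis
    then show ?case using Suc by (simp add: decimal_expansion_def)
  qed (simp add: decimal_expansion_def)
  ultimately show ?thesis by simp
qed

lemma ex_power_10_gt: "0 < (c::real) \<Longrightarrow> \<exists>n. B < 10 ^ n * c"
proof -
  assume "0 < c"
  obtain n where "B / c < 10 ^ n" using real_arch_pow[of 10 "B / c"] by auto
  then show ?thesis using \<open>0 < c\<close> by (intro exI[of _ n]) (simp add: field_simps)
qed

text \<open>A strict inequality with a fraction shows in a finite truncation of the expansion, so
  both cuts are enumerable.\<close>

lemma rep_abs_cuts:
  assumes "a \<in> computable_reals"
  shows "rep (\<lambda>q :: int \<times> nat. real_of_int (fst q) < \<bar>a\<bar> * real (Suc (snd q)))"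
    and "rep (\<lambda>q :: int \<times> nat. \<bar>a\<bar> * real (Suc (snd q)) < real_of_int (fst q))"
proof -
  define F where "F n = nat \<lfloor>10 ^ n * \<bar>a\<bar>\<rfloor>" for n
  have F: "recf F" unfolding F_def by (rule recf_floor_power[OF assms])
  have bounds: "real (F n) \<le> 10 ^ n * \<bar>a\<bar>" "10 ^ n * \<bar>a\<bar> < real (F n) + 1" for n
    by (simp_all add: F_def)
  show "rep (\<lambda>q :: int \<times> nat. real_of_int (fst q) < \<bar>a\<bar> * real (Suc (snd q)))"
  proof (rule rep_exI)
    show "decp (\<lambda>q :: (int \<times> nat) \<times> nat. fst (fst q) * int (10 ^ snd q) < int (F (snd q) * Suc (snd (fst q))))"
      by (intro rec_intros recf_comp[OF F])
    fix q :: "int \<times> nat"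
    obtain k d where q: "q = (k, d)" by force
    have "(real_of_int k < \<bar>a\<bar> * real (Suc d)) \<longleftrightarrow> (\<exists>n. real_of_int k * 10 ^ n < real (F n) * real (Suc d))"
    proof
      assume "real_of_int k < \<bar>a\<bar> * real (Suc d)"
      \<comment> \<open>At this scale the gap exceeds the error of truncation, which is at most
        \<open>Suc d\<close>.\<close>
      then obtain n where n: "real (Suc d) < 10 ^ n * (\<bar>a\<bar> * real (Suc d) - real_of_int k)"
        using ex_power_10_gt[of "\<bar>a\<bar> * real (Suc d) - real_of_int k"] by auto
      have "(10 ^ n * \<bar>a\<bar> - 1) * real (Suc d) \<le> real (F n) * real (Suc d)"
        using bounds(2)[of n] by (intro mult_right_mono) auto
      then show "\<exists>n. real_of_int k * 10 ^ n < real (F n) * real (Suc d)"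
        using n by (intro exI[of _ n]) (simp add: algebra_simps)
    next
      assume "\<exists>n. real_of_int k * 10 ^ n < real (F n) * real (Suc d)"
      then obtain n where n: "real_of_int k * 10 ^ n < real (F n) * real (Suc d)" ..
      have "real (F n) * real (Suc d) \<le> (10 ^ n * \<bar>a\<bar>) * real (Suc d)"
        using bounds(1)[of n] by (intro mult_right_mono) auto
      then have "10 ^ n * real_of_int k < 10 ^ n * (\<bar>a\<bar> * real (Suc d))" using n by (simp add: algebra_simps)
      then show "real_of_int k < \<bar>a\<bar> * real (Suc d)" by (simp only: mult_less_cancel_left_pos[of "10 ^ n"] zero_less_power zero_less_numeral)
    qed
    moreover have "real_of_int k * 10 ^ n < real (F n) * real (Suc d) \<longleftrightarrow> k * int (10 ^ n) < int (F n * Suc d)" for n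
      by (subst of_int_less_iff[symmetric, where 'a = real]) (simp add: algebra_simps)
    ultimately show "real_of_int (fst q) < \<bar>a\<bar> * real (Suc (snd q)) \<longleftrightarrow>
      (\<exists>n. fst (fst (q, n)) * int (10 ^ snd (q, n)) < int (F (snd (q, n)) * Suc (snd (fst (q, n)))))"
      by (simp only: q fst_conv snd_conv)
  qed
  show "rep (\<lambda>q :: int \<times> nat. \<bar>a\<bar> * real (Suc (snd q)) < real_of_int (fst q))"
  proof (rule rep_exI)
    show "decp (\<lambda>q :: (int \<times> nat) \<times> nat. int (Suc (F (snd q)) * Suc (snd (fst q))) \<le> fst (fst q) * int (10 ^ snd q))"
      by (intro rec_intros recf_comp[OF F])
    fix q :: "int \<times> nat"
    obtain k d where q: "q = (k, d)" by force
    have "(\<bar>a\<bar> * real (Suc d) < real_of_int k) \<longleftrightarrow> (\<exists>n. real (Suc (F n)) * real (Suc d) \<le> real_of_int k * 10 ^ n)"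
    proof
      assume "\<bar>a\<bar> * real (Suc d) < real_of_int k"
      then obtain n where n: "real (Suc d) < 10 ^ n * (real_of_int k - \<bar>a\<bar> * real (Suc d))"
        using ex_power_10_gt[of "real_of_int k - \<bar>a\<bar> * real (Suc d)"] by auto
      have "real (F n) * real (Suc d) \<le> (10 ^ n * \<bar>a\<bar>) * real (Suc d)"
        using bounds(1)[of n] by (intro mult_right_mono) auto
      then show "\<exists>n. real (Suc (F n)) * real (Suc d) \<le> real_of_int k * 10 ^ n"
        using n by (intro exI[of _ n]) (simp add: algebra_simps)
    next
      assume "\<exists>n. real (Suc (F n)) * real (Suc d) \<le> real_of_int k * 10 ^ n"
      then obtain n where n: "real (Suc (F n)) * real (Suc d) \<le> real_of_int k * 10 ^ n" ..
      have "(10 ^ n * \<bar>a\<bar>) * real (Suc d) < real (Suc (F n)) * real (Suc d)"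
        using bounds(2)[of n] by (intro mult_strict_right_mono) auto
      then have "10 ^ n * (\<bar>a\<bar> * real (Suc d)) < 10 ^ n * real_of_int k" using n by (simp add: algebra_simps)
      then show "\<bar>a\<bar> * real (Suc d) < real_of_int k" by (simp only: mult_less_cancel_left_pos[of "10 ^ n"] zero_less_power zero_less_numeral)
    qed
    moreover have "real (Suc (F n)) * real (Suc d) \<le> real_of_int k * 10 ^ n \<longleftrightarrow> int (Suc (F n) * Suc d) \<le> k * int (10 ^ n)" for n
      by (subst of_int_le_iff[symmetric, where 'a = real]) (simp add: algebra_simps)
    ultimately show "\<bar>a\<bar> * real (Suc (snd q)) < real_of_int (fst q) \<longleftrightarrow>
      (\<exists>n. int (Suc (F (snd (q, n))) * Suc (snd (fst (q, n)))) \<le> fst (fst (q, n)) * int (10 ^ snd (q, n)))"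
      by (simp only: q fst_conv snd_conv)
  qed
qed

text \<open>The expansion forgets the sign of \<open>a\<close>; the case distinction supplies it, as
  one more piece of fixed data.\<close>

lemma rep_cuts:
  assumes "a \<in> computable_reals"
  shows "rep (\<lambda>q :: int \<times> nat. real_of_int (fst q) < a * real (Suc (snd q)))" (is ?L)
    and "rep (\<lambda>q :: int \<times> nat. a * real (Suc (snd q)) < real_of_int (fst q))" (is ?R)
proof -
  have neg: "recf (\<lambda>q :: int \<times> nat. (- fst q, snd q))" by (intro rec_intros)
  note c = rep_abs_cuts[OF assms]
  show ?L ?R
    using c rep_comp[OF c(1) neg] rep_comp[OF c(2) neg]
    by (cases "0 \<le> a"; simp add: algebra_simps)+
qed

section \<open>Deciding signs at a computable point\<close>

definition computable_env :: "(nat \<Rightarrow> real) \<Rightarrow> bool" where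
  "computable_env e \<longleftrightarrow> (\<exists>m. \<forall>i\<ge>m. e i = 0) \<and> range e \<subseteq> computable_reals"

text \<open>An open box with corners of common denominator \<open>Suc (snd b)\<close>, as two
  positivity conditions for each coordinate.\<close>

definition box_conditions :: "nat \<Rightarrow> (int \<times> int) list \<times> nat \<Rightarrow> (int_mpoly \<times> int) list" where
  "box_conditions m b = concat (map (\<lambda>i.
     [(mmult (mconst (int (Suc (snd b)))) (mvar i) @ mconst (- fst (nth_default (0, 0) (fst b) i)), 1),
      (mmult (mconst (- int (Suc (snd b)))) (mvar i) @ mconst (snd (nth_default (0, 0) (fst b) i)), 1)]) [0..<m])"

lemma recf_box_conditions: "recf f \<Longrightarrow> recf (\<lambda>x. box_conditions m (f x))"
  by (rule recf_comp[of "box_conditions m"]) (unfold box_conditions_def, intro rec_intros)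

lemma sat_box_conditions:
  "sat e (box_conditions m (bs, d)) \<longleftrightarrow> (\<forall>i<m. real_of_int (fst (nth_default (0, 0) bs i)) < e i * real (Suc d) \<and>
     e i * real (Suc d) < real_of_int (snd (nth_default (0, 0) bs i)))"
  by (auto simp: sat_def box_conditions_def algebra_simps)

lemma tendsto_mev:
  assumes "\<And>i. (\<lambda>n. x n i) \<longlonglongrightarrow> (e i :: real)" shows "(\<lambda>n. mev (x n) p) \<longlonglongrightarrow> mev e p"
proof (induction p)
  case (Cons y p)
  have "(\<lambda>n. prod_list (map (x n) vs)) \<longlonglongrightarrow> prod_list (map e vs)" for vs
    by (induction vs) (auto intro!: tendsto_intros assms)
  then show ?case using Cons unfolding mev_Cons by (intro tendsto_intros)
qed simp

lemma sat_append: "sat e (\<Delta> @ \<Delta>') \<longleftrightarrow> sat e \<Delta> \<and> sat e \<Delta>'"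
  by (auto simp: sat_def)

lemma sat_Cons: "sat e ((p, s) # \<Delta>) \<longleftrightarrow> isgn (mev e p) = s \<and> sat e \<Delta>"
  by (auto simp: sat_def)

lemma exsatI: "(\<And>i. i \<notin> set vs \<Longrightarrow> e' i = e i) \<Longrightarrow> sat e' \<Delta> \<Longrightarrow> exsat vs e \<Delta>"
  unfolding exsat_def by blast

lemma exsatE:
  assumes "exsat vs e \<Delta>" obtains e' where "\<And>i. i \<notin> set vs \<Longrightarrow> e' i = e i" "sat e' \<Delta>"
  using assms unfolding exsat_def by blast

text \<open>If every box around \<open>e\<close> met the set where \<open>p\<close> is not positive,
  shrinking boxes would give a sequence converging to \<open>e\<close>, and
  \<open>mev e p \<le> 0\<close> by continuity.\<close>

lemma mev_pos_iff_box:
  assumes "\<And>i. i \<ge> m \<Longrightarrow> e i = 0"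
  shows "mev e p > 0 \<longleftrightarrow> (\<exists>b. sat e (box_conditions m b) \<and>
    \<not> exsat [0..<m] (\<lambda>_. 0) ((p, 0) # box_conditions m b) \<and> \<not> exsat [0..<m] (\<lambda>_. 0) ((p, -1) # box_conditions m b))"
    (is "_ \<longleftrightarrow> (\<exists>b. ?P b)")
proof
  assume "\<exists>b. ?P b"
  then obtain b where b: "?P b" ..
  have "exsat [0..<m] (\<lambda>_. 0) ((p, isgn (mev e p)) # box_conditions m b)"
    by (rule exsatI[of _ e]) (use assms b in \<open>simp_all add: sat_Cons\<close>)
  then show "mev e p > 0" using b isgn_cases[of "mev e p"] by fastforce
next
  assume pos: "mev e p > 0"
  \<comment> \<open>\<open>ceiling - 1\<close> and \<open>floor + 1\<close> lie strictly on either
    side even when the coordinate is a multiple of \<open>1 / Suc d\<close>, and the width is at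
    most \<open>2 / Suc d\<close>.\<close>
  define bs where "bs d = (map (\<lambda>i. (\<lceil>e i * real (Suc d)\<rceil> - 1, \<lfloor>e i * real (Suc d)\<rfloor> + 1)) [0..<m], d)" for d
  have sat_bs: "sat x (box_conditions m (bs d)) \<longleftrightarrow> (\<forall>i<m. real_of_int (\<lceil>e i * real (Suc d)\<rceil> - 1) < x i * real (Suc d) \<and>
     x i * real (Suc d) < real_of_int (\<lfloor>e i * real (Suc d)\<rfloor> + 1))" for x d
    by (auto simp: bs_def sat_box_conditions nth_default_nth)
  show "\<exists>b. ?P b"
  proof (rule ccontr)
    assume no: "\<nexists>b. ?P b"
    have "\<exists>x. (\<forall>i\<ge>m. x i = 0) \<and> sat x (box_conditions m (bs d)) \<and> mev x p \<le> 0" for d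
    proof -
      have "sat e (box_conditions m (bs d))" unfolding sat_bs by (intro allI impI conjI; linarith)
      then obtain s where s: "s = 0 \<or> s = -1" "exsat [0..<m] (\<lambda>_. 0) ((p, s) # box_conditions m (bs d))"
        using no by blast
      from s(2) obtain x where x: "\<And>i. i \<notin> set [0..<m] \<Longrightarrow> x i = 0" "sat x ((p, s) # box_conditions m (bs d))"
        unfolding exsat_def by blast
      then have "mev x p \<le> 0" using s(1) isgn_simps[of "mev x p"] unfolding sat_Cons by linarith
      then show ?thesis using x unfolding sat_Cons by (intro exI[of _ x]) simp
    qed
    then obtain x where x: "\<And>d i. i \<ge> m \<Longrightarrow> x d i = 0" "\<And>d. sat (x d) (box_conditions m (bs d))" "\<And>d. mev (x d) p \<le> 0"
      by (metis (no_types))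
    have "(\<lambda>d. x d i) \<longlonglongrightarrow> e i" for i
    proof (cases "i < m")
      case True
      have le: "\<bar>x d i - e i\<bar> \<le> 2 * inverse (real (Suc d))" for d
      proof -
        have "real_of_int (\<lceil>e i * real (Suc d)\<rceil> - 1) < x d i * real (Suc d)" "x d i * real (Suc d) < real_of_int (\<lfloor>e i * real (Suc d)\<rfloor> + 1)"
          using x(2)[of d, unfolded sat_bs, rule_format, OF True] by blast+
        then have "\<bar>x d i * real (Suc d) - e i * real (Suc d)\<bar> \<le> 2" by linarith
        then have "\<bar>x d i - e i\<bar> * real (Suc d) \<le> 2" by (simp add: abs_mult flip: left_diff_distrib)
        then show ?thesis by (simp add: field_simps)
      qed
      have lim: "(\<lambda>d. 2 * inverse (real (Suc d))) \<longlonglongrightarrow> 0"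
        by (rule tendsto_mult_right_zero[OF LIMSEQ_inverse_real_of_nat])
      have "(\<lambda>d. x d i - e i) \<longlonglongrightarrow> 0"
        by (rule Lim_null_comparison[OF _ lim]) (use le in simp)
      then show ?thesis by (rule LIM_zero_cancel)
    qed (use x(1) assms in simp)
    then have "(\<lambda>d. mev (x d) p) \<longlonglongrightarrow> mev e p" by (rule tendsto_mev)
    then have "mev e p \<le> 0" by (rule LIMSEQ_le_const2) (use x(3) in blast)
    then show False using pos by simp
  qed
qed

text \<open>A polynomial is positive at a point iff it is positive on some rational box around it. The latter is a
  statement without parameters about the box, and the boxes around a computable point can be enumerated.\<close>

lemma rep_mev_pos:
  assumes "computable_env e" shows "rep (\<lambda>p. mev e p > 0)"
proof -
  obtain m where m: "\<And>i. i \<ge> m \<Longrightarrow> e i = 0" using assms by (auto simp: computable_env_def)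
  have e: "e i \<in> computable_reals" for i using assms by (auto simp: computable_env_def)
  have ex: "decp (\<lambda>q :: int_mpoly \<times> (int \<times> int) list \<times> nat. \<not> exsat [0..<m] (\<lambda>_. 0) ((fst q, s) # box_conditions m (snd q)))" for s
    by (intro decp_not decp_comp[OF decp_exsat_0, of "\<lambda>q. ([0..<m], (fst q, s) # box_conditions m (snd q))", simplified fst_conv snd_conv]
        rec_intros recf_box_conditions)
  have "rep (\<lambda>q :: int_mpoly \<times> (int \<times> int) list \<times> nat. sat e (box_conditions m (snd q)))"
  proof -
    have "rep (\<lambda>q :: int_mpoly \<times> (int \<times> int) list \<times> nat. \<forall>i<m.
        real_of_int (fst (nth_default (0, 0) (fst (snd q)) i)) < e i * real (Suc (snd (snd q))) \<and>
        e i * real (Suc (snd (snd q))) < real_of_int (snd (nth_default (0, 0) (fst (snd q)) i)))"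
    proof (intro rep_all_less rep_conj)
      fix i
      show "rep (\<lambda>q :: int_mpoly \<times> (int \<times> int) list \<times> nat. real_of_int (fst (nth_default (0, 0) (fst (snd q)) i)) < e i * real (Suc (snd (snd q))))"
        by (rule rep_comp[OF rep_cuts(1)[OF e], of "\<lambda>q. (fst (nth_default (0, 0) (fst (snd q)) i), snd (snd q))", simplified fst_conv snd_conv])
           (intro rec_intros)
      show "rep (\<lambda>q :: int_mpoly \<times> (int \<times> int) list \<times> nat. e i * real (Suc (snd (snd q))) < real_of_int (snd (nth_default (0, 0) (fst (snd q)) i)))"
        by (rule rep_comp[OF rep_cuts(2)[OF e], of "\<lambda>q. (snd (nth_default (0, 0) (fst (snd q)) i), snd (snd q))", simplified fst_conv snd_conv])
           (intro rec_intros)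
    qed
    moreover have "sat e (box_conditions m b) \<longleftrightarrow> (\<forall>i<m. real_of_int (fst (nth_default (0, 0) (fst b) i)) < e i * real (Suc (snd b)) \<and>
        e i * real (Suc (snd b)) < real_of_int (snd (nth_default (0, 0) (fst b) i)))" for b
      by (cases b) (simp only: sat_box_conditions fst_conv snd_conv)
    ultimately show ?thesis by (simp only:)
  qed
  then have "rep (\<lambda>q :: int_mpoly \<times> (int \<times> int) list \<times> nat. sat e (box_conditions m (snd q)) \<and>
    \<not> exsat [0..<m] (\<lambda>_. 0) ((fst q, 0) # box_conditions m (snd q)) \<and> \<not> exsat [0..<m] (\<lambda>_. 0) ((fst q, -1) # box_conditions m (snd q)))"
    by (intro rep_conj rep_decp[OF ex])
  from rep_ex[OF this] show ?thesis by (simp add: mev_pos_iff_box[OF m])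
qed

text \<open>Since finitely many integral equations of the parameters imply all others, vanishing at the parameters is
  an entailment without parameters.\<close>

lemma decp_mev_zero:
  assumes "computable_env e" shows "decp (\<lambda>p. mev e p = 0)"
proof -
  \<comment> \<open>Finite support makes both the basis theorem and a finite block of quantifiers
    applicable.\<close>
  obtain m where m: "\<And>i. i \<ge> m \<Longrightarrow> e i = 0" using assms by (auto simp: computable_env_def)
  from finite_equations[of "{p. mev e p = 0}" m] obtain Fs where Fs': "set Fs \<subseteq> {p. mev e p = 0}"
    "\<forall>x. (\<forall>i\<ge>m. x i = 0) \<longrightarrow> (\<forall>f\<in>set Fs. mev x f = (0::real)) \<longrightarrow> (\<forall>p\<in>{p. mev e p = 0}. mev x p = 0)"
    by (elim exE conjE) (rule that)
  have Fs: "mev e f = 0" if "f \<in> set Fs" for f using Fs'(1) that by blast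
  have Fs2: "mev x p = 0" if "\<forall>i\<ge>m. x i = 0" "\<forall>f\<in>set Fs. mev x f = 0" "mev e p = 0" for x :: "nat \<Rightarrow> real" and p
    using Fs'(2)[rule_format, of x p] that by simp
  let ?\<Delta> = "map (\<lambda>f. (f, 0)) Fs"
  have sat: "sat x ?\<Delta> \<longleftrightarrow> (\<forall>f\<in>set Fs. mev x f = 0)" for x by (auto simp: sat_def)
  have "mev e p = 0 \<longleftrightarrow> \<not> exsat [0..<m] (\<lambda>_. 0) ((p, 1) # ?\<Delta>) \<and> \<not> exsat [0..<m] (\<lambda>_. 0) ((p, -1) # ?\<Delta>)" (is "_ \<longleftrightarrow> ?R") for p
  proof
    assume z: "mev e p = 0"
    have "mev x p = 0" if "\<forall>i. i \<notin> set [0..<m] \<longrightarrow> x i = 0" "sat x ?\<Delta>" for x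
      using Fs2[of x p] that z unfolding sat by simp
    then have "\<not> exsat [0..<m] (\<lambda>_. 0) ((p, s) # ?\<Delta>)" if "s \<noteq> 0" for s
      using that by (auto simp: sat_Cons elim!: exsatE)
    then show ?R by simp
  next
    assume ?R
    have "sat e ?\<Delta>" unfolding sat using Fs by simp
    then have "exsat [0..<m] (\<lambda>_. 0) ((p, isgn (mev e p)) # ?\<Delta>)"
      by (intro exsatI[of _ e]) (simp_all add: sat_Cons m)
    then show "mev e p = 0" using \<open>?R\<close> isgn_cases[of "mev e p"] by fastforce
  qed
  moreover have "decp (\<lambda>p. \<not> exsat [0..<m] (\<lambda>_. 0) ((p, s) # ?\<Delta>))" for s
    by (intro decp_not decp_comp[OF decp_exsat_0, of "\<lambda>p. ([0..<m], (p, s) # ?\<Delta>)", simplified fst_conv snd_conv] rec_intros)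
  ultimately show ?thesis by (simp add: decp_conj)
qed

text \<open>Positive and negative values are confirmed by search and vanishing is decidable, so
  Post's theorem applies.\<close>

theorem recf_isgn_mev:
  assumes "computable_env e" shows "recf (\<lambda>p. isgn (mev e p))"
proof -
  note pos = rep_mev_pos[OF assms] and zero = decp_mev_zero[OF assms]
  have "rep (\<lambda>p. mev e (mneg p) > 0)" by (rule rep_comp[OF pos]) (intro rec_intros)
  then have neg: "rep (\<lambda>p. mev e p < 0)" by simp
  have "decp (\<lambda>p. mev e p > 0)"
  proof (rule decp_post[OF pos])
    obtain Q where Q: "decp Q" "\<And>p. mev e p < 0 \<longleftrightarrow> (\<exists>n. Q (p, n::nat))" using repE[OF neg] by blast
    show "rep (\<lambda>p. \<not> mev e p > 0)"
    proof (rule rep_exI)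
      show "decp (\<lambda>q. mev e (fst q) = 0 \<or> Q (fst q, snd q :: nat))"
        by (intro decp_disj decp_comp[OF zero] decp_comp[OF Q(1)] rec_intros)
      show "\<not> mev e p > 0 \<longleftrightarrow> (\<exists>n. mev e (fst (p, n)) = 0 \<or> Q (fst (p, n), snd (p, n)))" for p
        using Q(2)[of p] by (auto simp: not_less le_less)
    qed
  qed
  then have "recf (\<lambda>p. if mev e p > 0 then 1 else if mev e p = 0 then 0 else (-1::int))" by (intro rec_intros zero)
  moreover have "(if mev e p > 0 then 1 else if mev e p = 0 then 0 else (-1::int)) = isgn (mev e p)" for p
    by (auto simp: isgn_def)
  ultimately show ?thesis by simp
qed

lemmas decp_exsat_computable = decp_exsat[OF recf_isgn_mev]

section \<open>Roots over computable parameters\<close>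

lemma exsat_singleton: "exsat [v] e \<Delta> \<longleftrightarrow> (\<exists>x. sat (e(v := x)) \<Delta>)"
  by (simp add: exsat_Cons exsat_Nil)

text \<open>The root is enclosed in a rational interval without other roots. Comparing it with a
  fraction is then the solvability of sign conditions in one unknown over the parameters
  \<open>e\<close>, which is decidable. The value at \<open>b\<close> ensures that there are
  finitely many roots.\<close>

theorem computable_reals_root:
  assumes e: "computable_env e" and "mev (e(v := a)) p = 0" "mev (e(v := b)) p \<noteq> 0"
  shows "a \<in> computable_reals"
proof -
  define f where "f = upoly e (mcoeffs v p)"
  have f: "poly f x = mev (e(v := x)) p" for x by (simp add: f_def poly_upoly_mcoeffs)
  have "f \<noteq> 0" using assms(3) f by auto
  then have fin: "finite {x. poly f x = 0}" by (rule poly_roots_finite)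
  then obtain \<delta> where \<delta>: "\<delta> > 0" "\<And>x. poly f x = 0 \<Longrightarrow> x \<noteq> a \<Longrightarrow> \<delta> \<le> dist a x"
    using finite_set_avoid[OF fin, of a] by blast
  have "0 < \<delta> / 2" using \<delta>(1) by simp
  from reals_Archimedean[OF this] obtain D where "inverse (real (Suc D)) < \<delta> / 2" ..
  then have D: "2 * inverse (real (Suc D)) < \<delta>" by linarith
  \<comment> \<open>An interval of length at most \<open>2 / Suc D\<close>, which is less than the
    distance from \<open>a\<close> to any other root.\<close>
  define l u where "l = \<lceil>a * real (Suc D)\<rceil> - 1" and "u = \<lfloor>a * real (Suc D)\<rfloor> + 1"
  have a_lu: "real_of_int l < a * real (Suc D)" "a * real (Suc D) < real_of_int u" unfolding l_def u_def by linarith+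
  have unique: "x = a" if "poly f x = 0" "real_of_int l < x * real (Suc D)" "x * real (Suc D) < real_of_int u" for x
  proof (rule ccontr)
    assume "x \<noteq> a"
    have "\<bar>a * real (Suc D) - x * real (Suc D)\<bar> \<le> 2" using that(2,3) unfolding l_def u_def by linarith
    then have "\<bar>a - x\<bar> * real (Suc D) \<le> 2" by (simp add: abs_mult flip: left_diff_distrib)
    then have "\<bar>a - x\<bar> \<le> 2 * inverse (real (Suc D))" by (simp add: field_simps)
    then show False using \<delta>(2)[OF that(1) \<open>x \<noteq> a\<close>] D by (simp add: dist_real_def)
  qed
  \<comment> \<open>The last condition reads \<open>s * Suc d * x + k > 0\<close>. For
    \<open>s = 1\<close> and \<open>s = -1\<close> together it says that the absolute value of the
    root is below \<open>k / Suc d\<close>.\<close>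
  define \<Delta> :: "int \<Rightarrow> nat \<Rightarrow> nat \<Rightarrow> (int_mpoly \<times> int) list" where "\<Delta> s k d = [(p, 0), (mmult (mconst (int (Suc D))) (mvar v) @ mconst (- l), 1),
    (mmult (mconst (- int (Suc D))) (mvar v) @ mconst u, 1),
    (mmult (mconst (s * int (Suc d))) (mvar v) @ mconst (int k), 1)]" for s k d
  have sat: "exsat [v] e (\<Delta> s k d) \<longleftrightarrow> - (real_of_int s * real (Suc d) * a) < real k" for s k d
  proof -
    have sx: "sat (e(v := x)) (\<Delta> s k d) \<longleftrightarrow> poly f x = 0 \<and> real_of_int l < x * real (Suc D) \<and> x * real (Suc D) < real_of_int u \<and>
        - (real_of_int s * real (Suc d) * x) < real k" for x
      unfolding \<Delta>_def sat_Cons f by (auto simp: sat_def algebra_simps)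
    show ?thesis
    proof
      assume "exsat [v] e (\<Delta> s k d)"
      then obtain x where x: "sat (e(v := x)) (\<Delta> s k d)" unfolding exsat_singleton ..
      then have "x = a" unfolding sx by (intro unique) simp_all
      then show "- (real_of_int s * real (Suc d) * a) < real k" using x unfolding sx by simp
    next
      assume "- (real_of_int s * real (Suc d) * a) < real k"
      then have "sat (e(v := a)) (\<Delta> s k d)" unfolding sx f using a_lu assms(2) by simp
      then show "exsat [v] e (\<Delta> s k d)" unfolding exsat_singleton ..
    qed
  qed
  have rec: "decp (\<lambda>q. exsat [v] e (\<Delta> s (fst q) (snd q)))" for s
  proof -
    have "recf (\<lambda>q :: nat \<times> nat. ([v], \<Delta> s (fst q) (snd q)))" unfolding \<Delta>_def by (intro rec_intros)
    from decp_comp[OF decp_exsat_computable[OF e] this] show ?thesis by (simp only: fst_conv snd_conv)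
  qed
  have "\<bar>a\<bar> * real (Suc d) < real k \<longleftrightarrow> exsat [v] e (\<Delta> 1 k d) \<and> exsat [v] e (\<Delta> (-1) k d)" for k d
  proof -
    have "\<bar>a\<bar> * real (Suc d) = \<bar>real (Suc d) * a\<bar>" by (simp add: abs_mult)
    then show ?thesis unfolding sat by (simp only: of_int_1 of_int_minus mult_1 mult_minus_left minus_minus) linarith
  qed
  then show ?thesis by (intro computable_realsI) (simp add: decp_conj rec)
qed

subsection \<open>The computable reals as a real closed field\<close>

lemma computable_reals_0 [simp]: "0 \<in> computable_reals"
proof (rule computable_realsI)
  have "decp (\<lambda>q :: nat \<times> nat. 0 < fst q)" by (intro rec_intros)
  then show "decp (\<lambda>q :: nat \<times> nat. \<bar>0\<bar> * real (Suc (snd q)) < real (fst q))" by simp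
qed

lemma computable_env_0: "computable_env (\<lambda>_. 0)"
  unfolding computable_env_def by auto

lemma computable_env_upd:
  assumes "computable_env e" "a \<in> computable_reals" shows "computable_env (e(v := a))"
proof -
  obtain m where "\<And>i. i \<ge> m \<Longrightarrow> e i = 0" using assms by (auto simp: computable_env_def)
  then have "\<forall>i\<ge>max m (Suc v). (e(v := a)) i = 0" by auto
  moreover have "range (e(v := a)) \<subseteq> computable_reals" using assms by (auto simp: computable_env_def)
  ultimately show ?thesis unfolding computable_env_def by blast
qed

lemma computable_reals_of_rat_div: "of_int k / of_int l \<in> computable_reals"
proof (cases "l = 0")
  case False
  show ?thesis
  proof (rule computable_reals_root[OF computable_env_0, of 0])
    show "mev ((\<lambda>_. 0)(0 := real_of_int k / of_int l)) (mmult (mconst l) (mvar 0) @ mconst (- k)) = 0"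
      using False by simp
    show "mev ((\<lambda>_. 0)(0 := (of_int k + 1) / real_of_int l)) (mmult (mconst l) (mvar 0) @ mconst (- k)) \<noteq> 0"
      using False by simp
  qed
qed simp

lemma computable_reals_Rats: "x \<in> \<rat> \<Longrightarrow> x \<in> computable_reals"
  by (metis Rats_cases' computable_reals_of_rat_div)

lemma computable_reals_of_int [simp]: "of_int k \<in> computable_reals"
  by (rule computable_reals_Rats) simp

lemma computable_reals_of_nat [simp]: "of_nat k \<in> computable_reals"
  by (rule computable_reals_Rats) simp

lemma computable_reals_1 [simp]: "1 \<in> computable_reals"
  by (rule computable_reals_Rats) simp

text \<open>The sum is the root of a linear equation whose parameters occupy variables 0 and 1; a
  second value of the unknown shows that the equation is not trivial. Products, inverses and square
  roots follow the same pattern.\<close>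

lemma computable_reals_add:
  assumes "a \<in> computable_reals" "b \<in> computable_reals" shows "a + b \<in> computable_reals"
proof (rule computable_reals_root)
  let ?p = "mvar 2 @ mneg (mvar 0) @ mneg (mvar 1)"
  show "computable_env ((\<lambda>_. 0)(0 := a, 1 := b))" by (intro computable_env_upd computable_env_0 assms)
  show "mev (((\<lambda>_. 0)(0 := a, 1 := b))(2 := a + b)) ?p = 0" by simp
  show "mev (((\<lambda>_. 0)(0 := a, 1 := b))(2 := a + b + 1)) ?p \<noteq> 0" by simp
qed

lemma computable_reals_diff:
  "a \<in> computable_reals \<Longrightarrow> b \<in> computable_reals \<Longrightarrow> a - b \<in> computable_reals"
  using computable_reals_add[of a "- b"] by simp

lemma computable_reals_mult:
  assumes "a \<in> computable_reals" "b \<in> computable_reals" shows "a * b \<in> computable_reals"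
proof (rule computable_reals_root)
  let ?p = "mvar 2 @ mneg (mmult (mvar 0) (mvar 1))"
  show "computable_env ((\<lambda>_. 0)(0 := a, 1 := b))" by (intro computable_env_upd computable_env_0 assms)
  show "mev (((\<lambda>_. 0)(0 := a, 1 := b))(2 := a * b)) ?p = 0" by simp
  show "mev (((\<lambda>_. 0)(0 := a, 1 := b))(2 := a * b + 1)) ?p \<noteq> 0" by simp
qed

lemma computable_reals_inverse:
  assumes "a \<in> computable_reals" shows "inverse a \<in> computable_reals"
proof (cases "a = 0")
  case False
  show ?thesis
  proof (rule computable_reals_root)
    let ?p = "mmult (mvar 0) (mvar 1) @ mconst (- 1)"
    show "computable_env ((\<lambda>_. 0)(0 := a))" by (intro computable_env_upd computable_env_0 assms)
    show "mev (((\<lambda>_. 0)(0 := a))(1 := inverse a)) ?p = 0" using False by simp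
    show "mev (((\<lambda>_. 0)(0 := a))(1 := 0)) ?p \<noteq> 0" by simp
  qed
qed simp

lemma computable_reals_sqrt:
  assumes "a \<in> computable_reals" "0 \<le> a" shows "sqrt a \<in> computable_reals"
proof (rule computable_reals_root)
  let ?p = "mmult (mvar 1) (mvar 1) @ mneg (mvar 0)"
  show "computable_env ((\<lambda>_. 0)(0 := a))" by (intro computable_env_upd computable_env_0 assms)
  show "mev (((\<lambda>_. 0)(0 := a))(1 := sqrt a)) ?p = 0" using assms(2) by simp
  have "(a + 1) * (a + 1) - a = a * a + a + 1" by (simp add: algebra_simps)
  then have "(a + 1) * (a + 1) - a > 0" using assms(2) by (simp add: add_nonneg_pos)
  then show "mev (((\<lambda>_. 0)(0 := a))(1 := a + 1)) ?p \<noteq> 0" by simp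
qed

lemma computable_reals_sum: "(\<And>i. i \<in> A \<Longrightarrow> f i \<in> computable_reals) \<Longrightarrow> sum f A \<in> computable_reals"
  by (induction A rule: infinite_finite_induct) (auto intro: computable_reals_add)

lemma computable_reals_prod: "(\<And>i. i \<in> A \<Longrightarrow> f i \<in> computable_reals) \<Longrightarrow> prod f A \<in> computable_reals"
  by (induction A rule: infinite_finite_induct) (auto intro: computable_reals_mult)

lemma computable_reals_power: "a \<in> computable_reals \<Longrightarrow> a ^ n \<in> computable_reals"
  by (induction n) (auto intro: computable_reals_mult)

text \<open>A solution is either a root of a nonconstant equation, and thus computable, or can be moved to a rational point.\<close>

lemma sat_computable_solution:
  assumes e: "computable_env e" and x: "sat (e(v := x)) \<Delta>"
  shows "\<exists>x'\<in>computable_reals. sat (e(v := x')) \<Delta>"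
proof (cases "\<exists>y\<in>set \<Delta>. mev (e(v := x)) (fst y) = 0 \<and> (\<exists>b. mev (e(v := b)) (fst y) \<noteq> 0)")
  case True
  then show ?thesis using computable_reals_root[OF e] x by blast
next
  case False
  define g where "g y t = poly (upoly e (mcoeffs v (fst y))) t" for y :: "int_mpoly \<times> int" and t
  have g: "g y t = mev (e(v := t)) (fst y)" for y t by (simp only: g_def poly_upoly_mcoeffs)
  \<comment> \<open>The conditions whose polynomial does not vanish at \<open>x\<close>. All others
    vanish for every value of \<open>v\<close>, so only those in \<open>N\<close> restrict a move,
    and continuity keeps their signs.\<close>
  define N where "N = {y \<in> set \<Delta>. g y x \<noteq> 0}"
  have "open (\<Inter>y\<in>N. {t. g y t * g y x > 0})"
    by (intro open_INT ballI open_Collect_less continuous_intros) (auto simp: N_def g_def intro!: continuous_intros)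
  moreover have "x \<in> (\<Inter>y\<in>N. {t. g y t * g y x > 0})"
    by (auto simp: N_def zero_less_mult_iff linorder_neq_iff)
  ultimately obtain \<delta> where \<delta>: "\<delta> > 0" "\<And>t. dist t x < \<delta> \<Longrightarrow> t \<in> (\<Inter>y\<in>N. {t. g y t * g y x > 0})"
    unfolding open_dist by blast
  obtain t where t: "t \<in> \<rat>" "x < t" "t < x + \<delta>" using Rats_dense_in_real[of x "x + \<delta>"] \<delta>(1) by auto
  have t': "t \<in> (\<Inter>y\<in>N. {t. g y t * g y x > 0})" by (rule \<delta>(2)) (use t in \<open>simp add: dist_real_def\<close>)
  have "isgn (g y t) = isgn (g y x)" if y: "y \<in> set \<Delta>" for y
  proof (cases "y \<in> N")
    case True
    then have "g y t * g y x > 0" using t' by simp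
    then show ?thesis by (auto simp: isgn_def zero_less_mult_iff)
  next
    case F: False
    then have "g y x = 0" using y by (simp add: N_def)
    then have "g y t = 0" using False y unfolding g by blast
    then show ?thesis using \<open>g y x = 0\<close> by simp
  qed
  then have "sat (e(v := t)) \<Delta>" using x unfolding sat_def g by simp
  then show ?thesis using computable_reals_Rats[OF t(1)] by blast
qed

text \<open>Eliminating the remaining variables turns the condition on the first into sign
  conditions in one unknown, where a computable value exists; then the next variable is treated over
  the enlarged parameters.\<close>

theorem exsat_computable_solution:
  assumes "computable_env e" "exsat vs e \<Delta>"
  obtains e' where "computable_env e'" "\<And>i. i \<notin> set vs \<Longrightarrow> e' i = e i" "sat e' \<Delta>"
proof -
  obtain qs where qs: "\<And>vs \<Delta> e. exsat vs e \<Delta> \<longleftrightarrow> (\<exists>\<sigma>\<in>set (qs vs \<Delta>). sat e \<sigma>)"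
    by (rule exsat_elimination) blast
  have "\<exists>e'. computable_env e' \<and> (\<forall>i. i \<notin> set vs \<longrightarrow> e' i = e i) \<and> sat e' \<Delta>"
    using assms
  proof (induction vs arbitrary: e)
    case Nil
    then show ?case unfolding exsat_Nil by blast
  next
    case (Cons v vs)
    from Cons.prems(2) obtain x where "exsat vs (e(v := x)) \<Delta>" unfolding exsat_Cons ..
    then obtain \<sigma> where \<sigma>: "\<sigma> \<in> set (qs vs \<Delta>)" "sat (e(v := x)) \<sigma>" unfolding qs ..
    from sat_computable_solution[OF Cons.prems(1) \<sigma>(2)]
    obtain x' where x': "x' \<in> computable_reals" "sat (e(v := x')) \<sigma>" ..
    then have "exsat vs (e(v := x')) \<Delta>" unfolding qs using \<sigma>(1) by blast
    from Cons.IH[OF computable_env_upd[OF Cons.prems(1) x'(1)] this]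
    obtain e' where e': "computable_env e'" "\<And>i. i \<notin> set vs \<Longrightarrow> e' i = (e(v := x')) i" "sat e' \<Delta>" by blast
    have "e' i = e i" if "i \<notin> set (v # vs)" for i using e'(2)[of i] that by simp
    then show ?case using e' by blast
  qed
  then show ?thesis using that by blast
qed

section \<open>Polynomial functions on matrices\<close>

text \<open>Gaussian elimination over the integers: a point that satisfies the integral linear relations of a family of integral
  vectors satisfies all its linear relations.\<close>

lemma integral_functionals:
  fixes m :: "'k \<Rightarrow> 's \<Rightarrow> int" and x c :: "'k \<Rightarrow> 'a::field_char_0"
  assumes "finite K"
    and "\<And>d :: 'k \<Rightarrow> int. (\<And>s. s \<in> S \<Longrightarrow> (\<Sum>k\<in>K. d k * m k s) = 0) \<Longrightarrow> (\<Sum>k\<in>K. of_int (d k) * x k) = 0"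
    and "\<And>s. s \<in> S \<Longrightarrow> (\<Sum>k\<in>K. c k * of_int (m k s)) = 0"
  shows "(\<Sum>k\<in>K. c k * x k) = 0"
  using assms
proof (induction K arbitrary: m x)
  case (insert k K)
  note fin = \<open>finite K\<close> \<open>k \<notin> K\<close>
  show ?case
  proof (cases "\<forall>s\<in>S. m k s = 0")
    case True
    have upd: "(\<Sum>j\<in>K. (f(k := b)) j * g j) = (\<Sum>j\<in>K. f j * g j)" for f :: "'k \<Rightarrow> int" and b g
      using fin(2) by (intro sum.cong) auto
    have upd': "(\<Sum>j\<in>K. of_int ((f(k := b)) j) * g j) = (\<Sum>j\<in>K. of_int (f j) * g j)"
      for f :: "'k \<Rightarrow> int" and b and g :: "'k \<Rightarrow> 'a"
      using fin(2) by (intro sum.cong) auto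
    have "(\<Sum>j\<in>insert k K. of_int (((\<lambda>_. 0)(k := 1)) j) * x j) = 0"
    proof (rule insert.prems(1))
      fix s assume "s \<in> S"
      then show "(\<Sum>j\<in>insert k K. ((\<lambda>_. 0)(k := 1)) j * m j s) = 0"
        unfolding sum.insert[OF fin] upd using True by simp
    qed
    then have xk: "x k = 0" unfolding sum.insert[OF fin] upd' by simp
    have "(\<Sum>j\<in>K. c j * x j) = 0"
    proof (rule insert.IH)
      fix d :: "'k \<Rightarrow> int" assume d: "\<And>s. s \<in> S \<Longrightarrow> (\<Sum>j\<in>K. d j * m j s) = 0"
      have "(\<Sum>j\<in>insert k K. of_int (d j) * x j) = 0"
        by (rule insert.prems(1)) (use True d in \<open>simp add: sum.insert[OF fin]\<close>)
      then show "(\<Sum>j\<in>K. of_int (d j) * x j) = 0" unfolding sum.insert[OF fin] xk by simp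
    next
      fix s assume "s \<in> S"
      then show "(\<Sum>j\<in>K. c j * of_int (m j s)) = 0"
        using insert.prems(2)[OF \<open>s \<in> S\<close>] True unfolding sum.insert[OF fin] by simp
    qed
    then show ?thesis unfolding sum.insert[OF fin] xk by simp
  next
    case False
    then obtain s0 where s0: "s0 \<in> S" "m k s0 \<noteq> 0" by blast
    \<comment> \<open>The pivot. Vectors are multiplied by \<open>\<mu>\<close> rather than divided
      by it, to stay with integers.\<close>
    define \<mu> where "\<mu> = m k s0"
    define m' where "m' j s = \<mu> * m j s - m j s0 * m k s" for j s
    define x' where "x' j = of_int \<mu> * x j - of_int (m j s0) * x k" for j
    have c0: "(\<Sum>j\<in>K. c j * of_int (m j s)) = - (c k * of_int (m k s))" if "s \<in> S" for s
      using insert.prems(2)[OF that] unfolding sum.insert[OF fin] by (simp add: add_eq_0_iff)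
    have "(\<Sum>j\<in>K. c j * x' j) = 0"
    proof (rule insert.IH)
      fix d :: "'k \<Rightarrow> int" assume d: "\<And>s. s \<in> S \<Longrightarrow> (\<Sum>j\<in>K. d j * m' j s) = 0"
      \<comment> \<open>With this coefficient at \<open>k\<close>, the relation \<open>d\<close> of
        the reduced vectors becomes a relation of the original ones.\<close>
      define d' where "d' j = (if j = k then - (\<Sum>j\<in>K. d j * m j s0) else \<mu> * d j)" for j
      have dK: "(\<Sum>j\<in>K. d' j * g j) = (\<Sum>j\<in>K. \<mu> * d j * g j)" for g
        using fin(2) by (intro sum.cong) (auto simp: d'_def)
      have dK': "(\<Sum>j\<in>K. of_int (d' j) * g j) = (\<Sum>j\<in>K. of_int (\<mu> * d j) * g j)" for g :: "'k \<Rightarrow> 'a"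
        using fin(2) by (intro sum.cong) (auto simp: d'_def)
      have "(\<Sum>j\<in>insert k K. of_int (d' j) * x j) = 0"
      proof (rule insert.prems(1))
        fix s assume "s \<in> S"
        have "(\<Sum>j\<in>insert k K. d' j * m j s) = (\<Sum>j\<in>K. d j * m' j s)"
          unfolding sum.insert[OF fin] dK
          by (simp add: d'_def m'_def right_diff_distrib sum_subtractf sum_distrib_left sum_distrib_right mult_ac)
        then show "(\<Sum>j\<in>insert k K. d' j * m j s) = 0" using d[OF \<open>s \<in> S\<close>] by simp
      qed
      then show "(\<Sum>j\<in>K. of_int (d j) * x' j) = 0"
        unfolding sum.insert[OF fin] dK'
        by (simp add: d'_def x'_def right_diff_distrib sum_subtractf sum_distrib_left sum_distrib_right mult_ac)
    next
      fix s assume s: "s \<in> S"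
      have "(\<Sum>j\<in>K. c j * of_int (m' j s)) =
          of_int \<mu> * (\<Sum>j\<in>K. c j * of_int (m j s)) - (\<Sum>j\<in>K. c j * of_int (m j s0)) * of_int (m k s)"
        by (simp add: m'_def right_diff_distrib sum_subtractf sum_distrib_left sum_distrib_right mult_ac)
      then show "(\<Sum>j\<in>K. c j * of_int (m' j s)) = 0"
        unfolding c0[OF s] c0[OF s0(1)] by (simp add: \<mu>_def mult_ac)
    qed
    moreover have "(\<Sum>j\<in>K. c j * x' j) = of_int \<mu> * (\<Sum>j\<in>K. c j * x j) - (\<Sum>j\<in>K. c j * of_int (m j s0)) * x k"
      by (simp add: x'_def right_diff_distrib sum_subtractf sum_distrib_left sum_distrib_right mult_ac)
    ultimately have "of_int \<mu> * (\<Sum>j\<in>insert k K. c j * x j) = 0"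
      unfolding c0[OF s0(1)] sum.insert[OF fin] by (simp add: \<mu>_def algebra_simps)
    then show ?thesis using s0(2) by (simp add: \<mu>_def)
  qed
qed simp

section \<open>Matrix entries as variables\<close>

definition index_of :: "'n::finite \<Rightarrow> nat" where
  "index_of = (SOME b. bij_betw b UNIV {..<CARD('n)})"

lemma bij_index_of: "bij_betw (index_of :: 'n::finite \<Rightarrow> nat) UNIV {..<CARD('n)}"
proof -
  have "\<exists>b :: 'n \<Rightarrow> nat. bij_betw b UNIV {..<CARD('n)}"
    using ex_bij_betw_finite_nat[of "UNIV :: 'n set"] by (simp add: atLeast0LessThan)
  then show ?thesis unfolding index_of_def by (rule someI_ex)
qed

definition of_index :: "nat \<Rightarrow> 'n::finite" where
  "of_index = inv_into UNIV index_of"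

lemma of_index_index_of [simp]: "of_index (index_of i) = i"
  unfolding of_index_def by (rule inv_f_f[OF bij_betw_imp_inj_on[OF bij_index_of]])

lemma index_of_less [simp]: "index_of (i :: 'n::finite) < CARD('n)"
  using bij_index_of by (auto simp: bij_betw_def)

lemma index_of_of_index [simp]: "k < CARD('n) \<Longrightarrow> index_of (of_index k :: 'n::finite) = k"
  unfolding of_index_def using bij_index_of by (intro f_inv_into_f) (auto simp: bij_betw_def)

text \<open>The entries of a matrix in row order, followed by zeros.\<close>

definition entries_env :: "'a::zero^'n^'n \<Rightarrow> nat \<Rightarrow> 'a" where
  "entries_env A k = (if k < CARD('n) * CARD('n) then A $ of_index (k div CARD('n)) $ of_index (k mod CARD('n)) else 0)"

definition entry_index :: "'n::finite \<Rightarrow> 'n \<Rightarrow> nat" where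
  "entry_index i j = index_of i * CARD('n) + index_of j"

lemma mult_add_less: "a < n \<Longrightarrow> b < n \<Longrightarrow> a * n + b < n * (n::nat)"
proof -
  assume "a < n" "b < n"
  then have "a * n + b < Suc a * n" by simp
  also have "\<dots> \<le> n * n" using \<open>a < n\<close> by (intro mult_right_mono) auto
  finally show ?thesis .
qed

lemma entry_index_less: "entry_index (i :: 'n::finite) j < CARD('n) * CARD('n)"
  unfolding entry_index_def by (rule mult_add_less) simp_all

lemma entries_env_entry_index [simp]: "entries_env A (entry_index i j) = A $ i $ (j :: 'n::finite)"
proof -
  have "(index_of i * CARD('n) + index_of j) div CARD('n) = index_of i" by (simp add: div_mult_self3)
  moreover have "(index_of i * CARD('n) + index_of j) mod CARD('n) = index_of j" by simp
  ultimately show ?thesis using entry_index_less[of i j] by (simp add: entries_env_def entry_index_def)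
qed

definition map_mat :: "('a \<Rightarrow> 'b) \<Rightarrow> 'a^'n^'n \<Rightarrow> 'b^'n^'n" where
  "map_mat f A = (\<chi> i j. f (A $ i $ j))"

lemma map_mat_nth [simp]: "map_mat f A $ i $ j = f (A $ i $ j)"
  by (simp add: map_mat_def)

lemma map_mat_mult:
  assumes "\<And>x y. f (x + y) = f x + f y" "\<And>x y. f (x * y) = f x * f y" "f 0 = 0"
  shows "map_mat f (A ** B) = map_mat f A ** map_mat f (B :: 'a::comm_ring_1^'n^'n)"
proof -
  have "f (sum g S) = (\<Sum>k\<in>S. f (g k))" for g and S :: "'n set"
    by (induction S rule: infinite_finite_induct) (auto simp: assms)
  then show ?thesis by (simp add: vec_eq_iff matrix_matrix_mult_def assms)
qed

lemma map_mat_of_int_mult: "map_mat of_int (A ** B) = map_mat of_int A ** map_mat of_int B"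
  by (rule map_mat_mult) simp_all

lemma map_mat_one: "f 0 = 0 \<Longrightarrow> f 1 = 1 \<Longrightarrow> map_mat f (mat 1) = mat 1"
  by (simp add: vec_eq_iff mat_def)

lemma entries_env_map_mat: "f 0 = 0 \<Longrightarrow> entries_env (map_mat f A) k = f (entries_env A k)"
  by (simp add: entries_env_def)

lemma mev_of_int: "mev (\<lambda>k. of_int (e k)) p = of_int (mev e p)"
proof -
  have 1: "prod_list (map (\<lambda>k. of_int (e k)) vs) = of_int (prod_list (map e vs))" for vs
    by (induction vs) auto
  show ?thesis by (induction p) (simp_all add: mev_Cons 1)
qed

lemma mev_map_mat_of_int:
  "mev (entries_env (map_mat of_int A :: 'a::comm_ring_1^'n^'n)) p = of_int (mev (entries_env A) p)"
proof -
  have "entries_env (map_mat of_int A :: 'a^'n^'n) = (\<lambda>k. of_int (entries_env A k))"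
    by (rule ext) (simp add: entries_env_map_mat)
  then show ?thesis by (simp only: mev_of_int)
qed

text \<open>Coefficients come from the ring itself, in contrast to \<open>mev\<close>: arbitrary
  linear functionals of a matrix must count as polynomial.\<close>

definition fmev :: "(nat \<Rightarrow> 'a::comm_ring_1) \<Rightarrow> ('a \<times> nat list) list \<Rightarrow> 'a" where
  "fmev e p = (\<Sum>m\<leftarrow>p. fst m * prod_list (map e (snd m)))"

definition polyfun :: "('a::comm_ring_1^'n^'n \<Rightarrow> 'a) \<Rightarrow> bool" where
  "polyfun f \<longleftrightarrow> (\<exists>p. \<forall>A. f A = fmev (entries_env A) p)"

lemma polyfunI: "(\<And>A. f A = fmev (entries_env A) p) \<Longrightarrow> polyfun f"
  unfolding polyfun_def by blast

lemma polyfunE: assumes "polyfun f" obtains p where "\<And>A. f A = fmev (entries_env A) p"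
  using assms unfolding polyfun_def by blast

named_theorems polyfun_intros

lemma polyfun_const [polyfun_intros]: "polyfun (\<lambda>_. c)"
  by (rule polyfunI[of _ "[(c, [])]"]) (simp add: fmev_def)

lemma polyfun_entry [polyfun_intros]: "polyfun (\<lambda>A. A $ i $ j)"
  by (rule polyfunI[of _ "[(1, [entry_index i j])]"]) (simp add: fmev_def)

lemma polyfun_add [polyfun_intros]:
  assumes "polyfun f" "polyfun g" shows "polyfun (\<lambda>A. f A + g A)"
proof -
  obtain p q where "\<And>A. f A = fmev (entries_env A) p" "\<And>A. g A = fmev (entries_env A) q"
    using polyfunE[OF assms(1)] polyfunE[OF assms(2)] by metis
  then show ?thesis by (intro polyfunI[of _ "p @ q"]) (simp add: fmev_def)
qed

lemma fmev_mult: "fmev e (concat (map (\<lambda>m. map (\<lambda>m'. (fst m * fst m', snd m @ snd m')) q) p)) = fmev e p * fmev e q"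
proof (induction p)
  case (Cons m p)
  have "fmev e (map (\<lambda>m'. (k * fst m', vs @ snd m')) q) = k * prod_list (map e vs) * fmev e q" for k vs
    by (induction q) (simp_all add: fmev_def algebra_simps)
  then show ?case using Cons by (simp add: fmev_def distrib_right)
qed (simp add: fmev_def)

lemma polyfun_mult [polyfun_intros]:
  assumes "polyfun f" "polyfun g" shows "polyfun (\<lambda>A. f A * g A)"
proof -
  obtain p q where "\<And>A. f A = fmev (entries_env A) p" "\<And>A. g A = fmev (entries_env A) q"
    using polyfunE[OF assms(1)] polyfunE[OF assms(2)] by metis
  then show ?thesis by (intro polyfunI) (simp add: fmev_mult[symmetric])
qed

lemma polyfun_diff [polyfun_intros]: "polyfun f \<Longrightarrow> polyfun g \<Longrightarrow> polyfun (\<lambda>A. f A - g A)"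
  using polyfun_add[OF _ polyfun_mult[OF polyfun_const[of "-1"]], of f g] by simp

lemma polyfun_sum [polyfun_intros]: "(\<And>i. i \<in> S \<Longrightarrow> polyfun (f i)) \<Longrightarrow> polyfun (\<lambda>A. \<Sum>i\<in>S. f i A)"
  by (induction S rule: infinite_finite_induct) (auto intro: polyfun_intros)

lemma polyfun_prod [polyfun_intros]: "(\<And>i. i \<in> S \<Longrightarrow> polyfun (f i)) \<Longrightarrow> polyfun (\<lambda>A. \<Prod>i\<in>S. f i A)"
  by (induction S rule: infinite_finite_induct) (auto intro: polyfun_intros)

lemma polyfun_power [polyfun_intros]: "polyfun f \<Longrightarrow> polyfun (\<lambda>A. f A ^ n)"
  by (induction n) (auto intro: polyfun_intros)

lemma polyfun_det [polyfun_intros]: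
  "(\<And>i j. polyfun (\<lambda>A. F A $ i $ j)) \<Longrightarrow> polyfun (\<lambda>A. det (F A))"
  unfolding det_def by (intro polyfun_intros)

lemma polyfun_mev: "polyfun (\<lambda>A. mev (entries_env A) p)"
  by (rule polyfunI[of _ "map (\<lambda>m. (of_int (fst m), snd m)) p"]) (simp add: fmev_def mev_def comp_def)

lemma polyfun_entries_env:
  fixes F :: "'a::comm_ring_1^'m^'m \<Rightarrow> 'a^'n^'n"
  assumes "\<And>i j. polyfun (\<lambda>A. F A $ i $ j)" shows "polyfun (\<lambda>A. entries_env (F A) k)"
  by (cases "k < CARD('n) * CARD('n)") (simp_all add: entries_env_def assms polyfun_const)

lemma polyfun_compose:
  assumes "polyfun f" "\<And>i j. polyfun (\<lambda>A. F A $ i $ j)" shows "polyfun (\<lambda>A. f (F A))"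
proof -
  obtain p where p: "\<And>A. f A = fmev (entries_env A) p" using polyfunE[OF assms(1)] by blast
  have 1: "polyfun (\<lambda>A. prod_list (map (entries_env (F A)) vs))" for vs
  proof (induction vs)
    case (Cons v vs)
    show ?case unfolding list.map prod_list.Cons
      by (intro polyfun_mult polyfun_entries_env assms(2) Cons)
  qed (simp add: polyfun_const)
  have "polyfun (\<lambda>A. fmev (entries_env (F A)) p)"
  proof (induction p)
    case (Cons m p)
    then show ?case unfolding fmev_def list.map sum_list.Cons
      by (intro polyfun_add polyfun_mult polyfun_const 1)
  qed (simp add: fmev_def polyfun_const)
  then show ?thesis by (simp add: p)
qed

text \<open>Reduces statements on one-parameter groups to univariate polynomials, which in
  characteristic 0 are determined by their values at integers.\<close>

lemma polyfun_along_curve: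
  fixes F :: "'a::comm_ring_1 \<Rightarrow> 'a^'n^'n"
  assumes "polyfun f" "\<And>t i j. F t $ i $ j = poly (P i j) t"
  shows "\<exists>Q. \<forall>t. f (F t) = poly Q t"
proof -
  obtain p where p: "\<And>A. f A = fmev (entries_env A) p" using polyfunE[OF assms(1)] by blast
  have 0: "\<exists>Q. \<forall>t. entries_env (F t) k = poly Q t" for k
  proof (cases "k < CARD('n) * CARD('n)")
    case True
    then show ?thesis using assms(2) unfolding entries_env_def by auto
  next
    case False
    then show ?thesis unfolding entries_env_def by (intro exI[of _ 0]) simp
  qed
  have 1: "\<exists>Q. \<forall>t. prod_list (map (entries_env (F t)) vs) = poly Q t" for vs
  proof (induction vs)
    case (Cons v vs)
    then obtain Q Q' where "\<forall>t. prod_list (map (entries_env (F t)) vs) = poly Q t" "\<forall>t. entries_env (F t) v = poly Q' t"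
      using 0 by blast
    then show ?case by (intro exI[of _ "Q' * Q"]) simp
  qed (auto intro: exI[of _ 1])
  have "\<exists>Q. \<forall>t. fmev (entries_env (F t)) p = poly Q t"
  proof (induction p)
    case (Cons m p)
    then obtain Q Q' where "\<forall>t. fmev (entries_env (F t)) p = poly Q t" "\<forall>t. prod_list (map (entries_env (F t)) (snd m)) = poly Q' t"
      using 1 by blast
    then show ?case by (intro exI[of _ "smult (fst m) Q' + Q"]) (simp add: fmev_def)
  qed (auto simp: fmev_def intro: exI[of _ 0])
  then show ?thesis by (simp add: p)
qed

section \<open>Closures of groups of integral matrices\<close>

text \<open>The Zariski closure, over the ring of \<open>A\<close>, of a set of integral
  matrices.\<close>

definition int_closure :: "(int^'n^'n) set \<Rightarrow> ('a::comm_ring_1^'n^'n) set" where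
  "int_closure B = {A. \<forall>f. polyfun f \<longrightarrow> (\<forall>X\<in>B. f (map_mat of_int X) = 0) \<longrightarrow> f A = 0}"

lemma int_closureD:
  "A \<in> int_closure B \<Longrightarrow> polyfun f \<Longrightarrow> (\<And>X. X \<in> B \<Longrightarrow> f (map_mat of_int X) = 0) \<Longrightarrow> f A = 0"
  unfolding int_closure_def by blast

lemma int_closure_superset: "X \<in> B \<Longrightarrow> map_mat of_int X \<in> int_closure B"
  unfolding int_closure_def by blast

text \<open>The values of the monomials at points of \<open>B\<close> are integral vectors, and
  every linear relation among them over the field follows from integral relations. This makes
  closures over different fields comparable.\<close>

lemma int_closure_iff:
  fixes A :: "'a::field_char_0^'n^'n"
  shows "A \<in> int_closure B \<longleftrightarrow> (\<forall>p. (\<forall>X\<in>B. mev (entries_env X) p = 0) \<longrightarrow> mev (entries_env A) p = 0)"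
proof (intro iffI allI impI)
  fix p assume A: "A \<in> int_closure B" and p: "\<forall>X\<in>B. mev (entries_env X) p = 0"
  show "mev (entries_env A) p = 0"
    by (rule int_closureD[OF A polyfun_mev]) (simp add: mev_map_mat_of_int p)
next
  assume H: "\<forall>p. (\<forall>X\<in>B. mev (entries_env X) p = 0) \<longrightarrow> mev (entries_env A) p = 0"
  show "A \<in> int_closure B" unfolding int_closure_def
  proof (intro CollectI allI impI)
    fix f :: "'a^'n^'n \<Rightarrow> 'a" assume "polyfun f" and van: "\<forall>X\<in>B. f (map_mat of_int X) = 0"
    then obtain p where p: "\<And>A. f A = fmev (entries_env A) p" using polyfunE by blast
    have f: "f A = (\<Sum>k<length p. fst (p ! k) * prod_list (map (entries_env A) (snd (p ! k))))" for A
      unfolding p fmev_def by (simp add: sum_list_sum_nth atLeast0LessThan)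
    have "(\<Sum>k<length p. fst (p ! k) * prod_list (map (entries_env A) (snd (p ! k)))) = 0"
    proof (rule integral_functionals[of _ B "\<lambda>k X. prod_list (map (entries_env X) (snd (p ! k)))"])
      fix d :: "nat \<Rightarrow> int"
      assume d: "\<And>X. X \<in> B \<Longrightarrow> (\<Sum>k<length p. d k * prod_list (map (entries_env X) (snd (p ! k)))) = 0"
      define q where "q = map (\<lambda>k. (d k, snd (p ! k))) [0..<length p]"
      have q: "mev e q = (\<Sum>k<length p. of_int (d k) * prod_list (map e (snd (p ! k))))" for e :: "nat \<Rightarrow> 'c::comm_ring_1"
        unfolding q_def mev_def by (simp add: sum_list_sum_nth atLeast0LessThan)
      have "\<forall>X\<in>B. mev (entries_env X) q = 0" using d by (simp add: q)
      then have "mev (entries_env A) q = 0" using H by blast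
      then show "(\<Sum>k<length p. of_int (d k) * prod_list (map (entries_env A) (snd (p ! k)))) = 0" by (simp add: q)
    next
      fix X assume "X \<in> B"
      have "prod_list (map (entries_env (map_mat of_int X)) vs) = (of_int (prod_list (map (entries_env X) vs)) :: 'a)" for vs
        by (induction vs) (simp_all add: entries_env_map_mat)
      then have "(\<Sum>k<length p. fst (p ! k) * of_int (prod_list (map (entries_env X) (snd (p ! k))))) = f (map_mat of_int X)"
        unfolding f by simp
      then show "(\<Sum>k<length p. fst (p ! k) * of_int (prod_list (map (entries_env X) (snd (p ! k))))) = 0"
        using van \<open>X \<in> B\<close> by simp
    qed simp
    then show "f A = 0" by (simp add: f)
  qed
qed

lemma int_closure_map:
  fixes F :: "'a::comm_ring_1^'n^'n \<Rightarrow> 'a^'n^'n"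
  assumes F: "\<And>i j. polyfun (\<lambda>A. F A $ i $ j)" and "\<And>X. X \<in> B \<Longrightarrow> F (map_mat of_int X) \<in> int_closure B"
    and A: "A \<in> int_closure B"
  shows "F A \<in> int_closure B"
  unfolding int_closure_def
proof (intro CollectI allI impI)
  fix f :: "'a^'n^'n \<Rightarrow> 'a" assume f: "polyfun f" "\<forall>X\<in>B. f (map_mat of_int X) = 0"
  have "polyfun (\<lambda>A. f (F A))" using f(1) F by (rule polyfun_compose)
  then show "f (F A) = 0"
    by (rule int_closureD[OF A]) (use int_closureD[OF assms(2) f(1)] f(2) in blast)
qed

lemma polyfun_mult_left: "polyfun (\<lambda>A. (M ** A) $ i $ j)"
  unfolding matrix_matrix_mult_def by (simp, intro polyfun_intros)

lemma polyfun_mult_right: "polyfun (\<lambda>A. (A ** M) $ i $ j)"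
  unfolding matrix_matrix_mult_def by (simp, intro polyfun_intros)

lemma int_closure_mult:
  assumes B: "\<And>X Y. X \<in> B \<Longrightarrow> Y \<in> B \<Longrightarrow> X ** Y \<in> B"
    and A: "A \<in> int_closure B" "A' \<in> int_closure B"
  shows "A ** A' \<in> int_closure B"
proof -
  \<comment> \<open>The closure is stable under right multiplication by members of \<open>B\<close>;
    afterwards the left factor \<open>A\<close> is fixed and the right one varies over the
    closure.\<close>
  have 1: "A ** map_mat of_int Y \<in> int_closure B" if Y: "Y \<in> B" for Y
    by (rule int_closure_map[OF polyfun_mult_right _ A(1)])
       (auto simp flip: map_mat_of_int_mult intro: int_closure_superset B Y)
  show ?thesis by (rule int_closure_map[OF polyfun_mult_left 1 A(2)])
qed

text \<open>By Cramer's rule this is the inverse of a matrix of determinant 1, and it is polynomial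
  in the entries.\<close>

definition adjugate :: "'a::comm_ring_1^'n^'n \<Rightarrow> 'a^'n^'n" where
  "adjugate A = (\<chi> k j. det (\<chi> i l. if l = k then mat 1 $ i $ j else A $ i $ l))"

lemma adjugate_inverse:
  fixes A :: "'a::field^'n^'n"
  assumes "det A = 1" shows "A ** adjugate A = mat 1" "adjugate A ** A = mat 1"
proof -
  have col: "A *v column j (adjugate A) = column j (mat 1)" for j
  proof (subst cramer)
    show "column j (adjugate A) = (\<chi> k. det (\<chi> i l. if l = k then column j (mat 1) $ i else A $ i $ l) / det A)"
      unfolding assms by (simp add: vec_eq_iff adjugate_def column_def cong: if_cong)
  qed (simp add: assms)
  have "(A ** adjugate A) $ i $ j = mat 1 $ i $ j" for i j
    using arg_cong[OF col[of j], of "\<lambda>v. v $ i"]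
    by (simp add: matrix_vector_mult_def matrix_matrix_mult_def column_def)
  then show "A ** adjugate A = mat 1" by (simp add: vec_eq_iff)
  then show "adjugate A ** A = mat 1" by (simp add: matrix_left_right_inverse)
qed

lemma matrix_inverse_unique:
  fixes A :: "'a::comm_ring_1^'n^'n"
  assumes "X ** A = mat 1" "A ** Y = mat 1" shows "X = Y"
  by (metis assms matrix_mul_assoc matrix_mul_lid matrix_mul_rid)

lemma polyfun_adjugate: "polyfun (\<lambda>A. adjugate A $ i $ j)"
proof -
  have "polyfun (\<lambda>A. det (\<chi> a l. if l = i then mat 1 $ a $ j else A $ a $ l))"
  proof (rule polyfun_det)
    fix a l show "polyfun (\<lambda>A. (\<chi> a l. if l = i then mat 1 $ a $ j else A $ a $ l) $ a $ l)"
      by (cases "l = i") (simp_all add: polyfun_intros)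
  qed
  then show ?thesis by (simp add: adjugate_def)
qed

lemma det_map_mat_of_int: "det (map_mat of_int A) = of_int (det A)"
  unfolding det_def by simp

lemma int_closure_det:
  assumes "\<And>X. X \<in> B \<Longrightarrow> det X = 1" "A \<in> int_closure B" shows "det A = 1"
proof -
  have "polyfun (\<lambda>A. det A - 1)" by (intro polyfun_intros)
  from int_closureD[OF assms(2) this] show ?thesis using assms(1) by (simp add: det_map_mat_of_int)
qed

lemma int_closure_adjugate:
  fixes A :: "'a::field^'n^'n"
  assumes B: "\<And>X. X \<in> B \<Longrightarrow> det X = 1" "\<And>X. X \<in> B \<Longrightarrow> \<exists>Y\<in>B. X ** Y = mat 1"
    and A: "A \<in> int_closure B"
  shows "adjugate A \<in> int_closure B"
proof (rule int_closure_map[OF polyfun_adjugate _ A])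
  fix X assume X: "X \<in> B"
  then obtain Y where Y: "Y \<in> B" "X ** Y = mat 1" using B(2) by blast
  have "map_mat of_int X ** map_mat of_int Y = (mat 1 :: 'a^'n^'n)"
    by (simp add: Y(2) map_mat_one flip: map_mat_of_int_mult)
  moreover have "adjugate (map_mat of_int X) ** map_mat of_int X = (mat 1 :: 'a^'n^'n)"
    by (rule adjugate_inverse) (simp add: det_map_mat_of_int B(1)[OF X])
  ultimately have "adjugate (map_mat of_int X) = (map_mat of_int Y :: 'a^'n^'n)"
    using matrix_inverse_unique by blast
  then show "adjugate (map_mat of_int X) \<in> (int_closure B :: ('a^'n^'n) set)" using int_closure_superset[OF Y(1)] by metis
qed

subsection \<open>One-parameter groups of divided powers\<close>

text \<open>\<open>D \<beta> k\<close> stands for the \<open>k\<close>-th divided power of a root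
  vector. The multiplication rule replaces division by factorials, so root elements exist over every
  commutative ring.\<close>

locale divided_powers =
  fixes \<Phi> :: "'e set" and D :: "'e \<Rightarrow> nat \<Rightarrow> int^'n^'n" and bound :: nat
  assumes D_0: "\<beta> \<in> \<Phi> \<Longrightarrow> D \<beta> 0 = mat 1"
    and D_mult: "\<beta> \<in> \<Phi> \<Longrightarrow> (D \<beta> i ** D \<beta> j) $ a $ b = int ((i + j) choose i) * D \<beta> (i + j) $ a $ b"
    and D_bound: "\<beta> \<in> \<Phi> \<Longrightarrow> k \<ge> bound \<Longrightarrow> D \<beta> k = 0"
begin

definition X :: "'e \<Rightarrow> 'a::comm_ring_1 \<Rightarrow> 'a^'n^'n" where
  "X \<beta> t = (\<chi> i j. \<Sum>k<bound. t ^ k * of_int (D \<beta> k $ i $ j))"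

lemma X_nth: "X \<beta> t $ i $ j = (\<Sum>k<bound. t ^ k * of_int (D \<beta> k $ i $ j))"
  by (simp add: X_def)

lemma X_nth_more:
  assumes "\<beta> \<in> \<Phi>" "bound \<le> b"
  shows "X \<beta> t $ i $ j = (\<Sum>k<b. t ^ k * of_int (D \<beta> k $ i $ j))"
  unfolding X_nth by (rule sum.mono_neutral_left) (use assms D_bound in auto)

lemma X_0: assumes "\<beta> \<in> \<Phi>" shows "X \<beta> 0 = (mat 1 :: 'a::comm_ring_1^'n^'n)"
proof -
  have "X \<beta> 0 $ i $ j = (mat 1 :: 'a^'n^'n) $ i $ j" for i j
    unfolding X_nth_more[OF assms, of "Suc bound", OF le_SucI[OF order_refl]] sum.lessThan_Suc_shift
    by (simp add: D_0[OF assms] mat_def)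
  then show ?thesis by (simp add: vec_eq_iff)
qed

lemma X_add:
  assumes "\<beta> \<in> \<Phi>" shows "X \<beta> (s + t) = X \<beta> s ** X \<beta> (t :: 'a::comm_ring_1)"
proof -
  have "(X \<beta> s ** X \<beta> t) $ a $ b = X \<beta> (s + t) $ a $ b" for a b
  proof -
    define d :: "nat \<Rightarrow> 'a" where "d n = of_int (D \<beta> n $ a $ b)" for n
    have d0: "d n = 0" if "n \<ge> bound" for n using D_bound[OF assms that] by (simp add: d_def)
    have "(X \<beta> s ** X \<beta> t) $ a $ b = (\<Sum>i<bound. \<Sum>j<bound. s ^ i * t ^ j * of_int ((D \<beta> i ** D \<beta> j) $ a $ b))"
    proof -
      have "(X \<beta> s ** X \<beta> t) $ a $ b =
          (\<Sum>c\<in>UNIV. \<Sum>i<bound. \<Sum>j<bound. (s ^ i * of_int (D \<beta> i $ a $ c)) * (t ^ j * of_int (D \<beta> j $ c $ b)))"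
        by (simp add: matrix_matrix_mult_def X_nth sum_product)
      also have "\<dots> = (\<Sum>i<bound. \<Sum>j<bound. \<Sum>c\<in>UNIV. (s ^ i * of_int (D \<beta> i $ a $ c)) * (t ^ j * of_int (D \<beta> j $ c $ b)))"
        by (subst sum.swap, rule sum.cong[OF refl], rule sum.swap)
      also have "\<dots> = (\<Sum>i<bound. \<Sum>j<bound. s ^ i * t ^ j * of_int ((D \<beta> i ** D \<beta> j) $ a $ b))"
        by (simp add: matrix_matrix_mult_def sum_distrib_left mult_ac)
      finally show ?thesis .
    qed
    also have "\<dots> = (\<Sum>i<bound. \<Sum>j<bound. of_nat ((i + j) choose i) * s ^ i * t ^ j * d (i + j))"
      by (intro sum.cong refl) (simp add: D_mult[OF assms] d_def mult_ac)
    also have "\<dots> = (\<Sum>(i, j)\<in>{..<bound} \<times> {..<bound}. of_nat ((i + j) choose i) * s ^ i * t ^ j * d (i + j))"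
      by (rule sum.cartesian_product)
    \<comment> \<open>Terms with \<open>i + j\<close> at least \<open>bound\<close> vanish; the
      remaining triangle is summed along diagonals, where the binomial theorem applies.\<close>
    also have "\<dots> = (\<Sum>(i, j)\<in>{(i, j). i + j < bound}. of_nat ((i + j) choose i) * s ^ i * t ^ j * d (i + j))"
    proof (rule sum.mono_neutral_right)
      show "{(i, j). i + j < bound} \<subseteq> {..<bound} \<times> {..<bound}" by auto
      show "\<forall>i\<in>{..<bound} \<times> {..<bound} - {(i, j). i + j < bound}. (case i of (i, j) \<Rightarrow> of_nat ((i + j) choose i) * s ^ i * t ^ j * d (i + j)) = 0"
        by auto (metis d0 mult_zero_right not_le_imp_less)
    qed simp
    also have "\<dots> = (\<Sum>n<bound. \<Sum>i\<le>n. of_nat ((i + (n - i)) choose i) * s ^ i * t ^ (n - i) * d (i + (n - i)))"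
      by (rule sum.triangle_reindex)
    also have "\<dots> = (\<Sum>n<bound. (s + t) ^ n * d n)"
      by (intro sum.cong refl) (simp add: binomial_ring sum_distrib_right)
    finally show ?thesis by (simp add: X_nth d_def)
  qed
  then show ?thesis by (simp add: vec_eq_iff)
qed

lemma X_inverse: "\<beta> \<in> \<Phi> \<Longrightarrow> X \<beta> t ** X \<beta> (- t) = mat 1" "\<beta> \<in> \<Phi> \<Longrightarrow> X \<beta> (- t) ** X \<beta> t = mat 1"
  by (simp_all add: X_0 flip: X_add)

lemma X_of_int: "X \<beta> (of_int t) = map_mat of_int (X \<beta> t)"
  by (simp add: vec_eq_iff X_nth)

definition X_poly :: "'e \<Rightarrow> 'n \<Rightarrow> 'n \<Rightarrow> 'a::comm_ring_1 poly" where
  "X_poly \<beta> i j = (\<Sum>k<bound. monom (of_int (D \<beta> k $ i $ j)) k)"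

lemma poly_X_poly: "X \<beta> t $ i $ j = poly (X_poly \<beta> i j) t"
  by (simp add: X_poly_def X_nth poly_sum poly_monom mult.commute)

inductive_set int_group :: "(int^'n^'n) set" where
  one: "mat 1 \<in> int_group"
| mult: "A \<in> int_group \<Longrightarrow> \<beta> \<in> \<Phi> \<Longrightarrow> A ** X \<beta> t \<in> int_group"

lemma X_int_group: "\<beta> \<in> \<Phi> \<Longrightarrow> X \<beta> t \<in> int_group"
  using int_group.mult[OF int_group.one] by (metis matrix_mul_lid)

lemma int_group_mult: "A \<in> int_group \<Longrightarrow> B \<in> int_group \<Longrightarrow> A ** B \<in> int_group"
proof (rotate_tac, induction B rule: int_group.induct)
  case (mult B \<beta> t)
  have "A ** (B ** X \<beta> t) = (A ** B) ** X \<beta> t" by (simp add: matrix_mul_assoc)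
  then show ?case using int_group.mult[OF mult.IH[OF mult.prems] mult.hyps(2)] by metis
qed simp

lemma int_group_inverse: "A \<in> int_group \<Longrightarrow> \<exists>B\<in>int_group. A ** B = mat 1"
proof (induction rule: int_group.induct)
  case one
  show ?case using int_group.one by (intro bexI[of _ "mat 1"]) simp_all
next
  case (mult A \<beta> t)
  then obtain B where B: "B \<in> int_group" "A ** B = mat 1" by blast
  have "(A ** X \<beta> t) ** (X \<beta> (- t) ** B) = A ** (X \<beta> t ** X \<beta> (- t)) ** B" by (simp add: matrix_mul_assoc)
  also have "\<dots> = mat 1" using B(2) mult.hyps by (simp add: X_inverse)
  finally show ?case using int_group_mult[OF X_int_group[OF mult.hyps(2)] B(1)] by blast
qed

text \<open>A nonzero polynomial has finitely many roots. The factor \<open>c\<close> admits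
  hypotheses known only at multiples of \<open>c\<close>, such as the even integers for the
  determinant.\<close>

lemma poly_eq_const_on_ints:
  fixes Q :: "'a::field_char_0 poly"
  assumes "\<And>n::int. poly Q (of_int (c * n)) = b" "c \<noteq> 0" shows "poly Q t = b"
proof -
  have "inj (\<lambda>n::int. of_int (c * n) :: 'a)" using assms(2) by (auto simp: inj_def)
  then have "infinite (range (\<lambda>n::int. of_int (c * n) :: 'a))" using infinite_UNIV_int finite_imageD by blast
  moreover have "range (\<lambda>n::int. of_int (c * n)) \<subseteq> {x. poly (Q - [:b:]) x = 0}" using assms(1) by auto
  ultimately have "Q - [:b:] = 0" using poly_roots_finite finite_subset by blast
  then have "Q = [:b:]" by simp
  then show ?thesis by simp
qed

text \<open>At an integer the determinant is a unit of the integers, hence 1 at its double; as a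
  polynomial in \<open>t\<close> it is 1 everywhere.\<close>

lemma det_X_field: "\<beta> \<in> \<Phi> \<Longrightarrow> det (X \<beta> t :: 'a::field_char_0^'n^'n) = 1"
proof -
  assume \<beta>: "\<beta> \<in> \<Phi>"
  have "polyfun (det :: 'a^'n^'n \<Rightarrow> 'a)" using polyfun_det[of "\<lambda>A. A"] by (simp add: polyfun_intros)
  from polyfun_along_curve[OF this, of "X \<beta>" "X_poly \<beta>", OF poly_X_poly]
  obtain Q where Q: "\<And>t. det (X \<beta> t) = poly Q (t :: 'a)" by blast
  have "poly Q (of_int (2 * n)) = 1" for n
  proof -
    have "det (X \<beta> n) * det (X \<beta> (- n)) = 1" using det_mul[of "X \<beta> n" "X \<beta> (- n)"] by (simp add: X_inverse[OF \<beta>])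
    then have "det (X \<beta> n) = 1 \<or> det (X \<beta> n) = -1" by (auto simp: zmult_eq_1_iff)
    then have "det (X \<beta> (n + n)) = 1" unfolding X_add[OF \<beta>] det_mul by auto
    then have "det (X \<beta> (of_int (n + n)) :: 'a^'n^'n) = 1" unfolding X_of_int det_map_mat_of_int by simp
    then show ?thesis unfolding Q by simp
  qed
  then show ?thesis unfolding Q by (rule poly_eq_const_on_ints) simp
qed

lemma det_int_group: "A \<in> int_group \<Longrightarrow> det A = 1"
proof (induction rule: int_group.induct)
  case (mult A \<beta> t)
  have "det (X \<beta> (of_int t) :: real^'n^'n) = 1" by (rule det_X_field[OF mult.hyps(2)])
  then have "det (X \<beta> t) = 1" unfolding X_of_int det_map_mat_of_int by simp
  then show ?case using mult by (simp add: det_mul)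
qed simp

definition closed_group :: "('a::comm_ring_1^'n^'n) set" where
  "closed_group = int_closure int_group"

lemma closed_group_mult: "A \<in> closed_group \<Longrightarrow> B \<in> closed_group \<Longrightarrow> A ** B \<in> closed_group"
  unfolding closed_group_def by (rule int_closure_mult[OF int_group_mult])

lemma closed_group_one: "mat 1 \<in> closed_group"
  using int_closure_superset[OF int_group.one] by (simp add: map_mat_one closed_group_def)

lemma closed_group_det: "A \<in> closed_group \<Longrightarrow> det A = 1"
  unfolding closed_group_def by (rule int_closure_det[OF det_int_group])

lemma closed_group_adjugate:
  "A \<in> closed_group \<Longrightarrow> adjugate A \<in> (closed_group :: ('a::field^'n^'n) set)"
  unfolding closed_group_def by (rule int_closure_adjugate[OF det_int_group int_group_inverse])

lemma X_closed_group:
  assumes "\<beta> \<in> \<Phi>" shows "X \<beta> t \<in> (closed_group :: ('a::field_char_0^'n^'n) set)"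
  unfolding closed_group_def int_closure_def
proof (intro CollectI allI impI)
  fix f :: "'a^'n^'n \<Rightarrow> 'a" assume f: "polyfun f" "\<forall>X\<in>int_group. f (map_mat of_int X) = 0"
  from polyfun_along_curve[OF f(1), of "X \<beta>" "X_poly \<beta>", OF poly_X_poly]
  obtain Q where Q: "\<And>t. f (X \<beta> t) = poly Q (t :: 'a)" by blast
  have "poly Q (of_int (1 * n)) = 0" for n
    using f(2) X_int_group[OF assms, of n] by (simp add: X_of_int flip: Q)
  then show "f (X \<beta> t) = 0" unfolding Q by (rule poly_eq_const_on_ints) simp
qed

text \<open>Linear functionals vanishing on \<open>L\<close> become polynomial functions of
  \<open>A\<close>, because the inverse is given by \<open>adjugate\<close>. They vanish on the
  integral group and hence on its closure.\<close>

lemma closed_group_preserves_subspace: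
  fixes A :: "real^'n^'n" and L :: "(real^'n^'n) set"
  assumes A: "A \<in> closed_group" and L: "subspace L"
    and pres: "\<And>Y t \<beta>. Y \<in> L \<Longrightarrow> \<beta> \<in> \<Phi> \<Longrightarrow> X \<beta> t ** Y ** X \<beta> (- t) \<in> L"
    and Y: "Y \<in> L"
  shows "A ** Y ** adjugate A \<in> L"
proof (rule ccontr)
  assume notin: "A ** Y ** adjugate A \<notin> L"
  then obtain z where z: "\<And>u. u \<in> L \<Longrightarrow> inner z u = 0" "inner z (A ** Y ** adjugate A) \<noteq> 0"
  proof -
    obtain y w where yw: "y \<in> span L" "\<And>u. u \<in> span L \<Longrightarrow> orthogonal w u" "A ** Y ** adjugate A = y + w"
      using orthogonal_subspace_decomp_exists by blast
    have "y \<in> L" using yw(1) L by (simp add: span_eq_iff[THEN iffD2])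
    then have "w \<noteq> 0" using notin yw(3) by auto
    moreover have "inner w y = 0" using yw(1,2) by (simp add: orthogonal_def)
    ultimately have "inner w (A ** Y ** adjugate A) \<noteq> 0" unfolding yw(3) by (simp add: inner_add_right)
    then show ?thesis using that[of w] yw(2) by (simp add: orthogonal_def span_base)
  qed
  have "polyfun (\<lambda>A. inner z (A ** Y ** adjugate A))"
    unfolding inner_vec_def matrix_matrix_mult_def inner_real_def
    by (simp, intro polyfun_intros polyfun_adjugate)
  moreover have "inner z (map_mat of_int B ** Y ** adjugate (map_mat of_int B)) = 0" if "B \<in> int_group" for B
  proof (rule z(1))
    \<comment> \<open>The inverse is an arbitrary right inverse \<open>C\<close>, so that the last
      factor can be moved from the group element to \<open>C\<close> in the induction.\<close>
    have "\<forall>Y\<in>L. \<forall>C. map_mat of_int B ** C = (mat 1 :: real^'n^'n) \<longrightarrow> map_mat of_int B ** Y ** C \<in> L"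
      using that
    proof (induction rule: int_group.induct)
      case one
      show ?case by (simp add: map_mat_one)
    next
      case (mult B \<beta> t)
      show ?case
      proof (intro ballI allI impI)
        fix Y and C :: "real^'n^'n" assume Y: "Y \<in> L" and C: "map_mat of_int (B ** X \<beta> t) ** C = mat 1"
        let ?x = "X \<beta> (of_int t) :: real^'n^'n" and ?x' = "X \<beta> (- of_int t) :: real^'n^'n"
        let ?B = "map_mat of_int B :: real^'n^'n"
        have eq: "map_mat of_int (B ** X \<beta> t) = ?B ** ?x"
          by (simp add: map_mat_of_int_mult X_of_int)
        have "?B ** (?x ** C) = mat 1" using C unfolding eq by (simp add: matrix_mul_assoc)
        moreover have "?x ** Y ** ?x' \<in> L" by (rule pres[OF Y mult.hyps(2)])
        ultimately have "?B ** (?x ** Y ** ?x') ** (?x ** C) \<in> L" using mult.IH by blast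
        also have "?B ** (?x ** Y ** ?x') ** (?x ** C) = ?B ** ?x ** Y ** (?x' ** ?x) ** C"
          by (simp add: matrix_mul_assoc)
        also have "\<dots> = map_mat of_int (B ** X \<beta> t) ** Y ** C"
          unfolding eq X_inverse(2)[OF mult.hyps(2)] by simp
        finally show "map_mat of_int (B ** X \<beta> t) ** Y ** C \<in> L" .
      qed
    qed
    moreover have "map_mat of_int B ** adjugate (map_mat of_int B) = (mat 1 :: real^'n^'n)"
      by (rule adjugate_inverse) (simp add: det_map_mat_of_int det_int_group[OF that])
    ultimately show "map_mat of_int B ** Y ** adjugate (map_mat of_int B) \<in> L" using Y by blast
  qed
  ultimately have "inner z (A ** Y ** adjugate A) = 0" using int_closureD[OF A[unfolded closed_group_def]] by blast
  then show False using z(2) by simp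
qed

end

section \<open>Points of the Chevalley--Demazure scheme\<close>

lemma polyfun_eval_entry_poly: "polyfun (eval_entry_poly p)"
  unfolding eval_entry_poly_def by (intro polyfun_intros)

lemma eval_entry_poly_map_mat_of_int:
  "eval_entry_poly p (map_mat of_int A) = of_int (eval_entry_poly p A)"
  by (simp add: eval_entry_poly_def)

lemma eval_entry_poly_superset:
  assumes "finite S" "Poly_Mapping.keys p \<subseteq> S"
  shows "eval_entry_poly p A = (\<Sum>m\<in>S. of_int (Poly_Mapping.lookup p m) *
    (\<Prod>ij\<in>UNIV. (A $ fst ij $ snd ij) ^ Poly_Mapping.lookup m ij))"
proof -
  have prod: "(\<Prod>ij\<in>Poly_Mapping.keys m. (A $ fst ij $ snd ij) ^ Poly_Mapping.lookup m ij) =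
      (\<Prod>ij\<in>UNIV. (A $ fst ij $ snd ij) ^ Poly_Mapping.lookup m ij)" for m :: "('a \<times> 'a) \<Rightarrow>\<^sub>0 nat"
    by (rule prod.mono_neutral_left) (auto simp: in_keys_iff)
  show ?thesis unfolding eval_entry_poly_def prod
    by (rule sum.mono_neutral_left) (use assms in \<open>auto simp: in_keys_iff\<close>)
qed

lemma eval_entry_poly_add: "eval_entry_poly (p + q) A = eval_entry_poly p A + eval_entry_poly q A"
proof -
  let ?S = "Poly_Mapping.keys p \<union> Poly_Mapping.keys q"
  have "Poly_Mapping.keys (p + q) \<subseteq> ?S" by (rule Poly_Mapping.keys_add)
  then show ?thesis
    by (simp add: eval_entry_poly_superset[of ?S] lookup_add distrib_right sum.distrib)
qed

lemma eval_entry_poly_single: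
  "eval_entry_poly (Poly_Mapping.single m k) A =
     of_int k * (\<Prod>ij\<in>UNIV. (A $ fst ij $ snd ij) ^ Poly_Mapping.lookup m ij)"
  by (subst eval_entry_poly_superset[of "{m}"]) (auto simp: keys_single)

definition monomial_of :: "nat list \<Rightarrow> ('n::finite \<times> 'n) \<Rightarrow>\<^sub>0 nat" where
  "monomial_of vs = (\<Sum>i\<leftarrow>vs. Poly_Mapping.single (of_index (i div CARD('n)), of_index (i mod CARD('n))) 1)"

lemma prod_monomial_of:
  fixes A :: "'a::comm_ring_1^'n^'n"
  assumes "\<And>i. i \<in> set vs \<Longrightarrow> i < CARD('n) * CARD('n)"
  shows "(\<Prod>ij\<in>UNIV. (A $ fst ij $ snd ij) ^ Poly_Mapping.lookup (monomial_of vs) ij) = prod_list (map (entries_env A) vs)"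
  using assms
proof (induction vs)
  case (Cons i vs)
  let ?ij = "(of_index (i div CARD('n)), of_index (i mod CARD('n))) :: 'n \<times> 'n"
  have "(\<Prod>kl\<in>UNIV. (A $ fst kl $ snd kl) ^ Poly_Mapping.lookup (Poly_Mapping.single ?ij (1::nat)) kl) = entries_env A i"
  proof -
    have "(\<Prod>kl\<in>UNIV. (A $ fst kl $ snd kl) ^ Poly_Mapping.lookup (Poly_Mapping.single ?ij (1::nat)) kl) =
        (\<Prod>kl\<in>{?ij}. (A $ fst kl $ snd kl) ^ Poly_Mapping.lookup (Poly_Mapping.single ?ij (1::nat)) kl)"
      by (rule prod.mono_neutral_right) (auto simp: lookup_single when_def)
    then show ?thesis using Cons.prems by (simp add: entries_env_def)
  qed
  then show ?case using Cons
    by (simp add: monomial_of_def lookup_add power_add prod.distrib)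
qed (simp add: monomial_of_def)

text \<open>Monomials with a variable outside the matrix are dropped, in agreement with their value
  0 under \<open>entries_env\<close>.\<close>

definition entry_poly_of :: "int_mpoly \<Rightarrow> 'n::finite entry_poly" where
  "entry_poly_of p = (\<Sum>m\<leftarrow>filter (\<lambda>m. \<forall>i\<in>set (snd m). i < CARD('n) * CARD('n)) p.
     Poly_Mapping.single (monomial_of (snd m)) (fst m))"

lemma eval_entry_poly_of:
  fixes A :: "'a::comm_ring_1^'n^'n"
  shows "eval_entry_poly (entry_poly_of p) A = mev (entries_env A) p"
proof (induction p)
  case Nil
  then show ?case by (simp add: entry_poly_of_def eval_entry_poly_def)
next
  case (Cons m p)
  show ?case
  proof (cases "\<forall>i\<in>set (snd m). i < CARD('n) * CARD('n)")
    case True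
    then have "entry_poly_of (m # p) = Poly_Mapping.single (monomial_of (snd m)) (fst m) + (entry_poly_of p :: 'n entry_poly)"
      by (simp add: entry_poly_of_def)
    then show ?thesis using True Cons
      by (simp add: eval_entry_poly_add eval_entry_poly_single prod_monomial_of mev_Cons)
  next
    case False
    then obtain i where i: "i \<in> set (snd m)" "\<not> i < CARD('n) * CARD('n)" by blast
    then have "entries_env A i = 0" by (simp add: entries_env_def)
    then have "prod_list (map (entries_env A) (snd m)) = 0"
      using split_list[OF i(1)] by auto
    moreover have "entry_poly_of (m # p) = (entry_poly_of p :: 'n entry_poly)"
      using False unfolding entry_poly_of_def by (simp only: filter.simps if_False)
    ultimately show ?thesis using Cons by (simp add: mev_Cons)
  qed
qed

lemma SL_inverse:
  assumes "A \<in> carrier M" "B \<in> carrier M" "mult M = (**)" "one M = mat 1"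
    "A ** B = mat 1" "B ** A = (mat 1 :: 'k::comm_ring_1^'n^'n)"
  shows "inv\<^bsub>M\<^esub> A = B"
  unfolding m_inv_def assms(3,4)
proof (rule the_equality)
  fix C assume "C \<in> carrier M \<and> A ** C = mat 1 \<and> C ** A = mat 1"
  then show "C = B" using matrix_inverse_unique[of C A B] assms(5) by blast
qed (use assms in simp)

context divided_powers
begin

lemma complex_group_subset_closed_group:
  assumes "\<And>\<beta> t. \<beta> \<in> \<Phi> \<Longrightarrow> E \<beta> t = (X \<beta> t :: complex^'n^'n)"
    and "A \<in> generate (SL UNIV) {E \<beta> t |\<beta> t. \<beta> \<in> \<Phi>}"
  shows "A \<in> closed_group"
  using assms(2)
proof induction
  case one
  show ?case using closed_group_one by (simp add: SL_def)
next
  case (incl h)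
  then show ?case using assms(1) X_closed_group by auto
next
  case (inv h)
  then obtain \<beta> t where h: "\<beta> \<in> \<Phi>" "h = X \<beta> t" using assms(1) by auto
  have "inv\<^bsub>SL UNIV\<^esub> h = X \<beta> (- t)" unfolding h(2)
    by (rule SL_inverse) (simp_all add: SL_def det_X_field h(1) X_inverse)
  then show ?case using X_closed_group[OF h(1)] by simp
next
  case (eng h1 h2)
  then show ?case using closed_group_mult by (simp add: SL_def)
qed

lemma int_group_subset_complex_group:
  assumes "\<And>\<beta> t. \<beta> \<in> \<Phi> \<Longrightarrow> E \<beta> t = (X \<beta> t :: complex^'n^'n)" "A \<in> int_group"
  shows "map_mat of_int A \<in> generate (SL UNIV) {E \<beta> t |\<beta> t. \<beta> \<in> \<Phi>}"
  using assms(2)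
proof induction
  case one
  show ?case using generate.one[of "SL UNIV"] by (simp add: SL_def map_mat_one)
next
  case (mult A \<beta> t)
  have "E \<beta> (of_int t) \<in> generate (SL UNIV) {E \<beta> t |\<beta> t. \<beta> \<in> \<Phi>}"
    using mult.hyps(2) by (intro generate.incl) blast
  from generate.eng[OF mult.IH this] show ?case
    using assms(1)[OF mult.hyps(2), of "of_int t"] by (simp add: SL_def map_mat_of_int_mult X_of_int)
qed

text \<open>The integral group lies in the complex group, which lies in the complex closure of the
  integral group. By \<open>int_closure_iff\<close> the same integral polynomials vanish on all
  three, and these also define the real closure.\<close>

lemma scheme_points_iff:
  fixes A :: "real^'n^'n"
  assumes "\<And>\<beta> t. \<beta> \<in> \<Phi> \<Longrightarrow> E \<beta> t = (X \<beta> t :: complex^'n^'n)"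
  shows "det A = 1 \<and> (\<forall>p :: 'n entry_poly. (\<forall>B\<in>generate (SL UNIV) {E \<beta> t |\<beta> t. \<beta> \<in> \<Phi>}. eval_entry_poly p B = 0) \<longrightarrow>
    eval_entry_poly p A = 0) \<longleftrightarrow> A \<in> closed_group"
proof
  assume A: "det A = 1 \<and> (\<forall>p :: 'n entry_poly. (\<forall>B\<in>generate (SL UNIV) {E \<beta> t |\<beta> t. \<beta> \<in> \<Phi>}. eval_entry_poly p B = 0) \<longrightarrow>
    eval_entry_poly p A = 0)"
  show "A \<in> closed_group" unfolding closed_group_def int_closure_iff
  proof (intro allI impI)
    fix p assume p: "\<forall>X\<in>int_group. mev (entries_env X) p = 0"
    have "eval_entry_poly (entry_poly_of p) B = 0" if "B \<in> generate (SL UNIV) {E \<beta> t |\<beta> t. \<beta> \<in> \<Phi>}" for B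
    proof -
      have "B \<in> closed_group" using complex_group_subset_closed_group[OF assms that] .
      then show ?thesis using p unfolding closed_group_def int_closure_iff eval_entry_poly_of by blast
    qed
    then have "eval_entry_poly (entry_poly_of p) A = 0" using A by blast
    then show "mev (entries_env A) p = 0" by (simp only: eval_entry_poly_of)
  qed
next
  assume A: "A \<in> closed_group"
  have "eval_entry_poly p A = 0" if p: "\<forall>B\<in>generate (SL UNIV) {E \<beta> t |\<beta> t. \<beta> \<in> \<Phi>}. eval_entry_poly p B = 0" for p :: "'n entry_poly"
  proof (rule int_closureD[OF A[unfolded closed_group_def] polyfun_eval_entry_poly])
    fix Y assume "Y \<in> int_group"
    then have "eval_entry_poly p (map_mat of_int Y :: complex^'n^'n) = 0"
      using p int_group_subset_complex_group[OF assms] by blast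
    then show "eval_entry_poly p (map_mat of_int Y :: real^'n^'n) = 0"
      unfolding eval_entry_poly_map_mat_of_int by simp
  qed
  then show "det A = 1 \<and> (\<forall>p :: 'n entry_poly. (\<forall>B\<in>generate (SL UNIV) {E \<beta> t |\<beta> t. \<beta> \<in> \<Phi>}. eval_entry_poly p B = 0) \<longrightarrow>
    eval_entry_poly p A = 0)" using closed_group_det[OF A] by blast
qed

lemma adjugate_computable:
  assumes "\<And>i j. A $ i $ j \<in> computable_reals"
  shows "adjugate A $ i $ j \<in> computable_reals"
proof -
  have det: "det B \<in> computable_reals" if "\<And>i j. B $ i $ j \<in> computable_reals" for B :: "real^'m^'m"
    unfolding det_def by (intro computable_reals_sum computable_reals_mult computable_reals_prod that) simp
  have "det (\<chi> a l. if l = i then mat 1 $ a $ j else A $ a $ l) \<in> computable_reals"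
    by (rule det) (simp add: assms mat_def)
  then show ?thesis by (simp add: adjugate_def)
qed

lemma mult_computable:
  assumes "\<And>i j. A $ i $ j \<in> computable_reals" "\<And>i j. B $ i $ j \<in> computable_reals"
  shows "(A ** B) $ i $ j \<in> computable_reals"
  unfolding matrix_matrix_mult_def by (simp add: computable_reals_sum computable_reals_mult assms)

lemma X_computable: "t \<in> computable_reals \<Longrightarrow> X \<beta> t $ i $ j \<in> computable_reals"
  unfolding X_nth by (intro computable_reals_sum computable_reals_mult computable_reals_power) simp_all

definition computable_group :: "(real^'n^'n) monoid" where
  "computable_group = \<lparr>carrier = {A \<in> closed_group. \<forall>i j. A $ i $ j \<in> computable_reals}, mult = (**), one = mat 1\<rparr>"

lemma in_computable_group:
  "A \<in> carrier computable_group \<longleftrightarrow> A \<in> closed_group \<and> (\<forall>i j. A $ i $ j \<in> computable_reals)"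
  by (simp add: computable_group_def)

lemma computable_group_simps [simp]: "mult computable_group = (**)" "one computable_group = mat 1"
  by (simp_all add: computable_group_def)

lemma adjugate_in_computable_group: "A \<in> carrier computable_group \<Longrightarrow> adjugate A \<in> carrier computable_group"
  unfolding in_computable_group using closed_group_adjugate adjugate_computable by blast

lemma adjugate_inverses:
  assumes "A \<in> carrier computable_group" shows "A ** adjugate A = mat 1" "adjugate A ** A = mat 1"
  using adjugate_inverse[of A] closed_group_det[of A] assms unfolding in_computable_group by blast+

lemma group_computable_group: "group computable_group"
proof (rule groupI)
  show "x \<otimes>\<^bsub>computable_group\<^esub> y \<in> carrier computable_group"
    if "x \<in> carrier computable_group" "y \<in> carrier computable_group" for x y
    using that mult_computable[of x y] closed_group_mult[of x y] unfolding in_computable_group by simp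
  show "\<one>\<^bsub>computable_group\<^esub> \<in> carrier computable_group"
    using closed_group_one unfolding in_computable_group by (simp, simp add: mat_def)
  show "\<exists>y\<in>carrier computable_group. y \<otimes>\<^bsub>computable_group\<^esub> x = \<one>\<^bsub>computable_group\<^esub>"
    if "x \<in> carrier computable_group" for x
    using that adjugate_in_computable_group adjugate_inverses by (intro bexI[of _ "adjugate x"]) simp_all
qed (simp_all add: matrix_mul_assoc)

lemma inv_computable_group: "A \<in> carrier computable_group \<Longrightarrow> inv\<^bsub>computable_group\<^esub> A = adjugate A"
  by (rule SL_inverse) (simp_all add: adjugate_in_computable_group adjugate_inverses)

lemma X_computable_group: "\<beta> \<in> \<Phi> \<Longrightarrow> t \<in> computable_reals \<Longrightarrow> X \<beta> t \<in> carrier computable_group"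
  unfolding in_computable_group using X_closed_group X_computable by blast

end

section \<open>Integral matrices from a Chevalley basis\<close>

lemma matrix_power_0: "matrix_power A 0 = mat 1"
  by (simp add: matrix_power_def)

lemma matrix_power_Suc: "matrix_power A (Suc k) = A ** matrix_power A k"
  by (simp add: matrix_power_def)

lemma matrix_power_add: "matrix_power A (i + j) = matrix_power A i ** matrix_power A j"
  by (induction i) (simp_all add: matrix_power_0 matrix_power_Suc matrix_mul_assoc)

lemma matrix_power_scale:
  fixes A :: "'a::comm_ring_1^'n^'n"
  shows "matrix_power (\<chi> i j. t * A $ i $ j) k $ i $ j = t ^ k * matrix_power A k $ i $ j"
proof (induction k arbitrary: i j)
  case (Suc k)
  then show ?case
    by (simp add: matrix_power_Suc matrix_matrix_mult_def sum_distrib_left mult_ac)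
qed (simp add: matrix_power_0)

lemma norm_matrix_power_le:
  fixes A :: "complex^'n^'n"
  shows "norm (matrix_power A k $ i $ j) \<le> (\<Sum>i\<in>UNIV. \<Sum>j\<in>UNIV. norm (A $ i $ j)) ^ k"
proof (induction k arbitrary: i j)
  case 0
  show ?case by (simp add: matrix_power_0 mat_def)
next
  case (Suc k)
  let ?c = "\<Sum>i\<in>UNIV. \<Sum>j\<in>UNIV. norm (A $ i $ j)"
  have "norm (matrix_power A (Suc k) $ i $ j) \<le> (\<Sum>l\<in>UNIV. norm (A $ i $ l * matrix_power A k $ l $ j))"
    unfolding matrix_power_Suc matrix_matrix_mult_def by (simp add: norm_sum)
  also have "\<dots> \<le> (\<Sum>l\<in>UNIV. norm (A $ i $ l) * ?c ^ k)"
    unfolding norm_mult by (intro sum_mono mult_left_mono Suc.IH) simp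
  also have "\<dots> = (\<Sum>l\<in>UNIV. norm (A $ i $ l)) * ?c ^ k" by (simp add: sum_distrib_right)
  also have "\<dots> \<le> ?c * ?c ^ k"
    by (intro mult_right_mono member_le_sum[of i UNIV "\<lambda>i. \<Sum>j\<in>UNIV. norm (A $ i $ j)"] zero_le_power sum_nonneg) auto
  finally show ?case by simp
qed

text \<open>Divided powers are integral, but their entries are bounded by
  \<open>c ^ k / fact k\<close>, which tends to 0; an integer of absolute value below 1 is 0.
  Nilpotency of root vectors thus comes directly from admissibility.\<close>

lemma divided_powers_vanish:
  fixes A :: "complex^'n^'n"
  assumes "\<And>k i j. matrix_power A k $ i $ j / fact k \<in> \<int>"
  shows "\<forall>\<^sub>F k in sequentially. matrix_power A k = 0"
proof -
  let ?c = "\<Sum>i\<in>UNIV. \<Sum>j\<in>UNIV. norm (A $ i $ j)"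
  have "(\<lambda>n. ?c ^ n /\<^sub>R fact n) \<longlonglongrightarrow> 0" by (rule summable_LIMSEQ_zero[OF summable_exp_generic])
  then have "\<forall>\<^sub>F n in sequentially. ?c ^ n /\<^sub>R fact n < 1" by (rule order_tendstoD) simp
  then show ?thesis
  proof eventually_elim
    case (elim k)
    have "matrix_power A k $ i $ j = 0" for i j
    proof -
      obtain z where z: "matrix_power A k $ i $ j / fact k = of_int z" using assms[of k i j] Ints_cases by metis
      have "norm (matrix_power A k $ i $ j / fact k) \<le> ?c ^ k / fact k"
        by (simp add: norm_divide divide_right_mono norm_matrix_power_le)
      also have "\<dots> < 1" using elim by (simp add: divide_inverse mult.commute)
      finally have "\<bar>z\<bar> < 1" unfolding z by simp
      then show ?thesis using z by simp
    qed
    then show ?case by (simp add: vec_eq_iff)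
  qed
qed

text \<open>The roots span the space, so the Cartan numbers against all roots determine a
  vector.\<close>

lemma cartan_numbers_determine:
  assumes root_system: "root_system \<Phi>"
    and "\<And>\<delta>. \<delta> \<in> \<Phi> \<Longrightarrow> cartan_number \<gamma> \<delta> = cartan_number \<alpha> \<delta> + cartan_number \<beta> \<delta>"
  shows "\<gamma> = \<alpha> + \<beta>"
proof -
  have "orthogonal (\<gamma> - (\<alpha> + \<beta>)) \<delta>" if "\<delta> \<in> \<Phi>" for \<delta>
  proof -
    have "inner \<delta> \<delta> \<noteq> 0" using root_system that by (auto simp: root_system_def)
    then show ?thesis using assms(2)[OF that]
      by (simp add: cartan_number_def orthogonal_def inner_diff_left inner_add_left field_simps)
  qed
  then have "orthogonal (\<gamma> - (\<alpha> + \<beta>)) x" if "x \<in> span \<Phi>" for x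
    using orthogonal_to_span that by blast
  moreover have "span \<Phi> = UNIV" using root_system by (simp add: root_system_def)
  ultimately have "orthogonal (\<gamma> - (\<alpha> + \<beta>)) (\<gamma> - (\<alpha> + \<beta>))" by blast
  then show ?thesis by (simp add: orthogonal_self)
qed

locale chevalley_data = complex_lie_algebra scale bracket
  for scale :: "complex \<Rightarrow> 'g::ab_group_add \<Rightarrow> 'g" and bracket :: "'g \<Rightarrow> 'g \<Rightarrow> 'g" +
  fixes \<Phi> :: "'e::euclidean_space set" and H :: "'g set" and r :: "'e \<Rightarrow> 'g \<Rightarrow> complex"
    and e :: "'e \<Rightarrow> 'g" and \<pi> :: "'g \<Rightarrow> complex^'n^'n"
  assumes root_system: "root_system \<Phi>" and nonempty: "\<Phi> \<noteq> {}"
    and roots: "root_identification \<Phi> H r"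
    and root_vectors: "chevalley_root_vectors \<Phi> H r e"
    and representation: "faithful_representation \<pi>"
    and admissible: "admissible_basis \<Phi> e \<pi>"
begin

text \<open>The entry is an integer among the complex numbers; the real part and the floor only
  extract it.\<close>

definition D :: "'e \<Rightarrow> nat \<Rightarrow> int^'n^'n" where
  "D \<beta> k = (\<chi> i j. \<lfloor>Re (matrix_power (\<pi> (e \<beta>)) k $ i $ j / fact k)\<rfloor>)"

lemma of_int_D:
  assumes "\<beta> \<in> \<Phi>"
  shows "(of_int (D \<beta> k $ i $ j) :: complex) = matrix_power (\<pi> (e \<beta>)) k $ i $ j / fact k"
proof -
  obtain z where "matrix_power (\<pi> (e \<beta>)) k $ i $ j / fact k = of_int z"
    using admissible assms Ints_cases unfolding admissible_basis_def by metis
  then show ?thesis by (simp add: D_def)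
qed

lemma ex_bound: "\<exists>b. \<forall>\<beta>\<in>\<Phi>. \<forall>k\<ge>b. D \<beta> k = 0"
proof -
  have "finite \<Phi>" using root_system by (simp add: root_system_def)
  have "\<forall>\<beta>\<in>\<Phi>. \<forall>\<^sub>F k in sequentially. matrix_power (\<pi> (e \<beta>)) k = 0"
    using admissible by (auto simp: admissible_basis_def intro!: divided_powers_vanish)
  then have "\<forall>\<^sub>F k in sequentially. \<forall>\<beta>\<in>\<Phi>. matrix_power (\<pi> (e \<beta>)) k = 0"
    by (rule eventually_ball_finite[OF \<open>finite \<Phi>\<close>])
  then obtain b where "\<And>k \<beta>. k \<ge> b \<Longrightarrow> \<beta> \<in> \<Phi> \<Longrightarrow> matrix_power (\<pi> (e \<beta>)) k = 0"
    unfolding eventually_sequentially by blast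
  then have "\<forall>\<beta>\<in>\<Phi>. \<forall>k\<ge>b. D \<beta> k = 0" by (simp add: D_def vec_eq_iff)
  then show ?thesis ..
qed

definition D_bound :: nat where "D_bound = (SOME b. \<forall>\<beta>\<in>\<Phi>. \<forall>k\<ge>b. D \<beta> k = 0)"

sublocale divided_powers \<Phi> D D_bound
proof
  fix \<beta> assume \<beta>: "\<beta> \<in> \<Phi>"
  have inj: "A = B" if "\<And>i j. (of_int (A $ i $ j) :: complex) = of_int (B $ i $ j)" for A B :: "int^'n^'n"
    using that by (simp add: vec_eq_iff)
  show "D \<beta> 0 = mat 1"
    by (rule inj) (simp add: of_int_D[OF \<beta>] matrix_power_0, simp add: mat_def)
  show "D \<beta> k = 0" if "k \<ge> D_bound" for k
    using someI_ex[OF ex_bound] that \<beta> unfolding D_bound_def by blast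
  fix i j a b
  have "(of_int ((D \<beta> i ** D \<beta> j) $ a $ b) :: complex) =
      (\<Sum>k\<in>UNIV. matrix_power (\<pi> (e \<beta>)) i $ a $ k / fact i * (matrix_power (\<pi> (e \<beta>)) j $ k $ b / fact j))"
    by (simp add: matrix_matrix_mult_def of_int_D[OF \<beta>])
  also have "\<dots> = matrix_power (\<pi> (e \<beta>)) (i + j) $ a $ b / (fact i * fact j)"
    by (simp add: matrix_power_add matrix_matrix_mult_def sum_divide_distrib)
  also have "\<dots> = of_nat ((i + j) choose i) * (matrix_power (\<pi> (e \<beta>)) (i + j) $ a $ b / fact (i + j))"
    by (simp add: binomial_fact)
  also have "\<dots> = of_int (int ((i + j) choose i) * D \<beta> (i + j) $ a $ b)"
    by (simp add: of_int_D[OF \<beta>])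
  finally show "(D \<beta> i ** D \<beta> j) $ a $ b = int ((i + j) choose i) * D \<beta> (i + j) $ a $ b"
    by (simp only: of_int_eq_iff)
qed

lemma root_element_eq_X:
  assumes "\<beta> \<in> \<Phi>" shows "root_element e \<pi> \<beta> t = X \<beta> t"
proof -
  have "suminf (\<lambda>k. matrix_power (\<chi> i j. t * \<pi> (e \<beta>) $ i $ j) k $ i $ j / fact k) = (\<Sum>k<D_bound. t ^ k * of_int (D \<beta> k $ i $ j))" for i j
  proof -
    have "(\<lambda>k. matrix_power (\<chi> i j. t * \<pi> (e \<beta>) $ i $ j) k $ i $ j / fact k) = (\<lambda>k. t ^ k * of_int (D \<beta> k $ i $ j))"
      by (rule ext) (simp add: matrix_power_scale of_int_D[OF assms])
    moreover have "(\<lambda>k. t ^ k * of_int (D \<beta> k $ i $ j)) sums (\<Sum>k<D_bound. t ^ k * of_int (D \<beta> k $ i $ j))"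
      by (rule sums_finite) (auto simp: D_bound[OF assms] not_less)
    ultimately show ?thesis by (simp add: sums_iff)
  qed
  then show ?thesis by (simp add: root_element_def matrix_exp_def vec_eq_iff X_nth)
qed

lemma chevalley_group_eq: "chevalley_group \<Phi> e \<pi> computable_reals = computable_group"
proof -
  have E: "\<beta> \<in> \<Phi> \<Longrightarrow> root_element e \<pi> \<beta> t = X \<beta> t" for \<beta> t by (rule root_element_eq_X)
  have "{A \<in> carrier (SL computable_reals). \<forall>p :: 'n entry_poly.
        (\<forall>B\<in>complex_chevalley_group \<Phi> e \<pi>. eval_entry_poly p B = 0) \<longrightarrow> eval_entry_poly p A = 0} =
      carrier computable_group"
    using scheme_points_iff[of "root_element e \<pi>", OF E]
    unfolding complex_chevalley_group_def computable_group_def SL_def by auto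
  then show ?thesis unfolding chevalley_group_def by (simp add: SL_def computable_group_def)
qed

subsection \<open>Commutator relations\<close>

lemma neg_root: "\<alpha> \<in> \<Phi> \<Longrightarrow> - \<alpha> \<in> \<Phi>"
proof -
  assume \<alpha>: "\<alpha> \<in> \<Phi>"
  then have "inner \<alpha> \<alpha> \<noteq> 0" using root_system by (auto simp: root_system_def)
  then have "cartan_number \<alpha> \<alpha> = 2" by (simp add: cartan_number_def)
  moreover have "\<alpha> - cartan_number \<alpha> \<alpha> *\<^sub>R \<alpha> \<in> \<Phi>" using root_system \<alpha> by (auto simp: root_system_def)
  moreover have "\<alpha> - 2 *\<^sub>R \<alpha> = - \<alpha>" by (simp add: scaleR_2)
  ultimately show ?thesis by simp
qed

lemma root_nonzero: "\<alpha> \<in> \<Phi> \<Longrightarrow> inner \<alpha> \<alpha> > 0"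
  using root_system by (auto simp: root_system_def)

lemma cartan_self: "\<alpha> \<in> \<Phi> \<Longrightarrow> cartan_number \<alpha> \<alpha> = 2"
  using root_nonzero[of \<alpha>] by (simp add: cartan_number_def)

lemma cartan_number_minus [simp]: "cartan_number (- \<beta>) \<alpha> = - cartan_number \<beta> \<alpha>"
  by (simp add: cartan_number_def)

definition coroot :: "'e \<Rightarrow> 'g" where "coroot \<alpha> = bracket (e \<alpha>) (e (- \<alpha>))"

lemma coroot:
  assumes "\<alpha> \<in> \<Phi>"
  shows "coroot \<alpha> \<in> H" "\<beta> \<in> \<Phi> \<Longrightarrow> r \<beta> (coroot \<alpha>) = of_real (cartan_number \<beta> \<alpha>)"
  using root_vectors assms unfolding chevalley_root_vectors_def coroot_def by blast+

lemma e_root_space: "\<alpha> \<in> \<Phi> \<Longrightarrow> h \<in> H \<Longrightarrow> bracket h (e \<alpha>) = scale (r \<alpha> h) (e \<alpha>)"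
  using root_vectors unfolding chevalley_root_vectors_def root_space_def by blast

lemma bracket_zero [simp]: "bracket 0 x = 0" "bracket x 0 = 0"
  using bracket_add_left[of 0 0 x] bracket_add_right[of x 0 0] by simp_all

lemma bracket_anti: "bracket x y = - bracket y x"
proof -
  have "bracket (x + y) (x + y) = bracket x y + bracket y x"
    unfolding bracket_add_left bracket_add_right by (simp add: bracket_self)
  then show ?thesis by (simp add: bracket_self eq_neg_iff_add_eq_0)
qed

lemma bracket_minus_right: "bracket x (- y) = - bracket x y"
  using bracket_add_right[of x y "- y"] by (simp add: eq_neg_iff_add_eq_0 add.commute)

lemma bracket_derivation: "bracket h (bracket x y) = bracket (bracket h x) y + bracket x (bracket h y)"
proof -
  have "bracket h (bracket x y) = - bracket x (bracket y h) - bracket y (bracket h x)"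
    using jacobi[of h x y] by (simp add: algebra_simps eq_neg_iff_add_eq_0)
  then show ?thesis
    by (simp add: bracket_anti[of y h] bracket_minus_right bracket_anti[of y "bracket h x"])
qed

text \<open>A nonzero bracket would be a vector of weight \<open>r \<alpha> + r \<beta>\<close>. If
  the weight is nonzero on \<open>H\<close>, it is a root, and its values at the coroots identify it
  with \<open>\<alpha> + \<beta>\<close>; if it is zero, they give
  \<open>\<alpha> + \<beta> = 0\<close>.\<close>

lemma bracket_not_root:
  assumes \<alpha>: "\<alpha> \<in> \<Phi>" and \<beta>: "\<beta> \<in> \<Phi>" and "\<alpha> + \<beta> \<notin> \<Phi>" "\<alpha> + \<beta> \<noteq> 0"
  shows "bracket (e \<alpha>) (e \<beta>) = 0"
proof (rule ccontr)
  let ?x = "bracket (e \<alpha>) (e \<beta>)"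
  \<comment> \<open>Restricted to \<open>H\<close>, since members of \<open>roots H\<close> are
    extensional functions.\<close>
  define a where "a = restrict (\<lambda>h. r \<alpha> h + r \<beta> h) H"
  assume "?x \<noteq> 0"
  have a: "a (coroot \<delta>) = of_real (cartan_number \<alpha> \<delta> + cartan_number \<beta> \<delta>)" if "\<delta> \<in> \<Phi>" for \<delta>
    using coroot[OF that] \<alpha> \<beta> by (simp add: a_def)
  have "bracket h ?x = scale (a h) ?x" if "h \<in> H" for h
    unfolding bracket_derivation[of h] e_root_space[OF \<alpha> that] e_root_space[OF \<beta> that]
    by (simp add: bracket_scale_left bracket_scale_right a_def that scale_left_distrib)
  then have "?x \<in> root_space H a" by (simp add: root_space_def)
  then have ne: "root_space H a \<noteq> {0}" using \<open>?x \<noteq> 0\<close> by auto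
  show False
  proof (cases "\<exists>h\<in>H. a h \<noteq> 0")
    case True
    then have "a \<in> complex_lie_algebra.roots scale bracket H" using ne by (simp add: roots_def a_def)
    moreover have "bij_betw r \<Phi> (complex_lie_algebra.roots scale bracket H)"
      using roots unfolding root_identification_def by blast
    ultimately obtain \<gamma> where \<gamma>: "\<gamma> \<in> \<Phi>" "a = r \<gamma>" by (auto simp: bij_betw_def)
    have "cartan_number \<gamma> \<delta> = cartan_number \<alpha> \<delta> + cartan_number \<beta> \<delta>" if "\<delta> \<in> \<Phi>" for \<delta>
    proof -
      have "complex_of_real (cartan_number \<gamma> \<delta>) = complex_of_real (cartan_number \<alpha> \<delta> + cartan_number \<beta> \<delta>)"
        using a[OF that] coroot(2)[OF that \<gamma>(1)] unfolding \<gamma>(2) by simp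
      then show ?thesis by (simp only: of_real_eq_iff)
    qed
    then have "\<gamma> = \<alpha> + \<beta>" by (rule cartan_numbers_determine[OF root_system])
    then show False using \<gamma>(1) assms(3) by simp
  next
    case False
    have "cartan_number 0 \<delta> = cartan_number \<alpha> \<delta> + cartan_number \<beta> \<delta>" if "\<delta> \<in> \<Phi>" for \<delta>
      using a[OF that] False coroot(1)[OF that] by (simp add: cartan_number_def[of 0]) (metis of_real_0 of_real_add of_real_eq_iff)
    then have "0 = \<alpha> + \<beta>" by (rule cartan_numbers_determine[OF root_system])
    then show False using assms(4) by simp
  qed
qed

text \<open>Otherwise the coroot would be 0 while \<open>r \<alpha>\<close> takes the value 2 there;
  but the bracket of 0 with a nonzero root vector is 0, not twice the vector.\<close>

lemma e_nonzero: assumes \<alpha>: "\<alpha> \<in> \<Phi>" shows "e \<alpha> \<noteq> 0"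
proof
  assume "e \<alpha> = 0"
  then have "coroot \<alpha> = 0" by (simp add: coroot_def)
  then have "0 \<in> H" "r \<alpha> 0 = 2" using coroot[OF \<alpha>] \<alpha> by (simp_all add: cartan_self)
  have "r \<alpha> \<in> complex_lie_algebra.roots scale bracket H" using roots \<alpha> unfolding root_identification_def by (auto simp: bij_betw_def)
  moreover have "0 \<in> root_space H (r \<alpha>)" by (simp add: root_space_def)
  ultimately obtain x where x: "x \<in> root_space H (r \<alpha>)" "x \<noteq> 0" by (auto simp: roots_def)
  then have "bracket 0 x = scale 2 x" using \<open>0 \<in> H\<close> \<open>r \<alpha> 0 = 2\<close> by (auto simp: root_space_def)
  then show False using x(2) by simp
qed

lemma \<pi>_zero [simp]: "\<pi> 0 = 0"
  using representation unfolding faithful_representation_def by (metis add_cancel_right_right)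

lemma \<pi>_minus: "\<pi> (- x) = - \<pi> x"
  using representation unfolding faithful_representation_def by (metis \<pi>_zero add.right_inverse add_eq_0_iff)

lemma \<pi>_scale: "\<pi> (scale c x) $ i $ j = c * \<pi> x $ i $ j"
  using representation unfolding faithful_representation_def by blast

lemma \<pi>_bracket: "\<pi> (bracket x y) = \<pi> x ** \<pi> y - \<pi> y ** \<pi> x"
  using representation unfolding faithful_representation_def by blast

definition commutator :: "'a::comm_ring_1^'n^'n \<Rightarrow> 'a^'n^'n \<Rightarrow> 'a^'n^'n" where
  "commutator A B = A ** B - B ** A"

lemma \<pi>_e: "\<beta> \<in> \<Phi> \<Longrightarrow> \<pi> (e \<beta>) = map_mat of_int (D \<beta> 1)"
  by (simp add: vec_eq_iff of_int_D matrix_power_Suc[of _ 0, simplified] matrix_power_0)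

lemma \<pi>_commutator_int:
  "commutator (map_mat of_int A) (map_mat of_int B) = map_mat of_int (commutator A B)"
  by (simp add: commutator_def vec_eq_iff flip: map_mat_of_int_mult)

text \<open>The root vectors as real matrices with integral entries; relations of the complex Lie
  algebra pass to them through the integers.\<close>

definition N :: "'e \<Rightarrow> real^'n^'n" where "N \<beta> = map_mat of_int (D \<beta> 1)"
definition T :: "'e \<Rightarrow> real^'n^'n" where "T \<beta> = commutator (N \<beta>) (N (- \<beta>))"

lemma commutator_int_eqI:
  assumes "\<pi> (e \<alpha>) ** \<pi> (e \<beta>) - \<pi> (e \<beta>) ** \<pi> (e \<alpha>) = map_mat of_int C" "\<alpha> \<in> \<Phi>" "\<beta> \<in> \<Phi>"
  shows "commutator (N \<alpha>) (N \<beta>) = map_mat of_int C"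
proof -
  have "map_mat of_int (commutator (D \<alpha> 1) (D \<beta> 1)) = (map_mat of_int C :: complex^'n^'n)"
    using assms(1) unfolding \<pi>_e[OF assms(2)] \<pi>_e[OF assms(3)] commutator_def[symmetric] \<pi>_commutator_int .
  then have "commutator (D \<alpha> 1) (D \<beta> 1) = C" by (simp add: vec_eq_iff)
  then show ?thesis by (simp add: N_def \<pi>_commutator_int)
qed

lemma commutator_N_not_root:
  assumes "\<alpha> \<in> \<Phi>" "\<beta> \<in> \<Phi>" "\<alpha> + \<beta> \<notin> \<Phi>" "\<alpha> + \<beta> \<noteq> 0" shows "commutator (N \<alpha>) (N \<beta>) = 0"
proof -
  have "commutator (N \<alpha>) (N \<beta>) = map_mat of_int 0"
    by (rule commutator_int_eqI) (use assms bracket_not_root[OF assms] in \<open>simp_all add: vec_eq_iff flip: \<pi>_bracket\<close>)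
  then show ?thesis by (simp add: vec_eq_iff)
qed

lemma commutator_N_root:
  assumes "\<alpha> \<in> \<Phi>" "\<beta> \<in> \<Phi>" "\<alpha> + \<beta> \<in> \<Phi>" shows "\<exists>c. commutator (N \<alpha>) (N \<beta>) = c *\<^sub>R N (\<alpha> + \<beta>)"
proof -
  obtain p where "bracket (e \<alpha>) (e \<beta>) = scale (of_nat (p + 1)) (e (\<alpha> + \<beta>)) \<or>
      bracket (e \<alpha>) (e \<beta>) = - scale (of_nat (p + 1)) (e (\<alpha> + \<beta>))"
    using root_vectors assms unfolding chevalley_root_vectors_def Let_def by blast
  then obtain k :: int where "\<pi> (bracket (e \<alpha>) (e \<beta>)) = (\<chi> i j. of_int k * \<pi> (e (\<alpha> + \<beta>)) $ i $ j)"
  proof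
    assume "bracket (e \<alpha>) (e \<beta>) = scale (of_nat (p + 1)) (e (\<alpha> + \<beta>))"
    then show ?thesis by (intro that[of "int (p + 1)"]) (simp add: vec_eq_iff \<pi>_scale del: of_nat_add)
  next
    assume "bracket (e \<alpha>) (e \<beta>) = - scale (of_nat (p + 1)) (e (\<alpha> + \<beta>))"
    then have "\<pi> (bracket (e \<alpha>) (e \<beta>)) = - \<pi> (scale (of_nat (p + 1)) (e (\<alpha> + \<beta>)))" by (simp only: \<pi>_minus)
    moreover have "complex_of_int (- int (p + 1)) = - of_nat (p + 1)" by simp
    ultimately show ?thesis
      by (intro that[of "- int (p + 1)"]) (simp only: vec_eq_iff \<pi>_scale vector_uminus_component vec_lambda_beta mult_minus_left simp_thms)
  qed
  then have "\<pi> (e \<alpha>) ** \<pi> (e \<beta>) - \<pi> (e \<beta>) ** \<pi> (e \<alpha>) = map_mat of_int (\<chi> i j. k * D (\<alpha> + \<beta>) 1 $ i $ j)"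
    by (simp add: \<pi>_bracket \<pi>_e[OF assms(3)] vec_eq_iff)
  from commutator_int_eqI[OF this assms(1,2)] show ?thesis
    by (intro exI[of _ "of_int k"]) (simp add: vec_eq_iff N_def)
qed

lemma commutator_T_N:
  assumes "\<gamma> \<in> \<Phi>" "\<beta> \<in> \<Phi>" shows "commutator (T \<gamma>) (N \<beta>) = cartan_number \<beta> \<gamma> *\<^sub>R N \<beta>"
proof -
  have "cartan_number \<beta> \<gamma> \<in> \<int>" using root_system assms by (simp add: root_system_def)
  then obtain m where m: "cartan_number \<beta> \<gamma> = of_int m" by (elim Ints_cases)
  have "bracket (coroot \<gamma>) (e \<beta>) = scale (of_int m) (e \<beta>)"
    using e_root_space[OF assms(2) coroot(1)[OF assms(1)]] coroot(2)[OF assms] by (simp add: m)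
  moreover have "commutator (\<pi> (coroot \<gamma>)) (\<pi> (e \<beta>)) = \<pi> (bracket (coroot \<gamma>) (e \<beta>))"
    by (simp add: commutator_def \<pi>_bracket)
  ultimately have "commutator (\<pi> (coroot \<gamma>)) (\<pi> (e \<beta>)) = map_mat of_int (\<chi> i j. m * D \<beta> 1 $ i $ j)"
    by (simp add: vec_eq_iff \<pi>_scale \<pi>_e[OF assms(2)])
  moreover have "\<pi> (coroot \<gamma>) = map_mat of_int (commutator (D \<gamma> 1) (D (- \<gamma>) 1))"
    by (simp add: coroot_def \<pi>_bracket \<pi>_e[OF assms(1)] \<pi>_e[OF neg_root[OF assms(1)]] flip: commutator_def \<pi>_commutator_int)
  ultimately have "map_mat of_int (commutator (commutator (D \<gamma> 1) (D (- \<gamma>) 1)) (D \<beta> 1)) =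
      (map_mat of_int (\<chi> i j. m * D \<beta> 1 $ i $ j) :: complex^'n^'n)"
    by (simp add: \<pi>_e[OF assms(2)] \<pi>_commutator_int)
  then have "commutator (commutator (D \<gamma> 1) (D (- \<gamma>) 1)) (D \<beta> 1) = (\<chi> i j. m * D \<beta> 1 $ i $ j)"
    by (simp add: vec_eq_iff flip: of_int_mult)
  then show ?thesis
    by (simp add: T_def N_def \<pi>_commutator_int m vec_eq_iff)
qed

lemma N_nonzero: assumes "\<alpha> \<in> \<Phi>" shows "N \<alpha> \<noteq> 0"
proof
  assume "N \<alpha> = 0"
  then have "\<pi> (e \<alpha>) = \<pi> 0" by (simp add: \<pi>_e[OF assms] N_def vec_eq_iff)
  then have "e \<alpha> = 0" using representation unfolding faithful_representation_def by (meson injD)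
  then show False using e_nonzero[OF assms] by simp
qed

end

section \<open>One-parameter subgroups and tori\<close>

lemma bounded_bilinear_matrix_mult: "bounded_bilinear ((**) :: real^'n^'n \<Rightarrow> real^'n^'n \<Rightarrow> real^'n^'n)"
  unfolding bilinear_conv_bounded_bilinear[symmetric] bilinear_def
  by (auto intro!: linearI simp: vec_eq_iff matrix_matrix_mult_def sum.distrib algebra_simps sum_distrib_left)

interpretation matrix_mult: bounded_bilinear "(**) :: real^'n^'n \<Rightarrow> real^'n^'n \<Rightarrow> real^'n^'n"
  by (rule bounded_bilinear_matrix_mult)

lemma has_vector_derivative_mult_const_left:
  fixes M :: "real^'n^'n" and f :: "real \<Rightarrow> real^'n^'n"
  assumes "(f has_vector_derivative f') (at x)" shows "((\<lambda>t. M ** f t) has_vector_derivative (M ** f')) (at x)"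
  using matrix_mult.has_vector_derivative[OF has_vector_derivative_const[of M] assms] by simp

lemma has_vector_derivative_mult_const_right:
  fixes M :: "real^'n^'n" and f :: "real \<Rightarrow> real^'n^'n"
  assumes "(f has_vector_derivative f') (at x)" shows "((\<lambda>t. f t ** M) has_vector_derivative (f' ** M)) (at x)"
  using matrix_mult.has_vector_derivative[OF assms has_vector_derivative_const[of M]] by simp

lemma has_vector_derivative_reparam:
  assumes "(f has_vector_derivative f') (at (g x))" "(g has_real_derivative g') (at x)"
  shows "((\<lambda>t. f (g t)) has_vector_derivative (g' *\<^sub>R f')) (at x)"
  using vector_diff_chain_at[of g g' x f f'] assms
  by (simp add: has_real_derivative_iff_has_vector_derivative comp_def)

lemma vector_derivative_unique_solution:
  fixes f g :: "real \<Rightarrow> 'a::real_normed_vector"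
  assumes "\<And>t. (f has_vector_derivative f' t) (at t)" "\<And>t. (g has_vector_derivative f' t) (at t)" "f 0 = g 0"
  shows "f t = g t"
proof -
  have "((\<lambda>t. f t - g t) has_vector_derivative 0) (at t within UNIV)" for t
    using has_vector_derivative_diff[OF assms(1)[of t] assms(2)[of t]] by simp
  then obtain c where "\<And>t. f t - g t = c"
    using has_vector_derivative_zero_constant[of UNIV "\<lambda>t. f t - g t"] by auto
  from this[of t] this[of 0] show ?thesis using assms(3) by simp
qed

text \<open>Independence of eigenvectors, by applying \<open>A - \<mu> j\<close>. The
  \<open>\<mu> i\<close> differ from \<open>l\<close> but may coincide with each other.\<close>

lemma eigenvector_sum_zero:
  fixes A :: "'a::real_vector \<Rightarrow> 'a"
  assumes "linear A" "finite S" "\<And>i. i \<in> S \<Longrightarrow> A (x i) = \<mu> i *\<^sub>R x i" "\<And>i. i \<in> S \<Longrightarrow> \<mu> i \<noteq> l"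
    "A (sum x S) = l *\<^sub>R sum x S"
  shows "sum x S = 0"
  using assms(2-)
proof (induction S arbitrary: x)
  case (insert j S)
  have "A (sum x S) = (\<Sum>i\<in>S. \<mu> i *\<^sub>R x i)"
    unfolding linear_sum[OF assms(1)] using insert.prems by (intro sum.cong) auto
  then have "l *\<^sub>R sum x (insert j S) - \<mu> j *\<^sub>R sum x (insert j S) = (\<Sum>i\<in>S. \<mu> i *\<^sub>R x i) - \<mu> j *\<^sub>R sum x S"
    using insert.prems(1)[of j] insert.hyps unfolding insert.prems(3)[symmetric]
    by (simp add: linear_add[OF assms(1)] scaleR_add_right)
  also have "\<dots> = (\<Sum>i\<in>S. (\<mu> i - \<mu> j) *\<^sub>R x i)"
    by (simp add: scaleR_sum_right scaleR_diff_left sum_subtractf)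
  finally have eq: "(\<Sum>i\<in>S. (\<mu> i - \<mu> j) *\<^sub>R x i) = (l - \<mu> j) *\<^sub>R sum x (insert j S)"
    by (simp only: scaleR_diff_left)
  have "(\<Sum>i\<in>S. (\<mu> i - \<mu> j) *\<^sub>R x i) = 0"
  proof (rule insert.IH)
    show "A ((\<mu> i - \<mu> j) *\<^sub>R x i) = \<mu> i *\<^sub>R (\<mu> i - \<mu> j) *\<^sub>R x i" if "i \<in> S" for i
      using insert.prems(1)[of i] that by (simp add: linear_cmul[OF assms(1)] mult.commute)
    show "A (\<Sum>i\<in>S. (\<mu> i - \<mu> j) *\<^sub>R x i) = l *\<^sub>R (\<Sum>i\<in>S. (\<mu> i - \<mu> j) *\<^sub>R x i)"
      unfolding eq linear_cmul[OF assms(1)] insert.prems(3) by (simp add: mult.commute)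
  qed (use insert.prems(2) in blast)
  then show ?case using eq insert.prems(2)[of j] by simp
qed simp

text \<open>\<open>S\<close> may be linearly dependent: its members with eigenvalue other than
  \<open>l\<close> contribute 0 in total by the preceding lemma, which leaves a multiple of
  \<open>v\<close>.\<close>

lemma eigenvector_in_span:
  fixes A :: "'a::real_vector \<Rightarrow> 'a"
  assumes A: "linear A" and "finite S" "x \<in> span S" "A x = l *\<^sub>R x"
    and eigen: "\<And>s. s \<in> S \<Longrightarrow> \<exists>\<mu>. A s = \<mu> *\<^sub>R s \<and> (\<mu> = l \<longrightarrow> s = v)"
  shows "\<exists>c. x = c *\<^sub>R v"
proof -
  obtain \<mu> where \<mu>: "\<And>s. s \<in> S \<Longrightarrow> A s = \<mu> s *\<^sub>R s" "\<And>s. s \<in> S \<Longrightarrow> \<mu> s = l \<Longrightarrow> s = v"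
    using eigen by metis
  obtain u where x: "x = (\<Sum>s\<in>S. u s *\<^sub>R s)" using assms(2,3) by (auto simp: span_finite)
  define S1 S2 where "S1 = {s \<in> S. \<mu> s = l}" and "S2 = {s \<in> S. \<mu> s \<noteq> l}"
  have fin: "finite S1" "finite S2" using assms(2) by (auto simp: S1_def S2_def)
  have split: "x = (\<Sum>s\<in>S1. u s *\<^sub>R s) + (\<Sum>s\<in>S2. u s *\<^sub>R s)"
    unfolding x by (subst sum.union_disjoint[symmetric]) (use fin in \<open>auto simp: S1_def S2_def intro: sum.cong\<close>)
  have A1: "A (\<Sum>s\<in>S1. u s *\<^sub>R s) = l *\<^sub>R (\<Sum>s\<in>S1. u s *\<^sub>R s)"
    unfolding linear_sum[OF A] scaleR_sum_right
    by (rule sum.cong) (auto simp: S1_def linear_cmul[OF A] \<mu>(1) mult.commute)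
  have "(\<Sum>s\<in>S2. u s *\<^sub>R s) = 0"
  proof (rule eigenvector_sum_zero[OF A fin(2)])
    show "A (u s *\<^sub>R s) = \<mu> s *\<^sub>R u s *\<^sub>R s" if "s \<in> S2" for s
      using that by (simp add: S2_def linear_cmul[OF A] \<mu>(1) mult.commute)
    show "\<mu> s \<noteq> l" if "s \<in> S2" for s using that by (simp add: S2_def)
    have "A (\<Sum>s\<in>S2. u s *\<^sub>R s) = A x - A (\<Sum>s\<in>S1. u s *\<^sub>R s)"
      using linear_diff[OF A, of x "\<Sum>s\<in>S1. u s *\<^sub>R s"] by (simp add: split)
    then show "A (\<Sum>s\<in>S2. u s *\<^sub>R s) = l *\<^sub>R (\<Sum>s\<in>S2. u s *\<^sub>R s)"
      unfolding assms(4) A1 using split by (simp add: scaleR_add_right)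
  qed
  moreover have "S1 = {} \<or> S1 = {v}" using \<mu>(2) by (auto simp: S1_def)
  ultimately have "x = 0 *\<^sub>R v \<or> x = u v *\<^sub>R v" using split by auto
  then show ?thesis by blast
qed

section \<open>Conjugation by root elements\<close>

context chevalley_data
begin

lemma X_eq_sum:
  assumes "\<beta> \<in> \<Phi>"
  shows "X \<beta> t = (\<Sum>k<Suc D_bound. t ^ k *\<^sub>R (map_mat of_int (D \<beta> k) :: real^'n^'n))"
  by (simp add: vec_eq_iff X_nth_more[OF assms, of "Suc D_bound"] del: sum.lessThan_Suc)

lemma N_mult_D: "\<beta> \<in> \<Phi> \<Longrightarrow> N \<beta> ** map_mat of_int (D \<beta> k) = real (Suc k) *\<^sub>R map_mat of_int (D \<beta> (Suc k))"
  using D_mult[of \<beta> 1 k] by (simp add: N_def vec_eq_iff flip: map_mat_of_int_mult)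

lemma D_mult_N: "\<beta> \<in> \<Phi> \<Longrightarrow> map_mat of_int (D \<beta> k) ** N \<beta> = real (Suc k) *\<^sub>R map_mat of_int (D \<beta> (Suc k))"
  using D_mult[of \<beta> k 1] by (simp add: N_def vec_eq_iff flip: map_mat_of_int_mult)

lemma N_X_commute: "\<beta> \<in> \<Phi> \<Longrightarrow> N \<beta> ** X \<beta> t = X \<beta> t ** N \<beta>"
  unfolding X_eq_sum matrix_mult.sum_right matrix_mult.sum_left
  by (simp add: matrix_mult.scaleR_left matrix_mult.scaleR_right N_mult_D D_mult_N del: sum.lessThan_Suc)

lemma X_has_vector_derivative:
  assumes "\<beta> \<in> \<Phi>" shows "(X \<beta> has_vector_derivative N \<beta> ** X \<beta> t) (at t)"
proof -
  let ?A = "\<lambda>k. map_mat of_int (D \<beta> k) :: real^'n^'n"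
  have "((\<lambda>t. \<Sum>k<Suc D_bound. t ^ k *\<^sub>R ?A k) has_vector_derivative
      (\<Sum>k<Suc D_bound. (real k * t ^ (k - 1)) *\<^sub>R ?A k)) (at t)"
    by (rule has_vector_derivative_sum)
       (auto intro!: has_vector_derivative_scaleR[THEN has_vector_derivative_eq_rhs] derivative_eq_intros)
  also have "(\<Sum>k<Suc D_bound. (real k * t ^ (k - 1)) *\<^sub>R ?A k) = (\<Sum>k<D_bound. (real (Suc k) * t ^ k) *\<^sub>R ?A (Suc k))"
    by (subst sum.lessThan_Suc_shift) simp
  also have "\<dots> = N \<beta> ** X \<beta> t"
  proof -
    have "?A (Suc D_bound) = 0" using D_bound[OF assms, of "Suc D_bound"] by (simp add: vec_eq_iff)
    then show ?thesis unfolding X_eq_sum[OF assms] matrix_mult.sum_right matrix_mult.scaleR_right N_mult_D[OF assms]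
      by (simp add: mult.commute del: of_nat_Suc)
  qed
  finally have "((\<lambda>t. \<Sum>k<Suc D_bound. t ^ k *\<^sub>R ?A k) has_vector_derivative N \<beta> ** X \<beta> t) (at t)" .
  moreover have "X \<beta> = (\<lambda>t. \<Sum>k<Suc D_bound. t ^ k *\<^sub>R ?A k)" by (rule ext) (rule X_eq_sum[OF assms])
  ultimately show ?thesis by (simp only:)
qed

definition conj_X :: "'e \<Rightarrow> real \<Rightarrow> real^'n^'n \<Rightarrow> real^'n^'n" where
  "conj_X \<beta> t Y = X \<beta> t ** Y ** X \<beta> (- t)"

lemma linear_conj_X: "linear (conj_X \<beta> t)"
  unfolding conj_X_def
  by (intro linearI) (simp_all add: matrix_mult.add_left matrix_mult.add_right matrix_mult.scaleR_left matrix_mult.scaleR_right)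

lemma conj_X_simps:
  "conj_X \<beta> t (Y + Z) = conj_X \<beta> t Y + conj_X \<beta> t Z" "conj_X \<beta> t (Y - Z) = conj_X \<beta> t Y - conj_X \<beta> t Z"
  "conj_X \<beta> t (c *\<^sub>R Y) = c *\<^sub>R conj_X \<beta> t Y" "conj_X \<beta> t (- Y) = - conj_X \<beta> t Y"
  using linear_add[OF linear_conj_X] linear_diff[OF linear_conj_X] linear_cmul[OF linear_conj_X] linear_neg[OF linear_conj_X]
  by blast+

lemma conj_X_0: "\<beta> \<in> \<Phi> \<Longrightarrow> conj_X \<beta> 0 Y = Y"
  by (simp add: conj_X_def X_0)

text \<open>The derivative is again a conjugate, of the commutator with \<open>N \<beta>\<close>.
  Once iterated commutators vanish, integration gives the conjugate as a polynomial in
  \<open>t\<close>.\<close>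

lemma conj_X_has_vector_derivative:
  assumes \<beta>: "\<beta> \<in> \<Phi>"
  shows "((\<lambda>t. conj_X \<beta> t Y) has_vector_derivative conj_X \<beta> t (commutator (N \<beta>) Y)) (at t)"
proof -
  have 1: "((\<lambda>t. X \<beta> t ** Y) has_vector_derivative N \<beta> ** X \<beta> t ** Y) (at t)"
    by (rule has_vector_derivative_mult_const_right[OF X_has_vector_derivative[OF \<beta>]])
  have 2: "((\<lambda>t. X \<beta> (- t)) has_vector_derivative (- 1) *\<^sub>R (N \<beta> ** X \<beta> (- t))) (at t)"
    by (rule has_vector_derivative_reparam[OF X_has_vector_derivative[OF \<beta>]]) (auto intro!: derivative_eq_intros)
  have "((\<lambda>t. conj_X \<beta> t Y) has_vector_derivative
      (X \<beta> t ** Y) ** ((- 1) *\<^sub>R (N \<beta> ** X \<beta> (- t))) + (N \<beta> ** X \<beta> t ** Y) ** X \<beta> (- t)) (at t)"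
    unfolding conj_X_def by (rule matrix_mult.has_vector_derivative[OF 1 2])
  also have "(X \<beta> t ** Y) ** ((- 1) *\<^sub>R (N \<beta> ** X \<beta> (- t))) + (N \<beta> ** X \<beta> t ** Y) ** X \<beta> (- t) =
      conj_X \<beta> t (commutator (N \<beta>) Y)"
    unfolding conj_X_def commutator_def N_X_commute[OF \<beta>, of t]
    by (simp add: matrix_mult.minus_right matrix_mult.diff_left matrix_mult.diff_right matrix_mul_assoc)
  finally show ?thesis .
qed

lemma conj_X_fixed:
  assumes "\<beta> \<in> \<Phi>" "commutator (N \<beta>) Y = 0" shows "conj_X \<beta> t Y = Y"
proof (rule vector_derivative_unique_solution)
  show "((\<lambda>t. conj_X \<beta> t Y) has_vector_derivative conj_X \<beta> t (commutator (N \<beta>) Y)) (at t)" for t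
    by (rule conj_X_has_vector_derivative[OF assms(1)])
  show "((\<lambda>t. Y) has_vector_derivative conj_X \<beta> t (commutator (N \<beta>) Y)) (at t)" for t
    by (simp add: assms(2) conj_X_def)
qed (simp add: conj_X_0 assms)

lemma conj_X_linear:
  assumes "\<beta> \<in> \<Phi>" "commutator (N \<beta>) Y = Z" "commutator (N \<beta>) Z = 0"
  shows "conj_X \<beta> t Y = Y + t *\<^sub>R Z"
proof (rule vector_derivative_unique_solution)
  show "((\<lambda>t. conj_X \<beta> t Y) has_vector_derivative Z) (at t)" for t
    using conj_X_has_vector_derivative[OF assms(1), of Y t] conj_X_fixed[OF assms(1,3)] assms(2) by simp
  show "((\<lambda>t. Y + t *\<^sub>R Z) has_vector_derivative Z) (at t)" for t
    by (auto intro!: derivative_eq_intros)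
qed (simp add: conj_X_0 assms)

lemma conj_X_quadratic:
  assumes "\<beta> \<in> \<Phi>" "commutator (N \<beta>) Y = Z" "commutator (N \<beta>) Z = W" "commutator (N \<beta>) W = 0"
  shows "conj_X \<beta> t Y = Y + t *\<^sub>R Z + (t\<^sup>2 / 2) *\<^sub>R W"
proof (rule vector_derivative_unique_solution[where f = "\<lambda>t. conj_X \<beta> t Y" and g = "\<lambda>t. Y + t *\<^sub>R Z + (t\<^sup>2 / 2) *\<^sub>R W"])
  show "((\<lambda>t. conj_X \<beta> t Y) has_vector_derivative (Z + t *\<^sub>R W)) (at t)" for t
    using conj_X_has_vector_derivative[OF assms(1), of Y t] conj_X_linear[OF assms(1,3,4)] assms(2) by simp
  show "((\<lambda>t. Y + t *\<^sub>R Z + (t\<^sup>2 / 2) *\<^sub>R W) has_vector_derivative (Z + t *\<^sub>R W)) (at t)" for t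
    by (auto intro!: derivative_eq_intros)
qed (simp add: conj_X_0 assms)

lemma commutator_simps:
  fixes A B C :: "real^'n^'n"
  shows "commutator A A = 0" "commutator A B = - commutator B A" "commutator A (c *\<^sub>R B) = c *\<^sub>R commutator A B"
    "commutator A (- B) = - commutator A B" "commutator A 0 = 0" "commutator A (B + C) = commutator A B + commutator A C"
  by (simp_all add: commutator_def matrix_mult.scaleR_left matrix_mult.scaleR_right matrix_mult.minus_left matrix_mult.minus_right
     matrix_mult.zero_left matrix_mult.zero_right matrix_mult.add_left matrix_mult.add_right scaleR_diff_right)

lemma T_minus: "T (- \<alpha>) = - T \<alpha>"
  using commutator_simps(2)[of "N (- \<alpha>)" "N \<alpha>"] by (simp add: T_def)

lemma commutator_N_T: "\<alpha> \<in> \<Phi> \<Longrightarrow> \<gamma> \<in> \<Phi> \<Longrightarrow> commutator (N \<alpha>) (T \<gamma>) = (- cartan_number \<alpha> \<gamma>) *\<^sub>R N \<alpha>"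
  using commutator_T_N[of \<gamma> \<alpha>] commutator_simps(2)[of "N \<alpha>" "T \<gamma>"] by simp

lemma sl2_relations:
  assumes \<alpha>: "\<alpha> \<in> \<Phi>"
  shows "commutator (N \<alpha>) (N (- \<alpha>)) = T \<alpha>" "commutator (N \<alpha>) (T \<alpha>) = (- 2) *\<^sub>R N \<alpha>"
    "commutator (N (- \<alpha>)) (N \<alpha>) = - T \<alpha>" "commutator (N (- \<alpha>)) (T \<alpha>) = 2 *\<^sub>R N (- \<alpha>)"
  using commutator_N_T[OF \<alpha> \<alpha>] commutator_N_T[OF neg_root[OF \<alpha>] \<alpha>] T_minus[of \<alpha>] cartan_self[OF \<alpha>]
  by (simp_all add: T_def)

lemma conj_X_sl2:
  assumes \<alpha>: "\<alpha> \<in> \<Phi>"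
  shows "conj_X \<alpha> t (N \<alpha>) = N \<alpha>" "conj_X \<alpha> t (T \<alpha>) = T \<alpha> - (2 * t) *\<^sub>R N \<alpha>"
    "conj_X \<alpha> t (N (- \<alpha>)) = N (- \<alpha>) + t *\<^sub>R T \<alpha> - t\<^sup>2 *\<^sub>R N \<alpha>"
    "conj_X (- \<alpha>) t (N (- \<alpha>)) = N (- \<alpha>)" "conj_X (- \<alpha>) t (T \<alpha>) = T \<alpha> + (2 * t) *\<^sub>R N (- \<alpha>)"
    "conj_X (- \<alpha>) t (N \<alpha>) = N \<alpha> - t *\<^sub>R T \<alpha> - t\<^sup>2 *\<^sub>R N (- \<alpha>)"
proof -
  note rel = sl2_relations[OF \<alpha>] and \<alpha>' = neg_root[OF \<alpha>]
  note c = commutator_simps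
  show "conj_X \<alpha> t (N \<alpha>) = N \<alpha>" by (rule conj_X_fixed[OF \<alpha> c(1)])
  show "conj_X \<alpha> t (T \<alpha>) = T \<alpha> - (2 * t) *\<^sub>R N \<alpha>"
    using conj_X_linear[OF \<alpha> rel(2), of t] by (simp add: c(1,3,4) mult.commute)
  show "conj_X \<alpha> t (N (- \<alpha>)) = N (- \<alpha>) + t *\<^sub>R T \<alpha> - t\<^sup>2 *\<^sub>R N \<alpha>"
    using conj_X_quadratic[OF \<alpha> rel(1,2), of t] by (simp add: c(1,3,4))
  show "conj_X (- \<alpha>) t (N (- \<alpha>)) = N (- \<alpha>)" by (rule conj_X_fixed[OF \<alpha>' c(1)])
  show "conj_X (- \<alpha>) t (T \<alpha>) = T \<alpha> + (2 * t) *\<^sub>R N (- \<alpha>)"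
    using conj_X_linear[OF \<alpha>' rel(4), of t] by (simp add: c(1,3,4) mult.commute)
  have "commutator (N (- \<alpha>)) (- T \<alpha>) = (- 2) *\<^sub>R N (- \<alpha>)" using rel(4) by (simp add: c(4))
  from conj_X_quadratic[OF \<alpha>' rel(3) this, of t]
  show "conj_X (- \<alpha>) t (N \<alpha>) = N \<alpha> - t *\<^sub>R T \<alpha> - t\<^sup>2 *\<^sub>R N (- \<alpha>)" by (simp add: c(1,3,4))
qed

section \<open>Weyl group representatives and tori\<close>

definition w :: "'e \<Rightarrow> real \<Rightarrow> real^'n^'n" where
  "w \<alpha> t = X \<alpha> t ** X (- \<alpha>) (- 1 / t) ** X \<alpha> t"

text \<open>Valid also for \<open>t = 0\<close>, where \<open>- 1 / t\<close> is 0 and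
  \<open>w \<alpha> t\<close> is the identity.\<close>

lemma w_inverse: "\<alpha> \<in> \<Phi> \<Longrightarrow> w \<alpha> t ** w \<alpha> (- t) = mat 1"
proof -
  assume \<alpha>: "\<alpha> \<in> \<Phi>"
  have "w \<alpha> t ** w \<alpha> (- t) = X \<alpha> t ** X (- \<alpha>) (- 1 / t) ** (X \<alpha> t ** X \<alpha> (- t)) ** X (- \<alpha>) (1 / t) ** X \<alpha> (- t)"
    by (simp add: w_def matrix_mul_assoc)
  also have "\<dots> = X \<alpha> t ** (X (- \<alpha>) (- 1 / t) ** X (- \<alpha>) (1 / t)) ** X \<alpha> (- t)"
    by (simp add: X_inverse(1)[OF \<alpha>] matrix_mul_assoc)
  also have "\<dots> = mat 1"
    using X_inverse(1)[OF neg_root[OF \<alpha>], of "- 1 / t"] by (simp add: X_inverse(1)[OF \<alpha>])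
  finally show ?thesis .
qed

lemma conj_w: "w \<alpha> t ** Y ** w \<alpha> (- t) = conj_X \<alpha> t (conj_X (- \<alpha>) (- 1 / t) (conj_X \<alpha> t Y))"
  by (simp add: w_def conj_X_def matrix_mul_assoc)

lemma w_conj_N: "\<alpha> \<in> \<Phi> \<Longrightarrow> t \<noteq> 0 \<Longrightarrow> w \<alpha> t ** N \<alpha> ** w \<alpha> (- t) = (- 1 / t\<^sup>2) *\<^sub>R N (- \<alpha>)"
  unfolding conj_w
  by (simp add: conj_X_sl2 conj_X_simps scaleR_diff_right scaleR_add_right power2_eq_square)
     (simp add: vec_eq_iff field_simps)

lemma w_conj_T: "\<alpha> \<in> \<Phi> \<Longrightarrow> t \<noteq> 0 \<Longrightarrow> w \<alpha> t ** T \<alpha> ** w \<alpha> (- t) = - T \<alpha>"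
  unfolding conj_w
  by (simp add: conj_X_sl2 conj_X_simps scaleR_diff_right scaleR_add_right power2_eq_square)
     (simp add: vec_eq_iff field_simps)

lemma w_mult_right: "\<alpha> \<in> \<Phi> \<Longrightarrow> w \<alpha> t ** Y = (w \<alpha> t ** Y ** w \<alpha> (- t)) ** w \<alpha> t"
  using w_inverse[of \<alpha> "- t"] by (simp flip: matrix_mul_assoc)

text \<open>The logarithmic derivative of \<open>w \<alpha>\<close> is
  \<open>T \<alpha> / t\<close>: with all root vectors moved to the left, the terms in
  \<open>N \<alpha>\<close> and \<open>N (- \<alpha>)\<close> cancel. It makes the torus act by
  powers of \<open>t\<close>.\<close>

lemma w_has_vector_derivative:
  assumes \<alpha>: "\<alpha> \<in> \<Phi>" and t: "t \<noteq> 0"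
  shows "(w \<alpha> has_vector_derivative (1 / t) *\<^sub>R (T \<alpha> ** w \<alpha> t)) (at t)"
proof -
  let ?x = "X \<alpha> t" and ?y = "X (- \<alpha>) (- 1 / t)"
  have dy: "((\<lambda>t. X (- \<alpha>) (- 1 / t)) has_vector_derivative (1 / t\<^sup>2) *\<^sub>R (N (- \<alpha>) ** ?y)) (at t)"
    by (rule has_vector_derivative_reparam[OF X_has_vector_derivative[OF neg_root[OF \<alpha>]]])
       (use t in \<open>auto intro!: derivative_eq_intros simp: power2_eq_square\<close>)
  note dx = X_has_vector_derivative[OF \<alpha>, of t]
  have "(w \<alpha> has_vector_derivative
      (?x ** ?y) ** (N \<alpha> ** ?x) + (?x ** ((1 / t\<^sup>2) *\<^sub>R (N (- \<alpha>) ** ?y)) + (N \<alpha> ** ?x) ** ?y) ** ?x) (at t)"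
    unfolding w_def[abs_def] by (intro matrix_mult.has_vector_derivative dx dy)
  also have "(?x ** ?y) ** (N \<alpha> ** ?x) + (?x ** ((1 / t\<^sup>2) *\<^sub>R (N (- \<alpha>) ** ?y)) + (N \<alpha> ** ?x) ** ?y) ** ?x =
      w \<alpha> t ** N \<alpha> + (1 / t\<^sup>2) *\<^sub>R (?x ** N (- \<alpha>) ** ?y ** ?x) + N \<alpha> ** w \<alpha> t"
    unfolding N_X_commute[OF \<alpha>, of t]
    by (simp add: w_def matrix_mult.add_left matrix_mult.scaleR_left matrix_mult.scaleR_right matrix_mul_assoc)
       (simp add: N_X_commute[OF \<alpha>])
  also have "?x ** N (- \<alpha>) ** ?y ** ?x = conj_X \<alpha> t (N (- \<alpha>)) ** w \<alpha> t"
  proof -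
    have "conj_X \<alpha> t (N (- \<alpha>)) ** w \<alpha> t = ?x ** N (- \<alpha>) ** (X \<alpha> (- t) ** ?x) ** ?y ** ?x"
      by (simp add: conj_X_def w_def matrix_mul_assoc)
    then show ?thesis by (simp add: X_inverse(2)[OF \<alpha>])
  qed
  also have "w \<alpha> t ** N \<alpha> = ((- 1 / t\<^sup>2) *\<^sub>R N (- \<alpha>)) ** w \<alpha> t"
    using w_mult_right[OF \<alpha>, of t "N \<alpha>"] w_conj_N[OF \<alpha> t] by simp
  also have "((- 1 / t\<^sup>2) *\<^sub>R N (- \<alpha>)) ** w \<alpha> t + (1 / t\<^sup>2) *\<^sub>R (conj_X \<alpha> t (N (- \<alpha>)) ** w \<alpha> t) + N \<alpha> ** w \<alpha> t =
      ((- 1 / t\<^sup>2) *\<^sub>R N (- \<alpha>) + (1 / t\<^sup>2) *\<^sub>R conj_X \<alpha> t (N (- \<alpha>)) + N \<alpha>) ** w \<alpha> t"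
    by (simp add: matrix_mult.add_left matrix_mult.scaleR_left matrix_mult.diff_left matrix_mult.minus_left)
  also have "(- 1 / t\<^sup>2) *\<^sub>R N (- \<alpha>) + (1 / t\<^sup>2) *\<^sub>R conj_X \<alpha> t (N (- \<alpha>)) + N \<alpha> = (1 / t) *\<^sub>R T \<alpha>"
    using t by (simp add: conj_X_sl2[OF \<alpha>] scaleR_diff_right scaleR_add_right power2_eq_square)
  finally show ?thesis by (simp add: matrix_mult.scaleR_left)
qed

definition h :: "'e \<Rightarrow> real \<Rightarrow> real^'n^'n" where "h \<alpha> t = w \<alpha> t ** w \<alpha> (- 1)"
definition h_inv :: "'e \<Rightarrow> real \<Rightarrow> real^'n^'n" where "h_inv \<alpha> t = w \<alpha> 1 ** w \<alpha> (- t)"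

lemma w_inverse': "\<alpha> \<in> \<Phi> \<Longrightarrow> w \<alpha> (- t) ** w \<alpha> t = mat 1"
  using w_inverse[of \<alpha> "- t"] by simp

lemma h_inverse:
  assumes "\<alpha> \<in> \<Phi>" shows "h \<alpha> t ** h_inv \<alpha> t = mat 1" "h_inv \<alpha> t ** h \<alpha> t = mat 1"
proof -
  have "h \<alpha> t ** h_inv \<alpha> t = w \<alpha> t ** (w \<alpha> (- 1) ** w \<alpha> 1) ** w \<alpha> (- t)" by (simp add: h_def h_inv_def matrix_mul_assoc)
  then show "h \<alpha> t ** h_inv \<alpha> t = mat 1" using w_inverse'[OF assms, of 1] w_inverse[OF assms, of t] by simp
  have "h_inv \<alpha> t ** h \<alpha> t = w \<alpha> 1 ** (w \<alpha> (- t) ** w \<alpha> t) ** w \<alpha> (- 1)" by (simp add: h_def h_inv_def matrix_mul_assoc)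
  then show "h_inv \<alpha> t ** h \<alpha> t = mat 1" using w_inverse'[OF assms, of t] w_inverse[OF assms, of 1] by simp
qed

lemma w_T: "\<alpha> \<in> \<Phi> \<Longrightarrow> t \<noteq> 0 \<Longrightarrow> w \<alpha> t ** T \<alpha> = - (T \<alpha> ** w \<alpha> t)"
  using w_mult_right[of \<alpha> t "T \<alpha>"] w_conj_T[of \<alpha> t] by (simp add: matrix_mult.minus_left)

lemma h_T_commute: "\<alpha> \<in> \<Phi> \<Longrightarrow> t \<noteq> 0 \<Longrightarrow> h \<alpha> t ** T \<alpha> = T \<alpha> ** h \<alpha> t"
proof -
  assume \<alpha>: "\<alpha> \<in> \<Phi>" and t: "t \<noteq> 0"
  have "h \<alpha> t ** T \<alpha> = w \<alpha> t ** (w \<alpha> (- 1) ** T \<alpha>)" by (simp add: h_def matrix_mul_assoc)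
  also have "\<dots> = - ((w \<alpha> t ** T \<alpha>) ** w \<alpha> (- 1))" using w_T[OF \<alpha>, of "- 1"] by (simp add: matrix_mult.minus_right matrix_mul_assoc)
  also have "\<dots> = T \<alpha> ** h \<alpha> t" using w_T[OF \<alpha> t] by (simp add: matrix_mult.minus_left h_def matrix_mul_assoc)
  finally show ?thesis .
qed

lemma h_conj_T: "\<alpha> \<in> \<Phi> \<Longrightarrow> t \<noteq> 0 \<Longrightarrow> h_inv \<alpha> t ** T \<alpha> = T \<alpha> ** h_inv \<alpha> t"
proof -
  assume \<alpha>: "\<alpha> \<in> \<Phi>" and t: "t \<noteq> 0"
  have "h_inv \<alpha> t ** T \<alpha> = h_inv \<alpha> t ** (T \<alpha> ** h \<alpha> t) ** h_inv \<alpha> t"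
    using h_inverse(1)[OF \<alpha>, of t] by (simp flip: matrix_mul_assoc)
  also have "\<dots> = (h_inv \<alpha> t ** h \<alpha> t) ** T \<alpha> ** h_inv \<alpha> t"
    by (simp add: matrix_mul_assoc flip: h_T_commute[OF \<alpha> t])
  finally show ?thesis using h_inverse(2)[OF \<alpha>, of t] by simp
qed

text \<open>The torus acts on a weight vector of weight \<open>m\<close> by \<open>t\<^sup>m\<close>, since \<open>t h' = T h\<close>.\<close>

lemma h_conj_weight:
  assumes \<alpha>: "\<alpha> \<in> \<Phi>" and "t > 0" and m: "commutator (T \<alpha>) Y = m *\<^sub>R Y"
  shows "h \<alpha> t ** Y ** h_inv \<alpha> t = (t powr m) *\<^sub>R Y"
proof -
  define F where "F t = h \<alpha> t ** Y ** h_inv \<alpha> t" for t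
  \<comment> \<open>Integrating factor: the weight makes \<open>F\<close> solve
    \<open>F' = (m / t) F\<close>, so \<open>\<Psi>\<close> is constant.\<close>
  define \<Psi> where "\<Psi> t = (t powr (- m)) *\<^sub>R F t" for t
  have dh: "(h \<alpha> has_vector_derivative (1 / t) *\<^sub>R (T \<alpha> ** h \<alpha> t)) (at t)" if "t > 0" for t
    unfolding h_def[abs_def]
    using has_vector_derivative_mult_const_right[OF w_has_vector_derivative[OF \<alpha>], of t "w \<alpha> (- 1)"] that
    by (simp add: matrix_mult.scaleR_left matrix_mul_assoc)
  have dhi: "(h_inv \<alpha> has_vector_derivative - ((1 / t) *\<^sub>R (h_inv \<alpha> t ** T \<alpha>))) (at t)" if "t > 0" for t
  proof -
    have "((\<lambda>t. w \<alpha> (- t)) has_vector_derivative (- 1) *\<^sub>R ((1 / (- t)) *\<^sub>R (T \<alpha> ** w \<alpha> (- t)))) (at t)"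
      by (rule has_vector_derivative_reparam[OF w_has_vector_derivative[OF \<alpha>]])
         (use that in \<open>auto intro!: derivative_eq_intros\<close>)
    from has_vector_derivative_mult_const_left[OF this, of "w \<alpha> 1"]
    have "(h_inv \<alpha> has_vector_derivative (1 / t) *\<^sub>R (w \<alpha> 1 ** (T \<alpha> ** w \<alpha> (- t)))) (at t)"
      by (simp add: h_inv_def[abs_def] matrix_mult.scaleR_right)
    moreover have "T \<alpha> ** w \<alpha> (- t) = - (w \<alpha> (- t) ** T \<alpha>)" using w_T[OF \<alpha>, of "- t"] that by simp
    ultimately show ?thesis by (simp add: h_inv_def matrix_mult.minus_right matrix_mul_assoc)
  qed
  have dF: "(F has_vector_derivative (m / t) *\<^sub>R F t) (at t)" if "t > 0" for t
  proof -
    have "(F has_vector_derivative (h \<alpha> t ** Y) ** (- ((1 / t) *\<^sub>R (h_inv \<alpha> t ** T \<alpha>))) +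
        (((1 / t) *\<^sub>R (T \<alpha> ** h \<alpha> t)) ** Y) ** h_inv \<alpha> t) (at t)"
      unfolding F_def[abs_def]
      by (rule matrix_mult.has_vector_derivative[OF has_vector_derivative_mult_const_right[OF dh[OF that]] dhi[OF that]])
    also have "(h \<alpha> t ** Y) ** (- ((1 / t) *\<^sub>R (h_inv \<alpha> t ** T \<alpha>))) + (((1 / t) *\<^sub>R (T \<alpha> ** h \<alpha> t)) ** Y) ** h_inv \<alpha> t =
        (1 / t) *\<^sub>R (h \<alpha> t ** (T \<alpha> ** Y - Y ** T \<alpha>) ** h_inv \<alpha> t)"
      using that unfolding h_conj_T[OF \<alpha> less_imp_neq[OF that, symmetric]] h_T_commute[OF \<alpha> less_imp_neq[OF that, symmetric], symmetric]
      by (simp add: matrix_mult.minus_right matrix_mult.scaleR_right matrix_mult.scaleR_left matrix_mult.diff_right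
          matrix_mult.diff_left matrix_mul_assoc scaleR_diff_right)
    also have "\<dots> = (m / t) *\<^sub>R F t"
      using m unfolding commutator_def by (simp add: F_def matrix_mult.scaleR_right matrix_mult.scaleR_left)
    finally show ?thesis .
  qed
  have "(\<Psi> has_vector_derivative 0) (at t within {0<..})" if "t \<in> {0<..}" for t
  proof -
    have t: "t > 0" using that by simp
    have "(\<Psi> has_vector_derivative (t powr (- m)) *\<^sub>R ((m / t) *\<^sub>R F t) + ((- m) * t powr (- m - 1)) *\<^sub>R F t) (at t)"
      unfolding \<Psi>_def[abs_def]
      by (rule has_vector_derivative_scaleR[OF _ dF[OF t]]) (use t in \<open>auto intro!: derivative_eq_intros\<close>)
    also have "(t powr (- m)) *\<^sub>R ((m / t) *\<^sub>R F t) + ((- m) * t powr (- m - 1)) *\<^sub>R F t = 0"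
      using t by (simp add: powr_diff flip: scaleR_add_left)
    finally show ?thesis by (rule has_vector_derivative_at_within)
  qed
  then obtain c where c: "\<And>t. t > 0 \<Longrightarrow> \<Psi> t = c"
    using has_vector_derivative_zero_constant[of "{0<..} :: real set" \<Psi>] by auto
  have "h \<alpha> 1 = mat 1" "h_inv \<alpha> 1 = mat 1" using w_inverse[OF \<alpha>, of 1] by (simp_all add: h_def h_inv_def)
  then have "\<Psi> 1 = Y" by (simp add: \<Psi>_def F_def)
  then have "(t powr (- m)) *\<^sub>R F t = Y" using c[of t] c[of 1] \<open>t > 0\<close> by (simp add: \<Psi>_def)
  then have "(t powr m) *\<^sub>R ((t powr (- m)) *\<^sub>R F t) = (t powr m) *\<^sub>R Y" by simp
  moreover have "t powr m * t powr (- m) = 1" using \<open>t > 0\<close> by (simp flip: powr_add)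
  ultimately show ?thesis by (simp add: F_def)
qed

lemma h_commute:
  assumes \<alpha>: "\<alpha> \<in> \<Phi>" "t > 0" "s > 0" shows "h \<alpha> t ** h \<alpha> s = h \<alpha> s ** h \<alpha> t"
proof -
  have "commutator (T \<alpha>) (h \<alpha> s) = 0 *\<^sub>R h \<alpha> s" using h_T_commute[of \<alpha> s] assms by (simp add: commutator_def)
  from h_conj_weight[OF \<alpha>(1,2) this] have "(h \<alpha> t ** h \<alpha> s ** h_inv \<alpha> t) ** h \<alpha> t = h \<alpha> s ** h \<alpha> t" using \<alpha>(2) by simp
  then show ?thesis using h_inverse(2)[OF \<alpha>(1), of t] by (simp flip: matrix_mul_assoc)
qed

lemma X_conj_scale:
  assumes \<alpha>: "\<alpha> \<in> \<Phi>" and z: "z ** z' = mat 1" "z' ** z = mat 1" and c: "z ** N \<alpha> ** z' = c *\<^sub>R N \<alpha>"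
  shows "z ** X \<alpha> t ** z' = X \<alpha> (c * t)"
proof -
  define Q where "Q t = z ** X \<alpha> t ** z'" for t
  have NQ: "c *\<^sub>R (N \<alpha> ** Q t) = z ** (N \<alpha> ** X \<alpha> t) ** z'" for t
  proof -
    have "c *\<^sub>R (N \<alpha> ** Q t) = (z ** N \<alpha> ** z') ** Q t" unfolding c by (simp add: matrix_mult.scaleR_left)
    also have "\<dots> = z ** N \<alpha> ** (z' ** z) ** X \<alpha> t ** z'" by (simp add: Q_def matrix_mul_assoc)
    finally show ?thesis by (simp add: z(2) matrix_mul_assoc)
  qed
  have QN: "c *\<^sub>R (Q t ** N \<alpha>) = z ** (X \<alpha> t ** N \<alpha>) ** z'" for t
  proof -
    have "c *\<^sub>R (Q t ** N \<alpha>) = Q t ** (z ** N \<alpha> ** z')" unfolding c by (simp add: matrix_mult.scaleR_right)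
    also have "\<dots> = z ** X \<alpha> t ** (z' ** z) ** N \<alpha> ** z'" by (simp add: Q_def matrix_mul_assoc)
    finally show ?thesis by (simp add: z(2) matrix_mul_assoc)
  qed
  have dQ: "(Q has_vector_derivative c *\<^sub>R (N \<alpha> ** Q t)) (at t)" for t
    unfolding NQ unfolding Q_def[abs_def]
    by (intro has_vector_derivative_mult_const_right has_vector_derivative_mult_const_left X_has_vector_derivative[OF \<alpha>])
  have dX: "((\<lambda>t. X \<alpha> (- (c * t))) has_vector_derivative (- c) *\<^sub>R (N \<alpha> ** X \<alpha> (- (c * t)))) (at t)" for t
    by (rule has_vector_derivative_reparam[OF X_has_vector_derivative[OF \<alpha>]]) (auto intro!: derivative_eq_intros)
  \<comment> \<open>The logarithmic derivatives of the two factors are opposite, so their product is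
    constant.\<close>
  have "Q t ** X \<alpha> (- (c * t)) = mat 1"
  proof (rule vector_derivative_unique_solution[where f = "\<lambda>t. Q t ** X \<alpha> (- (c * t))" and g = "\<lambda>t. mat 1"])
    show "((\<lambda>t. Q t ** X \<alpha> (- (c * t))) has_vector_derivative 0) (at t)" for t
    proof -
      have "((\<lambda>t. Q t ** X \<alpha> (- (c * t))) has_vector_derivative
          Q t ** ((- c) *\<^sub>R (N \<alpha> ** X \<alpha> (- (c * t)))) + (c *\<^sub>R (N \<alpha> ** Q t)) ** X \<alpha> (- (c * t))) (at t)"
        by (rule matrix_mult.has_vector_derivative[OF dQ dX])
      moreover have "c *\<^sub>R (N \<alpha> ** Q t) = c *\<^sub>R (Q t ** N \<alpha>)" unfolding NQ QN N_X_commute[OF \<alpha>] ..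
      then have "(c *\<^sub>R (N \<alpha> ** Q t)) ** X \<alpha> (- (c * t)) = c *\<^sub>R (Q t ** (N \<alpha> ** X \<alpha> (- (c * t))))"
        by (simp only: matrix_mult.scaleR_left matrix_mul_assoc)
      ultimately show ?thesis by (simp add: matrix_mult.scaleR_right matrix_mult.minus_right)
    qed
    show "((\<lambda>t. mat 1 :: real^'n^'n) has_vector_derivative 0) (at t)" for t by simp
    show "Q 0 ** X \<alpha> (- (c * 0)) = mat 1" by (simp add: Q_def X_0[OF \<alpha>] z(1))
  qed
  then have "Q t ** (X \<alpha> (- (c * t)) ** X \<alpha> (c * t)) = X \<alpha> (c * t)" unfolding matrix_mul_assoc by simp
  then show ?thesis by (simp add: X_inverse(2)[OF \<alpha>] Q_def)
qed

text \<open>If \<open>X \<alpha> s\<close> were 1 for a nonzero \<open>s\<close>, it would be 1 at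
  all multiples of \<open>s\<close>; the polynomial curve would be constant, against its derivative
  \<open>N \<alpha>\<close> at 0, which is not 0.\<close>

lemma X_eq_one_iff:
  assumes \<alpha>: "\<alpha> \<in> \<Phi>" shows "X \<alpha> s = (mat 1 :: real^'n^'n) \<longleftrightarrow> s = 0"
proof
  assume s: "X \<alpha> s = (mat 1 :: real^'n^'n)"
  show "s = 0"
  proof (rule ccontr)
    assume "s \<noteq> 0"
    have X1: "X \<alpha> (real n * s) = (mat 1 :: real^'n^'n)" for n
      by (induction n) (simp_all add: X_0[OF \<alpha>] distrib_right X_add[OF \<alpha>] s)
    have "poly (X_poly \<alpha> i j) t = (mat 1 :: real^'n^'n) $ i $ j" for i j t
    proof -
      let ?Q = "X_poly \<alpha> i j - [:(mat 1 :: real^'n^'n) $ i $ j:]"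
      have "inj (\<lambda>n. real n * s)" using \<open>s \<noteq> 0\<close> by (auto simp: inj_def)
      then have "infinite (range (\<lambda>n. real n * s))" using infinite_UNIV_nat finite_imageD by blast
      moreover have "range (\<lambda>n. real n * s) \<subseteq> {x. poly ?Q x = 0}" using X1 by (auto simp flip: poly_X_poly)
      ultimately have "?Q = 0" using poly_roots_finite finite_subset by blast
      then have "X_poly \<alpha> i j = [:(mat 1 :: real^'n^'n) $ i $ j:]" by simp
      then show ?thesis by simp
    qed
    then have "X \<alpha> = (\<lambda>t. mat 1 :: real^'n^'n)" by (auto simp: vec_eq_iff poly_X_poly)
    then have "((\<lambda>t. mat 1 :: real^'n^'n) has_vector_derivative N \<alpha>) (at 0)"
      using X_has_vector_derivative[OF \<alpha>, of 0] by simp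
    then have "N \<alpha> = 0" using vector_derivative_unique_at has_vector_derivative_const by blast
    then show False using N_nonzero[OF \<alpha>] by simp
  qed
qed (simp add: X_0[OF \<alpha>])

end

section \<open>Undecidability\<close>

context chevalley_data
begin

lemma matrix_power_N:
  assumes "\<beta> \<in> \<Phi>" shows "matrix_power (N \<beta>) k = fact k *\<^sub>R (map_mat of_int (D \<beta> k) :: real^'n^'n)"
proof (induction k)
  case 0
  then show ?case by (simp add: matrix_power_0 D_0[OF assms] map_mat_one)
next
  case (Suc k)
  then show ?case by (simp add: matrix_power_Suc matrix_mult.scaleR_right N_mult_D[OF assms] mult.commute)
qed

text \<open>Each term of the iterated commutator is \<open>Y\<close> between two powers of
  \<open>N \<beta>\<close> whose exponents sum to the number of steps, so one of them is
  large.\<close>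

lemma commutator_N_nilpotent:
  assumes "\<beta> \<in> \<Phi>" shows "\<exists>k. (commutator (N \<beta>) ^^ k) Y = 0"
proof -
  let ?N = "N \<beta>"
  have lin: "linear (commutator ?N ^^ k)" for k
  proof (induction k)
    case (Suc k)
    have "linear (commutator ?N)" by (intro linearI) (simp_all only: commutator_simps(3,6))
    from linear_compose[OF Suc this] show ?case unfolding funpow.simps .
  qed (simp add: linear_iff)
  \<comment> \<open>Induction on \<open>a + b\<close>: multiplying \<open>Y\<close> by
    \<open>N \<beta>\<close> on the left lowers \<open>a\<close>, on the right it lowers
    \<open>b\<close>.\<close>
  have "(commutator ?N ^^ k) Y = 0"
    if "matrix_power ?N a ** Y = 0" "Y ** matrix_power ?N b = 0" "a + b = k" for a b k Y
    using that
  proof (induction k arbitrary: a b Y)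
    case 0
    then show ?case by (simp add: matrix_power_0)
  next
    case (Suc k)
    show ?case
    proof (cases "a = 0 \<or> b = 0")
      case True
      then have "Y = 0" using Suc.prems by (auto simp: matrix_power_0)
      then show ?thesis using linear_0[OF lin] by blast
    next
      case False
      then obtain a' b' where ab: "a = Suc a'" "b = Suc b'" by (metis not0_implies_Suc)
      have "matrix_power ?N (a' + 1) = matrix_power ?N a' ** ?N"
        unfolding matrix_power_add by (simp add: matrix_power_Suc matrix_power_0)
      then have "matrix_power ?N a' ** (?N ** Y) = 0" using Suc.prems(1) ab by (simp add: matrix_mul_assoc)
      moreover have "(?N ** Y) ** matrix_power ?N b = 0"
        using Suc.prems(2) by (simp add: matrix_mult.zero_right flip: matrix_mul_assoc)
      ultimately have 1: "(commutator ?N ^^ k) (?N ** Y) = 0" by (rule Suc.IH) (use Suc.prems(3) ab in simp)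
      have "matrix_power ?N a ** (Y ** ?N) = 0" using Suc.prems(1) by (simp add: matrix_mul_assoc matrix_mult.zero_left)
      moreover have "(Y ** ?N) ** matrix_power ?N b' = 0"
        using Suc.prems(2) ab by (simp add: matrix_power_Suc matrix_mul_assoc)
      ultimately have 2: "(commutator ?N ^^ k) (Y ** ?N) = 0" by (rule Suc.IH) (use Suc.prems(3) ab in simp)
      have "(commutator ?N ^^ Suc k) Y = (commutator ?N ^^ k) (?N ** Y - Y ** ?N)"
        by (simp only: funpow_Suc_right comp_def commutator_def)
      also have "\<dots> = 0" unfolding linear_diff[OF lin] 1 2 by simp
      finally show ?thesis .
    qed
  qed
  moreover have "matrix_power ?N D_bound = 0"
    using D_bound[OF assms, of D_bound] by (simp add: matrix_power_N[OF assms] vec_eq_iff)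
  ultimately have "(commutator ?N ^^ (D_bound + D_bound)) Y = 0"
    by (metis matrix_mult.zero_left matrix_mult.zero_right)
  then show ?thesis ..
qed

section \<open>The real matrix Lie algebra as an invariant subspace\<close>

definition root_span :: "(real^'n^'n) set" where
  "root_span = Real_Vector_Spaces.span (N ` \<Phi> \<union> T ` \<Phi>)"

lemma subspace_root_span: "Real_Vector_Spaces.subspace root_span"
  unfolding root_span_def by (rule real_vector.subspace_span)

lemma N_root_span: "\<beta> \<in> \<Phi> \<Longrightarrow> N \<beta> \<in> root_span" and T_root_span: "\<beta> \<in> \<Phi> \<Longrightarrow> T \<beta> \<in> root_span"
  unfolding root_span_def by (auto intro: real_vector.span_base)

lemma commutator_root_span:
  assumes \<beta>: "\<beta> \<in> \<Phi>" and "Y \<in> root_span" shows "commutator (N \<beta>) Y \<in> root_span"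
  using assms(2) unfolding root_span_def
proof (induction rule: real_vector.span_induct_alt)
  case base
  then show ?case by (simp add: commutator_simps(5) real_vector.span_zero)
next
  case (step c x y)
  note sub = subspace_root_span[unfolded root_span_def]
  have "commutator (N \<beta>) x \<in> root_span"
    using step(1)
  proof
    assume "x \<in> N ` \<Phi>"
    then obtain \<gamma> where \<gamma>: "\<gamma> \<in> \<Phi>" and x: "x = N \<gamma>" by blast
    consider "\<beta> + \<gamma> \<in> \<Phi>" | "\<beta> + \<gamma> = 0" | "\<beta> + \<gamma> \<notin> \<Phi>" "\<beta> + \<gamma> \<noteq> 0" by blast
    then show ?thesis
    proof cases
      case 1
      then obtain c where "commutator (N \<beta>) x = c *\<^sub>R N (\<beta> + \<gamma>)" using commutator_N_root[OF \<beta> \<gamma>] x by blast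
      then show ?thesis using N_root_span[OF 1] real_vector.subspace_scale[OF subspace_root_span] by simp
    next
      case 2
      then have "\<gamma> = - \<beta>" by (simp add: eq_neg_iff_add_eq_0 add.commute)
      then show ?thesis using T_root_span[OF \<beta>] x by (simp add: T_def)
    next
      case 3
      then show ?thesis using commutator_N_not_root[OF \<beta> \<gamma>] x real_vector.subspace_0[OF subspace_root_span] by simp
    qed
  next
    assume "x \<in> T ` \<Phi>"
    then obtain \<gamma> where \<gamma>: "\<gamma> \<in> \<Phi>" and x: "x = T \<gamma>" by blast
    show ?thesis unfolding x commutator_N_T[OF \<beta> \<gamma>]
      by (rule real_vector.subspace_scale[OF subspace_root_span N_root_span[OF \<beta>]])
  qed
  then show ?case using step(2) real_vector.subspace_add[OF sub] real_vector.subspace_scale[OF sub]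
    by (simp add: commutator_simps(3,6) root_span_def)
qed

text \<open>Induction on the nilpotency degree: the derivative in \<open>t\<close> stays in the
  subspace by hypothesis, so a vector orthogonal to the subspace has a constant inner product with
  the curve, which is 0 at \<open>t = 0\<close>.\<close>

lemma conj_X_root_span:
  assumes \<beta>: "\<beta> \<in> \<Phi>" and Y: "Y \<in> root_span" shows "conj_X \<beta> t Y \<in> root_span"
proof -
  obtain k where "(commutator (N \<beta>) ^^ k) Y = 0" using commutator_N_nilpotent[OF \<beta>] by blast
  then have "\<forall>t. conj_X \<beta> t Y \<in> root_span" using Y
  proof (induction k arbitrary: Y)
    case 0
    then show ?case using real_vector.subspace_0[OF subspace_root_span] linear_0[OF linear_conj_X] by simp
  next
    case (Suc k)
    have IH: "conj_X \<beta> t (commutator (N \<beta>) Y) \<in> root_span" for t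
      using Suc.IH[of "commutator (N \<beta>) Y"] Suc.prems commutator_root_span[OF \<beta>] by (simp add: funpow_swap1)
    show ?case
    proof (rule allI, rule ccontr)
      fix t assume notin: "conj_X \<beta> t Y \<notin> root_span"
      obtain y z where yz: "y \<in> root_span" "\<And>u. u \<in> root_span \<Longrightarrow> orthogonal z u" "conj_X \<beta> t Y = y + z"
        using orthogonal_subspace_decomp_exists[of root_span "conj_X \<beta> t Y"] subspace_root_span
        by (metis real_vector.span_eq_iff)
      have "inner z (conj_X \<beta> t Y) = inner z (conj_X \<beta> 0 Y)"
      proof (rule vector_derivative_unique_solution[where f = "\<lambda>t. inner z (conj_X \<beta> t Y)" and g = "\<lambda>_. inner z (conj_X \<beta> 0 Y)" and f' = "\<lambda>_. 0"])
        fix t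
        have "inner z (conj_X \<beta> t (commutator (N \<beta>) Y)) = 0" using yz(2)[OF IH] by (simp add: orthogonal_def)
        then show "((\<lambda>t. inner z (conj_X \<beta> t Y)) has_vector_derivative 0) (at t)"
          using bounded_linear.has_vector_derivative[OF bounded_linear_inner_right[of z] conj_X_has_vector_derivative[OF \<beta>, of Y t]]
          by simp
      qed simp_all
      also have "\<dots> = 0" using yz(2)[OF Suc.prems(2)] by (simp add: conj_X_0[OF \<beta>] orthogonal_def)
      finally have "inner z z = 0" using yz(2)[OF yz(1)] unfolding yz(3) by (simp add: orthogonal_def inner_add_right)
      then show False using notin yz(1,3) by simp
    qed
  qed
  then show ?thesis by blast
qed

lemma group_conj_root_span:
  assumes "A \<in> closed_group" "Y \<in> root_span" shows "A ** Y ** adjugate A \<in> root_span"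
  by (rule closed_group_preserves_subspace[OF assms(1) subspace_root_span _ assms(2)])
     (use conj_X_root_span in \<open>simp add: conj_X_def\<close>)

lemma commutator_T_T: "\<alpha> \<in> \<Phi> \<Longrightarrow> \<gamma> \<in> \<Phi> \<Longrightarrow> commutator (T \<alpha>) (T \<gamma>) = 0"
proof -
  assume \<alpha>: "\<alpha> \<in> \<Phi>" and \<gamma>: "\<gamma> \<in> \<Phi>"
  have "commutator (T \<alpha>) (T \<gamma>) = commutator (commutator (T \<alpha>) (N \<gamma>)) (N (- \<gamma>)) + commutator (N \<gamma>) (commutator (T \<alpha>) (N (- \<gamma>)))"
    unfolding T_def[of \<gamma>]
    by (simp add: commutator_def matrix_mult.diff_left matrix_mult.diff_right matrix_mul_assoc)
  also have "\<dots> = 0" unfolding commutator_T_N[OF \<alpha> \<gamma>] commutator_T_N[OF \<alpha> neg_root[OF \<gamma>]]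
    by (simp add: commutator_def matrix_mult.scaleR_left matrix_mult.scaleR_right scaleR_diff_right matrix_mult.minus_left matrix_mult.minus_right)
  finally show ?thesis .
qed

lemma centralizer_scales_N:
  assumes \<alpha>: "\<alpha> \<in> \<Phi>" and max: "\<And>\<beta>. \<beta> \<in> \<Phi> \<Longrightarrow> inner \<beta> \<beta> \<le> inner \<alpha> \<alpha>"
    and z: "z \<in> carrier computable_group" "z ** h \<alpha> 2 = h \<alpha> 2 ** z"
  shows "\<exists>c. c \<noteq> 0 \<and> z ** N \<alpha> ** adjugate z = c *\<^sub>R N \<alpha>"
proof -
  let ?h = "h \<alpha> 2" and ?h' = "h_inv \<alpha> 2" and ?z' = "adjugate z"
  note hh = h_inverse[OF \<alpha>, of 2] and zz = adjugate_inverses[OF z(1)]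
  define A where "A Y = ?h ** Y ** ?h'" for Y
  define Y where "Y = z ** N \<alpha> ** ?z'"
  have linA: "linear A" unfolding A_def
    by (intro linearI) (simp_all add: matrix_mult.add_left matrix_mult.add_right matrix_mult.scaleR_left matrix_mult.scaleR_right)
  have AN: "A (N \<beta>) = (2 powr cartan_number \<beta> \<alpha>) *\<^sub>R N \<beta>" if "\<beta> \<in> \<Phi>" for \<beta>
    unfolding A_def by (rule h_conj_weight[OF \<alpha> _ commutator_T_N[OF \<alpha> that]]) simp
  have AT: "A (T \<gamma>) = 1 *\<^sub>R T \<gamma>" if "\<gamma> \<in> \<Phi>" for \<gamma>
  proof -
    have "commutator (T \<alpha>) (T \<gamma>) = 0 *\<^sub>R T \<gamma>" using commutator_T_T[OF \<alpha> that] by simp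
    from h_conj_weight[OF \<alpha> _ this, of 2] show ?thesis by (simp add: A_def)
  qed
  have "Y \<in> root_span" unfolding Y_def
    using group_conj_root_span N_root_span[OF \<alpha>] z(1) by (simp add: in_computable_group)
  \<comment> \<open>The Cartan number of a root with itself is 2, so \<open>h \<alpha> 2\<close>
    scales \<open>N \<alpha>\<close> by \<open>2 ^ 2\<close>; conjugation by \<open>z\<close>
    preserves the eigenvalue, as \<open>z\<close> commutes with \<open>h \<alpha> 2\<close>.\<close>
  moreover have "A Y = 4 *\<^sub>R Y"
  proof -
    have "?h ** ?z' = ?z' ** ?h"
    proof -
      have "?h ** ?z' = ?z' ** (z ** ?h) ** ?z'" unfolding matrix_mul_assoc zz(2) by simp
      also have "\<dots> = ?z' ** ?h ** (z ** ?z')" unfolding z(2) by (simp add: matrix_mul_assoc)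
      finally show ?thesis unfolding zz(1) by simp
    qed
    then have "?h' ** (?h ** ?z') ** ?h' = ?h' ** (?z' ** ?h) ** ?h'" by simp
    moreover have "?h' ** (?h ** ?z') ** ?h' = ?z' ** ?h'" unfolding matrix_mul_assoc hh(2) by simp
    moreover have "?h' ** (?z' ** ?h) ** ?h' = ?h' ** ?z' ** (?h ** ?h')" by (simp add: matrix_mul_assoc)
    ultimately have comm: "?z' ** ?h' = ?h' ** ?z'" unfolding hh(1) by simp
    have "A Y = (?h ** z) ** N \<alpha> ** (?z' ** ?h')" by (simp add: A_def Y_def matrix_mul_assoc)
    also have "\<dots> = z ** A (N \<alpha>) ** ?z'" unfolding comm z(2)[symmetric] by (simp add: A_def matrix_mul_assoc)
    also have "\<dots> = 4 *\<^sub>R Y" unfolding AN[OF \<alpha>] cartan_self[OF \<alpha>]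
      by (simp add: Y_def matrix_mult.scaleR_left matrix_mult.scaleR_right)
    finally show ?thesis .
  qed
  ultimately have "\<exists>c. Y = c *\<^sub>R N \<alpha>"
  proof (intro eigenvector_in_span[OF linA])
    show "finite (N ` \<Phi> \<union> T ` \<Phi>)" using root_system by (simp add: root_system_def)
    fix s assume "s \<in> N ` \<Phi> \<union> T ` \<Phi>"
    then show "\<exists>\<mu>. A s = \<mu> *\<^sub>R s \<and> (\<mu> = 4 \<longrightarrow> s = N \<alpha>)"
    proof
      assume "s \<in> T ` \<Phi>"
      then have "A s = 1 *\<^sub>R s" using AT by auto
      then show ?thesis by (intro exI[of _ 1]) simp
    next
      assume "s \<in> N ` \<Phi>"
      then obtain \<beta> where \<beta>: "\<beta> \<in> \<Phi>" and s: "s = N \<beta>" by blast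
      \<comment> \<open>Cartan number 2 makes the squared length of
        \<open>\<beta> - \<alpha>\<close> equal to the difference of the squared lengths of
        \<open>\<beta>\<close> and \<open>\<alpha>\<close>, which is not positive for a longest
        \<open>\<alpha>\<close>.\<close>
      have "\<beta> = \<alpha>" if "2 powr cartan_number \<beta> \<alpha> = (4::real)"
      proof -
        have "2 powr cartan_number \<beta> \<alpha> = 2 powr (2::real)" using that by simp
        then have "cartan_number \<beta> \<alpha> = 2" by (subst (asm) powr_inj) auto
        then have "inner \<beta> \<alpha> = inner \<alpha> \<alpha>" using root_nonzero[OF \<alpha>] by (simp add: cartan_number_def field_simps)
        then have "inner (\<beta> - \<alpha>) (\<beta> - \<alpha>) \<le> 0" using max[OF \<beta>] by (simp add: inner_diff_left inner_diff_right inner_commute)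
        then show ?thesis by (metis inner_gt_zero_iff not_le right_minus_eq)
      qed
      then show ?thesis using AN[OF \<beta>] s by blast
    qed
  qed (simp_all add: root_span_def)
  then obtain c where c: "Y = c *\<^sub>R N \<alpha>" by blast
  moreover have "c \<noteq> 0"
  proof
    assume "c = 0"
    then have "?z' ** Y ** z = 0" using c by (simp add: matrix_mult.zero_left matrix_mult.zero_right)
    moreover have "?z' ** Y ** z = (?z' ** z) ** N \<alpha> ** (?z' ** z)" by (simp add: Y_def matrix_mul_assoc)
    ultimately show False using N_nonzero[OF \<alpha>] unfolding zz by simp
  qed
  ultimately show ?thesis unfolding Y_def by blast
qed

lemma group_mult: "A \<in> carrier computable_group \<Longrightarrow> B \<in> carrier computable_group \<Longrightarrow> A ** B \<in> carrier computable_group"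
  using monoid.m_closed[OF group.is_monoid[OF group_computable_group]] by simp

lemma h_in_group:
  assumes \<alpha>: "\<alpha> \<in> \<Phi>" and t: "t \<in> computable_reals" shows "h \<alpha> t \<in> carrier computable_group"
proof -
  have "w \<alpha> s \<in> carrier computable_group" if "s \<in> computable_reals" for s
    unfolding w_def using that \<alpha> neg_root[OF \<alpha>] computable_reals_inverse[OF that]
    by (intro group_mult X_computable_group) (simp_all add: divide_inverse)
  then show ?thesis unfolding h_def using t by (intro group_mult) simp_all
qed

lemma adjugate_h: "\<alpha> \<in> \<Phi> \<Longrightarrow> t \<in> computable_reals \<Longrightarrow> adjugate (h \<alpha> t) = h_inv \<alpha> t"
proof -
  assume a: "\<alpha> \<in> \<Phi>" "t \<in> computable_reals"
  have "adjugate (h \<alpha> t) = adjugate (h \<alpha> t) ** (h \<alpha> t ** h_inv \<alpha> t)" using h_inverse[OF a(1), of t] by simp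
  also have "\<dots> = h_inv \<alpha> t" unfolding matrix_mul_assoc adjugate_inverses(2)[OF h_in_group[OF a]] by simp
  finally show ?thesis .
qed

text \<open>Two-fold conjugation by elements commuting with \<open>h \<alpha> 2\<close> multiplies the parameter by a nonzero square,
  which expresses positivity.\<close>

lemma positive_iff_conjugate:
  assumes \<alpha>: "\<alpha> \<in> \<Phi>" and max: "\<And>\<beta>. \<beta> \<in> \<Phi> \<Longrightarrow> inner \<beta> \<beta> \<le> inner \<alpha> \<alpha>" and a: "a \<in> computable_reals"
  shows "(\<exists>z\<in>carrier computable_group. z ** h \<alpha> 2 = h \<alpha> 2 ** z \<and>
      z ** (z ** X \<alpha> 1 ** adjugate z) ** adjugate z = X \<alpha> a) \<longleftrightarrow> a > 0"
proof
  assume "\<exists>z\<in>carrier computable_group. z ** h \<alpha> 2 = h \<alpha> 2 ** z \<and> z ** (z ** X \<alpha> 1 ** adjugate z) ** adjugate z = X \<alpha> a"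
  then obtain z where z: "z \<in> carrier computable_group" "z ** h \<alpha> 2 = h \<alpha> 2 ** z"
    "z ** (z ** X \<alpha> 1 ** adjugate z) ** adjugate z = X \<alpha> a" by blast
  obtain c where c: "c \<noteq> 0" "z ** N \<alpha> ** adjugate z = c *\<^sub>R N \<alpha>" using centralizer_scales_N[OF \<alpha> max z(1,2)] by blast
  note conj = X_conj_scale[OF \<alpha> adjugate_inverses[OF z(1)] c(2)]
  have "X \<alpha> (c * c) = (X \<alpha> a :: real^'n^'n)" using z(3) conj[of 1] conj[of c] by simp
  then have "X \<alpha> (a + - (c * c)) = (mat 1 :: real^'n^'n)"
    unfolding X_add[OF \<alpha>] using X_inverse(1)[OF \<alpha>, of "c * c"] by simp
  then have "a = c * c" unfolding X_eq_one_iff[OF \<alpha>] by simp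
  then show "a > 0" using c(1) by (simp add: zero_less_mult_iff linorder_neq_iff disj_commute)
next
  assume "a > 0"
  \<comment> \<open>A fourth root: \<open>h \<alpha> s\<close> multiplies the parameter by
    \<open>s ^ 2\<close>, and conjugating twice gives \<open>s ^ 4\<close>.\<close>
  define s where "s = sqrt (sqrt a)"
  have s: "s > 0" "s \<in> computable_reals" unfolding s_def using \<open>a > 0\<close> a by (simp_all add: computable_reals_sqrt)
  let ?z = "h \<alpha> s"
  have "?z ** N \<alpha> ** adjugate ?z = s powr (cartan_number \<alpha> \<alpha>) *\<^sub>R N \<alpha>"
    unfolding adjugate_h[OF \<alpha> s(2)] by (rule h_conj_weight[OF \<alpha> s(1) commutator_T_N[OF \<alpha> \<alpha>]])
  then have "?z ** N \<alpha> ** adjugate ?z = (s ^ 2) *\<^sub>R N \<alpha>" using s(1) by (simp add: cartan_self[OF \<alpha>] powr_numeral)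
  note conj = X_conj_scale[OF \<alpha> adjugate_inverses[OF h_in_group[OF \<alpha> s(2)]] this]
  have "s\<^sup>2 * s\<^sup>2 = a" using \<open>a > 0\<close> by (simp add: s_def)
  then have "?z ** (?z ** X \<alpha> 1 ** adjugate ?z) ** adjugate ?z = X \<alpha> a" using conj[of 1] conj[of "s\<^sup>2"] by simp
  then show "\<exists>z\<in>carrier computable_group. z ** h \<alpha> 2 = h \<alpha> 2 ** z \<and> z ** (z ** X \<alpha> 1 ** adjugate z) ** adjugate z = X \<alpha> a"
    using h_in_group[OF \<alpha> s(2)] h_commute[OF \<alpha> s(1), of 2] by (intro bexI[of _ ?z]) simp_all
qed

end

text \<open>Diagonalization over digits 4 and 5; their distance from 0 and 9 makes all truncations of the expansion unambiguous.\<close>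

lemma computable_real_avoiding:
  fixes c :: "nat \<Rightarrow> nat \<Rightarrow> nat"
  assumes c: "recf (\<lambda>q. c (fst q) (snd q))"
  obtains b where "b \<in> computable_reals" "0 < b" "b < 1" "\<And>i. \<exists>k. c i k \<noteq> nat \<lceil>10 ^ k * b\<rceil>"
proof -
  \<comment> \<open>The ceiling to be avoided at scale \<open>Suc k\<close> ends in
    \<open>d k + 1\<close>, that is 5 or 6, so digit 4 is taken when the given number ends in 6 and
    digit 5 otherwise.\<close>
  define d where "d k = (if c k (Suc k) mod 10 = 6 then 4 else 5 :: nat)" for k
  define S where "S n = rec_nat 0 (\<lambda>k r. 10 * r + d k) n" for n
  have recf_d: "recf d" unfolding d_def[abs_def] by (intro rec_intros decp_eq recf_mod recf_comp2[OF c])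
  have recf_S: "recf S" unfolding S_def[abs_def] by (intro rec_intros recf_comp[OF recf_d])
  have d: "4 \<le> d k" "d k \<le> 5" for k by (simp_all add: d_def)
  have le5: "real (d m) / 10 ^ Suc k \<le> 5 / 10 ^ Suc k" for m k
    by (rule divide_right_mono) (use d(2)[of m] in simp_all)
  have geometric: "(\<lambda>k. 5 / 10 ^ Suc k) sums (5 / 9 :: real)"
  proof -
    have "(\<lambda>k. (1 / 10) ^ k) sums (1 / (1 - 1 / 10) :: real)" by (rule geometric_sums) simp
    from sums_mult[OF this, of "5 / 10"] show ?thesis by (simp add: power_divide)
  qed
  have summable: "summable (\<lambda>k. real (d (n + k)) / 10 ^ Suc k)" for n
    by (rule summable_comparison_test'[OF sums_summable[OF geometric], of 0]) (use le5 in \<open>simp del: power_Suc\<close>)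
  define tail where "tail n = suminf (\<lambda>k. real (d (n + k)) / 10 ^ Suc k)" for n
  have tail_pos: "0 < tail n" for n
    unfolding tail_def by (rule suminf_pos[OF summable]) (use d(1)[of "n + _"] in \<open>auto intro!: divide_pos_pos intro: less_le_trans[of 0 4]\<close>)
  have tail_less: "tail n < 1" for n
  proof -
    have "tail n \<le> 5 / 9" unfolding tail_def sums_unique[OF geometric]
      by (rule suminf_le[OF _ summable sums_summable[OF geometric]]) (use le5 in \<open>simp del: power_Suc\<close>)
    then show ?thesis by simp
  qed
  have tail_Suc: "10 * tail n = real (d n) + tail (Suc n)" for n
  proof -
    have "tail n = real (d n) / 10 + suminf (\<lambda>k. real (d (n + Suc k)) / 10 ^ Suc (Suc k))"
      unfolding tail_def using suminf_split_head[OF summable, of n] by simp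
    also have "suminf (\<lambda>k. real (d (n + Suc k)) / 10 ^ Suc (Suc k)) = tail (Suc n) / 10"
      unfolding tail_def suminf_divide[OF summable, symmetric] by simp
    finally show ?thesis by simp
  qed
  have shift: "10 ^ n * tail 0 = real (S n) + tail n" for n
  proof (induction n)
    case (Suc n)
    then have "10 ^ Suc n * tail 0 = 10 * real (S n) + 10 * tail n" by simp
    then show ?case unfolding tail_Suc by (simp add: S_def)
  qed (simp add: S_def)
  have floor: "\<lfloor>10 ^ n * tail 0\<rfloor> = int (S n)" and ceiling: "\<lceil>10 ^ n * tail 0\<rceil> = int (S n) + 1" for n
    unfolding shift using tail_pos[of n] tail_less[of n] by (simp_all add: floor_eq_iff ceiling_eq_iff)
  have "decimal_expansion (tail 0) n = (if n = 0 then 0 else S n mod 10)" for n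
    using floor[of n] floor[of 0] tail_pos[of 0] by (simp add: decimal_expansion_def S_def nat_mod_distrib)
  then have "decimal_expansion (tail 0) = (\<lambda>n. if n = 0 then 0 else S n mod 10)" by (rule ext)
  moreover have "recf (\<lambda>n::nat. if n = 0 then 0 else S n mod 10)"
    by (intro recf_if decp_eq recf_mod recf_comp[OF recf_S] rec_intros)
  ultimately have "tail 0 \<in> computable_reals" by (simp add: computable_reals_def recf_nat_iff)
  moreover have "\<exists>k. c i k \<noteq> nat \<lceil>10 ^ k * tail 0\<rceil>" for i
  proof (intro exI[of _ "Suc i"] notI)
    assume "c i (Suc i) = nat \<lceil>10 ^ Suc i * tail 0\<rceil>"
    then have "c i (Suc i) = Suc (10 * S i + d i)" using ceiling[of "Suc i"] by (simp add: S_def nat_add_distrib)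
    then have "c i (Suc i) mod 10 = Suc (d i) mod 10" by (metis add_Suc_right mod_mult_self4)
    then show False by (simp add: d_def split: if_splits)
  qed
  ultimately show ?thesis using tail_pos tail_less by (intro that) auto
qed

lemma recf_letter:
  "recf f \<Longrightarrow> recf (\<lambda>x. Var (f x))" "recf f \<Longrightarrow> recf (\<lambda>x. Var_Inv (f x))"
  "recf f \<Longrightarrow> recf (\<lambda>x. Coef (f x))" "recf f \<Longrightarrow> recf (\<lambda>x. Coef_Inv (f x))"
proof -
  have eq: "Var i = dec (4 * i)" "Var_Inv i = dec (4 * i + 1)" "Coef i = dec (4 * i + 2)" "Coef_Inv i = dec (4 * i + 3)" for i
    using dec_enc[of "Var i"] dec_enc[of "Var_Inv i"] dec_enc[of "Coef i"] dec_enc[of "Coef_Inv i"]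
    by (simp_all add: enc_letter_def)
  show "recf f \<Longrightarrow> recf (\<lambda>x. Var (f x))" "recf f \<Longrightarrow> recf (\<lambda>x. Var_Inv (f x))"
    "recf f \<Longrightarrow> recf (\<lambda>x. Coef (f x))" "recf f \<Longrightarrow> recf (\<lambda>x. Coef_Inv (f x))"
    unfolding eq by (intro recf_dec recf_add recf_mult recf_const; assumption)+
qed

text \<open>The first equation places \<open>z\<close> in the centralizer of
  \<open>h \<alpha> 2\<close>; the second reads \<open>z^2 u z^-2 = x^n u^-m\<close>, where
  \<open>u\<close> and \<open>x\<close> are the coefficients with indices \<open>iu\<close> and
  \<open>i\<close>.\<close>

definition positivity_system :: "nat \<Rightarrow> nat \<Rightarrow> nat \<Rightarrow> nat \<Rightarrow> nat \<Rightarrow> group_equation list" where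
  "positivity_system ih iu i n m = [[Var 0, Coef ih, Var_Inv 0, Coef_Inv ih],
     [Var 0, Var 0, Coef iu, Var_Inv 0, Var_Inv 0] @ replicate m (Coef iu) @ replicate n (Coef_Inv i)]"

lemma recf_positivity_system:
  "recf f \<Longrightarrow> recf g \<Longrightarrow> recf k \<Longrightarrow> recf (\<lambda>x. positivity_system ih iu (f x) (g x) (k x))"
  unfolding positivity_system_def by (intro rec_intros recf_letter)

context chevalley_data
begin

abbreviation "gprod \<equiv> group_prod computable_group"

lemma gprod_simps: "gprod [] = mat 1" "gprod (x # xs) = x ** gprod xs"
  by (simp_all add: group_prod_def)

lemma gprod_append: "gprod (xs @ ys) = gprod xs ** gprod ys"
  by (induction xs) (simp_all add: gprod_simps matrix_mul_assoc)

lemma gprod_replicate_X: "\<alpha> \<in> \<Phi> \<Longrightarrow> gprod (replicate n (X \<alpha> a)) = X \<alpha> (real n * a)"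
  by (induction n) (simp_all add: gprod_simps X_0 distrib_right flip: X_add)

lemma adjugate_X: "\<alpha> \<in> \<Phi> \<Longrightarrow> a \<in> computable_reals \<Longrightarrow> adjugate (X \<alpha> a) = X \<alpha> (- a)"
proof -
  assume a: "\<alpha> \<in> \<Phi>" "a \<in> computable_reals"
  have "adjugate (X \<alpha> a) = adjugate (X \<alpha> a) ** (X \<alpha> a ** X \<alpha> (- a))" using X_inverse(1)[OF a(1), of a] by simp
  also have "\<dots> = X \<alpha> (- a)" unfolding matrix_mul_assoc adjugate_inverses(2)[OF X_computable_group[OF a]] by simp
  finally show ?thesis .
qed

lemma solvable_positivity_system:
  assumes \<alpha>: "\<alpha> \<in> \<Phi>" and max: "\<And>\<beta>. \<beta> \<in> \<Phi> \<Longrightarrow> inner \<beta> \<beta> \<le> inner \<alpha> \<alpha>" and a: "a \<in> computable_reals"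
    and \<nu>: "\<nu> ih = h \<alpha> 2" "\<nu> iu = X \<alpha> 1" "\<nu> i = X \<alpha> a"
  shows "solvable_system computable_group \<nu> (positivity_system ih iu i n m) \<longleftrightarrow> real m < real n * a"
proof -
  let ?G = "computable_group"
  let ?b = "real n * a - real m"
  let ?P = "\<lambda>z. z ** h \<alpha> 2 = h \<alpha> 2 ** z \<and> z ** (z ** X \<alpha> 1 ** adjugate z) ** adjugate z = X \<alpha> ?b"
  have b: "?b \<in> computable_reals" using a by (simp add: computable_reals_diff computable_reals_mult)
  have h2: "h \<alpha> 2 \<in> carrier ?G" using h_in_group[OF \<alpha>, of 2] computable_reals_of_nat[of 2] by simp
  have eqs: "(\<forall>w\<in>set (positivity_system ih iu i n m). gprod (map (letter_value ?G \<nu> \<sigma>) w) = mat 1) \<longleftrightarrow> ?P (\<sigma> 0)"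
    if "\<sigma> 0 \<in> carrier ?G" for \<sigma>
  proof -
    define z z' where "z = \<sigma> 0" and "z' = adjugate (\<sigma> 0)"
    have zz: "z ** z' = mat 1" "z' ** z = mat 1" using adjugate_inverses[OF that] by (simp_all add: z_def z'_def)
    have hh: "h \<alpha> 2 ** adjugate (h \<alpha> 2) = mat 1" "adjugate (h \<alpha> 2) ** h \<alpha> 2 = mat 1"
      using adjugate_inverses[OF h2] by simp_all
    note inv = inv_computable_group[OF that] inv_computable_group[OF h2]
      inv_computable_group[OF X_computable_group[OF \<alpha> a]]
    have "gprod (map (letter_value ?G \<nu> \<sigma>) [Var 0, Coef ih, Var_Inv 0, Coef_Inv ih]) =
        z ** h \<alpha> 2 ** z' ** adjugate (h \<alpha> 2)"
      by (simp add: gprod_simps inv \<nu> z_def z'_def matrix_mul_assoc)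
    moreover have "z ** h \<alpha> 2 ** z' ** adjugate (h \<alpha> 2) = mat 1 \<longleftrightarrow> z ** h \<alpha> 2 = h \<alpha> 2 ** z"
    proof
      assume "z ** h \<alpha> 2 ** z' ** adjugate (h \<alpha> 2) = mat 1"
      then have "(z ** h \<alpha> 2 ** z' ** adjugate (h \<alpha> 2)) ** h \<alpha> 2 ** z = h \<alpha> 2 ** z" by simp
      moreover have "(z ** h \<alpha> 2 ** z' ** adjugate (h \<alpha> 2)) ** h \<alpha> 2 ** z = z ** h \<alpha> 2 ** (z' ** (adjugate (h \<alpha> 2) ** h \<alpha> 2) ** z)"
        by (simp add: matrix_mul_assoc)
      ultimately show "z ** h \<alpha> 2 = h \<alpha> 2 ** z" by (simp add: hh zz)
    next
      assume "z ** h \<alpha> 2 = h \<alpha> 2 ** z"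
      then have "z ** h \<alpha> 2 ** z' ** adjugate (h \<alpha> 2) = h \<alpha> 2 ** (z ** z') ** adjugate (h \<alpha> 2)" by (simp add: matrix_mul_assoc)
      then show "z ** h \<alpha> 2 ** z' ** adjugate (h \<alpha> 2) = mat 1" by (simp add: zz hh)
    qed
    moreover have "gprod (map (letter_value ?G \<nu> \<sigma>) ([Var 0, Var 0, Coef iu, Var_Inv 0, Var_Inv 0] @ replicate m (Coef iu) @ replicate n (Coef_Inv i))) =
        z ** (z ** X \<alpha> 1 ** z') ** z' ** X \<alpha> (- ?b)"
      using X_add[OF \<alpha>, of "real m" "- (real n * a)"]
      by (simp add: gprod_simps gprod_append inv \<nu> z_def z'_def matrix_mul_assoc gprod_replicate_X[OF \<alpha>] adjugate_X[OF \<alpha> a]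
         map_replicate)
    moreover have "Y ** X \<alpha> (- ?b) = mat 1 \<longleftrightarrow> Y = X \<alpha> ?b" for Y :: "real^'n^'n"
    proof
      assume "Y ** X \<alpha> (- ?b) = mat 1"
      then have "Y ** (X \<alpha> (- ?b) ** X \<alpha> ?b) = X \<alpha> ?b" unfolding matrix_mul_assoc by simp
      then show "Y = X \<alpha> ?b" unfolding X_inverse(2)[OF \<alpha>] by simp
    qed (simp only: X_inverse(1)[OF \<alpha>])
    ultimately show ?thesis unfolding positivity_system_def by (simp add: z_def z'_def)
  qed
  have "solvable_system ?G \<nu> (positivity_system ih iu i n m) \<longleftrightarrow> (\<exists>z\<in>carrier ?G. ?P z)"
  proof
    assume "solvable_system ?G \<nu> (positivity_system ih iu i n m)"
    then obtain \<sigma> where \<sigma>: "range \<sigma> \<subseteq> carrier ?G"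
      "\<forall>w\<in>set (positivity_system ih iu i n m). gprod (map (letter_value ?G \<nu> \<sigma>) w) = mat 1"
      unfolding solvable_system_def by auto
    then have "\<sigma> 0 \<in> carrier ?G" by blast
    then show "\<exists>z\<in>carrier ?G. ?P z" using eqs[of \<sigma>] \<sigma>(2) by blast
  next
    assume "\<exists>z\<in>carrier ?G. ?P z"
    then obtain z where z: "z \<in> carrier ?G" "?P z" by blast
    then have "\<forall>w\<in>set (positivity_system ih iu i n m). gprod (map (letter_value ?G \<nu> (\<lambda>_. z)) w) = mat 1"
      using eqs[of "\<lambda>_. z"] by simp
    moreover have "range (\<lambda>_. z) \<subseteq> carrier ?G" using z(1) by auto
    ultimately show "solvable_system ?G \<nu> (positivity_system ih iu i n m)" unfolding solvable_system_def
      by (intro exI[of _ "\<lambda>_. z"]) simp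
  qed
  also have "\<dots> \<longleftrightarrow> ?b > 0" by (rule positive_iff_conjugate[OF \<alpha> max b])
  finally show ?thesis by simp
qed

theorem diophantine_undecidable: "\<not> diophantine_decidable computable_group (carrier computable_group)"
proof
  let ?G = "computable_group"
  assume "diophantine_decidable ?G (carrier ?G)"
  then obtain \<nu> f where \<nu>: "range \<nu> = carrier ?G" and f: "computable f"
    "\<And>S. f (system_code S) = (if solvable_system ?G \<nu> S then 1 else 0)"
    unfolding diophantine_decidable_def diophantine_decidable_via_def by blast
  have "finite \<Phi>" using root_system by (simp add: root_system_def)
  have "Max ((\<lambda>\<beta>. inner \<beta> \<beta>) ` \<Phi>) \<in> (\<lambda>\<beta>. inner \<beta> \<beta>) ` \<Phi>" using \<open>finite \<Phi>\<close> nonempty by (intro Max_in) auto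
  then obtain \<alpha> where \<alpha>: "\<alpha> \<in> \<Phi>" "Max ((\<lambda>\<beta>. inner \<beta> \<beta>) ` \<Phi>) = inner \<alpha> \<alpha>" by blast
  have max: "inner \<beta> \<beta> \<le> inner \<alpha> \<alpha>" if "\<beta> \<in> \<Phi>" for \<beta>
    unfolding \<alpha>(2)[symmetric] using \<open>finite \<Phi>\<close> that by (intro Max_ge) auto
  note \<alpha> = \<alpha>(1)
  have surj: "\<exists>i. \<nu> i = A" if "A \<in> carrier ?G" for A using that unfolding \<nu>[symmetric] by blast
  obtain ih where ih: "\<nu> ih = h \<alpha> 2" using surj[OF h_in_group[OF \<alpha>, of 2]] computable_reals_of_nat[of 2] by auto
  obtain iu where iu: "\<nu> iu = X \<alpha> 1" using surj[OF X_computable_group[OF \<alpha>, of 1]] by auto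
  define P where "P i n m = solvable_system ?G \<nu> (positivity_system ih iu i n m)" for i n m
  have decS: "decp (\<lambda>S. solvable_system ?G \<nu> S)"
  proof -
    have "recf (\<lambda>S :: group_equation list. f (enc S))" by (rule recf_comp[OF f(1)[folded recf_nat_iff] recf_enc[OF recf_id]])
    then have "decp (\<lambda>S :: group_equation list. \<not> f (enc S) = 0)" by (intro rec_intros)
    moreover have "(\<not> f (enc S) = 0) = solvable_system ?G \<nu> S" for S
      using f(2)[of S] by (simp add: enc_system_code split: if_splits)
    ultimately show ?thesis by (simp only:)
  qed
  \<comment> \<open>The cutoff keeps the search total for all indices, whatever elements they
    denote; for \<open>X \<alpha> b\<close> with \<open>0 < b < 1\<close> it does not change the
    ceiling.\<close>
  define c where "c i k = (LEAST m. \<not> P i (10 ^ k) m \<or> 10 ^ k \<le> m)" for i k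
  have "recf (\<lambda>q. LEAST m. \<not> P (fst q) (10 ^ snd q) m \<or> 10 ^ snd q \<le> m)"
  proof (rule recf_Least)
    show "decp (\<lambda>q. \<not> P (fst (fst q)) (10 ^ snd (fst q)) (snd q) \<or> 10 ^ snd (fst q) \<le> snd q)"
      unfolding P_def by (intro decp_disj decp_not decp_le decp_comp[OF decS] recf_positivity_system recf_power recf_fst recf_snd recf_id recf_const)
  qed blast
  then have "recf (\<lambda>q. c (fst q) (snd q))" unfolding c_def .
  then obtain b where b: "b \<in> computable_reals" "0 < b" "b < 1" "\<And>i. \<exists>k. c i k \<noteq> nat \<lceil>10 ^ k * b\<rceil>"
    by (rule computable_real_avoiding) blast
  obtain i where i: "\<nu> i = X \<alpha> b" using surj[OF X_computable_group[OF \<alpha> b(1)]] by blast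
  have "c i k = nat \<lceil>10 ^ k * b\<rceil>" for k
  proof -
    have "P i (10 ^ k) m \<longleftrightarrow> real m < 10 ^ k * b" for m
      unfolding P_def using solvable_positivity_system[OF \<alpha> max b(1), of \<nu> ih iu i "10 ^ k" m] ih iu i by simp
    moreover have "10 ^ k * b \<le> real m" if "10 ^ k \<le> m" for m
    proof -
      have "10 ^ k * b \<le> 10 ^ k * 1" using b(3) by (intro mult_left_mono) auto
      also have "\<dots> \<le> real m" using that by (metis mult.right_neutral of_nat_le_iff of_nat_numeral of_nat_power)
      finally show ?thesis .
    qed
    ultimately have "c i k = (LEAST m. 10 ^ k * b \<le> real m)" unfolding c_def by (metis not_less)
    also have "\<dots> = nat \<lceil>10 ^ k * b\<rceil>" by (rule Least_equality) (linarith, linarith)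
    finally show ?thesis .
  qed
  then show False using b(4) by blast
qed

end

section \<open>Decidability with coefficients in a finitely generated subgroup\<close>

text \<open>Matrices of polynomials are lists in row order.\<close>

definition smult :: "nat \<Rightarrow> int_mpoly list \<Rightarrow> int_mpoly list \<Rightarrow> int_mpoly list" where
  "smult n A B = map (\<lambda>k. concat (map (\<lambda>l. mmult (nth_default [] A (k div n * n + l)) (nth_default [] B (l * n + k mod n)))
     [0..<n])) [0..<n * n]"

definition sone :: "nat \<Rightarrow> int_mpoly list" where
  "sone n = map (\<lambda>k. mconst (if k div n = k mod n then 1 else 0)) [0..<n * n]"

definition svar :: "nat \<Rightarrow> nat \<Rightarrow> int_mpoly list" where
  "svar n b = map (\<lambda>k. mvar (b * (n * n) + k)) [0..<n * n]"

definition smat_eq :: "nat \<Rightarrow> int_mpoly list \<Rightarrow> int_mpoly list \<Rightarrow> (int_mpoly \<times> int) list" where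
  "smat_eq n A B = map (\<lambda>k. (nth_default [] A k @ mneg (nth_default [] B k), 0)) [0..<n * n]"

text \<open>Dropping monomials with a variable beyond the matrix entries matches their value 0 under
  \<open>entries_env\<close>.\<close>

definition shift :: "nat \<Rightarrow> nat \<Rightarrow> int_mpoly \<Rightarrow> int_mpoly" where
  "shift n b p = map (\<lambda>m. (fst m, map (\<lambda>v. b * (n * n) + v) (snd m))) (filter (\<lambda>m. \<forall>v\<in>set (snd m). v < n * n) p)"

lemma recf_smult: "recf f \<Longrightarrow> recf g \<Longrightarrow> recf (\<lambda>x. smult n (f x) (g x))"
  by (rule recf_comp2[of "smult n"]) (unfold smult_def, intro rec_intros)

lemma recf_svar: "recf f \<Longrightarrow> recf (\<lambda>x. svar n (f x))"
  by (rule recf_comp[of "svar n"]) (unfold svar_def, intro rec_intros)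

lemma recf_smat_eq: "recf f \<Longrightarrow> recf g \<Longrightarrow> recf (\<lambda>x. smat_eq n (f x) (g x))"
  by (rule recf_comp2[of "smat_eq n"]) (unfold smat_eq_def, intro rec_intros)

lemma recf_shift: "recf f \<Longrightarrow> recf g \<Longrightarrow> recf (\<lambda>x. shift n (f x) (g x))"
  by (rule recf_comp2[of "shift n"]) (unfold shift_def, intro rec_intros)

definition smat_eval :: "(nat \<Rightarrow> real) \<Rightarrow> int_mpoly list \<Rightarrow> real^'n^'n" where
  "smat_eval e A = (\<chi> i j. mev e (nth_default [] A (entry_index i j)))"

definition block :: "(nat \<Rightarrow> real) \<Rightarrow> nat \<Rightarrow> real^'n^'n" where
  "block e b = (\<chi> i j. e (b * (CARD('n) * CARD('n)) + entry_index i j))"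

lemma entry_index_div_mod [simp]:
  "entry_index (i :: 'n::finite) j div CARD('n) = index_of i" "entry_index (i :: 'n) j mod CARD('n) = index_of j"
  by (simp_all add: entry_index_def div_mult_self3)

lemma index_of_eq_iff [simp]: "index_of i = index_of j \<longleftrightarrow> i = (j :: 'n::finite)"
  by (metis of_index_index_of)

lemma nth_default_map_upt: "k < m \<Longrightarrow> nth_default d (map f [0..<m]) k = f k"
  by (simp add: nth_default_def)

lemma mev_concat: "mev e (concat (map f xs)) = (\<Sum>x\<leftarrow>xs. mev e (f x))"
  by (induction xs) simp_all

lemma smat_eval_smult:
  "smat_eval e (smult CARD('n) A B) = smat_eval e A ** (smat_eval e B :: real^'n^'n)"
proof -
  have "(\<Sum>l\<leftarrow>[0..<CARD('n)]. f l) = (\<Sum>k\<in>(UNIV :: 'n set). f (index_of k))" for f :: "nat \<Rightarrow> real"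
    using sum.reindex_bij_betw[OF bij_index_of[where 'n = 'n], of f] by (simp add: interv_sum_list_conv_sum_set_nat atLeast0LessThan)
  then show ?thesis
    by (simp add: vec_eq_iff smat_eval_def smult_def nth_default_map_upt entry_index_less mev_concat
        matrix_matrix_mult_def flip: entry_index_def)
qed

lemma smat_eval_sone: "smat_eval e (sone CARD('n)) = (mat 1 :: real^'n^'n)"
  by (simp add: vec_eq_iff smat_eval_def sone_def nth_default_map_upt entry_index_less mat_def)

lemma smat_eval_svar: "smat_eval e (svar CARD('n) b) = (block e b :: real^'n^'n)"
  by (simp add: vec_eq_iff smat_eval_def svar_def block_def nth_default_map_upt entry_index_less)

lemma less_entry_index: "k < CARD('n) * CARD('n) \<Longrightarrow> \<exists>i j :: 'n::finite. k = entry_index i j"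
proof -
  assume k: "k < CARD('n) * CARD('n)"
  then have "k div CARD('n) < CARD('n)" by (rule less_mult_imp_div_less)
  moreover have "k mod CARD('n) < CARD('n)" by simp
  ultimately have "k = entry_index (of_index (k div CARD('n)) :: 'n) (of_index (k mod CARD('n)))"
    by (simp add: entry_index_def)
  then show ?thesis by blast
qed

lemma sat_smat_eq: "sat e (smat_eq CARD('n) A B) \<longleftrightarrow> smat_eval e A = (smat_eval e B :: real^'n^'n)"
proof -
  have "sat e (smat_eq CARD('n) A B) \<longleftrightarrow>
      (\<forall>k<CARD('n) * CARD('n). mev e (nth_default [] A k) = mev e (nth_default [] B k))"
    by (auto simp: sat_def smat_eq_def)
  also have "\<dots> \<longleftrightarrow> (\<forall>i j :: 'n. mev e (nth_default [] A (entry_index i j)) = mev e (nth_default [] B (entry_index i j)))"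
  proof
    assume "\<forall>i j :: 'n. mev e (nth_default [] A (entry_index i j)) = mev e (nth_default [] B (entry_index i j))"
    then show "\<forall>k<CARD('n) * CARD('n). mev e (nth_default [] A k) = mev e (nth_default [] B k)"
      using less_entry_index[where 'n = 'n] by metis
  qed (simp add: entry_index_less)
  also have "\<dots> \<longleftrightarrow> smat_eval e A = (smat_eval e B :: real^'n^'n)" by (simp add: vec_eq_iff smat_eval_def)
  finally show ?thesis .
qed

lemma entries_env_block:
  "entries_env (block e b :: real^'n^'n) k = (if k < CARD('n) * CARD('n) then e (b * (CARD('n) * CARD('n)) + k) else 0)"
proof (cases "k < CARD('n) * CARD('n)")
  case True
  then obtain i j :: 'n where "k = entry_index i j" using less_entry_index by blast
  then show ?thesis using True by (simp add: block_def)
qed (simp add: entries_env_def)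

lemma mev_shift: "mev e (shift CARD('n) b p) = mev (entries_env (block e b :: real^'n^'n)) p"
proof (induction p)
  case (Cons m p)
  let ?E = "entries_env (block e b :: real^'n^'n)"
  show ?case
  proof (cases "\<forall>v\<in>set (snd m). v < CARD('n) * CARD('n)")
    case True
    then have "prod_list (map e (map (\<lambda>v. b * (CARD('n) * CARD('n)) + v) (snd m))) = prod_list (map ?E (snd m))"
      unfolding map_map by (intro arg_cong[of _ _ prod_list] map_cong) (simp_all add: entries_env_block)
    moreover have "shift CARD('n) b (m # p) = (fst m, map (\<lambda>v. b * (CARD('n) * CARD('n)) + v) (snd m)) # shift CARD('n) b p"
      using True by (simp add: shift_def)
    ultimately show ?thesis using Cons by (simp add: mev_Cons)
  next
    case False
    then have "0 \<in> ?E ` set (snd m)" by (force simp: entries_env_block image_iff)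
    then have "prod_list (map ?E (snd m)) = 0" by (auto simp: prod_list_zero_iff)
    moreover have "shift CARD('n) b (m # p) = shift CARD('n) b p" using False by (simp add: shift_def)
    ultimately show ?thesis using Cons by (simp add: mev_Cons)
  qed
qed (simp add: shift_def)

text \<open>Matrices \<open>2 k\<close> and \<open>2 k + 1\<close> stand for a generator or variable and its inverse; the first \<open>l\<close> pairs for the generators.\<close>

definition partner :: "nat \<Rightarrow> nat" where
  "partner k = (if even k then Suc k else k - 1)"

text \<open>Indices from \<open>2 * l\<close> on in a coefficient denote letters beyond the
  generators, with value 1, and are left out. Arithmetic on codes replaces pattern matching, so that
  recursiveness follows from the rules.\<close>

definition letter_blocks :: "nat \<Rightarrow> letter \<Rightarrow> nat list" where
  "letter_blocks l x = (let a = enc x div 4; ks = filter (\<lambda>k. k < 2 * l) (list_decode a) in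
     if enc x mod 4 = 0 then [2 * l + 2 * a] else if enc x mod 4 = 1 then [2 * l + 2 * a + 1]
     else if enc x mod 4 = 2 then ks else map partner (rev ks))"

lemma letter_blocks_simps:
  "letter_blocks l (Var i) = [2 * l + 2 * i]" "letter_blocks l (Var_Inv i) = [2 * l + 2 * i + 1]"
  "letter_blocks l (Coef i) = filter (\<lambda>k. k < 2 * l) (list_decode i)"
  "letter_blocks l (Coef_Inv i) = map partner (rev (filter (\<lambda>k. k < 2 * l) (list_decode i)))"
proof -
  have "4 * i mod 4 = 0" "4 * i div 4 = i" "(4 * i + 1) mod 4 = 1" "(4 * i + 1) div 4 = i"
    "(4 * i + 2) mod 4 = 2" "(4 * i + 2) div 4 = i" "(4 * i + 3) mod 4 = 3" "(4 * i + 3) div 4 = i" for i :: nat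
    by presburger+
  note eqs = this
  show "letter_blocks l (Var i) = [2 * l + 2 * i]" "letter_blocks l (Var_Inv i) = [2 * l + 2 * i + 1]"
    "letter_blocks l (Coef i) = filter (\<lambda>k. k < 2 * l) (list_decode i)"
    "letter_blocks l (Coef_Inv i) = map partner (rev (filter (\<lambda>k. k < 2 * l) (list_decode i)))"
    by (simp_all only: letter_blocks_def enc_letter_def letter_code.simps eqs Let_def) simp_all
qed

lemma list_decode_eq_dec: "list_decode n = dec n"
proof -
  have "map (enc :: nat \<Rightarrow> nat) xs = xs" for xs by (simp add: enc_nat_def map_idI)
  then have "enc xs = list_encode xs" for xs :: "nat list" by (simp add: enc_list_def)
  from this[of "list_decode n"] show ?thesis by (metis dec_enc list_decode_inverse)
qed

lemma recf_letter_blocks: "recf f \<Longrightarrow> recf (\<lambda>x. letter_blocks l (f x))"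
proof (rule recf_comp[of "letter_blocks l"])
  have p: "recf partner" unfolding partner_def by (intro recf_if decp_even rec_intros)
  have ks: "recf (\<lambda>x :: letter. filter (\<lambda>k. k < 2 * l) (list_decode (enc x div 4)))"
    unfolding list_decode_eq_dec by (intro recf_filter decp_less recf_dec recf_div recf_enc recf_snd recf_id recf_mult recf_const)
  have "recf (\<lambda>x :: letter. enc x mod 4)" "recf (\<lambda>x :: letter. enc x div 4)"
    by (intro recf_mod recf_div recf_enc recf_id recf_const)+
  note ad = this
  show "recf (letter_blocks l)" unfolding letter_blocks_def Let_def
    by (intro recf_if decp_eq recf_Cons recf_add recf_mult recf_map recf_rev ks ad recf_const recf_comp[OF p] recf_snd recf_id)
qed

definition word_matrix :: "nat \<Rightarrow> nat \<Rightarrow> letter list \<Rightarrow> int_mpoly list" where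
  "word_matrix n l w = foldr (smult n) (map (svar n) (concat (map (letter_blocks l) w))) (sone n)"

text \<open>The index of a variable is at most the code of its letter, and the sum of all codes
  bounds each of them.\<close>

definition var_bound :: "group_equation list \<Rightarrow> nat" where
  "var_bound S = Suc (foldr (+) (map enc (concat S)) 0)"

text \<open>The even matrix of a pair satisfies the equations of the group, and its partner is then
  forced to be the inverse. The generator matrices enter as parameters.\<close>

definition translation :: "nat \<Rightarrow> nat \<Rightarrow> int_mpoly list \<Rightarrow> group_equation list \<Rightarrow> (int_mpoly \<times> int) list" where
  "translation n l Fs S =
     concat (map (\<lambda>i. smat_eq n (smult n (svar n (2 * l + 2 * i)) (svar n (2 * l + 2 * i + 1))) (sone n) @
       map (\<lambda>f. (shift n (2 * l + 2 * i) f, 0)) Fs) [0..<var_bound S]) @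
     concat (map (\<lambda>w. smat_eq n (word_matrix n l w) (sone n)) S)"

lemma recf_word_matrix: "recf f \<Longrightarrow> recf (\<lambda>x. word_matrix n l (f x))"
  by (rule recf_comp[of "word_matrix n l"])
    (unfold word_matrix_def, intro recf_foldr recf_smult recf_map recf_svar recf_concat recf_letter_blocks recf_const recf_id recf_snd recf_fst)

lemma recf_var_bound: "recf var_bound"
  unfolding var_bound_def by (intro rec_intros)

lemma recf_translation: "recf (translation n l Fs)"
  unfolding translation_def
  by (intro recf_append recf_concat recf_map recf_smat_eq recf_smult recf_svar recf_shift recf_Pair recf_word_matrix
      recf_upt recf_comp[OF recf_var_bound] recf_add recf_mult recf_const recf_id recf_snd recf_fst)

lemma smat_eval_word_matrix:
  "smat_eval e (word_matrix CARD('n) l w) = foldr (**) (map (block e) (concat (map (letter_blocks l) w))) (mat 1 :: real^'n^'n)"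
proof -
  have "smat_eval e (foldr (smult CARD('n)) (map (svar CARD('n)) bs) (sone CARD('n))) =
      foldr (**) (map (block e) bs) (mat 1 :: real^'n^'n)" for bs
    by (induction bs) (simp_all add: smat_eval_sone smat_eval_smult smat_eval_svar)
  then show ?thesis by (simp add: word_matrix_def)
qed

lemma sat_concat_map: "sat e (concat (map f xs)) \<longleftrightarrow> (\<forall>x\<in>set xs. sat e (f x))"
  by (auto simp: sat_def)

lemma sat_translation:
  "sat e (translation CARD('n) l Fs S) \<longleftrightarrow>
     (\<forall>i<var_bound S. block e (2 * l + 2 * i) ** block e (2 * l + 2 * i + 1) = (mat 1 :: real^'n^'n) \<and>
        (\<forall>f\<in>set Fs. mev (entries_env (block e (2 * l + 2 * i) :: real^'n^'n)) f = 0)) \<and>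
     (\<forall>w\<in>set S. foldr (**) (map (block e) (concat (map (letter_blocks l) w))) (mat 1 :: real^'n^'n) = mat 1)"
proof -
  have "sat e (map (\<lambda>f. (shift CARD('n) b f, 0)) Fs) \<longleftrightarrow> (\<forall>f\<in>set Fs. mev (entries_env (block e b :: real^'n^'n)) f = 0)" for b
    by (simp add: sat_def mev_shift)
  note F = this
  show ?thesis
    unfolding translation_def sat_append sat_concat_map sat_smat_eq F smat_eval_smult smat_eval_svar smat_eval_sone smat_eval_word_matrix
    by (simp add: Ball_def)
qed

lemma var_bound: "w \<in> set S \<Longrightarrow> x \<in> set w \<Longrightarrow> enc x < var_bound S"
proof -
  assume "w \<in> set S" "x \<in> set w"
  then have "enc x \<in> set (map enc (concat S))" by force
  then have "enc x \<le> sum_list (map enc (concat S))" by (rule member_le_sum_list) simp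
  then show ?thesis by (simp add: var_bound_def sum_list.eq_foldr)
qed

section \<open>Equation systems as sentences over the computable reals\<close>

context chevalley_data
begin

text \<open>Second use of the basis theorem: finitely many of the integral equations of the group
  suffice, so membership fits into a quantifier-free formula.\<close>

lemma closed_group_equations:
  "\<exists>Fs. \<forall>A :: real^'n^'n. A \<in> closed_group \<longleftrightarrow> (\<forall>f\<in>set Fs. mev (entries_env A) f = 0)"
proof -
  let ?Z = "{p. \<forall>B\<in>int_group. mev (entries_env B) p = 0}"
  obtain Fs where Fs: "set Fs \<subseteq> ?Z"
    "\<And>x. (\<forall>i\<ge>CARD('n) * CARD('n). x i = 0) \<Longrightarrow> (\<forall>f\<in>set Fs. mev x f = (0::real)) \<Longrightarrow> (\<forall>p\<in>?Z. mev x p = 0)"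
    using finite_equations[of ?Z "CARD('n) * CARD('n)"] by (elim exE conjE) (rule that, assumption, blast)
  have "A \<in> closed_group \<longleftrightarrow> (\<forall>f\<in>set Fs. mev (entries_env A) f = 0)" for A :: "real^'n^'n"
  proof
    assume "A \<in> closed_group"
    then show "\<forall>f\<in>set Fs. mev (entries_env A) f = 0" using Fs(1) unfolding closed_group_def int_closure_iff by blast
  next
    assume "\<forall>f\<in>set Fs. mev (entries_env A) f = 0"
    then have "\<forall>p\<in>?Z. mev (entries_env A) p = 0" by (intro Fs(2)) (simp_all add: entries_env_def)
    then show "A \<in> closed_group" unfolding closed_group_def int_closure_iff by blast
  qed
  then show ?thesis by blast
qed

lemma gprod_foldr: "gprod xs = foldr (**) xs (mat 1)"
  by (simp add: group_prod_def)

lemma gprod_in_group: "set xs \<subseteq> carrier computable_group \<Longrightarrow> gprod xs \<in> carrier computable_group"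
  using monoid.one_closed[OF group.is_monoid[OF group_computable_group]]
  by (induction xs) (simp_all add: gprod_simps group_mult)

lemma adjugate_unique:
  assumes "A \<in> carrier computable_group" "A ** B = mat 1" shows "adjugate A = B"
proof -
  have "adjugate A = adjugate A ** (A ** B)" using assms(2) by simp
  then show ?thesis unfolding matrix_mul_assoc adjugate_inverses(2)[OF assms(1)] by simp
qed

definition generator_block :: "(real^'n^'n) list \<Rightarrow> nat \<Rightarrow> real^'n^'n" where
  "generator_block gs k = (if even k then gs ! (k div 2) else adjugate (gs ! (k div 2)))"

lemma generator_block_in_group:
  assumes "set gs \<subseteq> carrier computable_group" "k < 2 * length gs" shows "generator_block gs k \<in> carrier computable_group"
proof -
  have "k div 2 < length gs" using assms(2) by linarith
  then have "gs ! (k div 2) \<in> carrier computable_group" using assms(1) nth_mem by blast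
  then show ?thesis by (simp add: generator_block_def adjugate_in_computable_group)
qed

lemma generator_block_partner:
  assumes "set gs \<subseteq> carrier computable_group" "k < 2 * length gs"
  shows "partner k < 2 * length gs" "generator_block gs k ** generator_block gs (partner k) = mat 1"
proof -
  have "k div 2 < length gs" using assms(2) by linarith
  then have "gs ! (k div 2) \<in> carrier computable_group" using assms(1) nth_mem by blast
  note inv = adjugate_inverses[OF this]
  show "partner k < 2 * length gs" using assms(2) unfolding partner_def by (auto elim!: evenE)
  have "partner k div 2 = k div 2" "even (partner k) \<longleftrightarrow> odd k" unfolding partner_def by (auto elim!: oddE)
  then show "generator_block gs k ** generator_block gs (partner k) = mat 1"
    using inv by (simp add: generator_block_def)
qed

lemma word_enum_eq:
  assumes "set gs \<subseteq> carrier computable_group"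
  shows "word_enum computable_group gs c = gprod (map (generator_block gs) (filter (\<lambda>k. k < 2 * length gs) (list_decode c)))"
proof -
  let ?v = "\<lambda>k. if k div 2 < length gs then (if even k then gs ! (k div 2) else inv\<^bsub>computable_group\<^esub> (gs ! (k div 2)))
    else \<one>\<^bsub>computable_group\<^esub>"
  have v: "?v k = (if k < 2 * length gs then generator_block gs k else mat 1)" for k
  proof -
    have "k div 2 < length gs \<longleftrightarrow> k < 2 * length gs" by linarith
    moreover have "inv\<^bsub>computable_group\<^esub> (gs ! (k div 2)) = adjugate (gs ! (k div 2))" if "k div 2 < length gs"
      by (rule inv_computable_group) (use that assms nth_mem in blast)
    ultimately show ?thesis by (simp add: generator_block_def)
  qed
  have "gprod (map ?v ks) = gprod (map (generator_block gs) (filter (\<lambda>k. k < 2 * length gs) ks))" for ks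
    unfolding v by (induction ks) (simp_all add: gprod_simps)
  then show ?thesis by (simp add: word_enum_def)
qed

lemma inv_word_enum:
  assumes "set gs \<subseteq> carrier computable_group"
  shows "inv\<^bsub>computable_group\<^esub> (word_enum computable_group gs c) =
    gprod (map (generator_block gs) (map partner (rev (filter (\<lambda>k. k < 2 * length gs) (list_decode c)))))"
proof -
  let ?p = "\<lambda>ks. gprod (map (generator_block gs) ks)"
  have in_group: "?p ks \<in> carrier computable_group" if "\<forall>k\<in>set ks. k < 2 * length gs" for ks
    by (rule gprod_in_group) (use that generator_block_in_group[OF assms] in auto)
  have "?p ks ** ?p (map partner (rev ks)) = mat 1" if "\<forall>k\<in>set ks. k < 2 * length gs" for ks
    using that
  proof (induction ks)
    case (Cons k ks)
    have "?p (k # ks) ** ?p (map partner (rev (k # ks))) =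
        generator_block gs k ** (?p ks ** ?p (map partner (rev ks))) ** generator_block gs (partner k)"
      by (simp add: gprod_simps gprod_append matrix_mul_assoc)
    also have "\<dots> = mat 1" using Cons generator_block_partner(2)[OF assms, of k] by simp
    finally show ?case .
  qed (simp add: gprod_simps)
  then show ?thesis unfolding word_enum_eq[OF assms] by (simp add: inv_computable_group in_group adjugate_unique[OF in_group])
qed

lemma range_word_enum:
  assumes gs: "set gs \<subseteq> carrier computable_group"
  shows "range (word_enum computable_group gs) = generate computable_group (set gs)"
proof
  let ?p = "\<lambda>ks. gprod (map (generator_block gs) ks)"
  have "?p ks \<in> generate computable_group (set gs)" if "\<forall>k\<in>set ks. k < 2 * length gs" for ks
    using that
  proof (induction ks)
    case Nil
    then show ?case using generate.one[of computable_group "set gs"] by (simp add: gprod_simps)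
  next
    case (Cons k ks)
    have k: "k div 2 < length gs" using Cons.prems by auto
    then have "gs ! (k div 2) \<in> carrier computable_group" using gs nth_mem by blast
    then have "generator_block gs k \<in> generate computable_group (set gs)"
      using generate.incl[OF nth_mem[OF k], of computable_group] generate.inv[OF nth_mem[OF k], of computable_group]
      by (simp add: generator_block_def inv_computable_group)
    then show ?case using generate.eng[of _ computable_group "set gs"] Cons by (simp add: gprod_simps)
  qed
  then show "range (word_enum computable_group gs) \<subseteq> generate computable_group (set gs)"
    by (auto simp: word_enum_eq[OF gs])
  have "\<exists>ks. (\<forall>k\<in>set ks. k < 2 * length gs) \<and> x = ?p ks" if "x \<in> generate computable_group (set gs)" for x
    using that
  proof (induction rule: generate.induct)
    case one
    then show ?case by (intro exI[of _ "[]"]) (simp add: gprod_simps)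
  next
    case (incl h)
    then obtain i where i: "i < length gs" "h = gs ! i" by (auto simp: in_set_conv_nth)
    then show ?case by (intro exI[of _ "[2 * i]"]) (simp add: gprod_simps generator_block_def)
  next
    case (inv h)
    then obtain i where i: "i < length gs" "h = gs ! i" by (auto simp: in_set_conv_nth)
    then have "gs ! i \<in> carrier computable_group" using gs nth_mem by blast
    then show ?case using i
      by (intro exI[of _ "[2 * i + 1]"]) (simp add: gprod_simps generator_block_def inv_computable_group)
  next
    case (eng h1 h2)
    then obtain ks1 ks2 where "\<forall>k\<in>set ks1. k < 2 * length gs" "h1 = ?p ks1" "\<forall>k\<in>set ks2. k < 2 * length gs" "h2 = ?p ks2"
      by blast
    then show ?case by (intro exI[of _ "ks1 @ ks2"]) (auto simp: gprod_append)
  qed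
  moreover have "?p ks = word_enum computable_group gs (list_encode ks)" if "\<forall>k\<in>set ks. k < 2 * length gs" for ks
    using that by (simp add: word_enum_eq[OF gs] filter_True)
  ultimately show "generate computable_group (set gs) \<subseteq> range (word_enum computable_group gs)" by fastforce
qed

text \<open>Matching blocks are asked only for variables that occur in \<open>u\<close>, since the
  translation has blocks for finitely many variables.\<close>

lemma word_value:
  fixes x :: "nat \<Rightarrow> real"
  assumes gs: "set gs \<subseteq> carrier computable_group" and \<sigma>: "range \<sigma> \<subseteq> carrier computable_group"
    and params: "\<And>k. k < 2 * length gs \<Longrightarrow> block x k = generator_block gs k"
    and vars: "\<And>y i. y \<in> set u \<Longrightarrow> y = Var i \<or> y = Var_Inv i \<Longrightarrow>
      block x (2 * length gs + 2 * i) = \<sigma> i \<and> block x (2 * length gs + 2 * i + 1) = adjugate (\<sigma> i)"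
  shows "gprod (map (letter_value computable_group (word_enum computable_group gs) \<sigma>) u) =
    foldr (**) (map (block x) (concat (map (letter_blocks (length gs)) u))) (mat 1)"
proof -
  let ?l = "length gs"
  have params': "map (block x) ks = map (generator_block gs) ks" if "\<forall>k\<in>set ks. k < 2 * ?l" for ks
    using that params by (intro map_cong) auto
  have "letter_value computable_group (word_enum computable_group gs) \<sigma> y = gprod (map (block x) (letter_blocks ?l y))"
    if "y \<in> set u" for y
  proof (cases y)
    case (Var i)
    then show ?thesis using vars[OF that, of i] by (simp add: letter_blocks_simps gprod_simps)
  next
    case (Var_Inv i)
    moreover have "inv\<^bsub>computable_group\<^esub> (\<sigma> i) = adjugate (\<sigma> i)" using \<sigma> by (intro inv_computable_group) auto
    ultimately show ?thesis using vars[OF that, of i] by (simp add: letter_blocks_simps gprod_simps)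
  next
    case (Coef i)
    have blocks: "map (block x) (letter_blocks ?l y) = map (generator_block gs) (letter_blocks ?l y)"
      by (rule params') (simp add: Coef letter_blocks_simps)
    show ?thesis unfolding blocks by (simp add: Coef word_enum_eq[OF gs] letter_blocks_simps)
  next
    case (Coef_Inv i)
    have blocks: "map (block x) (letter_blocks ?l y) = map (generator_block gs) (letter_blocks ?l y)"
      by (rule params') (use generator_block_partner(1)[OF gs] in \<open>auto simp: Coef_Inv letter_blocks_simps\<close>)
    show ?thesis unfolding blocks using inv_word_enum[OF gs, of i] by (simp add: Coef_Inv letter_blocks_simps)
  qed
  then show ?thesis unfolding gprod_foldr[symmetric]
    by (induction u) (simp_all add: gprod_simps gprod_append)
qed

lemma block_eqI:
  fixes A :: "real^'n^'n"
  assumes "\<And>i. i < CARD('n) * CARD('n) \<Longrightarrow> x (b * (CARD('n) * CARD('n)) + i) = entries_env A i" shows "block x b = A"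
  using assms by (simp add: vec_eq_iff block_def entry_index_less)

theorem diophantine_decidable_generate:
  assumes gs: "set gs \<subseteq> carrier computable_group"
  shows "diophantine_decidable_via computable_group (generate computable_group (set gs)) (word_enum computable_group gs)"
proof -
  let ?G = computable_group
  let ?\<nu> = "word_enum ?G gs"
  obtain Fs where Fs: "\<And>A :: real^'n^'n. A \<in> closed_group \<longleftrightarrow> (\<forall>f\<in>set Fs. mev (entries_env A) f = 0)"
    using closed_group_equations by blast
  define l m where "l = length gs" and "m = CARD('n) * CARD('n)"
  have "m > 0" by (simp add: m_def)
  define matrices_env where "matrices_env M k = entries_env (M (k div m) :: real^'n^'n) (k mod m)" for M k
  have matrices_env: "matrices_env M (b * m + i) = entries_env (M b) i" if "i < m" for M b i
    using that by (simp add: matrices_env_def)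
  \<comment> \<open>The parameters: entries of the generators and of their inverses, computable and
    finite in number.\<close>
  define x0 where "x0 k = (if k < 2 * l * m then matrices_env (generator_block gs) k else 0)" for k
  have block_index: "b * m + i < c * m" if "b < c" "i < m" for b c i :: nat
  proof -
    have "b * m + i < Suc b * m" using that(2) by simp
    also have "\<dots> \<le> c * m" using that(1) by (intro mult_right_mono) auto
    finally show ?thesis .
  qed
  have params: "block x b = generator_block gs b" if "\<And>k. k < 2 * l * m \<Longrightarrow> x k = x0 k" "b < 2 * l" for x b
    by (rule block_eqI, fold m_def) (use that block_index[OF that(2)] in \<open>simp add: x0_def matrices_env\<close>)
  have x0: "computable_env x0"
  proof -
    have "x0 k \<in> computable_reals" for k
    proof (cases "k < 2 * l * m")
      case True
      then have "k div m < 2 * l" by (rule less_mult_imp_div_less)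
      then have "generator_block gs (k div m) \<in> carrier ?G" using generator_block_in_group[OF gs] by (simp add: l_def)
      then show ?thesis using True by (simp add: x0_def matrices_env_def entries_env_def in_computable_group)
    qed (simp add: x0_def)
    then have "range x0 \<subseteq> computable_reals" by blast
    moreover have "\<forall>i\<ge>2 * l * m. x0 i = 0" by (simp add: x0_def)
    ultimately show ?thesis unfolding computable_env_def by blast
  qed
  define vs where "vs S = [2 * l * m..<(2 * l + 2 * var_bound S) * m]" for S
  have occurs: "i < var_bound S" if "u \<in> set S" "y \<in> set u" "y = Var i \<or> y = Var_Inv i" for S u y i
    using var_bound[OF that(1,2)] that(3) by (auto simp: enc_letter_def)
  have solvable: "solvable_system ?G ?\<nu> S \<longleftrightarrow> exsat (vs S) x0 (translation CARD('n) l Fs S)" for S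
  proof
    assume "solvable_system ?G ?\<nu> S"
    then obtain \<sigma> where \<sigma>: "range \<sigma> \<subseteq> carrier ?G"
      "\<And>u. u \<in> set S \<Longrightarrow> gprod (map (letter_value ?G ?\<nu> \<sigma>) u) = mat 1"
      unfolding solvable_system_def by auto
    \<comment> \<open>Since \<open>2 * l\<close> is even, parity distinguishes a variable from its
      inverse.\<close>
    define M where "M b = (let i = (b - 2 * l) div 2 in if even b then \<sigma> i else adjugate (\<sigma> i))" for b
    define x where "x k = (if k \<in> set (vs S) then matrices_env M k else x0 k)" for k
    have vars: "block x b = M b" if "2 * l \<le> b" "b < 2 * l + 2 * var_bound S" for b
    proof (rule block_eqI, fold m_def)
      fix i assume "i < m"
      have "2 * l * m \<le> b * m + i" using that(1) by (intro trans_le_add1 mult_right_mono) auto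
      then have "b * m + i \<in> set (vs S)" using block_index[OF that(2) \<open>i < m\<close>] by (simp add: vs_def)
      then show "x (b * m + i) = entries_env (M b) i" using matrices_env[OF \<open>i < m\<close>] by (simp add: x_def)
    qed
    have M: "M (2 * l + 2 * i) = \<sigma> i" "M (2 * l + 2 * i + 1) = adjugate (\<sigma> i)" for i
      by (simp_all add: M_def Let_def)
    have blocks: "block x (2 * l + 2 * i) = \<sigma> i" "block x (2 * l + 2 * i + 1) = adjugate (\<sigma> i)" if "i < var_bound S" for i
      using vars[of "2 * l + 2 * i"] vars[of "2 * l + 2 * i + 1"] M[of i] that by simp_all
    have "sat x (translation CARD('n) l Fs S)"
      unfolding sat_translation[where 'n = 'n]
    proof (intro conjI allI impI ballI)
      fix i assume i: "i < var_bound S"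
      have "\<sigma> i \<in> carrier ?G" using \<sigma>(1) by auto
      then show "block x (2 * l + 2 * i) ** block x (2 * l + 2 * i + 1) = (mat 1 :: real^'n^'n)"
        unfolding blocks[OF i] by (rule adjugate_inverses)
      fix f assume "f \<in> set Fs"
      then show "mev (entries_env (block x (2 * l + 2 * i) :: real^'n^'n)) f = 0"
        unfolding blocks[OF i] using \<open>\<sigma> i \<in> carrier ?G\<close> Fs by (simp add: in_computable_group)
    next
      fix u assume u: "u \<in> set S"
      have "gprod (map (letter_value ?G ?\<nu> \<sigma>) u) = foldr (**) (map (block x) (concat (map (letter_blocks l) u))) (mat 1)"
        unfolding l_def
      proof (rule word_value[OF gs \<sigma>(1)], fold l_def)
        show "block x k = generator_block gs k" if "k < 2 * l" for k
          by (rule params[OF _ that]) (simp add: x_def vs_def)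
        show "block x (2 * l + 2 * i) = \<sigma> i \<and> block x (2 * l + 2 * i + 1) = adjugate (\<sigma> i)"
          if "y \<in> set u" "y = Var i \<or> y = Var_Inv i" for y i
          using blocks[OF occurs[OF u that]] by blast
      qed
      then show "foldr (**) (map (block x) (concat (map (letter_blocks l) u))) (mat 1 :: real^'n^'n) = mat 1"
        using \<sigma>(2)[OF u] by simp
    qed
    then show "exsat (vs S) x0 (translation CARD('n) l Fs S)" by (rule exsatI[rotated]) (simp add: x_def)
  next
    assume "exsat (vs S) x0 (translation CARD('n) l Fs S)"
    \<comment> \<open>A real solution can be replaced by a computable one, so the matrices read off
      lie in the computable group.\<close>
    then obtain x where x: "computable_env x" "\<And>k. k \<notin> set (vs S) \<Longrightarrow> x k = x0 k" "sat x (translation CARD('n) l Fs S)"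
      by (rule exsat_computable_solution[OF x0]) blast
    note sat = x(3)[unfolded sat_translation[where 'n = 'n]]
    \<comment> \<open>Variables beyond the bound do not occur in \<open>S\<close>, and the identity
      serves as their value.\<close>
    define \<sigma> where "\<sigma> i = (if i < var_bound S then block x (2 * l + 2 * i) else mat 1 :: real^'n^'n)" for i
    have entries: "block x b $ i $ j \<in> computable_reals" for b and i j :: 'n
      using x(1) by (auto simp: block_def computable_env_def)
    have "\<sigma> i \<in> carrier ?G" for i
    proof (cases "i < var_bound S")
      case True
      then have "block x (2 * l + 2 * i) \<in> closed_group" using sat Fs by blast
      then show ?thesis using True entries by (simp add: \<sigma>_def in_computable_group)
    next
      case False
      then show ?thesis using monoid.one_closed[OF group.is_monoid[OF group_computable_group]] by (simp add: \<sigma>_def)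
    qed
    then have \<sigma>: "range \<sigma> \<subseteq> carrier ?G" by auto
    have blocks: "block x (2 * l + 2 * i) = \<sigma> i \<and> block x (2 * l + 2 * i + 1) = adjugate (\<sigma> i)" if "i < var_bound S" for i
    proof -
      have "\<sigma> i ** block x (2 * l + 2 * i + 1) = mat 1" using sat that by (simp add: \<sigma>_def)
      then have "adjugate (\<sigma> i) = block x (2 * l + 2 * i + 1)" using \<sigma> by (intro adjugate_unique) auto
      then show ?thesis using that by (simp add: \<sigma>_def)
    qed
    have "gprod (map (letter_value ?G ?\<nu> \<sigma>) u) = mat 1" if u: "u \<in> set S" for u
    proof -
      have "gprod (map (letter_value ?G ?\<nu> \<sigma>) u) = foldr (**) (map (block x) (concat (map (letter_blocks l) u))) (mat 1)"
        unfolding l_def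
      proof (rule word_value[OF gs \<sigma>], fold l_def)
        show "block x k = generator_block gs k" if "k < 2 * l" for k
          by (rule params[OF _ that]) (simp add: x(2) vs_def)
        show "block x (2 * l + 2 * i) = \<sigma> i \<and> block x (2 * l + 2 * i + 1) = adjugate (\<sigma> i)"
          if "y \<in> set u" "y = Var i \<or> y = Var_Inv i" for y i
          using blocks[OF occurs[OF u that]] .
      qed
      then show ?thesis using sat u by simp
    qed
    then show "solvable_system ?G ?\<nu> S" unfolding solvable_system_def using \<sigma> by (intro exI[of _ \<sigma>]) simp
  qed
  have "recf vs" unfolding vs_def[abs_def]
    by (intro recf_upt recf_mult recf_add recf_const recf_comp[OF recf_var_bound] recf_id)
  from decp_comp[OF decp_exsat_computable[OF x0] recf_Pair[OF this recf_translation[of "CARD('n)" l Fs]]]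
  have "decp (solvable_system ?G ?\<nu>)" unfolding solvable[abs_def] by simp
  then have "recf (\<lambda>k. if solvable_system ?G ?\<nu> (dec k) then 1 else (0::nat))"
    unfolding decp_def by (rule recf_comp[OF _ recf_dec[OF recf_id]])
  moreover have "dec (system_code S) = S" for S by (simp add: enc_system_code)
  ultimately show ?thesis unfolding diophantine_decidable_via_def recf_nat_iff
    by (intro conjI range_word_enum[OF gs] exI[of _ "\<lambda>k. if solvable_system ?G ?\<nu> (dec k) then 1 else (0::nat)"]) simp_all
qed

end

theorem mainTheorem9:
  fixes \<Phi> :: "'e::euclidean_space set"
    and scale :: "complex \<Rightarrow> 'g::ab_group_add \<Rightarrow> 'g"
    and bracket :: "'g \<Rightarrow> 'g \<Rightarrow> 'g"
    and H :: "'g set"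
    and r :: "'e \<Rightarrow> 'g \<Rightarrow> complex"
    and e :: "'e \<Rightarrow> 'g"
    and \<pi> :: "'g \<Rightarrow> complex^'n^'n"
    and G :: "(real^'n^'n) monoid"
  assumes "root_system \<Phi>" and "indecomposable \<Phi>" and "root_rank \<Phi> > 1"
    and "complex_lie_algebra scale bracket"
    and "complex_lie_algebra.semisimple scale bracket"
    and "complex_lie_algebra.cartan_subalgebra scale bracket H"
    and "complex_lie_algebra.root_identification scale bracket \<Phi> H r"
    and "complex_lie_algebra.chevalley_root_vectors scale bracket \<Phi> H r e"
    and "complex_lie_algebra.faithful_representation scale bracket \<pi>"
    and "admissible_basis \<Phi> e \<pi>"
    and G_def: "G = chevalley_group \<Phi> e \<pi> computable_reals"
  shows "\<not> diophantine_decidable G (carrier G) \<and>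
    (\<forall>C gs. subgroup C G \<and> set gs \<subseteq> carrier G \<and> C = generate G (set gs) \<longrightarrow>
      diophantine_decidable_via G C (word_enum G gs))"
proof -
  interpret complex_lie_algebra scale bracket by fact
  interpret chevalley_data scale bracket \<Phi> H r e \<pi>
    by unfold_locales (use assms in \<open>simp_all add: indecomposable_def\<close>)
  show ?thesis
    unfolding G_def chevalley_group_eq using diophantine_undecidable diophantine_decidable_generate by blast
qed

end
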